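(* Let $d\in\{2,3\}$, $p>d+2$ and $T>0$. Let $F:\mathbb{R}^{d\times d}_{\rm sym}\to[0,\infty)$ be a convex function (with domain the whole space $\mathbb{R}^{d\times d}_{\rm sym}$) such that $F(0)=0$. Let $F^*$ be its convex conjugate and $F_\infty$ its asymptotic function, and suppose that: (i) there is $r>0$ such that $0\le F^*(\mathbb{S})<\infty$ for all $\mathbb{S}\in\mathbb{R}^{d\times d}_{\rm sym}$ with $|\mathbb{S}|<r$; (ii) there is $r'>0$ such that $\mathrm{Dom}(F^* )\subset\Lambda^0+B(r',0)$, where $\Lambda=\mathrm{Dom}(F_\infty)$, $\Lambda^0$ is the polar set of $\Lambda$, and $B(r',0)$ is the ball of radius $r'$ centred at $0$. Let $\mathbf{v}_0\in W^{2-\frac2p,p}(\mathbb{T}^d;\mathbb{R}^d)$ with $\mathrm{div}_x\mathbf{v}_0=0$. Suppose that $\mathbf{v}$, with associated fields $\mathbb{S}$ and $\mathfrak{R}_v$, is a dissipative solution on the time interval $[0,T]$, with initial datum $\mathbf{v}_0$, of the problem $$\mathrm{div}_x\mathbf{v}=0,\qquad \partial_t\mathbf{v}+\mathrm{div}_x(\mathbf{v}\otimes\mathbf{v})+\nabla_x\Pi=\mathrm{div}_x\mathbb{S},\qquad \mathbb{S}:\mathbb{D}\mathbf{v}=F(\mathbb{D}\mathbf{v})+F^*(\mathbb{S}),\qquad \mathbf{v}(0,\cdot)=\mathbf{v}_0$$ on $(0,T)\times\mathbb{T}^d$, and that $\mathbf{v}$ belongs to the regularity class $$\mathbf{v}\in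 C([0,T];W^{2-\frac2p,p}(\mathbb{T}^d;\mathbb{R}^d)),\quad \partial_t\mathbf{v}\in L^p(0,T;L^p(\mathbb{T}^d;\mathbb{R}^d)),\quad \mathbf{v}\in L^p(0,T;W^{2,p}(\mathbb{T}^d;\mathbb{R}^d)).$$ Then $\mathfrak{R}_v=0$ and $$\mathbb{S}:\mathbb{D}\mathbf{v}=F(\mathbb{D}\mathbf{v})+F^*(\mathbb{S})\quad\text{a.e. in }(0,T)\times\mathbb{T}^d,$$ meaning that $\mathbf{v}$ is a strong solution of the problem $$\mathrm{div}_x\mathbf{v}=0,\qquad \partial_t\mathbf{v}+\mathrm{div}_x(\mathbf{v}\otimes\mathbf{v})+\nabla_x\Pi=\mathrm{div}_x\mathbb{S},\qquad \mathbb{S}:\mathbb{D}\mathbf{v}=F(\mathbb{D}\mathbf{v})+F^*(\mathbb{S}),\qquad \mathbf{v}(0,\cdot)=\mathbf{v}_0$$ on $(0,T)\times\mathbb{T}^d$.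
   Context: **Notation.** $\mathbb{T}^d=([-1,1]|_{\{-1,1\}})^d$ is the flat torus (all functions are spatially periodic). $\mathbb{R}^{d\times d}_{\rm sym}$ is the space of real symmetric $d\times d$ matrices with the inner product $\mathbb{A}:\mathbb{B}=\sum_{i,j}A_{ij}B_{ij}$. $\mathbb{D}\mathbf{v}=\frac12(\nabla_x\mathbf{v}+\nabla_x^t\mathbf{v})$ is the symmetric gradient, taken in the sense of distributions. $W^{2-\frac2p,p}$ is the Sobolev–Slobodeckii space. $C_{\rm weak}([0,T];L^2)$ denotes functions of time with values in $L^2$ that are continuous for the weak topology of $L^2$. $\mathcal{M}$ denotes finite (scalar- or matrix-valued) Radon measures. $\mathcal{M}^+(\mathbb{T}^d;\mathbb{R}^{d\times d}_{\rm sym})$ is the set of finite symmetric-matrix-valued measures $\mathbb{M}$ with $\int_{\mathbb{T}^d}\varphi\,(\xi\otimes\xi):\mathrm{d}\mathbb{M}\ge0$ for all $\xi\in\mathbb{R}^d$ and all smooth $\varphi\ge0$. $L^\infty(0,T;\mathcal{M}^+)$ denotes weakly-$*$ measurable, essentially bounded maps $t\mapsto\mathfrak{R}_v(t)\in\mathcal{M}^+$. **Convex analysis.** $F^*(\mathbb{S})=\sup_{\mathbb{D}}[\mathbb{S}:\mathbb{D}-F(\mathbb{D})]\in[0,\infty]$. $F_\infty(\mathbb{D})=\lim_{s\to\infty}F(s\mathbb{D})/s\in[0,\infty]$ is the asymptotic function of $F$. $\mathrm{Dom}(G)=\{G<\infty\}$. Since $\Lambda=\mathrm{Dom}(F_\infty)$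 is a convex cone, its polar set is $\Lambda^0=\{\mathbb{S}:\mathbb{S}:\mathbb{D}\le0\ \text{for all } \mathbb{D}\in\Lambda\}$. **Convex function of a measure (Demengel–Temam).** For $\mu\in\mathcal{M}((0,T)\times\mathbb{T}^d;\mathbb{R}^{d\times d}_{\rm sym})$ with Lebesgue decomposition $\mu=h\,\mathrm{d}x\,\mathrm{d}t+\mu^s$, where $\mu^s$ is singular and $\mu^s=\sigma|\mu^s|$ with $|\sigma|=1$ $|\mu^s|$-a.e., the nonnegative measure $F(\mu)$ is $F(\mu)=F(h)\,\mathrm{d}x\,\mathrm{d}t+F_\infty(\sigma)\,|\mu^s|$. The expression $\int_0^\tau\int_{\mathbb{T}^d}F(\mathbb{D}\mathbf{v})\,\mathrm{d}x\,\mathrm{d}t$ means $\int_{(0,\tau)\times\mathbb{T}^d}\mathrm{d}F(\mathbb{D}\mathbf{v})$, i.e. the mass that the measure $F(\mathbb{D}\mathbf{v})$ assigns to the set $(0,\tau)\times\mathbb{T}^d$. When $\mathbb{D}\mathbf{v}$ is an integrable function (as in the regularity class of the claim) this is the usual integral. **Dissipative solution.** $\mathbf{v}\in C_{\rm weak}([0,T];L^2(\mathbb{T}^d;\mathbb{R}^d))$ is a dissipative solution of the problem with initial datum $\mathbf{v}_0$ if $\mathbb{D}\mathbf{v}\in\mathcal{M}((0,T)\times\mathbb{T}^d;\mathbb{R}^{d\times d}_{\rm sym})$ and there exist (associated fields) $\mathbb{S}\in L^1((0,T)\times\mathbb{T}^d;\mathbb{R}^{d\times d}_{\rm sym})$ and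 $\mathfrak{R}_v\in L^\infty(0,T;\mathcal{M}^+(\mathbb{T}^d;\mathbb{R}^{d\times d}_{\rm sym}))$ such that: 1. (Incompressibility) $\int_0^T\int_{\mathbb{T}^d}\mathbf{v}\cdot\nabla_x\varphi\,\mathrm{d}x\,\mathrm{d}t=0$ for all $\varphi\in C^1([0,T]\times\mathbb{T}^d)$. 2. (Momentum equation) For all $0\le\tau\le T$ and all $\boldsymbol{\varphi}\in C^1([0,T]\times\mathbb{T}^d;\mathbb{R}^d)$ with $\mathrm{div}_x\boldsymbol{\varphi}=0$, $$\int_{\mathbb{T}^d}\mathbf{v}\cdot\boldsymbol{\varphi}(\tau,\cdot)\,\mathrm{d}x-\int_{\mathbb{T}^d}\mathbf{v}_0\cdot\boldsymbol{\varphi}(0,\cdot)\,\mathrm{d}x=\int_0^\tau\!\!\int_{\mathbb{T}^d}\big[\mathbf{v}\cdot\partial_t\boldsymbol{\varphi}+(\mathbf{v}\otimes\mathbf{v}):\nabla_x\boldsymbol{\varphi}\big]\mathrm{d}x\,\mathrm{d}t-\int_0^\tau\!\!\int_{\mathbb{T}^d}\mathbb{S}:\nabla_x\boldsymbol{\varphi}\,\mathrm{d}x\,\mathrm{d}t+\int_0^\tau\!\!\int_{\mathbb{T}^d}\nabla_x\boldsymbol{\varphi}:\mathrm{d}\mathfrak{R}_v\,\mathrm{d}t.$$ 3. (Energy inequality) For a.a. $\tau\in(0,T)$, $$\int_{\mathbb{T}^d}\tfrac12|\mathbf{v}|^2(\tau,\cdot)\,\mathrm{d}x+\int_{\mathbb{T}^d}\mathrm{d}\,\tfrac12\mathrm{trace}[\mathfrak{R}_v(\tau)]+\int_0^\tau\!\!\int_{\mathbb{T}^d}\big[F(\mathbb{D}\mathbf{v})+F^*(\mathbb{S})\big]\mathrm{d}x\,\mathrm{d}t\le\int_{\mathbb{T}^d}\tfrac12|\mathbf{v}_0|^2\,\mathrm{d}x.$$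 **Strong solution.** Here "$\mathbf{v}$ is a strong solution" means precisely: $\mathbf{v}$ lies in the regularity class of the claim, the momentum equation in item 2 holds with $\mathfrak{R}_v=0$ (i.e. the equation $\partial_t\mathbf{v}+\mathrm{div}_x(\mathbf{v}\otimes\mathbf{v})+\nabla_x\Pi=\mathrm{div}_x\mathbb{S}$ is satisfied, with $\mathrm{div}_x\mathbb{S}$ in the sense of distributions), $\mathrm{div}_x\mathbf{v}=0$, $\mathbf{v}(0,\cdot)=\mathbf{v}_0$, and the rheological law $\mathbb{S}:\mathbb{D}\mathbf{v}=F(\mathbb{D}\mathbf{v})+F^*(\mathbb{S})$ holds a.e. *)

theory Defs
  imports "HOL-Analysis.Analysis"
begin

section \<open>The flat torus and its function spaces\<close>

text \<open>
  A function on the torus \<open>([-1,1]/{-1,1})\<^sup>d\<close> is a function on the whole space that is 2-periodic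
  in every coordinate. The half-open cell contains exactly one representative of each point of the
  torus, so that Borel measures on the torus are the same as Borel measures on the cell.
\<close>

definition cell :: "(real^'d) set" where
  "cell = {x. \<forall>i. -1 \<le> x $ i \<and> x $ i < 1}"

definition periodic :: "(real^'d \<Rightarrow> 'b) \<Rightarrow> bool" where
  "periodic f \<longleftrightarrow> (\<forall>x i. f (x + 2 *\<^sub>R axis i 1) = f x)"

definition torus_Lp :: "real \<Rightarrow> (real^'d \<Rightarrow> 'b::euclidean_space) \<Rightarrow> bool" where
  "torus_Lp p f \<longleftrightarrow> periodic f \<and> f \<in> borel_measurable lebesgue \<and>
     integrable (lebesgue_on cell) (\<lambda>x. norm (f x) powr p)"

text \<open>Functions that are infinitely often differentiable: every directional derivative exists and
  is again such a function.\<close>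

coinductive smooth :: "('a::real_normed_vector \<Rightarrow> 'b::real_normed_vector) \<Rightarrow> bool" where
  "\<lbrakk>\<And>x. (f has_derivative (\<lambda>w. f' w x)) (at x); \<And>w. smooth (f' w)\<rbrakk> \<Longrightarrow> smooth f"

definition has_weak_partial ::
    "'d \<Rightarrow> (real^'d \<Rightarrow> 'b::euclidean_space) \<Rightarrow> (real^'d \<Rightarrow> 'b) \<Rightarrow> bool" where
  "has_weak_partial j f g \<longleftrightarrow> torus_Lp 1 f \<and> torus_Lp 1 g \<and>
     (\<forall>\<psi> :: real^'d \<Rightarrow> real. smooth \<psi> \<and> periodic \<psi> \<longrightarrow>
        (\<integral>x. frechet_derivative \<psi> (at x) (axis j 1) *\<^sub>R f x \<partial>lebesgue_on cell) =
        - (\<integral>x. \<psi> x *\<^sub>R g x \<partial>lebesgue_on cell))"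

definition weak_partial ::
    "'d \<Rightarrow> (real^'d \<Rightarrow> 'b::euclidean_space) \<Rightarrow> real^'d \<Rightarrow> 'b" where
  "weak_partial j f = (SOME g. has_weak_partial j f g)"

text \<open>
  The \<open>p\<close>-th power of the Sobolev--Slobodeckii norm of order \<open>s\<close>, for \<open>1 < s < 2\<close>:
  the \<open>W\<^sup>1\<^sup>,\<^sup>p\<close>-norm and the Gagliardo seminorm of order \<open>s - 1\<close> of the first derivatives. The two
  points in the Gagliardo double integral are \<open>x\<close> and \<open>x + h\<close>; for \<open>h\<close> in the cell, the Euclidean
  norm of \<open>h\<close> is their distance on the torus.
\<close>

definition slobodeckii_norm_power ::
    "real \<Rightarrow> real \<Rightarrow> (real^'d \<Rightarrow> 'b::euclidean_space) \<Rightarrow> ennreal" where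
  "slobodeckii_norm_power s p f =
     (\<integral>\<^sup>+x. ennreal (norm (f x) powr p) \<partial>lebesgue_on cell) +
     (\<Sum>j\<in>UNIV. \<integral>\<^sup>+x. ennreal (norm (weak_partial j f x) powr p) \<partial>lebesgue_on cell) +
     (\<Sum>j\<in>UNIV. \<integral>\<^sup>+h. (\<integral>\<^sup>+x. ennreal (norm (weak_partial j f (x + h) - weak_partial j f x) powr p /
         norm h powr (real CARD('d) + (s - 1) * p)) \<partial>lebesgue_on cell) \<partial>lebesgue_on cell)"

definition slobodeckii :: "real \<Rightarrow> real \<Rightarrow> (real^'d \<Rightarrow> 'b::euclidean_space) \<Rightarrow> bool" where
  "slobodeckii s p f \<longleftrightarrow>
     (\<forall>j. \<exists>g. has_weak_partial j f g) \<and> slobodeckii_norm_power s p f < \<infinity>"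

definition divergence_free :: "(real^'d \<Rightarrow> real^'d) \<Rightarrow> bool" where
  "divergence_free u \<longleftrightarrow> (\<forall>\<psi> :: real^'d \<Rightarrow> real. smooth \<psi> \<and> periodic \<psi> \<longrightarrow>
     (\<integral>x. (\<Sum>j\<in>UNIV. u x $ j * frechet_derivative \<psi> (at x) (axis j 1)) \<partial>lebesgue_on cell) = 0)"


section \<open>Functions of time and space\<close>

abbreviation spacetime :: "real \<Rightarrow> (real \<times> (real^'d)) set" where
  "spacetime T \<equiv> {0<..<T} \<times> cell"

definition torus_field :: "real \<Rightarrow> (real \<Rightarrow> real^'d \<Rightarrow> 'b::euclidean_space) \<Rightarrow> bool" where
  "torus_field T w \<longleftrightarrow> (\<forall>t\<in>{0<..<T}. periodic (w t)) \<and>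
     (\<lambda>(t, x). w t x) \<in> borel_measurable (lebesgue_on (spacetime T))"

definition spacetime_Lp :: "real \<Rightarrow> real \<Rightarrow> (real \<Rightarrow> real^'d \<Rightarrow> 'b::euclidean_space) \<Rightarrow> bool" where
  "spacetime_Lp T p w \<longleftrightarrow> torus_field T w \<and>
     integrable (lebesgue_on (spacetime T)) (\<lambda>(t, x). norm (w t x) powr p)"

text \<open>\<open>C\<^sub>w\<^sub>e\<^sub>a\<^sub>k([0,T]; L\<^sup>2)\<close>; such a map always has representatives that are measurable in \<open>(t, x)\<close>.\<close>

definition C_weak_L2 :: "real \<Rightarrow> (real \<Rightarrow> real^'d \<Rightarrow> 'b::euclidean_space) \<Rightarrow> bool" where
  "C_weak_L2 T v \<longleftrightarrow> torus_field T v \<and> (\<forall>t\<in>{0..T}. torus_Lp 2 (v t)) \<and>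
     (\<forall>g. torus_Lp 2 g \<longrightarrow> continuous_on {0..T} (\<lambda>t. \<integral>x. v t x \<bullet> g x \<partial>lebesgue_on cell))"

text \<open>\<open>\<phi> \<in> C\<^sup>1([0,T] \<times> torus)\<close>, with time derivative \<open>\<phi>t\<close> (one-sided at \<open>0\<close> and \<open>T\<close>) and spatial
  partial derivatives \<open>\<phi>x j\<close>.\<close>

definition C1_torus :: "real \<Rightarrow> (real \<Rightarrow> real^'d \<Rightarrow> 'b::real_normed_vector) \<Rightarrow>
    (real \<Rightarrow> real^'d \<Rightarrow> 'b) \<Rightarrow> ('d \<Rightarrow> real \<Rightarrow> real^'d \<Rightarrow> 'b) \<Rightarrow> bool" where
  "C1_torus T \<phi> \<phi>t \<phi>x \<longleftrightarrow>
     (\<forall>t\<in>{0..T}. periodic (\<phi> t)) \<and>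
     (\<forall>t\<in>{0..T}. \<forall>x. ((\<lambda>(s, y). \<phi> s y) has_derivative
        (\<lambda>(s, y). s *\<^sub>R \<phi>t t x + (\<Sum>j\<in>UNIV. y $ j *\<^sub>R \<phi>x j t x))) (at (t, x) within {0..T} \<times> UNIV)) \<and>
     continuous_on ({0..T} \<times> UNIV) (\<lambda>(t, x). \<phi>t t x) \<and>
     (\<forall>j. continuous_on ({0..T} \<times> UNIV) (\<lambda>(t, x). \<phi>x j t x))"

definition spacetime_test ::
    "real \<Rightarrow> (real \<times> (real^'d) \<Rightarrow> 'b::real_normed_vector) \<Rightarrow> bool" where
  "spacetime_test T \<psi> \<longleftrightarrow> smooth \<psi> \<and> (\<forall>t. periodic (\<lambda>x. \<psi> (t, x))) \<and>
     (\<exists>a b. 0 < a \<and> b < T \<and> (\<forall>t x. t \<notin> {a..b} \<longrightarrow> \<psi> (t, x) = 0))"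

definition has_weak_time_derivative :: "real \<Rightarrow> (real \<Rightarrow> real^'d \<Rightarrow> 'b::euclidean_space) \<Rightarrow>
    (real \<Rightarrow> real^'d \<Rightarrow> 'b) \<Rightarrow> bool" where
  "has_weak_time_derivative T v w \<longleftrightarrow>
     (\<forall>\<psi> :: real \<times> (real^'d) \<Rightarrow> 'b. spacetime_test T \<psi> \<longrightarrow>
        (\<integral>z. (case z of (t, x) \<Rightarrow> v t x \<bullet> frechet_derivative \<psi> (at z) (1, 0))
            \<partial>lebesgue_on (spacetime T)) =
        - (\<integral>z. (case z of (t, x) \<Rightarrow> w t x \<bullet> \<psi> z) \<partial>lebesgue_on (spacetime T)))"

text \<open>The space \<open>C([0,T]; W\<^sup>s\<^sup>,\<^sup>p)\<close>, for \<open>1 < s < 2\<close>; the \<open>p\<close>-th power of the norm tends to 0 exactly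
  when the norm does.\<close>

definition C_slobodeckii ::
    "real \<Rightarrow> real \<Rightarrow> real \<Rightarrow> (real \<Rightarrow> real^'d \<Rightarrow> 'b::euclidean_space) \<Rightarrow> bool" where
  "C_slobodeckii T s p v \<longleftrightarrow> (\<forall>t\<in>{0..T}. slobodeckii s p (v t) \<and>
     ((\<lambda>\<tau>. slobodeckii_norm_power s p (\<lambda>x. v \<tau> x - v t x)) \<longlongrightarrow> 0) (at t within {0..T}))"

text \<open>The Bochner space \<open>L\<^sup>p(0,T; W\<^sup>2\<^sup>,\<^sup>p)\<close>: the function and its spatial weak derivatives up to order
  two are given by measurable functions of \<open>(t, x)\<close> whose \<open>p\<close>-th powers are integrable.\<close>

definition Lp_W2p :: "real \<Rightarrow> real \<Rightarrow> (real \<Rightarrow> real^'d \<Rightarrow> 'b::euclidean_space) \<Rightarrow> bool" where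
  "Lp_W2p T p v \<longleftrightarrow> spacetime_Lp T p v \<and>
     (\<exists>G H. (\<forall>j. spacetime_Lp T p (G j)) \<and> (\<forall>j k. spacetime_Lp T p (H j k)) \<and>
        (AE t in lebesgue_on {0<..<T}. \<forall>j. has_weak_partial j (v t) (G j t) \<and>
           (\<forall>k. has_weak_partial k (G j t) (H j k t))))"

definition regularity_class :: "real \<Rightarrow> real \<Rightarrow> (real \<Rightarrow> real^'d \<Rightarrow> real^'d) \<Rightarrow> bool" where
  "regularity_class T p v \<longleftrightarrow> C_slobodeckii T (2 - 2 / p) p v \<and>
     (\<exists>w. spacetime_Lp T p w \<and> has_weak_time_derivative T v w) \<and> Lp_W2p T p v"


section \<open>Symmetric matrices and convex analysis\<close>

text \<open>The inner product \<open>A \<bullet> B\<close> and the norm of matrices are the Frobenius ones.\<close>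

definition sym_mats :: "(real^'d^'d) set" where
  "sym_mats = {A. transpose A = A}"

definition outer :: "real^'d \<Rightarrow> real^'d \<Rightarrow> real^'d^'d" where
  "outer u w = (\<chi> i j. u $ i * w $ j)"

definition conjugate :: "(real^'d^'d \<Rightarrow> real) \<Rightarrow> real^'d^'d \<Rightarrow> ereal" where
  "conjugate F A = (SUP D\<in>sym_mats. ereal (A \<bullet> D - F D))"

definition asymptotic :: "(real^'d^'d \<Rightarrow> real) \<Rightarrow> real^'d^'d \<Rightarrow> ereal" where
  "asymptotic F D = Lim at_top (\<lambda>s. ereal (F (s *\<^sub>R D) / s))"

definition Dom :: "(real^'d^'d \<Rightarrow> ereal) \<Rightarrow> (real^'d^'d) set" where
  "Dom G = {A \<in> sym_mats. G A < \<infinity>}"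

definition polar_set :: "(real^'d^'d) set \<Rightarrow> (real^'d^'d) set" where
  "polar_set \<Lambda> = {A \<in> sym_mats. \<forall>D\<in>\<Lambda>. A \<bullet> D \<le> 0}"


section \<open>Vector-valued and matrix-valued measures\<close>

abbreviation borel_on :: "'a::topological_space set \<Rightarrow> 'a measure" where
  "borel_on X \<equiv> restrict_space borel X"

definition vector_measure :: "'a measure \<Rightarrow> ('a set \<Rightarrow> 'b::real_normed_vector) \<Rightarrow> bool" where
  "vector_measure M \<mu> \<longleftrightarrow> (\<forall>A :: nat \<Rightarrow> 'a set. range A \<subseteq> sets M \<and> disjoint_family A \<longrightarrow>
     (\<lambda>n. \<mu> (A n)) sums \<mu> (\<Union>n. A n))"

definition variation :: "'a measure \<Rightarrow> ('a set \<Rightarrow> 'b::real_normed_vector) \<Rightarrow> 'a set \<Rightarrow> ennreal" where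
  "variation M \<mu> A = (SUP P\<in>{P. finite P \<and> disjoint P \<and> P \<subseteq> sets M \<and> \<Union>P \<subseteq> A}.
     \<Sum>B\<in>P. ennreal (norm (\<mu> B)))"

definition variation_measure :: "'a measure \<Rightarrow> ('a set \<Rightarrow> 'b::real_normed_vector) \<Rightarrow> 'a measure" where
  "variation_measure M \<mu> = measure_of (space M) (sets M) (variation M \<mu>)"

text \<open>The positive part of the Jordan decomposition of a finite signed measure; the negative part is
  the positive part of \<open>- m\<close>.\<close>

definition jordan_pos :: "'a measure \<Rightarrow> ('a set \<Rightarrow> real) \<Rightarrow> 'a measure" where
  "jordan_pos M m = measure_of (space M) (sets M) (\<lambda>A. SUP B\<in>{B \<in> sets M. B \<subseteq> A}. ennreal (m B))"

definition signed_integral :: "'a measure \<Rightarrow> ('a set \<Rightarrow> real) \<Rightarrow> ('a \<Rightarrow> real) \<Rightarrow> real" where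
  "signed_integral M m f =
     (\<integral>x. f x \<partial>jordan_pos M m) - (\<integral>x. f x \<partial>jordan_pos M (\<lambda>A. - m A))"

definition matrix_integral ::
    "'a measure \<Rightarrow> ('a set \<Rightarrow> real^'d^'d) \<Rightarrow> ('a \<Rightarrow> real^'d^'d) \<Rightarrow> real" where
  "matrix_integral M \<mu> \<Phi> =
     (\<Sum>i\<in>UNIV. \<Sum>j\<in>UNIV. signed_integral M (\<lambda>A. \<mu> A $ i $ j) (\<lambda>x. \<Phi> x $ i $ j))"

definition sym_matrix_measure ::
    "'a::topological_space set \<Rightarrow> ('a set \<Rightarrow> real^'d^'d) \<Rightarrow> bool" where
  "sym_matrix_measure X \<mu> \<longleftrightarrow> vector_measure (borel_on X) \<mu> \<and>
     (\<forall>A\<in>sets (borel_on X). \<mu> A \<in> sym_mats)"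

definition psd_measure :: "((real^'d) set \<Rightarrow> real^'d^'d) \<Rightarrow> bool" where
  "psd_measure \<mu> \<longleftrightarrow> sym_matrix_measure cell \<mu> \<and>
     (\<forall>\<xi> \<phi>. smooth \<phi> \<and> periodic \<phi> \<and> (\<forall>x. 0 \<le> \<phi> x) \<longrightarrow>
        0 \<le> matrix_integral (borel_on cell) \<mu> (\<lambda>x. \<phi> x *\<^sub>R outer \<xi> \<xi>))"

definition Linf_psd_measures :: "real \<Rightarrow> (real \<Rightarrow> (real^'d) set \<Rightarrow> real^'d^'d) \<Rightarrow> bool" where
  "Linf_psd_measures T R \<longleftrightarrow>
     (AE t in lebesgue_on {0<..<T}. psd_measure (R t)) \<and>
     (\<forall>\<Phi>. continuous_on UNIV \<Phi> \<and> periodic \<Phi> \<and> range \<Phi> \<subseteq> sym_mats \<longrightarrow>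
        (\<lambda>t. matrix_integral (borel_on cell) (R t) \<Phi>) \<in> borel_measurable (lebesgue_on {0<..<T})) \<and>
     (\<exists>C::real. AE t in lebesgue_on {0<..<T}. variation (borel_on cell) (R t) cell \<le> ennreal C)"

text \<open>Lebesgue decomposition \<open>\<mu> = h dz + \<mu>s\<close> with \<open>\<mu>s\<close> singular, and polar decomposition
  \<open>\<mu>s = \<sigma> |\<mu>s|\<close> of the singular part.\<close>

definition lebesgue_decomposition :: "'a::euclidean_space set \<Rightarrow> ('a set \<Rightarrow> real^'d^'d) \<Rightarrow>
    ('a \<Rightarrow> real^'d^'d) \<Rightarrow> ('a set \<Rightarrow> real^'d^'d) \<Rightarrow> ('a \<Rightarrow> real^'d^'d) \<Rightarrow> bool" where
  "lebesgue_decomposition X \<mu> h \<mu>s \<sigma> \<longleftrightarrow>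
     integrable (lebesgue_on X) h \<and> (\<forall>z. h z \<in> sym_mats) \<and>
     sym_matrix_measure X \<mu>s \<and>
     (\<forall>A\<in>sets (borel_on X). \<mu> A = set_lebesgue_integral lebesgue A h + \<mu>s A) \<and>
     (\<exists>N\<in>sets (borel_on X). emeasure lborel N = 0 \<and>
        (\<forall>A\<in>sets (borel_on X). A \<inter> N = {} \<longrightarrow> \<mu>s A = 0)) \<and>
     \<sigma> \<in> borel_measurable (borel_on X) \<and> (\<forall>z. \<sigma> z \<in> sym_mats) \<and>
     (AE z in variation_measure (borel_on X) \<mu>s. norm (\<sigma> z) = 1) \<and>
     (\<forall>A\<in>sets (borel_on X).
        \<mu>s A = set_lebesgue_integral (variation_measure (borel_on X) \<mu>s) A \<sigma>)"

text \<open>The nonnegative measure \<open>F(\<mu>) = F(h) dz + F\<^sub>\<infinity>(\<sigma>) |\<mu>s|\<close>, evaluated on a set.\<close>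

definition convex_of_measure :: "(real^'d^'d \<Rightarrow> real) \<Rightarrow> 'a::euclidean_space set \<Rightarrow>
    ('a set \<Rightarrow> real^'d^'d) \<Rightarrow> 'a set \<Rightarrow> ennreal" where
  "convex_of_measure F X \<mu> A =
     (let (h, \<mu>s, \<sigma>) = (SOME (h, \<mu>s, \<sigma>). lebesgue_decomposition X \<mu> h \<mu>s \<sigma>) in
       (\<integral>\<^sup>+z\<in>A. ennreal (F (h z)) \<partial>lebesgue) +
       (\<integral>\<^sup>+z\<in>A. e2ennreal (asymptotic F (\<sigma> z)) \<partial>variation_measure (borel_on X) \<mu>s))"


section \<open>The symmetric gradient\<close>

text \<open>
  The distributional symmetric gradient of \<open>v\<close>, applied to a test function \<open>\<Psi>\<close> with values in the
  symmetric matrices, is minus the integral of \<open>v \<bullet> div \<Psi>\<close>.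
\<close>

definition symgrad_dist :: "real \<Rightarrow> (real \<Rightarrow> real^'d \<Rightarrow> real^'d) \<Rightarrow>
    (real \<times> (real^'d) \<Rightarrow> real^'d^'d) \<Rightarrow> real" where
  "symgrad_dist T v \<Psi> = - (\<integral>z. (case z of (t, x) \<Rightarrow>
     (\<Sum>i\<in>UNIV. \<Sum>j\<in>UNIV. v t x $ i * frechet_derivative \<Psi> (at z) (0, axis j 1) $ i $ j))
     \<partial>lebesgue_on (spacetime T))"

definition symgrad_is_measure :: "real \<Rightarrow> (real \<Rightarrow> real^'d \<Rightarrow> real^'d) \<Rightarrow>
    ((real \<times> (real^'d)) set \<Rightarrow> real^'d^'d) \<Rightarrow> bool" where
  "symgrad_is_measure T v \<mu> \<longleftrightarrow> sym_matrix_measure (spacetime T) \<mu> \<and>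
     (\<forall>\<Psi>. spacetime_test T \<Psi> \<and> range \<Psi> \<subseteq> sym_mats \<longrightarrow>
        matrix_integral (borel_on (spacetime T)) \<mu> \<Psi> = symgrad_dist T v \<Psi>)"

definition symgrad_is_function :: "real \<Rightarrow> (real \<Rightarrow> real^'d \<Rightarrow> real^'d) \<Rightarrow>
    (real \<times> (real^'d) \<Rightarrow> real^'d^'d) \<Rightarrow> bool" where
  "symgrad_is_function T v D \<longleftrightarrow> integrable (lebesgue_on (spacetime T)) D \<and>
     range D \<subseteq> sym_mats \<and>
     (\<forall>\<Psi>. spacetime_test T \<Psi> \<and> range \<Psi> \<subseteq> sym_mats \<longrightarrow>
        (\<integral>z. \<Psi> z \<bullet> D z \<partial>lebesgue_on (spacetime T)) = symgrad_dist T v \<Psi>)"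


section \<open>Dissipative and strong solutions\<close>

definition stress_field :: "real \<Rightarrow> (real \<Rightarrow> real^'d \<Rightarrow> real^'d^'d) \<Rightarrow> bool" where
  "stress_field T S \<longleftrightarrow> spacetime_Lp T 1 S \<and> (\<forall>t x. S t x \<in> sym_mats)"

definition incompressible :: "real \<Rightarrow> (real \<Rightarrow> real^'d \<Rightarrow> real^'d) \<Rightarrow> bool" where
  "incompressible T v \<longleftrightarrow> (\<forall>(\<phi> :: real \<Rightarrow> real^'d \<Rightarrow> real) \<phi>t \<phi>x. C1_torus T \<phi> \<phi>t \<phi>x \<longrightarrow>
     (\<integral>z. (case z of (t, x) \<Rightarrow> \<Sum>j\<in>UNIV. v t x $ j * \<phi>x j t x) \<partial>lebesgue_on (spacetime T)) = 0)"

definition momentum_equation :: "real \<Rightarrow> (real^'d \<Rightarrow> real^'d) \<Rightarrow> (real \<Rightarrow> real^'d \<Rightarrow> real^'d) \<Rightarrow>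
    (real \<Rightarrow> real^'d \<Rightarrow> real^'d^'d) \<Rightarrow> (real \<Rightarrow> (real^'d) set \<Rightarrow> real^'d^'d) \<Rightarrow> bool" where
  "momentum_equation T v0 v S R \<longleftrightarrow>
     (\<forall>\<tau>\<in>{0..T}. \<forall>(\<phi> :: real \<Rightarrow> real^'d \<Rightarrow> real^'d) \<phi>t \<phi>x.
        C1_torus T \<phi> \<phi>t \<phi>x \<and> (\<forall>t\<in>{0..T}. \<forall>x. (\<Sum>j\<in>UNIV. \<phi>x j t x $ j) = 0) \<longrightarrow>
        (let grad = (\<lambda>t x. (\<chi> i j. \<phi>x j t x $ i) :: real^'d^'d) in
          (\<integral>x. v \<tau> x \<bullet> \<phi> \<tau> x \<partial>lebesgue_on cell) - (\<integral>x. v0 x \<bullet> \<phi> 0 x \<partial>lebesgue_on cell) =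
          (\<integral>(t, x). v t x \<bullet> \<phi>t t x + outer (v t x) (v t x) \<bullet> grad t x
              \<partial>lebesgue_on (spacetime \<tau>))
          - (\<integral>(t, x). S t x \<bullet> grad t x \<partial>lebesgue_on (spacetime \<tau>))
          + (\<integral>t. matrix_integral (borel_on cell) (R t) (grad t) \<partial>lebesgue_on {0<..<\<tau>})))"

text \<open>All terms are nonnegative (\<open>F\<^sup>* \<ge> 0\<close> because \<open>F 0 = 0\<close>), so the inequality is stated in the
  extended nonnegative reals. \<open>\<mu>\<close> is the measure given by the symmetric gradient of \<open>v\<close>.\<close>

definition energy_inequality :: "real \<Rightarrow> (real^'d^'d \<Rightarrow> real) \<Rightarrow> (real^'d \<Rightarrow> real^'d) \<Rightarrow>
    (real \<Rightarrow> real^'d \<Rightarrow> real^'d) \<Rightarrow> ((real \<times> (real^'d)) set \<Rightarrow> real^'d^'d) \<Rightarrow>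
    (real \<Rightarrow> real^'d \<Rightarrow> real^'d^'d) \<Rightarrow> (real \<Rightarrow> (real^'d) set \<Rightarrow> real^'d^'d) \<Rightarrow> bool" where
  "energy_inequality T F v0 v \<mu> S R \<longleftrightarrow>
     (AE \<tau> in lebesgue_on {0<..<T}.
        ennreal (\<integral>x. (norm (v \<tau> x))\<^sup>2 / 2 \<partial>lebesgue_on cell)
        + ennreal (trace (R \<tau> cell) / 2)
        + (convex_of_measure F (spacetime T) \<mu> (spacetime \<tau>)
           + (\<integral>\<^sup>+(t, x). e2ennreal (conjugate F (S t x)) \<partial>lebesgue_on (spacetime \<tau>)))
        \<le> ennreal (\<integral>x. (norm (v0 x))\<^sup>2 / 2 \<partial>lebesgue_on cell))"

definition dissipative_solution :: "real \<Rightarrow> (real^'d^'d \<Rightarrow> real) \<Rightarrow> (real^'d \<Rightarrow> real^'d) \<Rightarrow>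
    (real \<Rightarrow> real^'d \<Rightarrow> real^'d) \<Rightarrow> (real \<Rightarrow> real^'d \<Rightarrow> real^'d^'d) \<Rightarrow>
    (real \<Rightarrow> (real^'d) set \<Rightarrow> real^'d^'d) \<Rightarrow> bool" where
  "dissipative_solution T F v0 v S R \<longleftrightarrow>
     C_weak_L2 T v \<and> stress_field T S \<and> Linf_psd_measures T R \<and>
     incompressible T v \<and> momentum_equation T v0 v S R \<and>
     (\<exists>\<mu>. symgrad_is_measure T v \<mu> \<and> energy_inequality T F v0 v \<mu> S R)"

text \<open>The symmetric gradient has to be an integrable function for this law to be meaningful; it is
  then determined up to a null set.\<close>

definition rheological_law :: "real \<Rightarrow> (real^'d^'d \<Rightarrow> real) \<Rightarrow>
    (real \<Rightarrow> real^'d \<Rightarrow> real^'d) \<Rightarrow> (real \<Rightarrow> real^'d \<Rightarrow> real^'d^'d) \<Rightarrow> bool" where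
  "rheological_law T F v S \<longleftrightarrow> (\<exists>D. symgrad_is_function T v D \<and>
     (AE z in lebesgue_on (spacetime T). case z of (t, x) \<Rightarrow>
        ereal (S t x \<bullet> D z) = ereal (F (D z)) + conjugate F (S t x)))"

definition strong_solution :: "real \<Rightarrow> real \<Rightarrow> (real^'d^'d \<Rightarrow> real) \<Rightarrow> (real^'d \<Rightarrow> real^'d) \<Rightarrow>
    (real \<Rightarrow> real^'d \<Rightarrow> real^'d) \<Rightarrow> (real \<Rightarrow> real^'d \<Rightarrow> real^'d^'d) \<Rightarrow> bool" where
  "strong_solution T p F v0 v S \<longleftrightarrow>
     regularity_class T p v \<and> stress_field T S \<and>
     incompressible T v \<and> momentum_equation T v0 v S (\<lambda>_ _. 0) \<and>
     (AE x in lebesgue_on cell. v 0 x = v0 x) \<and> rheological_law T F v S"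

end

theory Submission
  imports Defs
begin

hide_fact (open)
  Henstock_Kurzweil_Integration.integrable_add Henstock_Kurzweil_Integration.integrable_bound
  Henstock_Kurzweil_Integration.integrable_cong Henstock_Kurzweil_Integration.integrable_diff
  Henstock_Kurzweil_Integration.integrable_sum Henstock_Kurzweil_Integration.integral_add
  Henstock_Kurzweil_Integration.integral_cong Henstock_Kurzweil_Integration.integral_diff
  Henstock_Kurzweil_Integration.integral_nonneg Henstock_Kurzweil_Integration.integral_sum

text \<open>
  As \<open>p > d + 2\<close>, the velocity and its gradient are bounded, by \<open>K\<close> say, uniformly in time. Testing
  the momentum equation with mollifications of \<open>v\<close> itself, and using that the pairing of \<open>R\<close> with a
  matrix field bounded by \<open>K\<close> is at most \<open>d\<^sup>2 K\<close> times the trace of \<open>R\<close>, gives in the limit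
  \<open>|v(\<tau>)|\<^sup>2 / 2 - |v(0)|\<^sup>2 / 2 \<ge> - \<integral>\<integral> S : Dv - d\<^sup>2 K \<integral> tr R\<close>. Added to the energy inequality, this yields
  \<open>tr R(\<tau>) / 2 + \<integral>\<integral> (F(Dv) + F\<^sup>*(S) - S : Dv) \<le> d\<^sup>2 K \<integral> tr R\<close>. The integrand on the left is nonnegative by
  the Fenchel--Young inequality, so Gronwall's lemma gives \<open>tr R = 0\<close>, hence \<open>R = 0\<close> by
  positivity, and then equality in the Fenchel--Young inequality. The mollifiers are nonnegative
  trigonometric kernels of finite rank.
\<close>

text \<open>The threshold p > d + 2 is that of a fractional Morrey estimate: the first derivatives
  of \<open>v t\<close> have smoothness s = 1 - 2/p, and s p = p - 2 > d. It yields bounded weak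
  derivatives, not a smooth field, so \<open>v\<close> itself is not an admissible test field. A
  kernel of the form \<open>\<Sum>m<N. F m x * F m y\<close> turns \<open>v t\<close> into a
  combination of N fixed smooth functions whose coefficients are continuous in t by weak continuity,
  so the equation need only be tested with fields frozen in time. The same factors in x and in y
  make the mollifier self-adjoint and its quadratic form a sum of squares. Nonnegativity and unit
  mass make it a contraction in the supremum norm, which preserves the bound K; as a convolution it
  commutes with derivatives and keeps the divergence zero. Two versions of the gradient coexist: one
  chosen at every single time, which is mollified, and one jointly measurable in time and space,
  which enters the dissipation; uniqueness of weak derivatives links them.\<close>

abbreviation (input) lcell :: "(real^'d) measure" where "lcell \<equiv> lebesgue_on cell"

abbreviation (input) ltime :: "real \<Rightarrow> real measure" where "ltime T \<equiv> lebesgue_on {0<..<T}"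

abbreviation (input) lst :: "real \<Rightarrow> (real \<times> (real^'d)) measure" where "lst T \<equiv> lebesgue_on (spacetime T)"

abbreviation (input) partial :: "'d \<Rightarrow> (real^'d \<Rightarrow> real) \<Rightarrow> real^'d \<Rightarrow> real" where
  "partial j f x \<equiv> frechet_derivative f (at x) (axis j 1)"

section \<open>Smooth functions\<close>

text \<open>The rule for \<open>smooth\<close> provides some family of directional derivatives;
  uniqueness of derivatives identifies it with \<open>frechet_derivative\<close>, which is the
  canonical choice from here on.\<close>

lemma smooth_has_derivative:
  assumes "smooth f"
  shows "(f has_derivative frechet_derivative f (at x)) (at x)"
    and "smooth (\<lambda>x. frechet_derivative f (at x) w)"
proof -
  obtain f' where f': "\<And>x. (f has_derivative (\<lambda>w. f' w x)) (at x)" "\<And>w. smooth (f' w)"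
    by (rule smooth.cases[OF assms]) blast
  have eq: "frechet_derivative f (at x) = (\<lambda>w. f' w x)" for x
    using frechet_derivative_at[OF f'(1)] by simp
  show "(f has_derivative frechet_derivative f (at x)) (at x)" unfolding eq by (rule f')
  show "smooth (\<lambda>x. frechet_derivative f (at x) w)" unfolding eq using f'(2) by simp
qed

lemma smooth_continuous_on: "smooth f \<Longrightarrow> continuous_on A f"
  by (meson continuous_at_imp_continuous_on has_derivative_continuous smooth_has_derivative(1))

text \<open>The invariant is a class of functions closed under directional derivatives; the closure
  proofs that use this rule differ only in the class they name.\<close>

lemma smooth_coinduct:
  assumes "X f"
    and "\<And>f. X f \<Longrightarrow> \<exists>f'. (\<forall>x. (f has_derivative (\<lambda>w. f' w x)) (at x)) \<and> (\<forall>w. X (f' w))"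
  shows "smooth f"
  using assms(1)
proof (coinduction arbitrary: f)
  case smooth
  then show ?case using assms(2)[of f] by auto
qed

lemma smooth_const: "smooth (\<lambda>_. c)"
proof (rule smooth_coinduct[where X = "\<lambda>f. \<exists>c. f = (\<lambda>_. c)"], goal_cases)
  case 1
  then show ?case by blast
next
  case (2 f)
  let ?X = "\<lambda>f. \<exists>c. f = (\<lambda>_. c)"
  from 2 obtain c where "f = (\<lambda>_. c)" by auto
  then show "\<exists>f'. (\<forall>x. (f has_derivative (\<lambda>w. f' w x)) (at x)) \<and> (\<forall>w. ?X (f' w))" by (intro exI[of _ "\<lambda>_ _. 0"]) auto
qed

lemma smooth_bounded_linear_left:
  assumes "bounded_linear L" "smooth f"
  shows "smooth (\<lambda>x. L (f x))"
proof (rule smooth_coinduct[where X = "\<lambda>g. \<exists>f. smooth f \<and> g = (\<lambda>x. L (f x))"], goal_cases)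
  case 1
  then show ?case using assms by blast
next
  case (2 g)
  then obtain f where f: "smooth f" "g = (\<lambda>x. L (f x))" by auto
  have "(g has_derivative (\<lambda>w. L (frechet_derivative f (at x) w))) (at x)" for x
    unfolding f(2)
    by (rule bounded_linear.has_derivative[OF assms(1) smooth_has_derivative(1)[OF f(1)]])
  then show ?case
    using smooth_has_derivative(2)[OF f(1)]
    by (intro exI[of _ "\<lambda>w x. L (frechet_derivative f (at x) w)"]) blast
qed

lemma smooth_bounded_linear_right:
  assumes "bounded_linear L" "smooth f"
  shows "smooth (\<lambda>x. f (L x))"
proof (rule smooth_coinduct[where X = "\<lambda>g. \<exists>f. smooth f \<and> g = (\<lambda>x. f (L x))"], goal_cases)
  case 1
  then show ?case using assms by blast
next
  case (2 g)
  then obtain f where f: "smooth f" "g = (\<lambda>x. f (L x))" by auto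
  have "(g has_derivative (\<lambda>w. frechet_derivative f (at (L x)) (L w))) (at x)" for x
    unfolding f(2)
    using diff_chain_at[OF bounded_linear_imp_has_derivative[OF assms(1)] smooth_has_derivative(1)[OF f(1)]]
    by (simp add: o_def)
  then show ?case
    using smooth_has_derivative(2)[OF f(1)]
    by (intro exI[of _ "\<lambda>w x. frechet_derivative f (at (L x)) (L w)"]) blast
qed

lemma smooth_translate:
  assumes "smooth f"
  shows "smooth (\<lambda>x. f (x + a))"
proof (rule smooth_coinduct[where X = "\<lambda>g. \<exists>f. smooth f \<and> g = (\<lambda>x. f (x + a))"], goal_cases)
  case 1
  then show ?case using assms by blast
next
  case (2 g)
  then obtain f where f: "smooth f" "g = (\<lambda>x. f (x + a))" by auto
  have "((\<lambda>x. x + a) has_derivative (\<lambda>x. x)) (at x)" for x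
    by (auto intro!: derivative_eq_intros)
  then have "(g has_derivative frechet_derivative f (at (x + a))) (at x)" for x
    unfolding f(2)
    using diff_chain_at[OF _ smooth_has_derivative(1)[OF f(1)]]
    by (fastforce simp add: o_def)
  then show ?case
    using smooth_has_derivative(2)[OF f(1)]
    by (intro exI[of _ "\<lambda>w x. frechet_derivative f (at (x + a)) w"]) blast
qed

text \<open>The sum, product and chain rules produce functions of the same shape, so this closure
  consists of smooth functions.\<close>

inductive smooth_alg :: "('a::real_normed_vector \<Rightarrow> real) \<Rightarrow> bool" where
  base: "smooth f \<Longrightarrow> smooth_alg f"
| comp: "smooth g \<Longrightarrow> smooth f \<Longrightarrow> smooth_alg (\<lambda>x. (g :: real \<Rightarrow> real) (f x))"
| add: "smooth_alg f \<Longrightarrow> smooth_alg g \<Longrightarrow> smooth_alg (\<lambda>x. f x + g x)"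
| mult: "smooth_alg f \<Longrightarrow> smooth_alg g \<Longrightarrow> smooth_alg (\<lambda>x. f x * g x)"

lemma smooth_alg_derivative:
  "smooth_alg f \<Longrightarrow> \<exists>f'. (\<forall>x. (f has_derivative (\<lambda>w. f' w x)) (at x)) \<and> (\<forall>w. smooth_alg (f' w))"
proof (induction rule: smooth_alg.induct)
  case (base f)
  then show ?case
    by (intro exI[of _ "\<lambda>w x. frechet_derivative f (at x) w"])
       (simp add: smooth_has_derivative smooth_alg.base)
next
  case (comp g f)
  define f' where "f' w x = frechet_derivative f (at x) w * frechet_derivative g (at (f x)) 1" for w x
  have "((\<lambda>x. g (f x)) has_derivative (\<lambda>w. f' w x)) (at x)" for x
  proof -
    have lin: "linear (frechet_derivative g (at (f x)))"
      using smooth_has_derivative(1)[OF comp(1)] has_derivative_linear by blast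
    \<comment> \<open>A linear map on the reals is multiplication by its value at 1, so the chain
      rule becomes a product of two members of the class.\<close>
    have eq: "frechet_derivative g (at (f x)) w = w * frechet_derivative g (at (f x)) 1" for w
      using linear_scale[OF lin, of w 1] by simp
    have "(\<lambda>w. f' w x) = (\<lambda>w. frechet_derivative g (at (f x)) (frechet_derivative f (at x) w))"
      by (rule ext, unfold f'_def, rule eq[symmetric])
    then show ?thesis
      using diff_chain_at[OF smooth_has_derivative(1)[OF comp(2)] smooth_has_derivative(1)[OF comp(1)]]
      by (simp add: o_def)
  qed
  moreover have "smooth_alg (f' w)" for w
    unfolding f'_def
    by (rule smooth_alg.mult[OF smooth_alg.base[OF smooth_has_derivative(2)[OF comp(2)]]
          smooth_alg.comp[OF smooth_has_derivative(2)[OF comp(1)] comp(2)]])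
  ultimately show ?case by blast
next
  case (add f g)
  then obtain f' g' where "\<And>x. (f has_derivative (\<lambda>w. f' w x)) (at x)" "\<And>w. smooth_alg (f' w)"
    "\<And>x. (g has_derivative (\<lambda>w. g' w x)) (at x)" "\<And>w. smooth_alg (g' w)" by auto
  then show ?case
    by (intro exI[of _ "\<lambda>w x. f' w x + g' w x"]) (simp add: has_derivative_add smooth_alg.add)
next
  case (mult f g)
  then obtain f' g' where *: "\<And>x. (f has_derivative (\<lambda>w. f' w x)) (at x)" "\<And>w. smooth_alg (f' w)"
    "\<And>x. (g has_derivative (\<lambda>w. g' w x)) (at x)" "\<And>w. smooth_alg (g' w)" by auto
  have "((\<lambda>x. f x * g x) has_derivative (\<lambda>w. f x * g' w x + f' w x * g x)) (at x)" for x
    using has_derivative_mult[OF *(1) *(3)] by simp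
  then show ?case
    by (intro exI[of _ "\<lambda>w x. f x * g' w x + f' w x * g x"])
       (simp add: * mult smooth_alg.add smooth_alg.mult)
qed

lemma smooth_alg_smooth: "smooth_alg f \<Longrightarrow> smooth f"
proof (coinduction arbitrary: f)
  case smooth
  then show ?case using smooth_alg_derivative[of f] by blast
qed

lemma smooth_add: "smooth f \<Longrightarrow> smooth g \<Longrightarrow> smooth (\<lambda>x. f x + g x :: real)"
  by (rule smooth_alg_smooth[OF smooth_alg.add[OF smooth_alg.base smooth_alg.base]])

lemma smooth_mult: "smooth f \<Longrightarrow> smooth g \<Longrightarrow> smooth (\<lambda>x. f x * g x :: real)"
  by (rule smooth_alg_smooth[OF smooth_alg.mult[OF smooth_alg.base smooth_alg.base]])

lemma smooth_compose: "smooth h \<Longrightarrow> smooth f \<Longrightarrow> smooth (\<lambda>x. (h :: real \<Rightarrow> real) (f x))"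
  by (rule smooth_alg_smooth[OF smooth_alg.comp])

lemma smooth_linear: "bounded_linear f \<Longrightarrow> smooth f"
  by (rule smooth.intros[of f "\<lambda>w x. f w"]) (auto intro: bounded_linear_imp_has_derivative smooth_const)

lemma smooth_diff: "smooth f \<Longrightarrow> smooth g \<Longrightarrow> smooth (\<lambda>x. f x - g x :: real)"
  using smooth_add[of f "\<lambda>x. (-1) * g x", OF _ smooth_mult[OF smooth_const[of "-1::real"]]]
  by simp

lemma smooth_sum: "(\<And>i. i \<in> I \<Longrightarrow> smooth (f i)) \<Longrightarrow> smooth (\<lambda>x. \<Sum>i\<in>I. f i x :: real)"
  by (induction I rule: infinite_finite_induct) (auto intro: smooth_const smooth_add)

lemma smooth_prod: "(\<And>i. i \<in> I \<Longrightarrow> smooth (f i)) \<Longrightarrow> smooth (\<lambda>x. \<Prod>i\<in>I. f i x :: real)"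
  by (induction I rule: infinite_finite_induct) (auto intro: smooth_const smooth_mult)

lemma smooth_power: "smooth f \<Longrightarrow> smooth (\<lambda>x. f x ^ n :: real)"
  by (induction n) (auto intro: smooth_const smooth_mult)

text \<open>Neither function alone is closed under differentiation, but their span is.\<close>

lemma smooth_trig: "smooth (\<lambda>x::real. a * cos x + b * sin x)"
proof (rule smooth_coinduct[where X = "\<lambda>f. \<exists>a b. f = (\<lambda>x::real. a * cos x + b * sin x)"], goal_cases)
  case 1
  then show ?case by blast
next
  case (2 f)
  let ?X = "\<lambda>f. \<exists>a b. f = (\<lambda>x::real. a * cos x + b * sin x)"
  from 2 obtain a b where f: "f = (\<lambda>x. a * cos x + b * sin x)" by blast
  have "(f has_derivative (\<lambda>w. (w * b) * cos x + (- w * a) * sin x)) (at x)" for x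
    unfolding f by (auto intro!: derivative_eq_intros simp: algebra_simps)
  then show "\<exists>f'. (\<forall>x. (f has_derivative (\<lambda>w. f' w x)) (at x)) \<and> (\<forall>w. ?X (f' w))"
    by (intro exI[of _ "\<lambda>w x. (w * b) * cos x + (- w * a) * sin x"]) blast
qed

lemma smooth_cos: "smooth (cos :: real \<Rightarrow> real)" and smooth_sin: "smooth (sin :: real \<Rightarrow> real)"
  using smooth_trig[of 1 0] smooth_trig[of 0 1] by simp_all

section \<open>A flat function and smooth cutoffs\<close>

definition flat_poly :: "real poly \<Rightarrow> real \<Rightarrow> real" where
  "flat_poly P x = (if x > 0 then poly P (1 / x) * exp (- (1 / x)) else 0)"

lemma poly_exp_tendsto: "((\<lambda>y. poly P y * exp (- y)) \<longlongrightarrow> (0::real)) at_top"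
proof -
  have "((\<lambda>y. \<Sum>i\<le>degree P. coeff P i * (y ^ i / exp y)) \<longlongrightarrow> (\<Sum>i\<le>degree P. coeff P i * 0)) at_top"
    by (intro tendsto_intros tendsto_power_div_exp_0)
  then show ?thesis
    by (simp add: poly_altdef exp_minus sum_distrib_right divide_inverse mult.assoc)
qed

lemma flat_poly_tendsto: "(flat_poly P \<longlongrightarrow> 0) (at 0)"
proof -
  have "((\<lambda>x. poly P (inverse x) * exp (- inverse x)) \<longlongrightarrow> 0) (at_right 0)"
    using filterlim_compose[OF poly_exp_tendsto filterlim_inverse_at_top_right] .
  then have "(flat_poly P \<longlongrightarrow> 0) (at_right 0)"
    by (rule Lim_transform_eventually)
       (auto simp: flat_poly_def eventually_at_filter divide_inverse)
  moreover have "(flat_poly P \<longlongrightarrow> 0) (at_left 0)"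
    by (rule Lim_transform_eventually[OF tendsto_const])
       (auto simp: flat_poly_def eventually_at_filter)
  ultimately show ?thesis by (simp add: filterlim_split_at)
qed

text \<open>With y = 1/x the function is P(y) exp(-y), and dy/dx = -y^2, so the derivative is y^2 (P
  - P')(y) exp(-y), of the same form again. Hence the class is closed under differentiation.\<close>

lemma flat_poly_derivative:
  "(flat_poly P has_real_derivative flat_poly ([:0, 0, 1:] * (P - pderiv P)) x) (at x)"
proof -
  define Q where "Q = [:0, 0, 1:] * (P - pderiv P)"
  consider "x > 0" | "x < 0" | "x = 0" by linarith
  then have "(flat_poly P has_real_derivative flat_poly Q x) (at x)"
  proof cases
    case 1
    have inv: "((\<lambda>x. 1 / x) has_real_derivative - (1 / x\<^sup>2)) (at x)"
      using 1 by (auto intro!: derivative_eq_intros simp: power2_eq_square)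
    have "((\<lambda>x. poly P (1 / x) * exp (- (1 / x))) has_real_derivative
        (poly (pderiv P) (1 / x) * - (1 / x\<^sup>2)) * exp (- (1 / x)) +
        (exp (- (1 / x)) * - (- (1 / x\<^sup>2))) * poly P (1 / x)) (at x)"
      by (intro DERIV_mult DERIV_chain2[OF poly_DERIV inv] DERIV_chain2[OF DERIV_exp]
          DERIV_minus inv)
    also have "(poly (pderiv P) (1 / x) * - (1 / x\<^sup>2)) * exp (- (1 / x)) +
        (exp (- (1 / x)) * - (- (1 / x\<^sup>2))) * poly P (1 / x) = flat_poly Q x"
      unfolding Q_def using 1 by (simp add: flat_poly_def algebra_simps power2_eq_square)
    finally have "((\<lambda>x. poly P (1 / x) * exp (- (1 / x))) has_real_derivative flat_poly Q x) (at x)" .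
    then show ?thesis
      by (rule has_field_derivative_transform_within_open[of _ _ _ "{0<..}"])
         (use 1 in \<open>auto simp: flat_poly_def\<close>)
  next
    case 2
    have "((\<lambda>x. 0) has_real_derivative flat_poly Q x) (at x)"
      using 2 by (auto simp: flat_poly_def)
    then show ?thesis
      by (rule has_field_derivative_transform_within_open[of _ _ _ "{..<0}"])
         (use 2 in \<open>auto simp: flat_poly_def\<close>)
  next
    case 3
    \<comment> \<open>Dividing by h multiplies the polynomial in 1/h by its variable, which is
      \<open>pCons 0 P\<close>; flatness at the origin then makes the difference quotient vanish in
      the limit.\<close>
    have "((\<lambda>h. flat_poly (pCons 0 P) h) \<longlongrightarrow> 0) (at 0)" by (rule flat_poly_tendsto)
    then have "((\<lambda>h. (flat_poly P h - flat_poly P 0) / (h - 0)) \<longlongrightarrow> 0) (at 0)"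
      by (rule Lim_transform_eventually) (auto simp: flat_poly_def eventually_at_filter)
    then show ?thesis unfolding 3 has_field_derivative_iff by (simp add: flat_poly_def)
  qed
  then show ?thesis by (simp add: Q_def)
qed

lemma smooth_flat_poly: "smooth (flat_poly P)"
proof (rule smooth_coinduct[where X = "\<lambda>f. \<exists>P. f = flat_poly P"], goal_cases)
  case 1
  then show ?case by blast
next
  case (2 f)
  then obtain P where f: "f = flat_poly P" by blast
  define Q where "Q = [:0, 0, 1:] * (P - pderiv P)"
  have "(\<lambda>x. w * flat_poly Q x) = flat_poly (smult w Q)" for w
    by (auto simp: flat_poly_def fun_eq_iff)
  moreover have "(f has_derivative (\<lambda>w. w * flat_poly Q x)) (at x)" for x
  proof -
    have "(*) (flat_poly Q x) = (\<lambda>w. w * flat_poly Q x)" by (simp add: fun_eq_iff)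
    then show ?thesis
      using flat_poly_derivative[of P x, folded Q_def] unfolding f has_field_derivative_def by simp
  qed
  ultimately show ?case
    by (intro exI[of _ "\<lambda>w x. w * flat_poly Q x"]) blast
qed

text \<open>Being positive exactly on the positive axis, it turns the superlevel set of f at c into
  the positivity set of the smooth function \<open>bump (f x - c)\<close>. A product of two of them
  is a cutoff to an open interval.\<close>

definition bump :: "real \<Rightarrow> real" where
  "bump x = (if x > 0 then exp (- (1 / x)) else 0)"

lemma smooth_bump: "smooth bump"
proof -
  have "flat_poly 1 = bump" by (auto simp: bump_def flat_poly_def fun_eq_iff)
  then show ?thesis using smooth_flat_poly[of 1] by simp
qed

lemma bump_bounds: "0 \<le> bump x" "bump x \<le> 1" "bump x > 0 \<longleftrightarrow> x > 0" "x \<le> 0 \<Longrightarrow> bump x = 0"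
  by (auto simp: bump_def)

lemmas smooth_intros = smooth_const smooth_add smooth_diff smooth_mult smooth_sum smooth_prod smooth_power
  smooth_compose[OF smooth_bump] smooth_compose[OF smooth_cos] smooth_compose[OF smooth_sin]

section \<open>Integration over the torus\<close>

text \<open>The Borel counterpart of \<open>lcell\<close>. Translations, image measures and Fubini
  are handled here, since Lebesgue measurability is not preserved under composition with measurable
  maps.\<close>

abbreviation torus :: "(real^'d) measure" where
  "torus \<equiv> restrict_space lborel cell"

lemma measurable_vec_nth[measurable]: "(\<lambda>x::'a::euclidean_space^'d. x $ i) \<in> borel_measurable borel"
  by (intro borel_measurable_continuous_onI continuous_intros)

lemma cell_borel[measurable]: "(cell :: (real^'d) set) \<in> sets borel"
proof -
  have "(cell :: (real^'d) set) = (\<Inter>i. {x \<in> space borel. -1 \<le> x $ i} \<inter> {x \<in> space borel. x $ i < 1})"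
    by (auto simp: cell_def)
  moreover have "{x \<in> space borel. -1 \<le> x $ i} \<inter> {x \<in> space borel. x $ i < 1} \<in> sets (borel :: (real^'d) measure)" for i :: 'd
    by measurable
  then have "(\<Inter>i. {x \<in> space borel. -1 \<le> x $ i} \<inter> {x \<in> space borel. x $ i < 1}) \<in> sets (borel :: (real^'d) measure)"
    by (intro sets.finite_INT) auto
  ultimately show ?thesis by (simp only:)
qed

lemma cell_lebesgue[simp]: "(cell :: (real^'d) set) \<in> sets lebesgue"
  by (simp add: cell_borel)

lemma cell_subset_cbox: "(cell :: (real^'d) set) \<subseteq> cbox (\<chi> i. -1) (\<chi> i. 1)"
  by (auto simp: cell_def mem_box_cart less_imp_le)

lemma bounded_cell: "bounded (cell :: (real^'d) set)"
  using bounded_cbox bounded_subset cell_subset_cbox by blast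

lemma emeasure_cell_finite: "emeasure lborel (cell :: (real^'d) set) < \<infinity>"
  using emeasure_bounded_finite[OF bounded_cell] by simp

lemma space_torus[simp]: "space torus = cell"
  by (simp add: space_restrict_space)

lemma emeasure_torus_space: "emeasure torus (cell :: (real^'d) set) = emeasure lborel (cell :: (real^'d) set)"
  by (simp add: emeasure_restrict_space)

interpretation torus: finite_measure "torus :: (real^'d) measure"
  by standard (use emeasure_cell_finite[where 'd='d] emeasure_torus_space[where 'd='d] in \<open>auto simp: less_top\<close>)

lemma sets_torus: "sets torus = sets (borel_on cell)"
  by (simp add: sets_restrict_space)

lemma borel_measurable_torus: "f \<in> borel_measurable borel \<Longrightarrow> f \<in> borel_measurable torus"
  by (simp add: measurable_restrict_space1)

lemma AE_torus_iff: "(AE x in lcell. P x) \<longleftrightarrow> (AE x in torus. P x)"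
  by (simp add: AE_restrict_space_iff AE_completion_iff)

section \<open>Borel representatives of Lebesgue measurable functions\<close>

lemma nn_integral_lebesgue_on_borel:
  assumes "f \<in> borel_measurable borel" "A \<in> sets borel"
  shows "(\<integral>\<^sup>+x. f x \<partial>lebesgue_on A) = (\<integral>\<^sup>+x. f x \<partial>restrict_space lborel A)"
  using assms by (simp add: nn_integral_restrict_space nn_integral_completion)

lemma integrable_lebesgue_on_borel:
  fixes f :: "'a::euclidean_space \<Rightarrow> 'b::{banach, second_countable_topology}"
  assumes "f \<in> borel_measurable borel" "A \<in> sets borel"
  shows "integrable (lebesgue_on A) f \<longleftrightarrow> integrable (restrict_space lborel A) f"
  using assms by (simp add: integrable_restrict_space integrable_completion)

lemma integral_lebesgue_on_borel:
  fixes f :: "'a::euclidean_space \<Rightarrow> 'b::{banach, second_countable_topology}"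
  assumes "f \<in> borel_measurable borel" "A \<in> sets borel"
  shows "integral\<^sup>L (lebesgue_on A) f = integral\<^sup>L (restrict_space lborel A) f"
  using assms by (simp add: integral_restrict_space integral_completion)

text \<open>The measurability is improved one coordinate at a time, where real-valued functions
  measurable for a completion have Borel versions.\<close>

lemma lebesgue_on_ex_borel:
  fixes f :: "'a::euclidean_space \<Rightarrow> 'b::euclidean_space"
  assumes "f \<in> borel_measurable (lebesgue_on A)" "A \<in> sets borel"
  obtains g where "g \<in> borel_measurable borel" "AE x in lborel. x \<in> A \<longrightarrow> f x = g x"
proof -
  have f: "(\<lambda>x. indicator A x *\<^sub>R f x) \<in> borel_measurable lebesgue"
    using assms by (subst borel_measurable_restrict_space_iff[symmetric]) auto
  have "(\<lambda>x. (indicator A x *\<^sub>R f x) \<bullet> b) \<in> borel_measurable lebesgue" for b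
    using f by measurable
  then have "\<exists>h. h \<in> borel_measurable lborel \<and> (AE x in lborel. (indicator A x *\<^sub>R f x) \<bullet> b = (h x :: real))" for b
    using completion_ex_borel_measurable_real[of "\<lambda>x. (indicator A x *\<^sub>R f x) \<bullet> b" lborel] by blast
  then obtain h where h: "\<And>b. h b \<in> borel_measurable lborel"
    "\<And>b. AE x in lborel. (indicator A x *\<^sub>R f x) \<bullet> b = (h b x :: real)" by metis
  show ?thesis
  proof (rule that)
    show "(\<lambda>x. \<Sum>b\<in>Basis. h b x *\<^sub>R b) \<in> borel_measurable borel" using h(1) by measurable
    have "AE x in lborel. \<forall>b\<in>Basis. (indicator A x *\<^sub>R f x) \<bullet> b = h b x"
      using h(2) by (intro AE_finite_allI) auto
    then show "AE x in lborel. x \<in> A \<longrightarrow> f x = (\<Sum>b\<in>Basis. h b x *\<^sub>R b)"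
    proof eventually_elim
      case (elim x)
      show ?case
      proof
        assume "x \<in> A"
        then have "f x \<bullet> b = h b x" if "b \<in> Basis" for b using elim that by auto
        then show "f x = (\<Sum>b\<in>Basis. h b x *\<^sub>R b)"
          using euclidean_representation[of "f x", symmetric] by simp
      qed
    qed
  qed
qed

section \<open>Periodicity and the fundamental cell\<close>

lemma periodic_int:
  assumes "periodic f"
  shows "f (x + (2 * of_int k) *\<^sub>R axis i 1) = f x"
proof -
  have nat: "f (x + (2 * of_nat n) *\<^sub>R axis i 1) = f x" for n x
  proof (induction n arbitrary: x)
    case (Suc n)
    have "x + (2 * of_nat (Suc n)) *\<^sub>R axis i 1 = (x + (2 * of_nat n) *\<^sub>R axis i 1) + 2 *\<^sub>R axis i (1::real)"
      by (simp add: algebra_simps scaleR_add_left)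
    moreover have "f ((x + (2 * of_nat n) *\<^sub>R axis i 1) + 2 *\<^sub>R axis i (1::real)) = f (x + (2 * of_nat n) *\<^sub>R axis i 1)"
      using assms unfolding periodic_def by blast
    ultimately show ?case by (simp only: Suc.IH)
  qed simp
  show ?thesis
  proof (cases k rule: int_cases2)
    case (nonneg n)
    then show ?thesis using nat[of x n] by simp
  next
    case (nonpos n)
    then show ?thesis using nat[of "x + (2 * of_int k) *\<^sub>R axis i 1" n] by simp
  qed
qed

text \<open>The representative of x modulo the lattice of even integer vectors that lies in the
  half-open cell.\<close>

definition wrap :: "real^'d \<Rightarrow> real^'d" where
  "wrap x = (\<chi> i. x $ i - 2 * of_int \<lfloor>(x $ i + 1) / 2\<rfloor>)"

lemma wrap_in_cell: "wrap x \<in> cell"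
proof -
  have "-1 \<le> y - 2 * of_int \<lfloor>(y + 1) / 2\<rfloor> \<and> y - 2 * of_int \<lfloor>(y + 1) / 2\<rfloor> < 1" for y :: real
  proof -
    have "of_int \<lfloor>(y + 1) / 2\<rfloor> \<le> (y + 1) / 2" "(y + 1) / 2 < of_int \<lfloor>(y + 1) / 2\<rfloor> + 1" by linarith+
    then show ?thesis by (simp add: field_simps)
  qed
  then show ?thesis by (simp add: wrap_def cell_def)
qed

lemma wrap_id: "x \<in> cell \<Longrightarrow> wrap x = x"
proof -
  assume x: "x \<in> cell"
  have "\<lfloor>(x $ i + 1) / 2\<rfloor> = 0" for i
  proof -
    have "-1 \<le> x $ i" "x $ i < 1" using x by (auto simp: cell_def)
    then show ?thesis by (simp add: floor_eq_iff)
  qed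
  then show ?thesis by (simp add: wrap_def vec_eq_iff)
qed

lemma wrap_measurable[measurable]: "wrap \<in> borel_measurable borel"
proof (rule borel_measurable_euclidean_space[THEN iffD2], rule ballI)
  fix b :: "real^'a" assume "b \<in> Basis"
  then obtain i where "b = axis i 1" by (auto simp: Basis_vec_def)
  then show "(\<lambda>x. wrap x \<bullet> b) \<in> borel_measurable borel"
    by (simp add: wrap_def inner_axis)
qed

lemma periodic_wrap_fun: "periodic (\<lambda>x. f (wrap x))"
proof -
  have "wrap (x + 2 *\<^sub>R axis i 1) = wrap x" for x :: "real^'a" and i
  proof -
    have "\<lfloor>(y + 2 + 1) / 2\<rfloor> = \<lfloor>(y + 1) / 2\<rfloor> + 1" for y :: real
    proof -
      have "(y + 2 + 1) / 2 = (y + 1) / 2 + of_int 1" by (simp add: field_simps)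
      then show ?thesis by (simp only: floor_add_int[symmetric])
    qed
    then show ?thesis by (auto simp: wrap_def vec_eq_iff axis_def add.commute add.left_commute)
  qed
  then show ?thesis by (simp add: periodic_def)
qed

lemma periodic_wrap:
  assumes "periodic f"
  shows "f (wrap x) = f x"
proof -
  have "f (x + (\<Sum>i\<in>I. (2 * of_int (k i)) *\<^sub>R axis i 1)) = f x" if "finite I" for I k x
    using that
  proof (induction I arbitrary: x)
    case (insert i I)
    have "x + (\<Sum>i\<in>insert i I. (2 * of_int (k i)) *\<^sub>R axis i 1) =
        (x + (\<Sum>i\<in>I. (2 * of_int (k i)) *\<^sub>R axis i 1)) + (2 * of_int (k i)) *\<^sub>R axis i (1::real)"
      by (simp only: sum.insert[OF insert.hyps] add.commute add.left_commute add.assoc)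
    then show ?case
      using periodic_int[OF assms, of "x + (\<Sum>i\<in>I. (2 * of_int (k i)) *\<^sub>R axis i 1)" "k i" i]
        insert.IH[of x] by metis
  qed simp
  moreover have "wrap x = x + (\<Sum>i\<in>UNIV. (2 * of_int (- \<lfloor>(x $ i + 1) / 2\<rfloor>)) *\<^sub>R axis i 1)"
    by (simp add: vec_eq_iff wrap_def axis_def if_distrib sum.delta cong: if_cong)
  ultimately show ?thesis by (simp only: finite_class.finite_UNIV)
qed

section \<open>Translation invariance of integrals and null sets\<close>

lemma periodic_shift: "periodic f \<Longrightarrow> periodic (\<lambda>x. f (x + a))"
  unfolding periodic_def
proof (intro allI)
  fix x :: "real^'a" and i assume "\<forall>x i. f (x + 2 *\<^sub>R axis i 1) = f x"
  moreover have "x + 2 *\<^sub>R axis i 1 + a = (x + a) + 2 *\<^sub>R axis i 1" by simp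
  ultimately show "f (x + 2 *\<^sub>R axis i 1 + a) = f (x + a)" by metis
qed

text \<open>The translated cell consists of the slab A of the cell that it still covers and of the
  remaining slab B moved by a full period; periodicity moves B back.\<close>

lemma nn_integral_torus_shift_axis:
  fixes f :: "real^'d \<Rightarrow> ennreal"
  assumes [measurable]: "f \<in> borel_measurable borel" and per: "periodic f" and s: "0 \<le> s" "s < 2"
  shows "(\<integral>\<^sup>+x. f (x + s *\<^sub>R axis i 1) \<partial>torus) = (\<integral>\<^sup>+x. f x \<partial>torus)"
proof -
  define a :: "real^'d" where "a = s *\<^sub>R axis i 1"
  define e :: "real^'d" where "e = 2 *\<^sub>R axis i 1"
  define A where "A = {x \<in> cell. -1 + s \<le> x $ i}"
  define B where "B = {x \<in> cell. x $ i < -1 + s}"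
  have A: "A \<in> sets borel" "B \<in> sets borel"
  proof -
    have "A = cell \<inter> {x \<in> space borel. -1 + s \<le> x $ i}" "B = cell \<inter> {x \<in> space borel. x $ i < -1 + s}"
      by (auto simp: A_def B_def)
    moreover have "{x \<in> space borel. -1 + s \<le> x $ i} \<in> sets borel" "{x \<in> space borel. x $ i < -1 + s} \<in> sets borel"
      by measurable
    ultimately show "A \<in> sets borel" "B \<in> sets borel" by auto
  qed
  note [measurable] = this
  have shift: "(\<integral>\<^sup>+x. g (x + c) \<partial>lborel) = (\<integral>\<^sup>+x. g x \<partial>lborel)"
    if [measurable]: "g \<in> borel_measurable borel" for g :: "real^'d \<Rightarrow> ennreal" and c
  proof -
    have "(\<integral>\<^sup>+x. g x \<partial>lborel) = (\<integral>\<^sup>+x. g x \<partial>distr lborel borel ((+) c))" by (simp add: lborel_distr_plus)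
    also have "\<dots> = (\<integral>\<^sup>+x. g (x + c) \<partial>lborel)" by (subst nn_integral_distr) (auto simp: add.commute)
    finally show ?thesis by simp
  qed
  have ind: "indicator cell (x - a) = indicator A x + (indicator B (x - e) :: ennreal)" for x
  proof -
    have "x - a \<in> cell \<longleftrightarrow> x \<in> A \<or> x - e \<in> B"
    proof -
      have "(\<forall>k. P k) \<longleftrightarrow> (\<forall>k. k \<noteq> i \<longrightarrow> P k) \<and> P i" for P by metis
      note * = this
      show ?thesis unfolding cell_def A_def B_def mem_Collect_eq
        by (subst (1 2 3) *) (use s in \<open>auto simp: a_def e_def axis_def\<close>)
    qed
    moreover have "\<not> (x \<in> A \<and> x - e \<in> B)"
    proof
      assume "x \<in> A \<and> x - e \<in> B"
      then have "x $ i < 1" "-1 \<le> (x - e) $ i" by (auto simp: A_def B_def cell_def)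
      then show False by (simp add: e_def axis_def)
    qed
    ultimately show ?thesis by (auto simp: indicator_def)
  qed
  have indAB: "indicator cell x = indicator A x + (indicator B x :: ennreal)" for x
    by (auto simp: A_def B_def indicator_def)
  have "(\<integral>\<^sup>+x. f (x + a) \<partial>torus) = (\<integral>\<^sup>+x. f (x + a) * indicator cell (x + a - a) \<partial>lborel)"
    by (simp add: nn_integral_restrict_space)
  also have "\<dots> = (\<integral>\<^sup>+x. f x * indicator cell (x - a) \<partial>lborel)"
    by (rule shift[of "\<lambda>x. f x * indicator cell (x - a)" a]) measurable
  also have "\<dots> = (\<integral>\<^sup>+x. f x * indicator A x \<partial>lborel) + (\<integral>\<^sup>+x. f x * indicator B (x - e) \<partial>lborel)"
    unfolding ind by (subst nn_integral_add[symmetric]) (auto simp: distrib_left)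
  also have "(\<integral>\<^sup>+x. f x * indicator B (x - e) \<partial>lborel) = (\<integral>\<^sup>+x. f (x + e) * indicator B (x + e - e) \<partial>lborel)"
    by (rule shift[of "\<lambda>x. f x * indicator B (x - e)" e, symmetric]) measurable
  also have "\<dots> = (\<integral>\<^sup>+x. f x * indicator B x \<partial>lborel)"
    using per by (simp add: periodic_def e_def)
  also have "(\<integral>\<^sup>+x. f x * indicator A x \<partial>lborel) + (\<integral>\<^sup>+x. f x * indicator B x \<partial>lborel) = (\<integral>\<^sup>+x. f x * indicator cell x \<partial>lborel)"
    unfolding indAB by (subst nn_integral_add[symmetric]) (auto simp: distrib_left)
  also have "\<dots> = (\<integral>\<^sup>+x. f x \<partial>torus)" by (simp add: nn_integral_restrict_space)
  finally show ?thesis by (simp add: a_def)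
qed

lemma nn_integral_torus_shift:
  fixes f :: "real^'d \<Rightarrow> ennreal"
  assumes [measurable]: "f \<in> borel_measurable borel" and per: "periodic f"
  shows "(\<integral>\<^sup>+x. f (x + a) \<partial>torus) = (\<integral>\<^sup>+x. f x \<partial>torus)"
proof -
  have axis: "(\<integral>\<^sup>+x. g (x + s *\<^sub>R axis i 1) \<partial>torus) = (\<integral>\<^sup>+x. g x \<partial>torus)"
    if g: "g \<in> borel_measurable borel" "periodic g" for g :: "real^'d \<Rightarrow> ennreal" and s i
  proof -
    define s' where "s' = s - 2 * of_int \<lfloor>s / 2\<rfloor>"
    have s': "0 \<le> s'" "s' < 2" unfolding s'_def by linarith+
    have "g (x + s *\<^sub>R axis i 1) = g (x + s' *\<^sub>R axis i 1)" for x
    proof -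
      have "x + s *\<^sub>R axis i 1 = (x + s' *\<^sub>R axis i 1) + (2 * of_int \<lfloor>s / 2\<rfloor>) *\<^sub>R axis i 1"
        by (simp add: s'_def scaleR_left_diff_distrib)
      then show ?thesis using periodic_int[OF g(2), of "x + s' *\<^sub>R axis i 1" "\<lfloor>s / 2\<rfloor>" i] by metis
    qed
    then show ?thesis using nn_integral_torus_shift_axis[OF g s'] by simp
  qed
  have "(\<integral>\<^sup>+x. f (x + (\<Sum>i\<in>I. (a $ i) *\<^sub>R axis i 1)) \<partial>torus) = (\<integral>\<^sup>+x. f x \<partial>torus)" if "finite I" for I :: "'d set"
    using that
  proof (induction I)
    case (insert i I)
    define c where "c = (\<Sum>i\<in>I. (a $ i) *\<^sub>R axis i (1::real))"
    have "(\<Sum>i\<in>insert i I. (a $ i) *\<^sub>R axis i (1::real)) = (a $ i) *\<^sub>R axis i 1 + c"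
      unfolding c_def by (rule sum.insert[OF insert.hyps])
    then have "(\<integral>\<^sup>+x. f (x + (\<Sum>i\<in>insert i I. (a $ i) *\<^sub>R axis i 1)) \<partial>torus) =
        (\<integral>\<^sup>+x. f ((x + (a $ i) *\<^sub>R axis i 1) + c) \<partial>torus)"
      by (simp only: add.assoc)
    also have "\<dots> = (\<integral>\<^sup>+x. f (x + c) \<partial>torus)"
    proof (rule axis)
      show "(\<lambda>x. f (x + c)) \<in> borel_measurable borel" by measurable
    qed (rule periodic_shift[OF per])
    finally show ?case unfolding c_def insert.IH .
  qed simp
  note * = this[OF finite_class.finite_UNIV]
  have "(\<Sum>i\<in>UNIV. (a $ i) *\<^sub>R axis i (1::real)) = a"
    by (simp add: vec_eq_iff axis_def if_distrib sum.delta cong: if_cong)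
  with * show ?thesis by (simp only:)
qed

text \<open>Invariance is put as an equality of image measures because in this form it passes at
  once to Bochner integrals, integrability and null sets.\<close>

lemma distr_torus_shift: "distr torus borel (\<lambda>x. wrap (x + a)) = distr torus borel (\<lambda>x. x)"
proof (rule measure_eqI)
  fix B assume B: "B \<in> sets (distr torus borel (\<lambda>x. wrap (x + a)))"
  then have [measurable]: "B \<in> sets borel" by simp
  have 1: "(\<lambda>x. wrap (x + a)) \<in> torus \<rightarrow>\<^sub>M borel" by (intro borel_measurable_torus) measurable
  have 2: "(\<lambda>x. x) \<in> torus \<rightarrow>\<^sub>M borel" by (intro borel_measurable_torus) measurable
  have "emeasure (distr torus borel (\<lambda>x. wrap (x + a))) B = (\<integral>\<^sup>+x. indicator B x \<partial>distr torus borel (\<lambda>x. wrap (x + a)))"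
    by simp
  also have "\<dots> = (\<integral>\<^sup>+x. indicator B (wrap (x + a)) \<partial>torus)"
    by (subst nn_integral_distr[OF 1]) auto
  also have "\<dots> = (\<integral>\<^sup>+x. indicator B (wrap x) \<partial>torus)"
    by (intro nn_integral_torus_shift[of "\<lambda>x. indicator B (wrap x)"] periodic_wrap_fun) measurable
  also have "\<dots> = (\<integral>\<^sup>+x. indicator B x \<partial>torus)"
    by (intro nn_integral_cong) (simp add: wrap_id)
  also have "\<dots> = (\<integral>\<^sup>+x. indicator B x \<partial>distr torus borel (\<lambda>x. x))"
    by (subst nn_integral_distr[OF 2]) auto
  also have "\<dots> = emeasure (distr torus borel (\<lambda>x. x)) B" by simp
  finally show "emeasure (distr torus borel (\<lambda>x. wrap (x + a))) B = emeasure (distr torus borel (\<lambda>x. x)) B" .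
qed simp

lemma
  fixes f :: "real^'d \<Rightarrow> 'b::{banach, second_countable_topology}"
  assumes [measurable]: "f \<in> borel_measurable borel" and per: "periodic f"
  shows integrable_torus_shift: "integrable torus (\<lambda>x. f (x + a)) \<longleftrightarrow> integrable torus f"
    and integral_torus_shift: "(\<integral>x. f (x + a) \<partial>torus) = (\<integral>x. f x \<partial>torus)"
proof -
  have 1: "(\<lambda>x. wrap (x + a)) \<in> torus \<rightarrow>\<^sub>M borel" by (intro borel_measurable_torus) measurable
  have 2: "(\<lambda>x. x) \<in> torus \<rightarrow>\<^sub>M borel" by (intro borel_measurable_torus) measurable
  show "integrable torus (\<lambda>x. f (x + a)) \<longleftrightarrow> integrable torus f"
    using integrable_distr_eq[OF 1, of f] integrable_distr_eq[OF 2, of f] periodic_wrap[OF per]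
    by (simp add: distr_torus_shift)
  show "(\<integral>x. f (x + a) \<partial>torus) = (\<integral>x. f x \<partial>torus)"
    using integral_distr[OF 1, of f] integral_distr[OF 2, of f] periodic_wrap[OF per]
    by (simp add: distr_torus_shift)
qed

lemma AE_torus_shift:
  assumes "periodic P" "AE x in torus. P x"
  shows "AE x in torus. P (x + a)"
proof -
  have 1: "(\<lambda>x. wrap (x + a)) \<in> torus \<rightarrow>\<^sub>M borel" by (intro borel_measurable_torus) measurable
  have 2: "(\<lambda>x. x) \<in> torus \<rightarrow>\<^sub>M borel" by (intro borel_measurable_torus) measurable
  obtain N where N: "N \<in> sets torus" "emeasure torus N = 0" "{x \<in> cell. \<not> P x} \<subseteq> N"
    using assms(2) by (auto elim!: AE_E)
  have Nb[measurable]: "N \<in> sets borel" and Nc: "N \<subseteq> cell"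
    using N(1) by (auto simp: sets_restrict_space_iff)
  have "emeasure (distr torus borel (\<lambda>x. x)) N = 0"
    using N Nc by (subst emeasure_distr[OF 2]) (auto simp: Int_absorb2)
  then have "AE y in distr torus borel (\<lambda>x. x). y \<notin> N"
    by (intro AE_not_in null_setsI) auto
  then have "AE y in distr torus borel (\<lambda>x. wrap (x + a)). y \<notin> N" unfolding distr_torus_shift .
  then have "AE x in torus. wrap (x + a) \<notin> N"
    by (subst (asm) AE_distr_iff[OF 1]) auto
  then show ?thesis
  proof eventually_elim
    case (elim x)
    then have "P (wrap (x + a))" using N(3) wrap_in_cell[of "x + a"] by blast
    then show ?case using periodic_wrap[OF assms(1), of "x + a"] by simp
  qed
qed

text \<open>Composition with \<open>wrap\<close> makes a Borel version periodic and leaves it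
  unchanged on the cell.\<close>

lemma torus_ex_borel_periodic:
  fixes f :: "real^'d \<Rightarrow> 'b::euclidean_space"
  assumes "f \<in> borel_measurable lcell"
  obtains g where "g \<in> borel_measurable borel" "periodic g" "AE x in torus. f x = g x"
proof -
  obtain h where h: "h \<in> borel_measurable borel" "AE x in lborel. x \<in> cell \<longrightarrow> f x = h x"
    using lebesgue_on_ex_borel[OF assms cell_borel] by blast
  show ?thesis
  proof (rule that[of "\<lambda>x. h (wrap x)"])
    show "(\<lambda>x. h (wrap x)) \<in> borel_measurable borel" using h(1) by measurable
    show "AE x in torus. f x = h (wrap x)"
      using h(2) by (auto simp: AE_restrict_space_iff wrap_id)
  qed (rule periodic_wrap_fun)
qed

section \<open>Generating classes of functions\<close>

text \<open>The powers \<open>1 - (1 - f) ^ m\<close> increase to the indicator of \<open>{f > 0}\<close>, so that the integrals of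
  the functions in a class closed under this operation determine the measure of that set.\<close>

definition generating :: "'a measure \<Rightarrow> ('a \<Rightarrow> real) set \<Rightarrow> bool" where
  "generating M \<A> \<longleftrightarrow>
     sets M = sigma_sets (space M) {{x \<in> space M. 0 < f x} | f. f \<in> \<A>} \<and>
     (\<forall>f\<in>\<A>. f \<in> borel_measurable M \<and> (\<forall>x. 0 \<le> f x \<and> f x \<le> 1)) \<and>
     (\<forall>f\<in>\<A>. \<forall>g\<in>\<A>. (\<lambda>x. f x * g x) \<in> \<A>) \<and>
     (\<forall>f\<in>\<A>. \<forall>m. (\<lambda>x. 1 - (1 - f x) ^ m) \<in> \<A>) \<and>
     (\<exists>F::nat \<Rightarrow> _. range F \<subseteq> \<A> \<and> (\<Union>k. {x \<in> space M. 0 < F k x}) = space M)"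

lemma generating_cong: "sets M = sets N \<Longrightarrow> generating M \<A> \<longleftrightarrow> generating N \<A>"
  using sets_eq_imp_space_eq[of M N] by (simp add: generating_def cong: measurable_cong_sets)

lemma generating_Int_stable:
  assumes "generating M \<A>"
  shows "Int_stable {{x \<in> space M. 0 < f x} | f. f \<in> \<A>}"
proof (rule Int_stableI, clarify)
  fix f g assume fg: "f \<in> \<A>" "g \<in> \<A>"
  then have nn: "0 \<le> f x" "0 \<le> g x" for x using assms by (auto simp: generating_def)
  have "0 < f x * g x \<longleftrightarrow> 0 < f x \<and> 0 < g x" for x
    using nn[of x] by (auto simp: less_le)
  then have "{x \<in> space M. 0 < f x} \<inter> {x \<in> space M. 0 < g x} = {x \<in> space M. 0 < f x * g x}" by auto
  moreover have "(\<lambda>x. f x * g x) \<in> \<A>" using fg assms by (auto simp: generating_def)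
  ultimately show "\<exists>h. {x \<in> space M. 0 < f x} \<inter> {x \<in> space M. 0 < g x} = {x \<in> space M. 0 < h x} \<and> h \<in> \<A>"
    by (intro exI[of _ "\<lambda>x. f x * g x"] conjI)
qed

lemma power_indicator_tendsto:
  fixes a :: real assumes "0 \<le> a" "a \<le> 1"
  shows "(\<lambda>m. 1 - (1 - a) ^ m) \<longlonglongrightarrow> (if 0 < a then 1 else 0)"
proof (cases "0 < a")
  case True
  then have "(\<lambda>m. (1 - a) ^ m) \<longlonglongrightarrow> 0" using assms by (intro LIMSEQ_realpow_zero) auto
  from tendsto_diff[OF tendsto_const this, of 1] show ?thesis using True by simp
next
  case False
  then show ?thesis using assms by simp
qed

lemma generating_tendsto_measure:
  assumes gen: "generating M \<A>" and "finite_measure M" "f \<in> \<A>"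
  shows "(\<lambda>m. \<integral>x. 1 - (1 - f x) ^ m \<partial>M) \<longlonglongrightarrow> measure M {x \<in> space M. 0 < f x}"
proof -
  interpret finite_measure M by fact
  have [measurable]: "f \<in> borel_measurable M" and f: "0 \<le> f x" "f x \<le> 1" for x
    using assms by (auto simp: generating_def)
  have "(\<lambda>m. \<integral>x. 1 - (1 - f x) ^ m \<partial>M) \<longlonglongrightarrow> (\<integral>x. indicator {x \<in> space M. 0 < f x} x \<partial>M)"
  proof (rule integral_dominated_convergence[where w = "\<lambda>_. 1"])
    show "AE x in M. (\<lambda>m. 1 - (1 - f x) ^ m) \<longlonglongrightarrow> indicator {x \<in> space M. 0 < f x} x"
    proof (rule AE_I2)
      fix x assume "x \<in> space M"
      then show "(\<lambda>m. 1 - (1 - f x) ^ m) \<longlonglongrightarrow> indicator {x \<in> space M. 0 < f x} x"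
        using power_indicator_tendsto[OF f[of x]] by (cases "0 < f x") (simp_all add: indicator_def)
    qed
    have "norm (1 - (1 - f x) ^ m) \<le> 1" for m x
      using f[of x] power_le_one[of "1 - f x" m] zero_le_power[of "1 - f x" m] by auto
    then show "AE x in M. norm (1 - (1 - f x) ^ m) \<le> 1" for m by simp
  qed measurable
  then show ?thesis by simp
qed

text \<open>In the limit m to infinity the integrals of \<open>1 - (1 - f) ^ m\<close> give the
  masses of the positivity sets, and these sets form an intersection-stable generator.\<close>

lemma generating_measure_eqI:
  assumes gen: "generating P \<A>" and sets: "sets N = sets P"
    and fin: "finite_measure P" "finite_measure N"
    and eq: "\<And>f. f \<in> \<A> \<Longrightarrow> (\<integral>x. f x \<partial>P) = (\<integral>x. f x \<partial>N)"
  shows "P = N"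
proof -
  have genN: "generating N \<A>" using gen generating_cong[OF sets] by simp
  have sp: "space N = space P" using sets by (rule sets_eq_imp_space_eq)
  have "emeasure P {x \<in> space P. 0 < f x} = emeasure N {x \<in> space P. 0 < f x}" if f: "f \<in> \<A>" for f
  proof -
    have "(\<integral>x. 1 - (1 - f x) ^ m \<partial>P) = (\<integral>x. 1 - (1 - f x) ^ m \<partial>N)" for m
      using f gen by (intro eq) (auto simp: generating_def)
    then have "measure P {x \<in> space P. 0 < f x} = measure N {x \<in> space P. 0 < f x}"
      using generating_tendsto_measure[OF gen fin(1) f] generating_tendsto_measure[OF genN fin(2) f]
      by (simp add: LIMSEQ_unique sp)
    then show ?thesis
      by (simp add: finite_measure.emeasure_eq_measure fin)
  qed
  note eqE = this
  obtain F :: "nat \<Rightarrow> _" where F: "range F \<subseteq> \<A>" "(\<Union>k. {x \<in> space P. 0 < F k x}) = space P"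
    using gen unfolding generating_def by auto
  show ?thesis
  proof (rule measure_eqI_generator_eq[OF generating_Int_stable[OF gen], where A = "\<lambda>k. {x \<in> space P. 0 < F k x}"])
    show "sets P = sigma_sets (space P) {{x \<in> space P. 0 < f x} |f. f \<in> \<A>}"
      using gen by (auto simp: generating_def)
    then show "sets N = sigma_sets (space P) {{x \<in> space P. 0 < f x} |f. f \<in> \<A>}"
      using sets by simp
    show "range (\<lambda>k. {x \<in> space P. 0 < F k x}) \<subseteq> {{x \<in> space P. 0 < f x} |f. f \<in> \<A>}"
      using F(1) by blast
    show "emeasure P {x \<in> space P. 0 < F i x} \<noteq> \<infinity>" for i
      using fin(1) by (simp add: finite_measure.emeasure_eq_measure)
  qed (use eqE F(2) in auto)
qed

text \<open>The positive and the negative part of g are densities of two finite measures with the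
  same integrals over the class. The measures agree, so the two parts agree almost everywhere; as
  one of them always vanishes, both do.\<close>

lemma generating_AE_zero:
  fixes g :: "'a \<Rightarrow> real"
  assumes gen: "generating M \<A>" and fin: "finite_measure M" and g: "integrable M g"
    and eq: "\<And>f. f \<in> \<A> \<Longrightarrow> (\<integral>x. f x * g x \<partial>M) = 0"
  shows "AE x in M. g x = 0"
proof -
  interpret finite_measure M by fact
  have [measurable]: "g \<in> borel_measurable M" using g by simp
  define P where "P = density M (\<lambda>x. ennreal (max 0 (g x)))"
  define N where "N = density M (\<lambda>x. ennreal (max 0 (- g x)))"
  have int: "integrable M (\<lambda>x. max 0 (g x))" "integrable M (\<lambda>x. max 0 (- g x))" using g by auto
  have fin: "finite_measure P" "finite_measure N"
  proof -
    have "finite_measure (density M (\<lambda>x. ennreal (h x)))" if h: "integrable M h" "\<And>x. 0 \<le> h x" for h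
    proof (rule finite_measureI)
      have [measurable]: "h \<in> borel_measurable M" using h by simp
      have "emeasure (density M (\<lambda>x. ennreal (h x))) (space M) = (\<integral>\<^sup>+x. ennreal (h x) * indicator (space M) x \<partial>M)"
        by (rule emeasure_density) measurable
      also have "\<dots> = (\<integral>\<^sup>+x. ennreal (h x) \<partial>M)" by (intro nn_integral_cong) simp
      also have "\<dots> = ennreal (\<integral>x. h x \<partial>M)" using h by (intro nn_integral_eq_integral) auto
      finally show "emeasure (density M (\<lambda>x. ennreal (h x))) (space (density M (\<lambda>x. ennreal (h x)))) \<noteq> \<infinity>"
        by simp
    qed
    from this[OF int(1)] this[OF int(2)] show "finite_measure P" "finite_measure N"
      by (simp_all add: P_def N_def)
  qed
  have "P = N"
  proof (rule generating_measure_eqI[of _ \<A>])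
    show "generating P \<A>" using gen generating_cong[of P M] by (simp add: P_def)
    fix f assume f: "f \<in> \<A>"
    then have [measurable]: "f \<in> borel_measurable M" and b: "0 \<le> f x" "f x \<le> 1" for x
      using gen by (auto simp: generating_def)
    have "integrable M (\<lambda>x. f x * h x)" if "integrable M h" for h :: "'a \<Rightarrow> real"
    proof (rule integrable_bound[OF that])
      have [measurable]: "h \<in> borel_measurable M" using that by simp
      show "(\<lambda>x. f x * h x) \<in> borel_measurable M" by measurable
      have "norm (f x * h x) \<le> norm (h x)" for x
        using b[of x] by (simp add: abs_mult mult_left_le_one_le)
      then show "AE x in M. norm (f x * h x) \<le> norm (h x)" by simp
    qed
    note * = this[OF int(1)] this[OF int(2)]
    have "(\<integral>x. f x \<partial>P) - (\<integral>x. f x \<partial>N) = (\<integral>x. f x * max 0 (g x) - f x * max 0 (- g x) \<partial>M)"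
      using * by (simp add: P_def N_def integral_density mult.commute)
    also have "\<dots> = (\<integral>x. f x * g x \<partial>M)"
      by (intro integral_cong) (auto simp: max_def)
    finally show "(\<integral>x. f x \<partial>P) = (\<integral>x. f x \<partial>N)" using eq[OF f] by simp
  qed (use fin in \<open>auto simp: P_def N_def\<close>)
  then have "AE x in M. ennreal (max 0 (g x)) = ennreal (max 0 (- g x))"
    unfolding P_def N_def by (subst (asm) density_unique_iff) auto
  then show ?thesis by eventually_elim (auto simp: max_def split: if_splits)
qed

text \<open>The functions that L approximates in the mean form a class D closed under sums,
  multiples and limits in the mean. It contains the indicators of positivity sets as limits of
  \<open>1 - (1 - f) ^ m\<close>, then all indicators by a Dynkin argument, then all integrable
  functions.\<close>

lemma generating_dense:
  fixes u :: "'a \<Rightarrow> real"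
  assumes gen: "generating M \<A>" and fin: "finite_measure M" and u: "integrable M u"
    and L: "\<And>f. f \<in> L \<Longrightarrow> integrable M f" "\<A> \<subseteq> L" "(\<lambda>_. 1) \<in> L"
      "\<And>f g. f \<in> L \<Longrightarrow> g \<in> L \<Longrightarrow> (\<lambda>x. f x + g x) \<in> L" "\<And>f c. f \<in> L \<Longrightarrow> (\<lambda>x. c * f x) \<in> L"
    and "0 < (e::real)"
  obtains f where "f \<in> L" "(\<integral>x. \<bar>u x - f x\<bar> \<partial>M) < e"
proof -
  interpret finite_measure M by fact
  define D where "D u \<longleftrightarrow> integrable M u \<and> (\<forall>e>0. \<exists>f\<in>L. (\<integral>x. \<bar>u x - f x\<bar> \<partial>M) < e)" for u :: "'a \<Rightarrow> real"
  have DE: "\<exists>f\<in>L. (\<integral>x. \<bar>u x - f x\<bar> \<partial>M) < e" if "D u" "e > 0" for u e using that by (simp add: D_def)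
  have add: "D (\<lambda>x. u x + w x)" if uw: "D u" "D w" for u w
    unfolding D_def
  proof (intro conjI allI impI)
    show "integrable M (\<lambda>x. u x + w x)" using uw by (auto simp: D_def)
    fix e :: real assume "e > 0"
    then have "e / 2 > 0" by simp
    obtain f where f: "f \<in> L" "(\<integral>x. \<bar>u x - f x\<bar> \<partial>M) < e / 2"
      using DE[OF uw(1) \<open>e / 2 > 0\<close>] by blast
    obtain g where g: "g \<in> L" "(\<integral>x. \<bar>w x - g x\<bar> \<partial>M) < e / 2"
      using DE[OF uw(2) \<open>e / 2 > 0\<close>] by blast
    note fg = f(1) g(1) f(2) g(2)
    have [simp]: "integrable M u" "integrable M w" "integrable M f" "integrable M g"
      using uw by (simp_all add: D_def fg L(1))
    have "(\<integral>x. \<bar>u x + w x - (f x + g x)\<bar> \<partial>M) \<le> (\<integral>x. \<bar>u x - f x\<bar> + \<bar>w x - g x\<bar> \<partial>M)"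
      by (intro integral_mono) auto
    also have "\<dots> < e" using fg by simp
    finally show "\<exists>f\<in>L. (\<integral>x. \<bar>u x + w x - f x\<bar> \<partial>M) < e" by (intro bexI[of _ "\<lambda>x. f x + g x"] L(4)[OF fg(1,2)])
  qed
  have scale: "D (\<lambda>x. c * u x)" if du: "D u" for u c
    unfolding D_def
  proof (intro conjI allI impI)
    show "integrable M (\<lambda>x. c * u x)" using du by (auto simp: D_def)
    fix e :: real assume "e > 0"
    then have "e / (\<bar>c\<bar> + 1) > 0" by simp
    from DE[OF du this] obtain f where f: "f \<in> L" "(\<integral>x. \<bar>u x - f x\<bar> \<partial>M) < e / (\<bar>c\<bar> + 1)" by blast
    have "(\<integral>x. \<bar>c * u x - c * f x\<bar> \<partial>M) = \<bar>c\<bar> * (\<integral>x. \<bar>u x - f x\<bar> \<partial>M)"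
      by (simp add: right_diff_distrib[symmetric] abs_mult)
    also have "\<dots> \<le> (\<bar>c\<bar> + 1) * (\<integral>x. \<bar>u x - f x\<bar> \<partial>M)" by (simp add: mult_right_mono)
    also have "\<dots> < e" using f(2) by (simp add: field_simps)
    finally show "\<exists>f\<in>L. (\<integral>x. \<bar>c * u x - f x\<bar> \<partial>M) < e" by (intro bexI[of _ "\<lambda>x. c * f x"] L(5)[OF f(1)])
  qed
  have lim: "D u" if u: "integrable M u" and ds: "\<And>i. D (s i)" and s: "(\<lambda>i. \<integral>x. \<bar>u x - s i x\<bar> \<partial>M) \<longlonglongrightarrow> 0" for u and s :: "nat \<Rightarrow> _"
    unfolding D_def
  proof (intro conjI allI impI)
    show "integrable M u" by fact
    fix e :: real assume "e > 0"
    then have "eventually (\<lambda>i. (\<integral>x. \<bar>u x - s i x\<bar> \<partial>M) < e / 2) sequentially"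
      by (intro order_tendstoD(2)[OF s]) auto
    then obtain i where i: "(\<integral>x. \<bar>u x - s i x\<bar> \<partial>M) < e / 2" unfolding eventually_sequentially by blast
    obtain f where f: "f \<in> L" "(\<integral>x. \<bar>s i x - f x\<bar> \<partial>M) < e / 2" using DE[OF ds[of i], of "e / 2"] \<open>e > 0\<close> by auto
    have [simp]: "integrable M u" "integrable M (s i)" "integrable M f"
      using ds[of i] u by (simp_all add: D_def f L(1))
    have "(\<integral>x. \<bar>u x - f x\<bar> \<partial>M) \<le> (\<integral>x. \<bar>u x - s i x\<bar> + \<bar>s i x - f x\<bar> \<partial>M)"
      by (intro integral_mono) auto
    also have "\<dots> < e" using i f by simp
    finally show "\<exists>f\<in>L. (\<integral>x. \<bar>u x - f x\<bar> \<partial>M) < e" by (intro bexI[of _ f] f(1))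
  qed
  have dom: "(\<lambda>i. \<integral>x. \<bar>u x - s i x\<bar> \<partial>M) \<longlonglongrightarrow> 0"
    if u: "integrable M u" "integrable M w" and [measurable]: "\<And>i. s i \<in> borel_measurable M"
      and c: "\<And>x. x \<in> space M \<Longrightarrow> (\<lambda>i. s i x) \<longlonglongrightarrow> u x" and b: "\<And>i x. x \<in> space M \<Longrightarrow> \<bar>s i x\<bar> \<le> w x"
    for u w :: "'a \<Rightarrow> real" and s :: "nat \<Rightarrow> 'a \<Rightarrow> real"
  proof -
    have [measurable]: "u \<in> borel_measurable M" using u by simp
    have "(\<lambda>i. \<integral>x. \<bar>u x - s i x\<bar> \<partial>M) \<longlonglongrightarrow> (\<integral>x. 0 \<partial>M)"
    proof (rule integral_dominated_convergence[where w = "\<lambda>x. \<bar>u x\<bar> + w x"])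
      show "AE x in M. (\<lambda>i. \<bar>u x - s i x\<bar>) \<longlonglongrightarrow> 0"
      proof (intro AE_I2 tendsto_rabs_zero)
        fix x assume "x \<in> space M"
        from tendsto_diff[OF tendsto_const c[OF this], of "u x"] show "(\<lambda>i. u x - s i x) \<longlonglongrightarrow> 0" by simp
      qed
      show "AE x in M. norm \<bar>u x - s i x\<bar> \<le> \<bar>u x\<bar> + w x" for i
      proof (intro AE_I2)
        fix x assume "x \<in> space M"
        from b[OF this, of i] show "norm \<bar>u x - s i x\<bar> \<le> \<bar>u x\<bar> + w x" by simp
      qed
    qed (use u in auto)
    then show ?thesis by simp
  qed
  have base: "D f" if "f \<in> L" for f
    unfolding D_def using that L(1) by (auto intro!: bexI[of _ f])
  have ind: "D (indicator A)" if "A \<in> sets M" for A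
  proof -
    have sub: "{{x \<in> space M. 0 < f x} | f. f \<in> \<A>} \<subseteq> Pow (space M)" by auto
    have "A \<in> sigma_sets (space M) {{x \<in> space M. 0 < f x} | f. f \<in> \<A>}"
      using that gen by (simp add: generating_def)
    with generating_Int_stable[OF gen] sub show ?thesis
    proof (induction rule: sigma_sets_induct_disjoint)
      case (basic A)
      then obtain f where f: "f \<in> \<A>" "A = {x \<in> space M. 0 < f x}" by auto
      have [measurable]: "f \<in> borel_measurable M" and b: "0 \<le> f x" "f x \<le> 1" for x
        using gen f by (auto simp: generating_def)
      show ?case
      proof (rule lim)
        have mem: "(\<lambda>x. 1 - (1 - f x) ^ m) \<in> L" for m
          using gen f(1) L(2) by (auto simp: generating_def)
        then show "D (\<lambda>x. 1 - (1 - f x) ^ m)" for m by (rule base)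
        show i: "integrable M (indicator A :: _ \<Rightarrow> real)" unfolding f(2) by (simp add: less_top[symmetric])
        show "(\<lambda>m. \<integral>x. \<bar>indicator A x - (1 - (1 - f x) ^ m)\<bar> \<partial>M) \<longlonglongrightarrow> 0"
        proof (rule dom[where w = "\<lambda>_. 1"])
          show "(\<lambda>m. 1 - (1 - f x) ^ m) \<longlonglongrightarrow> indicator A x" if "x \<in> space M" for x
            using power_indicator_tendsto[OF b[of x]] that by (cases "0 < f x") (simp_all add: f(2) indicator_def)
          show "\<bar>1 - (1 - f x) ^ m\<bar> \<le> 1" for m x
            using b[of x] power_le_one[of "1 - f x" m] zero_le_power[of "1 - f x" m] by auto
        qed (use i in auto)
      qed
    next
      case empty
      have "D (\<lambda>x. 0 * 1)" by (intro scale base L(3))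
      then show ?case by (simp add: indicator_def)
    next
      case (compl A)
      have *: "D (\<lambda>x. 1 + (-1) * indicator A x)" by (intro scale add base L(3) compl)
      \<comment> \<open>The indicator of the complement agrees with the function just constructed
        only on the space, which is all that D sees.\<close>
      have D_cong: "D w" if "D u" "\<And>x. x \<in> space M \<Longrightarrow> u x = w x" for u w
      proof -
        have "(\<integral>x. \<bar>u x - f x\<bar> \<partial>M) = (\<integral>x. \<bar>w x - f x\<bar> \<partial>M)" for f
          by (intro integral_cong) (auto simp: that)
        then show ?thesis using that unfolding D_def by (simp cong: integrable_cong)
      qed
      show ?case by (rule D_cong[OF *]) (auto simp: indicator_def)
    next
      case (union A)
      have A: "A i \<in> sets M" for i
      proof -
        have "sets M = sigma_sets (space M) {{x \<in> space M. 0 < f x} | f. f \<in> \<A>}"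
          using gen by (simp add: generating_def)
        with union(2) show ?thesis by blast
      qed
      show ?case
      proof (rule lim)
        have "D (\<lambda>x. \<Sum>i<n. indicator (A i) x)" for n
        proof (induction n)
          case 0
          have "D (\<lambda>x. 0 * 1)" by (intro scale base L(3))
          then show ?case by simp
        next
          case (Suc n)
          then show ?case using add[OF Suc union(3)[of n]] by simp
        qed
        then show "D (\<lambda>x. \<Sum>i<n. indicator (A i) x)" for n .
        show i: "integrable M (indicator (\<Union>(range A)) :: _ \<Rightarrow> real)"
          using A by (simp add: less_top[symmetric] sets.countable_UN)
        show "(\<lambda>n. \<integral>x. \<bar>indicator (\<Union>(range A)) x - (\<Sum>i<n. indicator (A i) x) :: real\<bar> \<partial>M) \<longlonglongrightarrow> 0"
        proof (rule dom[where w = "\<lambda>_. 1" and u = "indicator (\<Union>(range A))" and s = "\<lambda>n x. \<Sum>i<n. indicator (A i) x"])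
          have *: "(\<Sum>i<n. indicator (A i) x) = (indicator (\<Union>i<n. A i) x :: real)" for n x
            using union(1) by (subst indicator_UN_disjoint) (auto intro: disjoint_family_on_mono)
          show "(\<lambda>n. \<Sum>i<n. indicator (A i) x) \<longlonglongrightarrow> (indicator (\<Union>(range A)) x :: real)" for x
            unfolding * by (rule LIMSEQ_indicator_UN)
          show "\<bar>\<Sum>i<n. indicator (A i) x\<bar> \<le> (1::real)" for n x unfolding * by simp
        qed (use i A in auto)
      qed
    qed
  qed
  have "D u"
    using u
  proof (induction rule: integrable_induct)
    case (base A c)
    then show ?case using scale[OF ind[of A], of c] by (simp add: mult.commute)
  next
    case (add f g)
    then show ?case by (intro \<open>\<And>u w. D u \<Longrightarrow> D w \<Longrightarrow> D (\<lambda>x. u x + w x)\<close>)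
  next
    case (lim f s)
    show ?case
    proof (rule \<open>\<And>u s. integrable M u \<Longrightarrow> (\<And>i. D (s i)) \<Longrightarrow> (\<lambda>i. \<integral>x. \<bar>u x - s i x\<bar> \<partial>M) \<longlonglongrightarrow> 0 \<Longrightarrow> D u\<close>)
      show "(\<lambda>i. \<integral>x. \<bar>f x - s i x\<bar> \<partial>M) \<longlonglongrightarrow> 0"
        by (rule dom[where w = "\<lambda>x. 2 * \<bar>f x\<bar>"]) (use lim in auto)
    qed (use lim in auto)
  qed
  then show ?thesis using that \<open>0 < e\<close> unfolding D_def by blast
qed

section \<open>Test functions on the torus\<close>

lemma borel_measurable_vecI:
  fixes f :: "'a \<Rightarrow> 'b::euclidean_space^'d"
  assumes "\<And>i. (\<lambda>w. f w $ i) \<in> borel_measurable M"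
  shows "f \<in> borel_measurable M"
proof (rule borel_measurable_euclidean_space[THEN iffD2], rule ballI)
  fix b :: "'b^'d" assume "b \<in> Basis"
  then obtain i u where "b = axis i u" by (auto simp: Basis_vec_def)
  then show "(\<lambda>x. f x \<bullet> b) \<in> borel_measurable M"
    using assms[of i] by (simp add: inner_axis)
qed

text \<open>On a half-open circle the angle is a Borel function of its cosine and sine: the arc
  cosine with the sign of the sine. At -1 the sine vanishes although the angle is negative, hence
  the extra case. This recovers the coordinates, which are not periodic, from smooth periodic
  functions.\<close>

lemma measurable_from_trig:
  fixes y :: "'a \<Rightarrow> real"
  assumes range: "\<And>w. w \<in> space M \<Longrightarrow> -1 \<le> y w \<and> y w < 1"
    and [measurable]: "(\<lambda>w. cos (pi * y w)) \<in> borel_measurable M" "(\<lambda>w. sin (pi * y w)) \<in> borel_measurable M"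
  shows "y \<in> borel_measurable M"
proof -
  \<comment> \<open>Clamping the argument makes the arc cosine continuous, hence Borel, on the whole
    line.\<close>
  define acos where "acos c = arccos (max (-1) (min 1 c))" for c :: real
  have "continuous_on UNIV acos"
    unfolding acos_def by (rule continuous_on_compose2[OF continuous_on_arccos']) (auto intro!: continuous_intros)
  then have [measurable]: "acos \<in> borel_measurable borel" by (rule borel_measurable_continuous_onI)
  define z where "z w = (if sin (pi * y w) < 0 \<or> cos (pi * y w) = -1 then - acos (cos (pi * y w)) / pi else acos (cos (pi * y w)) / pi)" for w
  have "y w = z w" if "w \<in> space M" for w
  proof (cases "y w \<ge> 0")
    case True
    then have r: "0 \<le> pi * y w" "pi * y w < pi" using range[OF that] by auto
    then have "sin (pi * y w) \<ge> 0" by (intro sin_ge_zero) auto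
    moreover have "cos (pi * y w) \<noteq> -1"
      using cos_monotone_0_pi[OF r(1) r(2) order_refl] by simp
    moreover have "acos (cos (pi * y w)) = pi * y w" using r by (simp add: acos_def arccos_cos)
    ultimately show ?thesis by (simp add: z_def)
  next
    case False
    then have r: "0 < - (pi * y w)" "- (pi * y w) \<le> pi"
      using range[OF that] mult_left_mono[of "-1" "y w" pi] by (auto simp: mult_less_0_iff)
    have "sin (pi * y w) < 0 \<or> cos (pi * y w) = -1"
    proof (cases "y w = -1")
      case False
      then have "- 1 < y w" using range[OF that] by simp
      then have "- (pi * y w) < pi" using mult_strict_left_mono[of "-1" "y w" pi] by simp
      then have "sin (- (pi * y w)) > 0" using r by (intro sin_gt_zero) auto
      then show ?thesis by simp
    qed simp
    moreover have "acos (cos (pi * y w)) = - (pi * y w)"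
    proof -
      have "arccos (cos (- (pi * y w))) = - (pi * y w)" using r by (intro arccos_cos) auto
      then show ?thesis by (simp add: acos_def)
    qed
    ultimately show ?thesis by (simp add: z_def)
  qed
  moreover have "z \<in> borel_measurable M" unfolding z_def by measurable
  ultimately show ?thesis by (simp cong: measurable_cong)
qed

definition torus_tests :: "(real^'d \<Rightarrow> real) set" where
  "torus_tests = {f. smooth f \<and> periodic f \<and> (\<forall>x. 0 \<le> f x \<and> f x \<le> 1)}"

lemma periodic_const: "periodic (\<lambda>_. c)"
  and periodic_compose: "periodic f \<Longrightarrow> periodic (\<lambda>x. h (f x))"
  and periodic_compose2: "periodic f \<Longrightarrow> periodic g \<Longrightarrow> periodic (\<lambda>x. k (f x) (g x))"
  by (auto simp: periodic_def)

lemma smooth_nth: "smooth (\<lambda>x::real^'d. c * x $ i)"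
  by (intro smooth_linear bounded_linear_const_mult bounded_linear_vec_nth)

lemma smooth_cos_nth: "smooth (\<lambda>x::real^'d. cos (pi * x $ i))"
  and smooth_sin_nth: "smooth (\<lambda>x::real^'d. sin (pi * x $ i))"
  by (rule smooth_compose[OF smooth_cos smooth_nth], rule smooth_compose[OF smooth_sin smooth_nth])

lemma periodic_cos_nth: "periodic (\<lambda>x::real^'d. cos (pi * x $ i))"
  and periodic_sin_nth: "periodic (\<lambda>x::real^'d. sin (pi * x $ i))"
  by (auto simp: periodic_def axis_def distrib_left cos_add sin_add mult.commute[of pi 2])

lemma smooth_measurable: "smooth f \<Longrightarrow> f \<in> borel_measurable borel"
  by (intro borel_measurable_continuous_onI smooth_continuous_on)

text \<open>Composition with \<open>bump\<close> shows that the generated sigma-algebra makes every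
  smooth periodic function measurable, in particular the cosines and sines of the coordinates, hence
  the coordinates and the identity map. So it contains all Borel sets of the cell.\<close>

lemma generating_torus: "generating (torus :: (real^'d) measure) torus_tests"
proof -
  let ?E = "{{x \<in> cell. 0 < f x} | f. f \<in> (torus_tests :: (real^'d \<Rightarrow> real) set)}"
  have sub: "?E \<subseteq> Pow cell" by auto
  define S where "S = sigma cell ?E"
  have S: "space S = cell" "sets S = sigma_sets cell ?E" using sub by (auto simp: S_def)
  have pos: "{x \<in> space S. 0 < f x} \<in> sets S" if "f \<in> torus_tests" for f
    unfolding S using that by (intro sigma_sets.Basic) blast
  have meas: "f \<in> borel_measurable S" if "smooth f" "periodic f" for f :: "real^'d \<Rightarrow> real"
  proof (rule borel_measurable_iff_greater[THEN iffD2], rule allI)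
    fix a
    have "(\<lambda>x. bump (f x - a)) \<in> torus_tests"
      using that by (auto simp: torus_tests_def bump_bounds intro!: smooth_intros periodic_compose[of f])
    from pos[OF this] show "{w \<in> space S. a < f w} \<in> sets S" by (simp add: bump_bounds)
  qed
  have id: "(\<lambda>x. x) \<in> borel_measurable S"
  proof (rule borel_measurable_vecI, rule measurable_from_trig)
    fix i
    show "\<And>w. w \<in> space S \<Longrightarrow> - 1 \<le> w $ i \<and> w $ i < 1" by (auto simp: S cell_def)
  qed (auto intro!: meas smooth_cos_nth smooth_sin_nth periodic_cos_nth periodic_sin_nth)
  have "sets torus = sets S"
  proof
    show "sets torus \<subseteq> sets S"
    proof
      fix A :: "(real^'d) set" assume "A \<in> sets torus"
      then have A: "A \<in> sets borel" "A \<subseteq> cell" by (auto simp: sets_restrict_space_iff)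
      have "(\<lambda>x. x) -` A \<inter> space S \<in> sets S" using id A(1) by (rule measurable_sets)
      then show "A \<in> sets S" using A(2) by (simp add: S Int_absorb2)
    qed
    show "sets S \<subseteq> sets torus"
      unfolding S
    proof (rule sets.sigma_sets_subset'[of _ torus, simplified])
      show "?E \<subseteq> sets torus"
      proof clarify
        fix f :: "real^'d \<Rightarrow> real" assume "f \<in> torus_tests"
        then have [measurable]: "f \<in> borel_measurable torus"
          by (intro borel_measurable_torus smooth_measurable) (auto simp: torus_tests_def)
        have "{x \<in> space torus. 0 < f x} \<in> sets torus" by measurable
        then show "{x \<in> cell. 0 < f x} \<in> sets torus" by simp
      qed
      show "cell \<in> sets torus" using sets.top[of torus] by simp
    qed
  qed
  moreover have "(\<lambda>x. f x * g x) \<in> torus_tests" if "f \<in> torus_tests" "g \<in> torus_tests" for f g :: "real^'d \<Rightarrow> real"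
    using that by (auto simp: torus_tests_def intro!: smooth_mult periodic_compose2[of f g] mult_le_one)
  moreover have "(\<lambda>x. 1 - (1 - f x) ^ m) \<in> torus_tests" if "f \<in> torus_tests" for f :: "real^'d \<Rightarrow> real" and m
    using that by (auto simp: torus_tests_def intro!: smooth_intros periodic_compose[of f] power_le_one)
  moreover have "f \<in> borel_measurable torus" if "f \<in> torus_tests" for f :: "real^'d \<Rightarrow> real"
    using that by (intro borel_measurable_torus smooth_measurable) (auto simp: torus_tests_def)
  moreover have "\<exists>F::nat \<Rightarrow> (real^'d \<Rightarrow> real). range F \<subseteq> torus_tests \<and> (\<Union>k. {x \<in> cell. 0 < F k x}) = cell"
    by (intro exI[of _ "\<lambda>_ _. 1"]) (auto simp: torus_tests_def smooth_const periodic_const)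
  ultimately show ?thesis
    by (simp add: generating_def S(2)) (auto simp: torus_tests_def)
qed

lemma periodic_continuous_bounded:
  fixes f :: "real^'d \<Rightarrow> real"
  assumes "continuous_on UNIV f" "periodic f"
  obtains B where "B > 0" "\<And>x. \<bar>f x\<bar> \<le> B"
proof -
  have "compact (f ` cbox (\<chi> i. -1) (\<chi> i. 1))"
    using assms(1) by (intro compact_continuous_image) (auto intro: continuous_on_subset)
  then obtain B where B: "B > 0" "\<And>y. y \<in> f ` cbox (\<chi> i. -1) (\<chi> i. 1) \<Longrightarrow> norm y \<le> B"
    using compact_imp_bounded bounded_pos by (metis (no_types, lifting))
  show ?thesis
  proof (rule that[OF B(1)])
    fix x
    have "f (wrap x) \<in> f ` cbox (\<chi> i. -1) (\<chi> i. 1)" using wrap_in_cell cell_subset_cbox by blast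
    then show "\<bar>f x\<bar> \<le> B" using B(2) periodic_wrap[OF assms(2)] by fastforce
  qed
qed

lemma integrable_torus_bounded:
  fixes f :: "real^'d \<Rightarrow> 'b::{banach, second_countable_topology}"
  assumes "f \<in> borel_measurable borel" "\<And>x. norm (f x) \<le> B"
  shows "integrable torus f"
  by (rule torus.integrable_const_bound[of _ B]) (use assms borel_measurable_torus in auto)

lemma integrable_smooth_periodic:
  fixes f :: "real^'d \<Rightarrow> real"
  assumes "smooth f" "periodic f" shows "integrable torus f"
proof -
  obtain B where "B > 0" "\<And>x. \<bar>f x\<bar> \<le> B"
    using periodic_continuous_bounded[OF smooth_continuous_on[OF assms(1)] assms(2)] by blast
  then show ?thesis by (intro integrable_torus_bounded[of _ B] smooth_measurable assms) auto
qed

section \<open>Density of smooth functions, translations and approximate identities\<close>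

lemma smooth_periodic_dense:
  fixes u :: "real^'d \<Rightarrow> real"
  assumes "integrable torus u" "0 < e"
  obtains \<psi> where "smooth \<psi>" "periodic \<psi>" "(\<integral>x. \<bar>u x - \<psi> x\<bar> \<partial>torus) < e"
proof -
  obtain \<psi> where "\<psi> \<in> {\<psi>. smooth \<psi> \<and> periodic \<psi>}" "(\<integral>x. \<bar>u x - \<psi> x\<bar> \<partial>torus) < e"
  proof (rule generating_dense[OF generating_torus torus.finite_measure_axioms assms(1) _ _ _ _ _ assms(2)])
    show "f \<in> {\<psi>. smooth \<psi> \<and> periodic \<psi>} \<Longrightarrow> integrable torus f" for f :: "real^'d \<Rightarrow> real"
      using integrable_smooth_periodic by auto
    show "torus_tests \<subseteq> {\<psi>. smooth \<psi> \<and> periodic \<psi>}" by (auto simp: torus_tests_def)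
    show "(\<lambda>x. f x + g x) \<in> {\<psi>. smooth \<psi> \<and> periodic \<psi>}"
      if "f \<in> {\<psi>. smooth \<psi> \<and> periodic \<psi>}" "g \<in> {\<psi>. smooth \<psi> \<and> periodic \<psi>}" for f g :: "real^'d \<Rightarrow> real"
      using that by (auto intro: smooth_add periodic_compose2[of f g])
    show "(\<lambda>x. c * f x) \<in> {\<psi>. smooth \<psi> \<and> periodic \<psi>}"
      if "f \<in> {\<psi>. smooth \<psi> \<and> periodic \<psi>}" for f :: "real^'d \<Rightarrow> real" and c
      using that by (auto intro: smooth_mult smooth_const periodic_compose[of f])
  qed (auto simp: smooth_const periodic_const)
  then show ?thesis using that by auto
qed

lemma torus_AE_zero:
  fixes g :: "real^'d \<Rightarrow> real"
  assumes "integrable torus g" "\<And>\<psi>. smooth \<psi> \<Longrightarrow> periodic \<psi> \<Longrightarrow> (\<integral>x. \<psi> x * g x \<partial>torus) = 0"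
  shows "AE x in torus. g x = 0"
  by (rule generating_AE_zero[OF generating_torus torus.finite_measure_axioms assms(1)])
     (auto simp: torus_tests_def assms(2))

text \<open>A smooth approximation moves little by uniform continuity, and the approximation error
  keeps its norm under translation; each of the three terms receives a third of e.\<close>

lemma L1_translation:
  fixes u :: "real^'d \<Rightarrow> real"
  assumes [measurable]: "u \<in> borel_measurable borel" and per: "periodic u" and u: "integrable torus u" and "e > 0"
  shows "\<exists>\<delta>>0. \<forall>y. norm y < \<delta> \<longrightarrow> (\<integral>x. \<bar>u (x + y) - u x\<bar> \<partial>torus) \<le> e"
proof -
  obtain \<psi> where \<psi>: "smooth \<psi>" "periodic \<psi>" "(\<integral>x. \<bar>u x - \<psi> x\<bar> \<partial>torus) < e / 3"
    using smooth_periodic_dense[OF u, of "e / 3"] \<open>e > 0\<close> by auto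
  have [measurable]: "\<psi> \<in> borel_measurable borel" using \<psi>(1) by (rule smooth_measurable)
  define V where "V = measure torus (cell :: (real^'d) set)"
  have V: "V \<ge> 0" by (simp add: V_def)
  obtain R where R: "\<And>x::real^'d. x \<in> cell \<Longrightarrow> norm x \<le> R" using bounded_cell by (auto simp: bounded_iff)
  \<comment> \<open>Shifts are taken shorter than 1, so that x in the cell and x + y both stay in
    this compact ball.\<close>
  have "uniformly_continuous_on (cball 0 (R + 1)) \<psi>"
    by (intro compact_uniformly_continuous smooth_continuous_on \<psi>) auto
  moreover have "e / (3 * (V + 1)) > 0" using \<open>e > 0\<close> V by simp
  ultimately obtain \<delta> where \<delta>: "\<delta> > 0" "\<And>x x'. x \<in> cball 0 (R + 1) \<Longrightarrow> x' \<in> cball 0 (R + 1) \<Longrightarrow> dist x' x < \<delta> \<Longrightarrow> dist (\<psi> x') (\<psi> x) < e / (3 * (V + 1))"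
    unfolding uniformly_continuous_on_def by metis
  have int: "integrable torus (\<lambda>x. u x - \<psi> x)" "integrable torus u" "integrable torus \<psi>"
    using u integrable_smooth_periodic[OF \<psi>(1,2)] by auto
  have per2: "periodic (\<lambda>x. u x - \<psi> x)" "periodic (\<lambda>x. \<bar>u x - \<psi> x\<bar>)"
    using periodic_compose2[OF per \<psi>(2), of "\<lambda>a b. a - b"] periodic_compose2[OF per \<psi>(2), of "\<lambda>a b. \<bar>a - b\<bar>"] by auto
  show ?thesis
  proof (intro exI[of _ "min \<delta> 1"] conjI allI impI)
    show "min \<delta> 1 > 0" using \<delta> by simp
    fix y :: "real^'d" assume y: "norm y < min \<delta> 1"
    have [simp]: "integrable torus (\<lambda>x. u (x + y) - \<psi> (x + y))" "integrable torus (\<lambda>x. u (x + y))" "integrable torus (\<lambda>x. \<psi> (x + y))"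
      using integrable_torus_shift[OF _ per2(1), of y] integrable_torus_shift[OF _ per, of y] integrable_torus_shift[OF _ \<psi>(2), of y] int
      by auto
    have 1: "(\<integral>x. \<bar>u (x + y) - \<psi> (x + y)\<bar> \<partial>torus) = (\<integral>x. \<bar>u x - \<psi> x\<bar> \<partial>torus)"
      by (rule integral_torus_shift[OF _ per2(2)]) measurable
    have "(\<integral>x. \<bar>\<psi> (x + y) - \<psi> x\<bar> \<partial>torus) \<le> (\<integral>x. e / (3 * (V + 1)) \<partial>(torus :: (real^'d) measure))"
    proof (rule integral_mono)
      fix x :: "real^'d" assume "x \<in> space torus"
      then have "norm x \<le> R" using R by simp
      then have "norm (x + y) \<le> R + 1" using y norm_triangle_ineq[of x y] by simp
      then show "\<bar>\<psi> (x + y) - \<psi> x\<bar> \<le> e / (3 * (V + 1))"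
        using \<delta>(2)[of x "x + y"] \<open>norm x \<le> R\<close> y
        by (simp add: mem_cball_0 dist_norm[of "x + y"] dist_norm[of "\<psi> (x + y)"] less_imp_le)
    qed (use int in auto)
    also have "\<dots> = V * (e / (3 * (V + 1)))" by (simp add: V_def)
    also have "\<dots> \<le> e / 3" using V \<open>e > 0\<close> by (simp add: field_simps)
    finally have 2: "(\<integral>x. \<bar>\<psi> (x + y) - \<psi> x\<bar> \<partial>torus) \<le> e / 3" .
    have "(\<integral>x. \<bar>u (x + y) - u x\<bar> \<partial>torus) \<le> (\<integral>x. \<bar>u (x + y) - \<psi> (x + y)\<bar> + \<bar>\<psi> (x + y) - \<psi> x\<bar> + \<bar>u x - \<psi> x\<bar> \<partial>torus)"
      by (intro integral_mono) (use int in auto)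
    also have "\<dots> = (\<integral>x. \<bar>u (x + y) - \<psi> (x + y)\<bar> \<partial>torus) + (\<integral>x. \<bar>\<psi> (x + y) - \<psi> x\<bar> \<partial>torus) + (\<integral>x. \<bar>u x - \<psi> x\<bar> \<partial>torus)"
      using int by simp
    also have "\<dots> \<le> e" using 1 2 \<psi>(3) by simp
    finally show "(\<integral>x. \<bar>u (x + y) - u x\<bar> \<partial>torus) \<le> e" .
  qed
qed

text \<open>The convolution is taken in the form of integrating u(x + y) k(y) over the cell, which
  puts no periodicity on the kernel; one notion thus covers box averages and trigonometric
  kernels.\<close>

definition approx_id :: "(nat \<Rightarrow> real^'d \<Rightarrow> real) \<Rightarrow> bool" where
  "approx_id k \<longleftrightarrow> (\<forall>n. k n \<in> borel_measurable borel \<and> (\<forall>y. 0 \<le> k n y) \<and> (\<exists>B. \<forall>y. k n y \<le> B) \<and> (\<integral>y. k n y \<partial>torus) = 1) \<and>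
     (\<forall>\<delta>>0. (\<lambda>n. \<integral>y. (if norm y < \<delta> then 0 else k n y) \<partial>torus) \<longlonglongrightarrow> 0)"

lemma measurable_torus_pair:
  assumes "f \<in> borel_measurable (borel \<Otimes>\<^sub>M borel)"
  shows "f \<in> borel_measurable (torus \<Otimes>\<^sub>M torus)"
proof -
  have id: "(\<lambda>x. x) \<in> torus \<rightarrow>\<^sub>M borel" by (intro borel_measurable_torus) simp
  have "(\<lambda>z. (fst z, snd z)) \<in> torus \<Otimes>\<^sub>M torus \<rightarrow>\<^sub>M borel \<Otimes>\<^sub>M borel"
    by (intro measurable_Pair measurable_compose[OF measurable_fst id] measurable_compose[OF measurable_snd id])
  from measurable_compose[OF this assms] show ?thesis by simp
qed

text \<open>By Fubini the error is at most the kernel average of the translation modulus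
  \<open>\<omega>\<close>, which is small near the origin and bounded by twice the norm of u
  elsewhere. The nonnegative integral is used since its monotonicity asks for no measurability of
  the convolution.\<close>

lemma approx_id_L1:
  fixes u :: "real^'d \<Rightarrow> real"
  assumes [measurable]: "u \<in> borel_measurable borel" and per: "periodic u" and u: "integrable torus u" and k: "approx_id k"
  shows "(\<lambda>n. \<integral>\<^sup>+x. ennreal \<bar>(\<integral>y. u (x + y) * k n y \<partial>torus) - u x\<bar> \<partial>torus) \<longlonglongrightarrow> 0"
proof -
  have [measurable]: "k n \<in> borel_measurable borel" and nn: "0 \<le> k n y" and k1: "(\<integral>y. k n y \<partial>torus) = 1" for n y
    using k by (auto simp: approx_id_def)
  have kint: "integrable torus (\<lambda>y. c y * k n y)" if "integrable torus c" for c n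
  proof -
    obtain B where B: "\<And>y. k n y \<le> B" using k unfolding approx_id_def by blast
    have [measurable]: "c \<in> borel_measurable torus" "k n \<in> borel_measurable torus"
      using that by (auto intro!: borel_measurable_torus)
    show ?thesis
    proof (rule integrable_bound)
      show "integrable torus (\<lambda>y. B * c y)" using that by simp
      have "B \<ge> 0" using nn B order_trans by blast
      then have "norm (c y * k n y) \<le> norm (B * c y)" for y
        using mult_right_mono[OF B[of y] abs_ge_zero[of "c y"]] nn[of n y] \<open>B \<ge> 0\<close> by (simp add: abs_mult mult.commute)
      then show "AE y in torus. norm (c y * k n y) \<le> norm (B * c y)" by simp
    qed measurable
  qed
  have kint1: "integrable torus (k n)" for n
    using kint[of "\<lambda>_. 1" n] by simp
  define \<omega> where "\<omega> y = (\<integral>x. \<bar>u (x + y) - u x\<bar> \<partial>torus)" for y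
  have ush: "integrable torus (\<lambda>x. u (x + y))" for y
    using integrable_torus_shift[OF _ per, of y] u by simp
  define U where "U = (\<integral>x. \<bar>u x\<bar> \<partial>torus)"
  have \<omega>U: "\<omega> y \<le> 2 * U" for y
  proof -
    have "\<omega> y \<le> (\<integral>x. \<bar>u (x + y)\<bar> + \<bar>u x\<bar> \<partial>torus)" unfolding \<omega>_def using ush[of y] u by (intro integral_mono) auto
    also have "\<dots> = (\<integral>x. \<bar>u (x + y)\<bar> \<partial>torus) + U" using ush[of y] u by (simp add: U_def)
    also have "(\<integral>x. \<bar>u (x + y)\<bar> \<partial>torus) = U"
      unfolding U_def by (rule integral_torus_shift[OF _ periodic_compose[OF per]]) measurable
    finally show ?thesis by simp
  qed
  have bound: "(\<integral>\<^sup>+x. ennreal \<bar>(\<integral>y. u (x + y) * k n y \<partial>torus) - u x\<bar> \<partial>torus) \<le> ennreal (e + 2 * U * (\<integral>y. (if norm y < \<delta> then 0 else k n y) \<partial>torus))"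
    if e: "e > 0" and \<delta>: "\<And>y. norm y < \<delta> \<Longrightarrow> \<omega> y \<le> e" for e \<delta> n
  proof -
    have ush': "integrable torus (\<lambda>y. u (x + y))" for x using ush[of x] by (simp add: add.commute)
    have "(\<integral>\<^sup>+x. ennreal \<bar>(\<integral>y. u (x + y) * k n y \<partial>torus) - u x\<bar> \<partial>torus) \<le> (\<integral>\<^sup>+x. (\<integral>\<^sup>+y. ennreal (\<bar>u (x + y) - u x\<bar> * k n y) \<partial>torus) \<partial>torus)"
    proof (rule nn_integral_mono)
      fix x
      have i: "integrable torus (\<lambda>y. (u (x + y) - u x) * k n y)" by (intro kint integrable_diff ush') simp
      have "(\<integral>y. (u (x + y) - u x) * k n y \<partial>torus) = (\<integral>y. u (x + y) * k n y - u x * k n y \<partial>torus)"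
        by (simp add: left_diff_distrib)
      also have "\<dots> = (\<integral>y. u (x + y) * k n y \<partial>torus) - u x"
        using kint[OF ush'[of x]] kint1 by (simp add: k1)
      finally have "\<bar>(\<integral>y. u (x + y) * k n y \<partial>torus) - u x\<bar> = \<bar>\<integral>y. (u (x + y) - u x) * k n y \<partial>torus\<bar>" by simp
      also have "\<dots> \<le> (\<integral>y. \<bar>u (x + y) - u x\<bar> * k n y \<partial>torus)"
        using integral_abs_bound[of torus "\<lambda>y. (u (x + y) - u x) * k n y"] nn by (simp add: abs_mult)
      finally have "ennreal \<bar>(\<integral>y. u (x + y) * k n y \<partial>torus) - u x\<bar> \<le> ennreal (\<integral>y. \<bar>u (x + y) - u x\<bar> * k n y \<partial>torus)"
        by (rule ennreal_leI)
      also have "\<dots> = (\<integral>\<^sup>+y. ennreal (\<bar>u (x + y) - u x\<bar> * k n y) \<partial>torus)"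
        using integrable_abs[OF i] nn by (intro nn_integral_eq_integral[symmetric]) (auto simp: abs_mult)
      finally show "ennreal \<bar>(\<integral>y. u (x + y) * k n y \<partial>torus) - u x\<bar> \<le> (\<integral>\<^sup>+y. ennreal (\<bar>u (x + y) - u x\<bar> * k n y) \<partial>torus)" .
    qed
    also have "\<dots> = (\<integral>\<^sup>+y. (\<integral>\<^sup>+x. ennreal (\<bar>u (x + y) - u x\<bar> * k n y) \<partial>torus) \<partial>torus)"
    proof -
      interpret P: pair_sigma_finite "torus :: (real^'d) measure" "torus :: (real^'d) measure" ..
      have "(\<lambda>(x, y). ennreal (\<bar>u (x + y) - u x\<bar> * k n y)) \<in> borel_measurable (torus \<Otimes>\<^sub>M torus)"
        by (rule measurable_torus_pair) measurable
      from P.Fubini'[OF this] show ?thesis by simp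
    qed
    also have "\<dots> = (\<integral>\<^sup>+y. ennreal (\<omega> y * k n y) \<partial>torus)"
    proof (rule nn_integral_cong)
      fix y
      have "(\<integral>\<^sup>+x. ennreal (\<bar>u (x + y) - u x\<bar> * k n y) \<partial>torus) = ennreal (\<integral>x. \<bar>u (x + y) - u x\<bar> * k n y \<partial>torus)"
        using ush[of y] u nn by (intro nn_integral_eq_integral) auto
      then show "(\<integral>\<^sup>+x. ennreal (\<bar>u (x + y) - u x\<bar> * k n y) \<partial>torus) = ennreal (\<omega> y * k n y)" by (simp add: \<omega>_def)
    qed
    also have "\<dots> \<le> (\<integral>\<^sup>+y. ennreal (e * k n y + 2 * U * (if norm y < \<delta> then 0 else k n y)) \<partial>torus)"
    proof (intro nn_integral_mono ennreal_leI)
      fix y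
      have "0 \<le> U" by (simp add: U_def)
      then show "\<omega> y * k n y \<le> e * k n y + 2 * U * (if norm y < \<delta> then 0 else k n y)"
        using \<delta>[of y] \<omega>U[of y] nn[of n y] e mult_right_mono[of "\<omega> y" e "k n y"] mult_right_mono[of "\<omega> y" "2 * U" "k n y"]
        by (auto intro: add_increasing)
    qed
    also have "\<dots> = ennreal (\<integral>y. e * k n y + 2 * U * (if norm y < \<delta> then 0 else k n y) \<partial>torus)"
    proof (rule nn_integral_eq_integral)
      have c: "integrable torus (\<lambda>y. (if norm y < \<delta> then 0 else 1) * k n y)"
        by (intro kint integrable_torus_bounded[of _ 1]) auto
      have *: "(\<lambda>y. if norm y < \<delta> then 0 else k n y) = (\<lambda>y. (if norm y < \<delta> then 0 else 1) * k n y)" by auto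
      show "integrable torus (\<lambda>y. e * k n y + 2 * U * (if norm y < \<delta> then 0 else k n y))"
        using c kint1 unfolding *[symmetric] by (intro integrable_add integrable_mult_right) auto
      show "AE y in torus. 0 \<le> e * k n y + 2 * U * (if norm y < \<delta> then 0 else k n y)"
        using nn e by (intro AE_I2) (simp add: U_def)
    qed
    also have "(\<integral>y. e * k n y + 2 * U * (if norm y < \<delta> then 0 else k n y) \<partial>torus) = e + 2 * U * (\<integral>y. (if norm y < \<delta> then 0 else k n y) \<partial>torus)"
    proof -
      have c: "integrable torus (\<lambda>y. (if norm y < \<delta> then 0 else 1) * k n y)"
        by (intro kint integrable_torus_bounded[of _ 1]) auto
      have *: "(\<lambda>y. if norm y < \<delta> then 0 else k n y) = (\<lambda>y. (if norm y < \<delta> then 0 else 1) * k n y)" by auto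
      from c have "integrable torus (\<lambda>y. if norm y < \<delta> then 0 else k n y)" unfolding * .
      then show ?thesis using kint1[of n] k1[of n] by simp
    qed
    finally show ?thesis .
  qed
  show ?thesis
  proof (rule order_tendstoI)
    fix a :: ennreal assume "0 < a"
    obtain e where e: "e > 0" "ennreal e < a"
    proof (cases a)
      case (real r)
      then show ?thesis using that[of "r / 2"] \<open>0 < a\<close> by (simp add: ennreal_less_iff)
    next
      case top
      then show ?thesis using that[of 1] by simp
    qed
    have "e / 2 > 0" using e by simp
    then obtain \<delta> where \<delta>: "\<delta> > 0" "\<And>y. norm y < \<delta> \<Longrightarrow> \<omega> y \<le> e / 2"
      using L1_translation[OF _ per u, of "e / 2"] unfolding \<omega>_def by auto
    have "(\<lambda>n. e / 2 + 2 * U * (\<integral>y. (if norm y < \<delta> then 0 else k n y) \<partial>torus)) \<longlonglongrightarrow> e / 2 + 2 * U * 0"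
      using k \<delta>(1) by (intro tendsto_intros) (auto simp: approx_id_def)
    then have "eventually (\<lambda>n. e / 2 + 2 * U * (\<integral>y. (if norm y < \<delta> then 0 else k n y) \<partial>torus) < e) sequentially"
      by (rule order_tendstoD(2)) (use e in simp)
    then show "eventually (\<lambda>n. (\<integral>\<^sup>+x. ennreal \<bar>(\<integral>y. u (x + y) * k n y \<partial>torus) - u x\<bar> \<partial>torus) < a) sequentially"
    proof eventually_elim
      case (elim n)
      have "(\<integral>\<^sup>+x. ennreal \<bar>(\<integral>y. u (x + y) * k n y \<partial>torus) - u x\<bar> \<partial>torus) \<le> ennreal (e / 2 + 2 * U * (\<integral>y. (if norm y < \<delta> then 0 else k n y) \<partial>torus))"
        by (rule bound) (use \<open>e / 2 > 0\<close> \<delta> in auto)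
      also have "\<dots> \<le> ennreal e" using elim by (intro ennreal_leI) simp
      finally show ?case using e(2) by (rule le_less_trans)
    qed
  qed simp
qed

section \<open>Boundedness from the Gagliardo seminorm\<close>

lemma nn_integral_lborel_shift:
  assumes [measurable]: "f \<in> borel_measurable borel"
  shows "(\<integral>\<^sup>+x. f (c + x) \<partial>lborel) = (\<integral>\<^sup>+x. f (x::'a::euclidean_space) \<partial>lborel)"
proof -
  have "(\<integral>\<^sup>+x. f x \<partial>lborel) = (\<integral>\<^sup>+x. f x \<partial>distr lborel borel ((+) c))" by (simp add: lborel_distr_plus)
  also have "\<dots> = (\<integral>\<^sup>+x. f (c + x) \<partial>lborel)" by (subst nn_integral_distr) auto
  finally show ?thesis by simp
qed

lemma nn_integral_torus_add_cmult:
  fixes f h :: "real^'d \<Rightarrow> real^'d \<Rightarrow> ennreal"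
  assumes "(\<lambda>w. f (fst w) (snd w)) \<in> borel_measurable (borel \<Otimes>\<^sub>M borel)"
    and "(\<lambda>w. h (fst w) (snd w)) \<in> borel_measurable (borel \<Otimes>\<^sub>M borel)"
  shows "(\<integral>\<^sup>+y. (\<integral>\<^sup>+z. f y z + c * h y z \<partial>torus) \<partial>torus) =
    (\<integral>\<^sup>+y. (\<integral>\<^sup>+z. f y z \<partial>torus) \<partial>torus) + c * (\<integral>\<^sup>+y. (\<integral>\<^sup>+z. h y z \<partial>torus) \<partial>torus)"
proof -
  note [measurable] = assms[THEN measurable_torus_pair]
  have 1: "(\<integral>\<^sup>+y. (\<integral>\<^sup>+z. k y z \<partial>torus) \<partial>torus) = (\<integral>\<^sup>+w. k (fst w) (snd w) \<partial>(torus \<Otimes>\<^sub>M torus))"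
    if "(\<lambda>w. k (fst w) (snd w)) \<in> borel_measurable (torus \<Otimes>\<^sub>M torus)" for k :: "real^'d \<Rightarrow> real^'d \<Rightarrow> ennreal"
    using torus.nn_integral_fst[OF that] by simp
  have "(\<integral>\<^sup>+y. (\<integral>\<^sup>+z. f y z + c * h y z \<partial>torus) \<partial>torus) =
      (\<integral>\<^sup>+w. f (fst w) (snd w) + c * h (fst w) (snd w) \<partial>(torus \<Otimes>\<^sub>M torus))"
    by (rule 1) measurable
  also have "\<dots> = (\<integral>\<^sup>+w. f (fst w) (snd w) \<partial>(torus \<Otimes>\<^sub>M torus)) + c * (\<integral>\<^sup>+w. h (fst w) (snd w) \<partial>(torus \<Otimes>\<^sub>M torus))"
    by (subst nn_integral_add, measurable, subst nn_integral_cmult, measurable)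
  also have "\<dots> = (\<integral>\<^sup>+y. (\<integral>\<^sup>+z. f y z \<partial>torus) \<partial>torus) + c * (\<integral>\<^sup>+y. (\<integral>\<^sup>+z. h y z \<partial>torus) \<partial>torus)"
    using assms[THEN measurable_torus_pair] by (simp only: 1)
  finally show ?thesis .
qed

text \<open>The exponent \<open>k + 1\<close> keeps the side at most 1/2, so that boxes and the
  differences of two points of one box lie in the half-open cell.\<close>

definition dyadic :: "nat \<Rightarrow> real" where
  "dyadic k = (1 / 2) ^ (k + 1)"

definition dyadic_box :: "nat \<Rightarrow> (real^'d) set" where
  "dyadic_box k = cbox 0 (\<chi> i. dyadic k)"

definition dyadic_kernel :: "nat \<Rightarrow> real^'d \<Rightarrow> real" where
  "dyadic_kernel k y = indicator (dyadic_box k) y / dyadic k ^ CARD('d)"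

lemma dyadic_pos: "dyadic k > 0" and dyadic_le: "dyadic k \<le> 1 / 2" and dyadic_Suc: "dyadic (Suc k) = dyadic k / 2"
  using power_le_one[of "1 / 2 :: real" k] by (auto simp: dyadic_def)

lemma mem_dyadic_box: "y \<in> dyadic_box k \<longleftrightarrow> (\<forall>i. 0 \<le> y $ i \<and> y $ i \<le> dyadic k)"
  by (simp add: dyadic_box_def mem_box_cart)

lemma dyadic_box_measurable[measurable]: "dyadic_box k \<in> sets borel"
  by (simp add: dyadic_box_def)

lemma dyadic_box_cell: "dyadic_box k \<subseteq> cell"
proof
  fix y :: "real^'a" assume "y \<in> dyadic_box k"
  then have "0 \<le> y $ i" "y $ i \<le> dyadic k" for i by (auto simp: mem_dyadic_box)
  then have "-1 \<le> y $ i \<and> y $ i < 1" for i using dyadic_le[of k] by (smt (verit) field_sum_of_halves)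
  then show "y \<in> cell" by (simp add: cell_def)
qed

lemma dyadic_box_Suc: "dyadic_box (Suc k) \<subseteq> dyadic_box k"
proof
  fix y :: "real^'a" assume "y \<in> dyadic_box (Suc k)"
  then have "0 \<le> y $ i" "y $ i \<le> dyadic k / 2" for i by (auto simp: mem_dyadic_box dyadic_Suc)
  then have "0 \<le> y $ i \<and> y $ i \<le> dyadic k" for i using dyadic_pos[of k] by (smt (verit) field_sum_of_halves)
  then show "y \<in> dyadic_box k" by (simp add: mem_dyadic_box)
qed

lemma dyadic_box_diff:
  assumes "y \<in> dyadic_box k" "y + h \<in> dyadic_box k"
  shows "h \<in> cell" "norm (h :: real^'d) \<le> real CARD('d) * dyadic k"
proof -
  have h: "\<bar>h $ i\<bar> \<le> dyadic k" for i
  proof -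
    have "0 \<le> y $ i" "y $ i \<le> dyadic k" "0 \<le> y $ i + h $ i" "y $ i + h $ i \<le> dyadic k"
      using assms by (auto simp: mem_dyadic_box)
    then show ?thesis by linarith
  qed
  have "- 1 \<le> h $ i \<and> h $ i < 1" for i using h[of i] dyadic_le[of k] by linarith
  then show "h \<in> cell" by (simp add: cell_def)
  have "norm h \<le> (\<Sum>i\<in>UNIV. \<bar>h $ i\<bar>)" by (rule norm_le_l1_cart)
  also have "\<dots> \<le> (\<Sum>i\<in>(UNIV::'d set). dyadic k)" by (intro sum_mono h)
  finally show "norm h \<le> real CARD('d) * dyadic k" by simp
qed

lemma dyadic_kernel_measurable[measurable]: "dyadic_kernel k \<in> borel_measurable borel"
  unfolding dyadic_kernel_def by measurable

lemma dyadic_kernel_nonneg: "0 \<le> dyadic_kernel k y"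
  using dyadic_pos[of k] by (simp add: dyadic_kernel_def)

lemma approx_id_dyadic: "approx_id (dyadic_kernel :: nat \<Rightarrow> real^'d \<Rightarrow> real)"
  unfolding approx_id_def
proof (intro conjI allI impI)
  fix k
  show "dyadic_kernel k \<in> borel_measurable borel" by measurable
  show "0 \<le> dyadic_kernel k y" for y by (rule dyadic_kernel_nonneg)
  show "\<exists>B. \<forall>y. dyadic_kernel k (y :: real^'d) \<le> B"
    using dyadic_pos[of k] by (intro exI[of _ "1 / dyadic k ^ CARD('d)"]) (auto simp: dyadic_kernel_def indicator_def divide_simps)
  have "measure torus (dyadic_box k :: (real^'d) set) = measure lborel (dyadic_box k :: (real^'d) set)"
    using dyadic_box_cell by (intro measure_restrict_space) auto
  also have "\<dots> = measure lborel (cbox (0::real^'d) (\<chi> i. dyadic k))" by (simp add: dyadic_box_def)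
  also have "\<dots> = dyadic k ^ CARD('d)"
    using dyadic_pos[of k] by (subst content_cbox_cart) (auto simp: interval_ne_empty_cart less_imp_le)
  finally have m: "measure torus (dyadic_box k :: (real^'d) set) = dyadic k ^ CARD('d)" .
  have "dyadic_box k \<inter> cell = (dyadic_box k :: (real^'d) set)" using dyadic_box_cell by blast
  then show "(\<integral>y. dyadic_kernel k (y :: real^'d) \<partial>torus) = 1"
    using m dyadic_pos[of k] by (simp add: dyadic_kernel_def)
next
  fix \<delta> :: real assume "\<delta> > 0"
  have "(\<lambda>k. real CARD('d) * dyadic k) \<longlonglongrightarrow> real CARD('d) * (0 * (1 / 2))"
    unfolding dyadic_def power_add power_one_right by (intro tendsto_intros LIMSEQ_power_zero) simp
  then have "eventually (\<lambda>k. real CARD('d) * dyadic k < \<delta>) sequentially"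
    by (rule order_tendstoD(2)) (use \<open>\<delta> > 0\<close> in simp)
  then have "eventually (\<lambda>k. (\<integral>y. (if norm y < \<delta> then 0 else dyadic_kernel k (y :: real^'d)) \<partial>torus) = 0) sequentially"
  proof eventually_elim
    case (elim k)
    have "(if norm y < \<delta> then 0 else dyadic_kernel k y) = 0" for y :: "real^'d"
    proof (cases "y \<in> dyadic_box k")
      case True
      moreover have "0 \<in> (dyadic_box k :: (real^'d) set)" using dyadic_pos[of k] by (simp add: mem_dyadic_box)
      ultimately have "norm y \<le> real CARD('d) * dyadic k" using dyadic_box_diff(2)[of 0 k y] by simp
      then show ?thesis using elim by simp
    qed (simp add: dyadic_kernel_def)
    then show ?case by simp
  qed
  then show "(\<lambda>k. \<integral>y. (if norm y < \<delta> then 0 else dyadic_kernel k (y :: real^'d)) \<partial>torus) \<longlonglongrightarrow> 0"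
    by (rule tendsto_eventually)
qed

lemma dyadic_kernel_integrable:
  assumes "integrable torus c"
  shows "integrable torus (\<lambda>y. c y * dyadic_kernel k y)"
proof (rule integrable_bound)
  let ?B = "1 / dyadic k ^ CARD('a)"
  have [measurable]: "c \<in> borel_measurable torus" "dyadic_kernel k \<in> borel_measurable torus"
    using assms by (auto intro!: borel_measurable_torus)
  show "integrable torus (\<lambda>y. ?B * c y)" by (intro integrable_mult_right assms)
  show "(\<lambda>y. c y * dyadic_kernel k y) \<in> borel_measurable torus" by measurable
  show "AE y in torus. norm (c y * dyadic_kernel k y) \<le> norm (?B * c y)"
    using dyadic_pos[of k] by (intro AE_I2) (auto simp: dyadic_kernel_def indicator_def abs_mult)
qed

text \<open>Truncation at the level \<open>e\<close> replaces Hoelder's inequality.\<close>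

lemma le_add_powr:
  fixes a e p :: real
  assumes "0 \<le> a" "0 < e" "1 \<le> p"
  shows "a \<le> e + e powr (1 - p) * a powr p"
proof (cases "a \<le> e")
  case False
  then have "a = a powr (1 - p) * a powr p" using assms by (simp add: powr_add[symmetric])
  also have "\<dots> \<le> e powr (1 - p) * a powr p"
    using False assms by (intro mult_right_mono powr_mono2') auto
  finally show ?thesis using assms by simp
qed (use assms in \<open>auto intro: add_increasing2\<close>)

text \<open>The increment is a double average of g(x + y) - g(x + z) with y in the smaller and z in
  the larger box. Such points are at most d times the side apart, so the power of the difference is
  controlled by the Gagliardo quotient; the two kernels contribute the inverse volumes in the
  constant.\<close>

lemma dyadic_average_increment:
  fixes g :: "real^'d \<Rightarrow> real"
  assumes [measurable]: "g \<in> borel_measurable borel" and per: "periodic g" and g: "integrable torus g"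
    and p: "1 \<le> p" and q: "0 \<le> q" and e: "0 < e" and M: "0 \<le> M"
    and G: "(\<integral>\<^sup>+h. (\<integral>\<^sup>+x. ennreal (\<bar>g (x + h) - g x\<bar> powr p / norm h powr q) \<partial>torus) \<partial>torus) \<le> ennreal M"
  shows "\<bar>(\<integral>y. g (x + y) * dyadic_kernel (Suc k) y \<partial>torus) - (\<integral>y. g (x + y) * dyadic_kernel k y \<partial>torus)\<bar> \<le>
    e + e powr (1 - p) * ((real CARD('d) * dyadic k) powr q / (dyadic k ^ CARD('d) * dyadic (Suc k) ^ CARD('d))) * M"
proof -
  let ?b = "dyadic_kernel k :: real^'d \<Rightarrow> real" and ?b' = "dyadic_kernel (Suc k) :: real^'d \<Rightarrow> real"
  define c where "c = (real CARD('d) * dyadic k) powr q / (dyadic k ^ CARD('d) * dyadic (Suc k) ^ CARD('d))"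
  have c: "c \<ge> 0" using dyadic_pos by (simp add: c_def less_imp_le)
  define \<Phi> where "\<Phi> h y = \<bar>g (y + h) - g y\<bar> powr p / norm h powr q" for h y
  have [measurable]: "(\<lambda>z. \<Phi> (fst z) (snd z)) \<in> borel_measurable (borel \<Otimes>\<^sub>M borel)" unfolding \<Phi>_def by measurable
  have b1: "integrable torus ?b" "integrable torus ?b'" "(\<integral>y. ?b y \<partial>torus) = 1" "(\<integral>y. ?b' y \<partial>torus) = 1"
    using dyadic_kernel_integrable[of "\<lambda>_. 1" k] dyadic_kernel_integrable[of "\<lambda>_. 1" "Suc k"] approx_id_dyadic
    by (auto simp: approx_id_def)
  have gx: "integrable torus (\<lambda>y. g (x + y))"
    using integrable_torus_shift[OF _ per, of x] g by (simp add: add.commute)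
  define A where "A = (\<integral>y. g (x + y) * ?b y \<partial>torus)"
  have "(\<integral>y. g (x + y) * ?b' y \<partial>torus) - A = (\<integral>y. (g (x + y) - A) * ?b' y \<partial>torus)"
    using dyadic_kernel_integrable[OF gx, of "Suc k"] b1 by (simp add: left_diff_distrib)
  then have "\<bar>(\<integral>y. g (x + y) * ?b' y \<partial>torus) - A\<bar> \<le> (\<integral>y. \<bar>g (x + y) - A\<bar> * ?b' y \<partial>torus)"
    using integral_abs_bound[of torus "\<lambda>y. (g (x + y) - A) * ?b' y"] by (simp add: abs_mult dyadic_kernel_nonneg)
  then have "ennreal \<bar>(\<integral>y. g (x + y) * ?b' y \<partial>torus) - A\<bar> \<le> ennreal (\<integral>y. \<bar>g (x + y) - A\<bar> * ?b' y \<partial>torus)"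
    by (rule ennreal_leI)
  also have "\<dots> = (\<integral>\<^sup>+y. ennreal (\<bar>g (x + y) - A\<bar> * ?b' y) \<partial>torus)"
    using dyadic_kernel_integrable[of "\<lambda>y. \<bar>g (x + y) - A\<bar>" "Suc k"] gx
    by (intro nn_integral_eq_integral[symmetric]) (auto simp: dyadic_kernel_nonneg)
  also have "\<dots> \<le> (\<integral>\<^sup>+y. (\<integral>\<^sup>+z. ennreal (\<bar>g (x + y) - g (x + z)\<bar> * ?b z * ?b' y) \<partial>torus) \<partial>torus)"
  proof (rule nn_integral_mono)
    fix y
    have i: "integrable torus (\<lambda>z. (g (x + y) - g (x + z)) * ?b z)"
      using gx by (intro dyadic_kernel_integrable) auto
    have "g (x + y) - A = (\<integral>z. (g (x + y) - g (x + z)) * ?b z \<partial>torus)"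
      using dyadic_kernel_integrable[OF gx, of k] b1 by (simp add: left_diff_distrib A_def)
    then have "\<bar>g (x + y) - A\<bar> \<le> (\<integral>z. \<bar>g (x + y) - g (x + z)\<bar> * ?b z \<partial>torus)"
      using integral_abs_bound[of torus "\<lambda>z. (g (x + y) - g (x + z)) * ?b z"] by (simp add: abs_mult dyadic_kernel_nonneg)
    then have "\<bar>g (x + y) - A\<bar> * ?b' y \<le> (\<integral>z. \<bar>g (x + y) - g (x + z)\<bar> * ?b z \<partial>torus) * ?b' y"
      by (intro mult_right_mono dyadic_kernel_nonneg)
    also have "\<dots> = (\<integral>z. \<bar>g (x + y) - g (x + z)\<bar> * ?b z * ?b' y \<partial>torus)" by simp
    finally have "ennreal (\<bar>g (x + y) - A\<bar> * ?b' y) \<le> ennreal (\<integral>z. \<bar>g (x + y) - g (x + z)\<bar> * ?b z * ?b' y \<partial>torus)"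
      by (rule ennreal_leI)
    also have "\<dots> = (\<integral>\<^sup>+z. ennreal (\<bar>g (x + y) - g (x + z)\<bar> * ?b z * ?b' y) \<partial>torus)"
      using integrable_abs[OF i] by (intro nn_integral_eq_integral[symmetric]) (auto simp: dyadic_kernel_nonneg abs_mult)
    finally show "ennreal (\<bar>g (x + y) - A\<bar> * ?b' y) \<le> (\<integral>\<^sup>+z. ennreal (\<bar>g (x + y) - g (x + z)\<bar> * ?b z * ?b' y) \<partial>torus)" .
  qed
  also have "\<dots> \<le> (\<integral>\<^sup>+y. (\<integral>\<^sup>+z. ennreal (e * ?b z * ?b' y) +
      ennreal (e powr (1 - p) * c) * (ennreal (\<Phi> (z - y) (x + y)) * indicator (dyadic_box k) z * indicator (dyadic_box k) y) \<partial>torus) \<partial>torus)"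
  proof (intro nn_integral_mono)
    fix y z :: "real^'d"
    show "ennreal (\<bar>g (x + y) - g (x + z)\<bar> * ?b z * ?b' y) \<le> ennreal (e * ?b z * ?b' y) +
        ennreal (e powr (1 - p) * c) * (ennreal (\<Phi> (z - y) (x + y)) * indicator (dyadic_box k) z * indicator (dyadic_box k) y)"
    proof (cases "z \<in> dyadic_box k \<and> y \<in> dyadic_box (Suc k)")
      case True
      then have zy: "z \<in> dyadic_box k" "y \<in> dyadic_box k" "y + (z - y) \<in> dyadic_box k" using dyadic_box_Suc by auto
      let ?a = "\<bar>g (x + y) - g (x + z)\<bar>"
      have a: "?a powr p \<le> \<Phi> (z - y) (x + y) * (real CARD('d) * dyadic k) powr q"
      \<comment> \<open>On the diagonal the quotient is 0 by division by zero and cannot be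
        multiplied back, but the difference vanishes there as well.\<close>
      proof (cases "z = y")
        case False
        have "?a powr p = \<Phi> (z - y) (x + y) * norm (z - y) powr q"
          using False by (simp add: \<Phi>_def abs_minus_commute)
        also have "\<dots> \<le> \<Phi> (z - y) (x + y) * (real CARD('d) * dyadic k) powr q"
          using dyadic_box_diff(2)[OF zy(2,3)] q by (intro mult_left_mono powr_mono2) (auto simp: \<Phi>_def)
        finally show ?thesis .
      qed (simp add: \<Phi>_def)
      have "?a \<le> e + e powr (1 - p) * ?a powr p" by (rule le_add_powr) (use e p in auto)
      also have "\<dots> \<le> e + e powr (1 - p) * (\<Phi> (z - y) (x + y) * (real CARD('d) * dyadic k) powr q)"
        using a by (intro add_left_mono mult_left_mono) auto
      finally have "?a * (?b z * ?b' y) \<le> (e + e powr (1 - p) * (\<Phi> (z - y) (x + y) * (real CARD('d) * dyadic k) powr q)) * (?b z * ?b' y)"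
        by (rule mult_right_mono) (simp add: dyadic_kernel_nonneg)
      also have "\<dots> = e * ?b z * ?b' y + e powr (1 - p) * c * \<Phi> (z - y) (x + y)"
        using True by (simp add: dyadic_kernel_def c_def algebra_simps)
      finally have "ennreal (?a * ?b z * ?b' y) \<le> ennreal (e * ?b z * ?b' y + e powr (1 - p) * c * \<Phi> (z - y) (x + y))"
        by (intro ennreal_leI) (simp add: mult.assoc)
      also have "\<dots> = ennreal (e * ?b z * ?b' y) + ennreal (e powr (1 - p) * c * \<Phi> (z - y) (x + y))"
        using e c by (intro ennreal_plus) (auto simp: dyadic_kernel_nonneg \<Phi>_def)
      also have "ennreal (e powr (1 - p) * c * \<Phi> (z - y) (x + y)) = ennreal (e powr (1 - p) * c) * ennreal (\<Phi> (z - y) (x + y))"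
        using c by (intro ennreal_mult) (auto simp: \<Phi>_def)
      finally show ?thesis using zy by simp
    qed (auto simp: dyadic_kernel_def)
  qed
  also have "\<dots> = (\<integral>\<^sup>+y. (\<integral>\<^sup>+z. ennreal (e * ?b z * ?b' y) \<partial>torus) \<partial>torus) +
      ennreal (e powr (1 - p) * c) * (\<integral>\<^sup>+y. (\<integral>\<^sup>+z. ennreal (\<Phi> (z - y) (x + y)) * indicator (dyadic_box k) z * indicator (dyadic_box k) y \<partial>torus) \<partial>torus)"
  proof -
    have [measurable]: "(\<lambda>w. \<Phi> (snd w - fst w) (x + fst w)) \<in> borel_measurable (borel \<Otimes>\<^sub>M borel)"
      unfolding \<Phi>_def by measurable
    show ?thesis
      by (rule nn_integral_torus_add_cmult[of "\<lambda>y z. ennreal (e * ?b z * ?b' y)"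
            "\<lambda>y z. ennreal (\<Phi> (z - y) (x + y)) * indicator (dyadic_box k) z * indicator (dyadic_box k) y"]) measurable
  qed
  also have "(\<integral>\<^sup>+y. (\<integral>\<^sup>+z. ennreal (e * ?b z * ?b' y) \<partial>torus) \<partial>torus) = ennreal e"
  proof -
    have "(\<integral>\<^sup>+z. ennreal (e * ?b z * ?b' y) \<partial>torus) = ennreal (e * ?b' y)" for y
    proof -
      have "(\<integral>\<^sup>+z. ennreal (e * ?b z * ?b' y) \<partial>torus) = ennreal (\<integral>z. e * ?b z * ?b' y \<partial>torus)"
        using e b1 by (intro nn_integral_eq_integral) (auto simp: dyadic_kernel_nonneg)
      then show ?thesis using b1 by simp
    qed
    moreover have "(\<integral>\<^sup>+y. ennreal (e * ?b' y) \<partial>torus) = ennreal (\<integral>y. e * ?b' y \<partial>torus)"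
      using e b1 by (intro nn_integral_eq_integral) (auto simp: dyadic_kernel_nonneg)
    ultimately show ?thesis using b1 by simp
  qed
  also have "(\<integral>\<^sup>+y. (\<integral>\<^sup>+z. ennreal (\<Phi> (z - y) (x + y)) * indicator (dyadic_box k) z * indicator (dyadic_box k) y \<partial>torus) \<partial>torus) \<le> ennreal M"
  proof -
    \<comment> \<open>For fixed y put h = z - y, which ranges in the cell because y and z lie in one
      box. Once the boxes are dropped, the shift by x is absorbed by periodicity and Fubini gives
      the seminorm.\<close>
    define \<Psi> where "\<Psi> y = (\<integral>\<^sup>+h. ennreal (\<Phi> h y) \<partial>torus)" for y
    have "(\<integral>\<^sup>+z. ennreal (\<Phi> (z - y) (x + y)) * indicator (dyadic_box k) z * indicator (dyadic_box k) y \<partial>torus) \<le> \<Psi> (y + x)" for y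
    proof -
      have [measurable]: "(\<lambda>z. \<Phi> (z - y) (x + y)) \<in> borel_measurable borel" "(\<lambda>h. \<Phi> h (x + y)) \<in> borel_measurable borel"
        unfolding \<Phi>_def by measurable
      have "(\<integral>\<^sup>+z. ennreal (\<Phi> (z - y) (x + y)) * indicator (dyadic_box k) z * indicator (dyadic_box k) y \<partial>torus) \<le>
          (\<integral>\<^sup>+z. ennreal (\<Phi> (z - y) (x + y)) * indicator (dyadic_box k) z * indicator (dyadic_box k) y \<partial>lborel)"
        by (subst nn_integral_restrict_space) (auto intro!: nn_integral_mono simp: indicator_def)
      also have "\<dots> = (\<integral>\<^sup>+h. ennreal (\<Phi> (y + h - y) (x + y)) * indicator (dyadic_box k) (y + h) * indicator (dyadic_box k) y \<partial>lborel)"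
        by (rule nn_integral_lborel_shift[symmetric, of "\<lambda>z. ennreal (\<Phi> (z - y) (x + y)) * indicator (dyadic_box k) z * indicator (dyadic_box k) y"]) measurable
      also have "\<dots> \<le> (\<integral>\<^sup>+h. ennreal (\<Phi> h (x + y)) * indicator cell h \<partial>lborel)"
        using dyadic_box_diff(1)[of y k] by (intro nn_integral_mono) (auto simp: indicator_def)
      also have "\<dots> = \<Psi> (y + x)" by (simp add: \<Psi>_def nn_integral_restrict_space add.commute)
      finally show ?thesis .
    qed
    then have "(\<integral>\<^sup>+y. (\<integral>\<^sup>+z. ennreal (\<Phi> (z - y) (x + y)) * indicator (dyadic_box k) z * indicator (dyadic_box k) y \<partial>torus) \<partial>torus) \<le> (\<integral>\<^sup>+y. \<Psi> (y + x) \<partial>torus)"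
      by (intro nn_integral_mono)
    also have "\<dots> = (\<integral>\<^sup>+y. \<Psi> y \<partial>torus)"
    proof (rule nn_integral_torus_shift)
      have id: "(\<lambda>x. x) \<in> torus \<rightarrow>\<^sub>M borel" by (intro borel_measurable_torus) simp
      have "(\<lambda>w. (snd w, fst w)) \<in> borel \<Otimes>\<^sub>M torus \<rightarrow>\<^sub>M borel \<Otimes>\<^sub>M borel"
        by (intro measurable_Pair measurable_compose[OF measurable_snd id] measurable_fst)
      then have "(\<lambda>w. ennreal (\<Phi> (snd w) (fst w))) \<in> borel_measurable (borel \<Otimes>\<^sub>M torus)"
        using measurable_compose[of "\<lambda>w. (snd w, fst w)" "borel \<Otimes>\<^sub>M torus" "borel \<Otimes>\<^sub>M borel" "\<lambda>w. ennreal (\<Phi> (fst w) (snd w))" borel]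
        by simp
      then show "\<Psi> \<in> borel_measurable borel"
        unfolding \<Psi>_def using torus.borel_measurable_nn_integral[of "\<lambda>y h. ennreal (\<Phi> h y)" borel] by (simp add: split_beta')
      show "periodic \<Psi>"
        unfolding periodic_def \<Psi>_def \<Phi>_def
      proof (intro allI nn_integral_cong)
        fix y h :: "real^'d" and i
        have "g (y + 2 *\<^sub>R axis i 1 + h) = g (y + h)"
          using periodic_shift[OF per, of h] unfolding periodic_def by blast
        moreover have "g (y + 2 *\<^sub>R axis i 1) = g y" using per unfolding periodic_def by blast
        ultimately show "ennreal (\<bar>g (y + 2 *\<^sub>R axis i 1 + h) - g (y + 2 *\<^sub>R axis i 1)\<bar> powr p / norm h powr q) = ennreal (\<bar>g (y + h) - g y\<bar> powr p / norm h powr q)"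
          by simp
      qed
    qed
    also have "\<dots> = (\<integral>\<^sup>+h. (\<integral>\<^sup>+y. ennreal (\<Phi> h y) \<partial>torus) \<partial>torus)"
    proof -
      interpret P: pair_sigma_finite "torus :: (real^'d) measure" "torus :: (real^'d) measure" ..
      have "(\<lambda>(h, y). ennreal (\<Phi> h y)) \<in> borel_measurable (torus \<Otimes>\<^sub>M torus)"
        by (rule measurable_torus_pair) (simp add: split_beta')
      from P.Fubini'[OF this] show ?thesis unfolding \<Psi>_def by simp
    qed
    also have "\<dots> \<le> ennreal M" using G by (simp add: \<Phi>_def)
    finally show ?thesis .
  qed
  finally have "ennreal \<bar>(\<integral>y. g (x + y) * ?b' y \<partial>torus) - A\<bar> \<le> ennreal e + ennreal (e powr (1 - p) * c) * ennreal M"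
    by (simp add: mult_left_mono add_left_mono)
  also have "\<dots> = ennreal (e + e powr (1 - p) * c * M)"
    using e c M by (simp add: ennreal_mult[symmetric] ennreal_plus[symmetric] del: ennreal_plus)
  finally show ?thesis
    unfolding A_def[symmetric] c_def[symmetric]
    by (rule ennreal_le_iff[THEN iffD1, rotated]) (use e c M in simp)
qed

text \<open>A fractional Morrey estimate. Truncating the k-th increment of the dyadic averages at
  the level \<open>r ^ k\<close> makes the increments summable, the first average is controlled by
  the norm in the mean, and the averages converge to g in the mean.\<close>

lemma gagliardo_imp_bounded:
  fixes p M :: real
  assumes p: "p > real CARD('d) + 2" and M: "0 \<le> M"
  obtains K where "0 \<le> K" "\<And>g :: real^'d \<Rightarrow> real. g \<in> borel_measurable borel \<Longrightarrow> periodic g \<Longrightarrow> integrable torus g \<Longrightarrow>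
      (\<integral>x. \<bar>g x\<bar> \<partial>torus) \<le> M \<Longrightarrow>
      (\<integral>\<^sup>+h. (\<integral>\<^sup>+x. ennreal (\<bar>g (x + h) - g x\<bar> powr p / norm h powr (real CARD('d) + p - 2)) \<partial>torus) \<partial>torus) \<le> ennreal M \<Longrightarrow>
      AE x in torus. \<bar>g x\<bar> \<le> K"
proof -
  define d where "d = real CARD('d)"
  define q where "q = d + p - 2"
  \<comment> \<open>The second term of the k-th increment decays at least like \<open>r ^ k\<close>
    as soon as \<open>\<alpha> * p \<le> p - 2 - d\<close>; half of the largest such value is taken.
    It is positive exactly because p > d + 2.\<close>
  define \<alpha> where "\<alpha> = (p - 2 - d) / (2 * p)"
  define r where "r = 2 powr (- \<alpha>)"
  have d: "d \<ge> 1" unfolding d_def using zero_less_card_finite[where 'a = 'd] by linarith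
  have pd: "p > d + 2" using p by (simp add: d_def)
  have p1: "p > 3" "q > 0" using pd d unfolding q_def by linarith+
  have \<alpha>: "\<alpha> > 0" using pd p1 by (simp add: \<alpha>_def)
  have r: "0 < r" "r < 1" using \<alpha> by (auto simp: r_def powr_less_one)
  \<comment> \<open>C collects the factors of the increment that do not depend on k. In K,
    \<open>2 powr d\<close> bounds the kernel of the largest box and 1 / (1 - r) is the geometric
    series.\<close>
  define C where "C = 2 powr (3 * d - q) * d powr q"
  define K where "K = 2 powr d * M + (1 + C * M) / (1 - r)"
  have C: "C \<ge> 0" by (simp add: C_def)
  have K: "K \<ge> 0" using r M C by (simp add: K_def)
  have inc: "r ^ k + (r ^ k) powr (1 - p) * ((d * dyadic k) powr q / (dyadic k ^ CARD('d) * dyadic (Suc k) ^ CARD('d))) * M \<le> (1 + C * M) * r ^ k" for k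
  proof -
    have dy: "dyadic k = 2 powr (- real (k + 1))" for k
    proof -
      have "2 powr (- real (k + 1)) = inverse (2 powr real (k + 1))" by (rule powr_minus)
      also have "2 powr real (k + 1) = 2 ^ (k + 1)" by (rule powr_realpow) simp
      finally show ?thesis by (simp add: dyadic_def power_one_over inverse_eq_divide)
    qed
    have dyp: "dyadic k ^ CARD('d) = 2 powr (- real (k + 1) * d)" for k
    proof -
      have "dyadic k ^ CARD('d) = dyadic k powr d" unfolding d_def using powr_realpow[OF dyadic_pos] by simp
      then show ?thesis by (simp only: dy powr_powr)
    qed
    have rk: "r ^ k = 2 powr (- \<alpha> * k)"
    proof -
      have "r ^ k = r powr k" using powr_realpow[OF r(1)] by simp
      then show ?thesis by (simp only: r_def powr_powr)
    qed
    have "(d * dyadic k) powr q / (dyadic k ^ CARD('d) * dyadic (Suc k) ^ CARD('d)) =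
        d powr q * 2 powr (- real (k + 1) * q) / (2 powr (- real (k + 1) * d) * 2 powr (- real (k + 2) * d))"
      unfolding dyp using d by (simp only: dy powr_mult powr_powr) (simp add: add.commute)
    also have "\<dots> = d powr q * 2 powr (- real (k + 1) * q - (- real (k + 1) * d + - real (k + 2) * d))"
      by (simp only: powr_add[symmetric] powr_diff times_divide_eq_right)
    also have "- real (k + 1) * q - (- real (k + 1) * d + - real (k + 2) * d) = (3 * d - q) + k * (2 * d - q)"
      by (simp add: algebra_simps)
    finally have 1: "(d * dyadic k) powr q / (dyadic k ^ CARD('d) * dyadic (Suc k) ^ CARD('d)) = C * 2 powr (k * (2 * d - q))"
      by (simp add: C_def powr_add)
    have "(r ^ k) powr (1 - p) * (C * 2 powr (k * (2 * d - q))) = C * 2 powr (- \<alpha> * k * (1 - p) + k * (2 * d - q))"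
      by (simp only: rk powr_powr powr_add mult.left_commute[of _ C])
    also have "\<dots> \<le> C * r ^ k"
    proof -
      have "\<alpha> * p = (p - 2 - d) / 2" using p1 by (simp add: \<alpha>_def)
      then have "- \<alpha> * (1 - p) + (2 * d - q) \<le> - \<alpha>" using pd by (simp add: q_def algebra_simps)
      then have "k * (- \<alpha> * (1 - p) + (2 * d - q)) \<le> k * (- \<alpha>)" by (intro mult_left_mono) auto
      then have "- \<alpha> * k * (1 - p) + k * (2 * d - q) \<le> - \<alpha> * k" by (simp add: algebra_simps)
      then show ?thesis unfolding rk using C by (intro mult_left_mono powr_mono) auto
    qed
    finally have "(r ^ k) powr (1 - p) * (C * 2 powr (k * (2 * d - q))) * M \<le> C * r ^ k * M"
      using M by (intro mult_right_mono)
    then show ?thesis unfolding 1 by (simp add: algebra_simps)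
  qed
  show ?thesis
  proof (rule that[OF K])
    fix g :: "real^'d \<Rightarrow> real"
    assume gm[measurable]: "g \<in> borel_measurable borel" and per: "periodic g" and g: "integrable torus g"
      and L1: "(\<integral>x. \<bar>g x\<bar> \<partial>torus) \<le> M"
      and G: "(\<integral>\<^sup>+h. (\<integral>\<^sup>+x. ennreal (\<bar>g (x + h) - g x\<bar> powr p / norm h powr (real CARD('d) + p - 2)) \<partial>torus) \<partial>torus) \<le> ennreal M"
    define A where "A k x = (\<integral>y. g (x + y) * dyadic_kernel k y \<partial>torus)" for k x
    have gx: "integrable torus (\<lambda>y. g (x + y))" for x
      using integrable_torus_shift[OF gm per, of x] g by (simp add: add.commute)
    have A0: "\<bar>A 0 x\<bar> \<le> 2 powr d * M" for x
    proof -
      have "\<bar>A 0 x\<bar> \<le> (\<integral>y. \<bar>g (x + y)\<bar> * dyadic_kernel 0 y \<partial>torus)"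
        using integral_abs_bound[of torus "\<lambda>y. g (x + y) * dyadic_kernel 0 y"]
        by (simp add: A_def abs_mult dyadic_kernel_nonneg)
      also have "\<dots> \<le> (\<integral>y. 2 powr d * \<bar>g (y + x)\<bar> \<partial>torus)"
      proof (rule integral_mono)
        show "integrable torus (\<lambda>y. \<bar>g (x + y)\<bar> * dyadic_kernel 0 y)"
          using gx[of x] by (intro dyadic_kernel_integrable) auto
        show "integrable torus (\<lambda>y. 2 powr d * \<bar>g (y + x)\<bar>)" using gx[of x] by (simp add: add.commute)
        fix y
        have "dyadic_kernel 0 (y :: real^'d) \<le> 2 powr d"
          by (simp add: dyadic_kernel_def dyadic_def indicator_def d_def powr_realpow power_one_over)
        then show "\<bar>g (x + y)\<bar> * dyadic_kernel 0 y \<le> 2 powr d * \<bar>g (y + x)\<bar>"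
          using mult_left_mono[of "dyadic_kernel 0 y" "2 powr d" "\<bar>g (x + y)\<bar>"] by (simp add: mult.commute add.commute)
      qed
      also have "\<dots> = 2 powr d * (\<integral>y. \<bar>g y\<bar> \<partial>torus)"
        using integral_torus_shift[of "\<lambda>y. \<bar>g y\<bar>" x] periodic_compose[OF per, of abs] by simp
      also have "\<dots> \<le> 2 powr d * M" using L1 by simp
      finally show ?thesis .
    qed
    have Ak: "\<bar>A k x\<bar> \<le> 2 powr d * M + (1 + C * M) * (\<Sum>i<k. r ^ i)" for k x
    proof (induction k)
      case 0
      then show ?case using A0 by simp
    next
      case (Suc k)
      have "\<bar>A (Suc k) x - A k x\<bar> \<le> (1 + C * M) * r ^ k"
        using dyadic_average_increment[OF gm per g, of p q "r ^ k" M x k] inc[of k] G p1 r M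
        by (simp add: A_def d_def q_def)
      then show ?case using Suc by (simp add: algebra_simps)
    qed
    have AK: "\<bar>A k x\<bar> \<le> K" for k x
    proof -
      have "(\<Sum>i<k. r ^ i) \<le> 1 / (1 - r)"
        using r by (simp add: sum_gp_strict divide_right_mono)
      then have "(1 + C * M) * (\<Sum>i<k. r ^ i) \<le> (1 + C * M) * (1 / (1 - r))"
        using C M by (intro mult_left_mono) auto
      then show ?thesis using Ak[of k x] by (simp add: K_def)
    qed
    \<comment> \<open>As \<open>ennreal\<close> cuts negative numbers off at 0, the left side
      measures the excess of g over K, while the averages never exceed K.\<close>
    have "(\<integral>\<^sup>+x. ennreal (\<bar>g x\<bar> - K) \<partial>torus) \<le> (\<integral>\<^sup>+x. ennreal \<bar>A k x - g x\<bar> \<partial>torus)" for k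
    proof (intro nn_integral_mono ennreal_leI)
      fix x show "\<bar>g x\<bar> - K \<le> \<bar>A k x - g x\<bar>" using AK[of k x] by linarith
    qed
    moreover have "(\<lambda>k. \<integral>\<^sup>+x. ennreal \<bar>A k x - g x\<bar> \<partial>torus) \<longlonglongrightarrow> 0"
      unfolding A_def by (rule approx_id_L1[OF gm per g approx_id_dyadic])
    ultimately have "(\<integral>\<^sup>+x. ennreal (\<bar>g x\<bar> - K) \<partial>torus) \<le> 0"
      by (intro LIMSEQ_le_const) auto
    moreover have "(\<lambda>x. ennreal (\<bar>g x\<bar> - K)) \<in> borel_measurable torus"
      by (rule borel_measurable_torus) measurable
    ultimately have "AE x in torus. ennreal (\<bar>g x\<bar> - K) = 0"
      by (simp add: nn_integral_0_iff_AE)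
    then show "AE x in torus. \<bar>g x\<bar> \<le> K"
      by eventually_elim (simp add: ennreal_eq_0_iff)
  qed
qed

section \<open>Trigonometric kernels\<close>

text \<open>Both variables carry the same factors, so the kernel is symmetric and positive
  semidefinite: its quadratic form is a sum of squares. A list rather than a set allows repeated
  terms.\<close>

definition finite_rank :: "(real^'d \<Rightarrow> real^'d \<Rightarrow> real) \<Rightarrow> bool" where
  "finite_rank K \<longleftrightarrow> (\<exists>fs. (\<forall>f\<in>set fs. smooth f \<and> periodic f) \<and> K = (\<lambda>x y. \<Sum>f\<leftarrow>fs. f x * f y))"

lemma sum_list_map_product:
  "(\<Sum>(a, b)\<leftarrow>List.product xs ys. p a * q b) = (\<Sum>a\<leftarrow>xs. p a) * (\<Sum>b\<leftarrow>ys. q b :: real)"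
  by (induction xs) (simp_all add: o_def sum_list_const_mult distrib_right)

lemma finite_rank_mult:
  assumes "finite_rank K" "finite_rank L" shows "finite_rank (\<lambda>x y. K x y * L x y)"
proof -
  obtain fs where fs: "\<forall>f\<in>set fs. smooth f \<and> periodic f" "K = (\<lambda>x y. \<Sum>f\<leftarrow>fs. f x * f y)"
    using assms(1) unfolding finite_rank_def by blast
  obtain gs where gs: "\<forall>f\<in>set gs. smooth f \<and> periodic f" "L = (\<lambda>x y. \<Sum>f\<leftarrow>gs. f x * f y)"
    using assms(2) unfolding finite_rank_def by blast
  let ?hs = "map (\<lambda>(f, g) x. f x * g x) (List.product fs gs)"
  have "\<forall>h\<in>set ?hs. smooth h \<and> periodic h"
  proof
    fix h assume "h \<in> set ?hs"
    then obtain f g where fg: "f \<in> set fs" "g \<in> set gs" "h = (\<lambda>x. f x * g x)" by auto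
    then have "smooth f" "smooth g" "periodic f" "periodic g" using fs(1) gs(1) by auto
    then show "smooth h \<and> periodic h"
      unfolding fg(3) using smooth_mult[of f g] periodic_compose2[of f g "(*)"] by simp
  qed
  moreover have "K x y * L x y = (\<Sum>h\<leftarrow>?hs. h x * h y)" for x y
    unfolding fs gs sum_list_map_product[symmetric] map_map o_def
    by (intro arg_cong[of _ _ sum_list] map_cong) (auto simp: mult_ac)
  ultimately show ?thesis unfolding finite_rank_def by blast
qed

lemma finite_rank_one: "finite_rank (\<lambda>_ _. 1)"
  unfolding finite_rank_def by (intro exI[of _ "[\<lambda>_. 1]"]) (auto simp: smooth_const periodic_const)

text \<open>A nonnegative constant must be split evenly between the two variables, whence the square
  root.\<close>

lemma finite_rank_cmult:
  assumes "finite_rank K" "0 \<le> c" shows "finite_rank (\<lambda>x y. K x y * c)"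
proof -
  have "finite_rank (\<lambda>_ _. c)"
    unfolding finite_rank_def using \<open>0 \<le> c\<close>
    by (intro exI[of _ "[\<lambda>_. sqrt c]"]) (auto simp: smooth_const periodic_const)
  from finite_rank_mult[OF assms(1) this] show ?thesis .
qed

lemma finite_rank_power: "finite_rank K \<Longrightarrow> finite_rank (\<lambda>x y. K x y ^ n)"
proof (induction n)
  case (Suc n)
  then show ?case using finite_rank_mult[of K "\<lambda>x y. K x y ^ n"] by simp
qed (simp add: finite_rank_one)

lemma finite_rank_prod: "finite I \<Longrightarrow> (\<And>i. i \<in> I \<Longrightarrow> finite_rank (K i)) \<Longrightarrow> finite_rank (\<lambda>x y. \<Prod>i\<in>I. K i x y)"
proof (induction I rule: finite_induct)
  case (insert i I)
  then show ?case using finite_rank_mult[of "K i" "\<lambda>x y. \<Prod>i\<in>I. K i x y"] by simp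
qed (simp add: finite_rank_one)

lemma finite_rank_cos: "finite_rank (\<lambda>x y::real^'d. 1 + cos (pi * (x - y) $ i))"
  unfolding finite_rank_def
  by (intro exI[of _ "[\<lambda>_. 1, \<lambda>x. cos (pi * x $ i), \<lambda>x. sin (pi * x $ i)]"])
     (auto simp: smooth_const periodic_const smooth_cos_nth smooth_sin_nth periodic_cos_nth periodic_sin_nth
        cos_diff right_diff_distrib fun_eq_iff)

text \<open>Since 1 + cos(\<pi> y) = 2 cos^2(\<pi> y / 2), the normalised powers are products of de
  la Vallee Poussin kernels: nonnegative trigonometric polynomials that concentrate at the
  origin.\<close>

definition trig_weight :: "real^'d \<Rightarrow> real" where
  "trig_weight y = (\<Prod>i\<in>UNIV. 1 + cos (pi * y $ i))"

definition trig_kernel :: "nat \<Rightarrow> real^'d \<Rightarrow> real" where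
  "trig_kernel n y = trig_weight y ^ n / (\<integral>z. trig_weight z ^ n \<partial>(torus :: (real^'d) measure))"

lemma one_plus_cos_nonneg: "0 \<le> 1 + cos (x::real)"
  using cos_ge_minus_one[of x] by linarith

lemma trig_weight_nonneg: "0 \<le> trig_weight y"
  by (simp add: trig_weight_def prod_nonneg one_plus_cos_nonneg)

lemma trig_weight_le: "trig_weight (y :: real^'d) \<le> trig_weight (0 :: real^'d)"
  unfolding trig_weight_def by (intro prod_mono) (auto simp: one_plus_cos_nonneg)

lemma trig_weight_0: "trig_weight (0 :: real^'d) > 0"
  by (simp add: trig_weight_def)

lemma trig_weight_continuous: "continuous_on A trig_weight"
  unfolding trig_weight_def by (intro continuous_intros)

lemma trig_weight_less:
  fixes y :: "real^'d"
  assumes "y \<in> cbox (\<chi> i. -1) (\<chi> i. 1)" "y \<noteq> 0"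
  shows "trig_weight y < trig_weight (0 :: real^'d)"
proof -
  obtain i where i: "y $ i \<noteq> 0" using assms(2) by (auto simp: vec_eq_iff)
  have r: "- 1 \<le> y $ i" "y $ i \<le> 1" using assms(1) by (auto simp: mem_box_cart)
  have "cos (pi * y $ i) < 1"
  proof -
    have "cos (pi * \<bar>y $ i\<bar>) < cos 0"
      using i r by (intro cos_monotone_0_pi) (auto simp: abs_le_iff)
    then show ?thesis by (simp add: abs_if split: if_splits)
  qed
  have "(\<Prod>k\<in>UNIV. 1 + cos (pi * y $ k)) = (1 + cos (pi * y $ i)) * (\<Prod>k\<in>UNIV - {i}. 1 + cos (pi * y $ k))"
    by (rule prod.remove) auto
  also have "\<dots> \<le> (1 + cos (pi * y $ i)) * (\<Prod>k\<in>UNIV - {i}. 2)"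
    by (intro mult_left_mono prod_mono) (auto simp: one_plus_cos_nonneg)
  also have "\<dots> < 2 * (\<Prod>k\<in>UNIV - {i}. 2)"
    using \<open>cos (pi * y $ i) < 1\<close> by (intro mult_strict_right_mono prod_pos) auto
  also have "\<dots> = (\<Prod>k\<in>(UNIV::'d set). 2)" by (rule prod.remove[symmetric]) auto
  finally show ?thesis by (simp add: trig_weight_def)
qed

lemma trig_weight_measurable[measurable]: "trig_weight \<in> borel_measurable borel"
  by (intro borel_measurable_continuous_onI trig_weight_continuous)

lemma integrable_trig_weight: "integrable torus (\<lambda>y :: real^'d. trig_weight y ^ n)"
proof (rule integrable_torus_bounded)
  show "norm (trig_weight y ^ n) \<le> trig_weight (0 :: real^'d) ^ n" for y :: "real^'d"
    using trig_weight_nonneg[of y] trig_weight_le[of y] by (simp add: power_mono)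
qed measurable

text \<open>The weight has a strict maximum over the torus at the origin, so that its normalised
  powers concentrate there.\<close>

lemma trig_weight_mass:
  assumes "0 < \<rho>" "\<rho> < trig_weight (0 :: real^'d)"
  obtains m where "m > 0" "\<And>n. \<rho> ^ n * m \<le> (\<integral>z. trig_weight z ^ n \<partial>(torus :: (real^'d) measure))"
proof -
  have "open {y :: real^'d. \<rho> < trig_weight y}"
    using trig_weight_continuous[of UNIV] by (intro open_Collect_less) auto
  moreover have "0 \<in> {y :: real^'d. \<rho> < trig_weight y}" using assms by simp
  ultimately obtain \<eta> where \<eta>: "\<eta> > 0" "ball 0 \<eta> \<subseteq> {y :: real^'d. \<rho> < trig_weight y}"
    by (meson openE)
  define B where "B = (ball 0 (min \<eta> 1) :: (real^'d) set)"
  have "B \<subseteq> cell"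
  proof
    fix y :: "real^'d" assume "y \<in> B"
    then have "\<bar>y $ i\<bar> < 1" for i using component_le_norm_cart[of y i] by (auto simp: B_def)
    then have "- 1 \<le> y $ i \<and> y $ i < 1" for i by (metis abs_less_iff less_imp_le minus_le_iff)
    then show "y \<in> cell" by (simp add: cell_def)
  qed
  have [measurable]: "B \<in> sets borel" by (simp add: B_def)
  have Bt: "B \<in> sets torus" using \<open>B \<subseteq> cell\<close> by (simp add: sets_restrict_space_iff)
  have "measure torus B = measure lborel B" using \<open>B \<subseteq> cell\<close> by (intro measure_restrict_space) auto
  also have "\<dots> > 0" using \<eta> by (simp add: B_def content_ball_pos)
  finally have m: "measure torus B > 0" .
  show ?thesis
  proof (rule that[OF m])
    fix n
    have "\<rho> ^ n * measure torus B = (\<integral>z. \<rho> ^ n * indicator B z \<partial>torus)"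
      using Bt sets.sets_into_space[OF Bt] by (simp add: Int_absorb2)
    also have "\<dots> \<le> (\<integral>z. trig_weight z ^ n \<partial>(torus :: (real^'d) measure))"
    proof (rule integral_mono)
      show "integrable torus (\<lambda>z. \<rho> ^ n * indicator B z)"
        using Bt by (intro integrable_mult_right integrable_real_indicator) (auto simp: torus.emeasure_finite less_top[symmetric])
      show "\<rho> ^ n * indicator B z \<le> trig_weight z ^ n" for z
      proof (cases "z \<in> B")
        case True
        then have "\<rho> < trig_weight z" using \<eta>(2) by (auto simp: B_def)
        then show ?thesis using True assms(1) by (simp add: power_mono)
      qed (simp add: trig_weight_nonneg)
    qed (rule integrable_trig_weight)
    finally show "\<rho> ^ n * measure torus B \<le> (\<integral>z. trig_weight z ^ n \<partial>(torus :: (real^'d) measure))" .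
  qed
qed

lemma trig_mass_pos: "(\<integral>z. trig_weight z ^ n \<partial>(torus :: (real^'d) measure)) > 0"
proof -
  let ?\<rho> = "trig_weight (0::real^'d) / 2"
  have r: "0 < ?\<rho>" "?\<rho> < trig_weight (0::real^'d)" using trig_weight_0[where 'd='d] by auto
  obtain m where m: "m > 0" "?\<rho> ^ n * m \<le> (\<integral>z. trig_weight z ^ n \<partial>(torus :: (real^'d) measure))"
    by (rule trig_weight_mass[OF r]) blast
  have "?\<rho> ^ n * m > 0" using m(1) trig_weight_0[where 'd='d] by simp
  then show ?thesis using m(2) by linarith
qed

lemma trig_kernel_nonneg: "0 \<le> trig_kernel n y"
  by (simp add: trig_kernel_def trig_weight_nonneg less_imp_le[OF trig_mass_pos])

lemma trig_kernel_measurable[measurable]: "trig_kernel n \<in> borel_measurable borel"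
  unfolding trig_kernel_def by measurable

lemma approx_id_trig: "approx_id (trig_kernel :: nat \<Rightarrow> real^'d \<Rightarrow> real)"
  unfolding approx_id_def
proof (intro conjI allI impI)
  fix n
  show "trig_kernel n \<in> borel_measurable borel" by measurable
  show "0 \<le> trig_kernel n y" for y by (rule trig_kernel_nonneg)
  show "\<exists>B. \<forall>y. trig_kernel n (y :: real^'d) \<le> B"
    unfolding trig_kernel_def using trig_weight_le trig_weight_nonneg trig_mass_pos[of n]
    by (intro exI[of _ "trig_weight 0 ^ n / (\<integral>z. trig_weight z ^ n \<partial>(torus :: (real^'d) measure))"] allI
        divide_right_mono power_mono) (auto simp: less_imp_le)
  show "(\<integral>y. trig_kernel n (y :: real^'d) \<partial>torus) = 1"
    unfolding trig_kernel_def using trig_mass_pos[where 'd='d, of n] by simp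
next
  fix \<delta> :: real assume "\<delta> > 0"
  \<comment> \<open>The half-open cell is replaced by the closed cube, so that the maximum of the
    weight away from the origin is attained; S may be empty when \<open>\<delta>\<close> is
    large.\<close>
  define S where "S = cbox (\<chi> i. -1) (\<chi> i. 1) - ball (0::real^'d) \<delta>"
  have "\<exists>\<rho>. 0 < \<rho> \<and> \<rho> < trig_weight (0::real^'d) \<and> (\<forall>y\<in>S. trig_weight y \<le> \<rho>)"
  proof (cases "S = {}")
    case True
    then show ?thesis using trig_weight_0[where 'd='d] by (intro exI[of _ "trig_weight (0::real^'d) / 2"]) auto
  next
    case False
    have "compact S" by (simp add: S_def compact_diff)
    then obtain y where y: "y \<in> S" "\<forall>z\<in>S. trig_weight z \<le> trig_weight y"
      using continuous_attains_sup[OF _ False trig_weight_continuous] by blast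
    have "trig_weight y < trig_weight (0::real^'d)"
      using y(1) \<open>\<delta> > 0\<close> by (intro trig_weight_less) (auto simp: S_def)
    then show ?thesis using y(2) trig_weight_0[where 'd='d]
      by (intro exI[of _ "max (trig_weight y) (trig_weight (0::real^'d) / 2)"]) (auto simp: le_max_iff_disj)
  qed
  then obtain \<rho> where \<rho>: "0 < \<rho>" "\<rho> < trig_weight (0::real^'d)" "\<And>y. y \<in> S \<Longrightarrow> trig_weight y \<le> \<rho>" by blast
  \<comment> \<open>The weight is at most \<open>\<rho>\<close> away from the origin and exceeds
    \<open>\<sigma>\<close> on a small ball, so the outer mass decays like the n-th power of the
    quotient \<open>\<rho> / \<sigma>\<close> < 1.\<close>
  obtain \<sigma> where \<sigma>: "\<rho> < \<sigma>" "\<sigma> < trig_weight (0::real^'d)" using dense[OF \<rho>(2)] by blast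
  obtain m where m: "m > 0" "\<And>n. \<sigma> ^ n * m \<le> (\<integral>z. trig_weight z ^ n \<partial>(torus :: (real^'d) measure))"
    by (rule trig_weight_mass[OF less_trans[OF \<rho>(1) \<sigma>(1)] \<sigma>(2)]) blast
  define V where "V = measure torus (cell :: (real^'d) set)"
  have bound: "(\<integral>y. (if norm y < \<delta> then 0 else trig_kernel n (y :: real^'d)) \<partial>torus) \<le> (\<rho> / \<sigma>) ^ n * (V / m)" for n
  proof -
    have "(\<integral>y. (if norm y < \<delta> then 0 else trig_kernel n (y :: real^'d)) \<partial>torus) \<le> (\<integral>y. \<rho> ^ n / (\<sigma> ^ n * m) \<partial>(torus :: (real^'d) measure))"
    proof (rule integral_mono')
      fix y :: "real^'d" assume "y \<in> space torus"
      show "(if norm y < \<delta> then 0 else trig_kernel n y) \<le> \<rho> ^ n / (\<sigma> ^ n * m)"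
      proof (cases "norm y < \<delta>")
        case False
        then have "y \<in> S" using \<open>y \<in> space torus\<close> cell_subset_cbox by (auto simp: S_def)
        then have "trig_weight y ^ n \<le> \<rho> ^ n" using \<rho>(3) by (intro power_mono trig_weight_nonneg)
        then show ?thesis unfolding trig_kernel_def using False m \<rho>(1) \<sigma>(1)
          by (auto intro!: frac_le)
      qed (use m \<rho> \<sigma> in auto)
      show "0 \<le> \<rho> ^ n / (\<sigma> ^ n * m)" using m \<rho> \<sigma> by simp
    qed simp
    also have "\<dots> = (\<rho> / \<sigma>) ^ n * (V / m)" by (simp add: V_def power_divide)
    finally show ?thesis .
  qed
  have "(\<lambda>n. (\<rho> / \<sigma>) ^ n * (V / m)) \<longlonglongrightarrow> 0 * (V / m)"
    using \<rho> \<sigma> by (intro tendsto_intros LIMSEQ_realpow_zero) auto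
  then have lim: "(\<lambda>n. (\<rho> / \<sigma>) ^ n * (V / m)) \<longlonglongrightarrow> 0" by simp
  show "(\<lambda>n. \<integral>y. (if norm y < \<delta> then 0 else trig_kernel n (y :: real^'d)) \<partial>torus) \<longlonglongrightarrow> 0"
  proof (rule tendsto_sandwich[OF _ _ tendsto_const lim])
    show "\<forall>\<^sub>F n in sequentially. 0 \<le> (\<integral>y. (if norm y < \<delta> then 0 else trig_kernel n (y :: real^'d)) \<partial>torus)"
      by (intro always_eventually allI integral_nonneg) (simp add: trig_kernel_nonneg)
  qed (intro always_eventually allI bound)
qed

text \<open>With this expansion every mollification is a combination of the same finitely many
  smooth functions, and only its coefficients depend on the function mollified.\<close>

lemma trig_kernel_rank:
  obtains N and F :: "nat \<Rightarrow> real^'d \<Rightarrow> real" where "\<And>m. m < N \<Longrightarrow> smooth (F m)" "\<And>m. m < N \<Longrightarrow> periodic (F m)"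
    "\<And>x y. trig_kernel n (x - y) = (\<Sum>m<N. F m x * F m y)"
proof -
  have "finite_rank (\<lambda>x y :: real^'d. (\<Prod>i\<in>UNIV. 1 + cos (pi * (x - y) $ i)) ^ n * (1 / (\<integral>z. trig_weight z ^ n \<partial>(torus :: (real^'d) measure))))"
    by (intro finite_rank_cmult finite_rank_power finite_rank_prod finite_rank_cos) (auto simp: less_imp_le[OF trig_mass_pos])
  then have "finite_rank (\<lambda>x y :: real^'d. trig_kernel n (x - y))"
    by (simp add: trig_kernel_def trig_weight_def)
  then obtain fs where fs: "\<forall>f\<in>set fs. smooth f \<and> periodic f" "(\<lambda>x y :: real^'d. trig_kernel n (x - y)) = (\<lambda>x y. \<Sum>f\<leftarrow>fs. f x * f y)"
    unfolding finite_rank_def by blast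
  show ?thesis
  proof (rule that[of "length fs" "\<lambda>m. fs ! m"])
    show "trig_kernel n (x - y) = (\<Sum>m<length fs. (fs ! m) x * (fs ! m) y)" for x y
      using fun_cong[OF fun_cong[OF fs(2), of x], of y] by (simp add: sum_list_sum_nth atLeast0LessThan)
  qed (use fs(1) in auto)
qed

lemma trig_kernel_even: "trig_kernel n (- y) = trig_kernel n y"
  by (simp add: trig_kernel_def trig_weight_def)

section \<open>Mollification\<close>

lemma torus_Lp_1D:
  assumes "torus_Lp 1 f"
  shows "periodic f" "f \<in> borel_measurable lcell" "integrable lcell f"
proof -
  show "periodic f" using assms by (simp add: torus_Lp_def)
  show m: "f \<in> borel_measurable lcell"
    using assms by (auto simp: torus_Lp_def intro: measurable_restrict_space1)
  have "integrable lcell (\<lambda>x. norm (f x))" using assms by (simp add: torus_Lp_def)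
  then show "integrable lcell f" using integrable_norm_iff[OF m] by simp
qed

lemma
  fixes f :: "real^'d \<Rightarrow> 'b::{banach, second_countable_topology}"
  assumes f: "f \<in> borel_measurable lcell" and g: "g \<in> borel_measurable borel" and eq: "AE x in torus. f x = g x"
  shows integral_rep: "integral\<^sup>L lcell f = integral\<^sup>L torus g"
    and integrable_rep: "integrable lcell f \<longleftrightarrow> integrable torus g"
proof -
  have g': "g \<in> borel_measurable lcell"
    using g by (intro measurable_restrict_space1 borel_measurable_if_lebesgue_on[THEN iffD1] measurable_completion) auto
  have eq': "AE x in lcell. f x = g x" using eq by (simp add: AE_torus_iff)
  show "integral\<^sup>L lcell f = integral\<^sup>L torus g"
    using integral_cong_AE[OF f g' eq'] integral_lebesgue_on_borel[OF g cell_borel] by simp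
  show "integrable lcell f \<longleftrightarrow> integrable torus g"
    using integrable_cong_AE[OF f g' eq'] integrable_lebesgue_on_borel[OF g cell_borel] by simp
qed

lemma nn_integral_rep:
  assumes g: "g \<in> borel_measurable borel" and eq: "AE x in torus. f x = g x"
  shows "(\<integral>\<^sup>+x. f x \<partial>lcell) = (\<integral>\<^sup>+x. g x \<partial>torus)"
  using nn_integral_cong_AE[of f g "lcell"] eq nn_integral_lebesgue_on_borel[OF g cell_borel]
  by (simp add: AE_torus_iff)

lemma torus_rep:
  fixes f :: "real^'d \<Rightarrow> 'b::euclidean_space"
  assumes "integrable lcell f"
  obtains g where "g \<in> borel_measurable borel" "periodic g" "AE x in torus. f x = g x" "integrable torus g"
proof -
  have f: "f \<in> borel_measurable lcell" using assms by simp
  obtain g where g: "g \<in> borel_measurable borel" "periodic g" "AE x in torus. f x = g x"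
    using torus_ex_borel_periodic[OF f] by blast
  then show ?thesis using integrable_rep[OF f g(1,3)] assms that by blast
qed

lemma lebesgue_on_borel_measurable:
  "g \<in> borel_measurable borel \<Longrightarrow> g \<in> borel_measurable (lebesgue_on A)"
  by (rule measurable_restrict_space1) (simp add: measurable_completion)

lemma integrable_mult_bounded:
  fixes f h :: "'a \<Rightarrow> real"
  assumes f: "integrable M f" and h: "h \<in> borel_measurable M" "AE x in M. \<bar>h x\<bar> \<le> B"
  shows "integrable M (\<lambda>x. f x * h x)"
proof (rule integrable_bound)
  show "integrable M (\<lambda>x. B * f x)" using f by simp
  show "(\<lambda>x. f x * h x) \<in> borel_measurable M" using f h by measurable
  show "AE x in M. norm (f x * h x) \<le> norm (B * f x)"
    using h(2)
  proof eventually_elim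
    case (elim x)
    then have "\<bar>h x\<bar> * \<bar>f x\<bar> \<le> B * \<bar>f x\<bar>" by (rule mult_right_mono) simp
    then show ?case using elim by (simp add: abs_mult mult.commute)
  qed
qed

lemma integrable_smooth_mult:
  fixes f h :: "real^'d \<Rightarrow> real"
  assumes f: "integrable lcell f" and h: "smooth h" "periodic h"
  shows "integrable lcell (\<lambda>x. f x * h x)"
proof -
  obtain B where "\<And>x. \<bar>h x\<bar> \<le> B" using periodic_continuous_bounded[OF smooth_continuous_on[OF h(1)] h(2)] by blast
  then show ?thesis
    by (intro integrable_mult_bounded[OF f, of _ B] lebesgue_on_borel_measurable smooth_measurable h) auto
qed

lemma frechet_derivative_eqI: "(f has_derivative f') (at x) \<Longrightarrow> frechet_derivative f (at x) = f'"
  using frechet_derivative_at by metis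

lemma smooth_periodic_partial:
  fixes \<psi> :: "real^'d \<Rightarrow> 'b::real_normed_vector"
  assumes "smooth \<psi>" "periodic \<psi>"
  shows "smooth (\<lambda>x. frechet_derivative \<psi> (at x) w)" "periodic (\<lambda>x. frechet_derivative \<psi> (at x) w)"
proof -
  show "smooth (\<lambda>x. frechet_derivative \<psi> (at x) w)" using assms(1) by (rule smooth_has_derivative)
  have "frechet_derivative \<psi> (at (x + c)) = frechet_derivative \<psi> (at x)" if c: "\<And>x. \<psi> (x + c) = \<psi> x" for x c
  proof -
    have "((\<lambda>x. x + c) has_derivative (\<lambda>x. x)) (at x)" by (auto intro!: derivative_eq_intros)
    from diff_chain_at[OF this smooth_has_derivative(1)[OF assms(1)]]
    have "(\<psi> has_derivative frechet_derivative \<psi> (at (x + c))) (at x)" by (simp add: o_def c)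
    then show ?thesis by (simp add: frechet_derivative_eqI)
  qed
  then show "periodic (\<lambda>x. frechet_derivative \<psi> (at x) w)"
    using assms(2) by (simp add: periodic_def)
qed

lemma weak_partial_component:
  fixes f g :: "real^'d \<Rightarrow> real^'m"
  assumes "has_weak_partial j f g" "smooth \<psi>" "periodic \<psi>"
  shows "(\<integral>x. f x $ i * partial j \<psi> x \<partial>lcell) = - (\<integral>x. g x $ i * \<psi> x \<partial>lcell)"
proof -
  have f: "torus_Lp 1 f" "torus_Lp 1 g" using assms(1) by (auto simp: has_weak_partial_def)
  have int: "integrable lcell (\<lambda>x. h x *\<^sub>R u x)" if "torus_Lp 1 u" "smooth h" "periodic h" for h :: "real^'d \<Rightarrow> real" and u :: "real^'d \<Rightarrow> real^'m"
  proof -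
    have "integrable lcell (\<lambda>x. norm (u x) * h x)"
      using torus_Lp_1D(3)[OF that(1)] by (intro integrable_smooth_mult that) auto
    moreover have "(\<lambda>x. h x *\<^sub>R u x) \<in> borel_measurable lcell"
      using torus_Lp_1D(2)[OF that(1)] lebesgue_on_borel_measurable[OF smooth_measurable[OF that(2)], of cell] by measurable
    ultimately show ?thesis
      by (rule integrable_bound) (simp add: abs_mult mult.commute)
  qed
  note sp = smooth_periodic_partial[OF assms(2,3), of "axis j 1"]
  have "(\<integral>x. partial j \<psi> x *\<^sub>R f x \<partial>lcell) $ i = (- (\<integral>x. \<psi> x *\<^sub>R g x \<partial>lcell)) $ i"
    using assms by (simp add: has_weak_partial_def)
  then have "(\<integral>x. (partial j \<psi> x *\<^sub>R f x) $ i \<partial>lcell) = - (\<integral>x. (\<psi> x *\<^sub>R g x) $ i \<partial>lcell)"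
    using integral_bounded_linear[OF bounded_linear_vec_nth int[OF f(1) sp], of i]
      integral_bounded_linear[OF bounded_linear_vec_nth int[OF f(2) assms(2,3)], of i] by simp
  then show ?thesis by (simp add: mult.commute)
qed

lemma integrable_component: "integrable M f \<Longrightarrow> integrable M (\<lambda>x. (f x :: 'b::euclidean_space^'m) $ i)"
  by (rule integrable_bounded_linear[OF bounded_linear_vec_nth])

lemma torus_AE_zero_lebesgue:
  fixes g :: "real^'d \<Rightarrow> real"
  assumes g: "integrable lcell g"
    and z: "\<And>\<psi>. smooth \<psi> \<Longrightarrow> periodic \<psi> \<Longrightarrow> (\<integral>x. g x * \<psi> x \<partial>lcell) = 0"
  shows "AE x in torus. g x = 0"
proof -
  obtain h where h: "h \<in> borel_measurable borel" "AE x in torus. g x = h x" "integrable torus h"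
    using torus_rep[OF g] by blast
  have "AE x in torus. h x = 0"
  proof (rule torus_AE_zero[OF h(3)])
    fix \<psi> :: "real^'d \<Rightarrow> real" assume \<psi>: "smooth \<psi>" "periodic \<psi>"
    have "(\<integral>x. g x * \<psi> x \<partial>lcell) = (\<integral>x. h x * \<psi> x \<partial>torus)"
    proof (rule integral_rep)
      show "(\<lambda>x. g x * \<psi> x) \<in> borel_measurable lcell" using integrable_smooth_mult[OF g \<psi>] by simp
      show "(\<lambda>x. h x * \<psi> x) \<in> borel_measurable borel" using h(1) smooth_measurable[OF \<psi>(1)] by measurable
      show "AE x in torus. g x * \<psi> x = h x * \<psi> x" using h(2) by eventually_elim simp
    qed
    then show "(\<integral>x. \<psi> x * h x \<partial>torus) = 0" using z[OF \<psi>] by (simp add: mult.commute)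
  qed
  with h(2) show ?thesis by eventually_elim simp
qed

text \<open>Tested with smooth functions the difference of the two candidates integrates to zero.
  This is what relates the arbitrarily chosen \<open>weak_partial\<close> to any other
  representative.\<close>

lemma weak_partial_unique:
  fixes f g :: "real^'d \<Rightarrow> real^'m"
  assumes "has_weak_partial j f g" "has_weak_partial j f g'"
  shows "AE x in torus. g x = g' x"
proof -
  have int: "integrable lcell g" "integrable lcell g'"
    using assms by (auto simp: has_weak_partial_def intro: torus_Lp_1D)
  have "AE x in torus. g x $ i - g' x $ i = 0" for i
  proof (rule torus_AE_zero_lebesgue)
    show "integrable lcell (\<lambda>x. g x $ i - g' x $ i)"
      using int by (intro integrable_diff integrable_component)
    fix \<psi> :: "real^'d \<Rightarrow> real" assume \<psi>: "smooth \<psi>" "periodic \<psi>"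
    have "integrable lcell (\<lambda>x. g x $ i * \<psi> x)" "integrable lcell (\<lambda>x. g' x $ i * \<psi> x)"
      using int \<psi> by (auto intro!: integrable_smooth_mult integrable_component)
    then show "(\<integral>x. (g x $ i - g' x $ i) * \<psi> x \<partial>lcell) = 0"
      using weak_partial_component[OF assms(1) \<psi>, of i] weak_partial_component[OF assms(2) \<psi>, of i]
      by (simp add: left_diff_distrib)
  qed
  then have "AE x in torus. \<forall>i. g x $ i - g' x $ i = 0" by (simp add: AE_all_countable)
  then show ?thesis by eventually_elim (simp add: vec_eq_iff)
qed

lemma torus_Lp_1_diff:
  assumes "torus_Lp 1 f" "torus_Lp 1 g" shows "torus_Lp 1 (\<lambda>x. f x - g x)"
proof -
  have "integrable lcell (\<lambda>x. norm (f x - g x))"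
    using torus_Lp_1D(3)[OF assms(1)] torus_Lp_1D(3)[OF assms(2)] by (intro integrable_norm integrable_diff)
  then show ?thesis using assms by (auto simp: torus_Lp_def periodic_def)
qed

lemma has_weak_partial_diff:
  assumes f: "has_weak_partial j f f'" and g: "has_weak_partial j g g'"
  shows "has_weak_partial j (\<lambda>x. f x - g x) (\<lambda>x. f' x - g' x)"
  unfolding has_weak_partial_def
proof (intro conjI allI impI)
  have L: "torus_Lp 1 f" "torus_Lp 1 f'" "torus_Lp 1 g" "torus_Lp 1 g'"
    using assms by (auto simp: has_weak_partial_def)
  show "torus_Lp 1 (\<lambda>x. f x - g x)" "torus_Lp 1 (\<lambda>x. f' x - g' x)" using L torus_Lp_1_diff by auto
  fix \<psi> :: "real^'a \<Rightarrow> real" assume "smooth \<psi> \<and> periodic \<psi>"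
  then have \<psi>: "smooth \<psi>" "periodic \<psi>" by auto
  have int: "integrable lcell (\<lambda>x. h x *\<^sub>R u x)" if "torus_Lp 1 u" "smooth h" "periodic h" for h :: "real^'a \<Rightarrow> real" and u :: "real^'a \<Rightarrow> 'b"
  proof -
    have "integrable lcell (\<lambda>x. norm (u x) * h x)"
      using torus_Lp_1D(3)[OF that(1)] by (intro integrable_smooth_mult that) auto
    moreover have "(\<lambda>x. h x *\<^sub>R u x) \<in> borel_measurable lcell"
      using torus_Lp_1D(2)[OF that(1)] lebesgue_on_borel_measurable[OF smooth_measurable[OF that(2)], of cell] by measurable
    ultimately show ?thesis
      by (rule integrable_bound) (simp add: abs_mult mult.commute)
  qed
  note sp = smooth_periodic_partial[OF \<psi>, of "axis j 1"]
  show "(\<integral>x. partial j \<psi> x *\<^sub>R (f x - g x) \<partial>lcell) = - (\<integral>x. \<psi> x *\<^sub>R (f' x - g' x) \<partial>lcell)"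
    using int[OF L(1) sp] int[OF L(2) \<psi>] int[OF L(3) sp] int[OF L(4) \<psi>] f g \<psi>
    by (simp add: scaleR_diff_right has_weak_partial_def)
qed

lemma has_weak_partial_weak_partial:
  "(\<exists>g. has_weak_partial j f g) \<Longrightarrow> has_weak_partial j f (weak_partial j f)"
  unfolding weak_partial_def by (erule someI_ex)

section \<open>Convolution with the trigonometric kernels\<close>

definition mol :: "nat \<Rightarrow> (real^'d \<Rightarrow> real) \<Rightarrow> real^'d \<Rightarrow> real" where
  "mol n f x = (\<integral>y. f y * trig_kernel n (x - y) \<partial>lcell)"

lemma trig_kernel_smooth: "smooth (trig_kernel n :: real^'d \<Rightarrow> real)"
  and trig_kernel_periodic: "periodic (trig_kernel n :: real^'d \<Rightarrow> real)"
proof -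
  obtain N and F :: "nat \<Rightarrow> real^'d \<Rightarrow> real" where F: "\<And>m. m < N \<Longrightarrow> smooth (F m)" "\<And>m. m < N \<Longrightarrow> periodic (F m)"
    "\<And>x y. trig_kernel n (x - y) = (\<Sum>m<N. F m x * F m y)" using trig_kernel_rank by blast
  have "trig_kernel n = (\<lambda>x. \<Sum>m<N. F m x * F m 0)" using F(3)[of _ 0] by (simp add: fun_eq_iff)
  then show "smooth (trig_kernel n :: real^'d \<Rightarrow> real)" "periodic (trig_kernel n :: real^'d \<Rightarrow> real)"
    using F(1,2) by (auto intro!: smooth_sum smooth_mult smooth_const simp: periodic_def)
qed

lemma mol_expand:
  assumes f: "integrable lcell f"
    and F: "\<And>m. m < N \<Longrightarrow> smooth (F m)" "\<And>m. m < N \<Longrightarrow> periodic (F m)"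
      "\<And>x y. trig_kernel n (x - y) = (\<Sum>m<N. F m x * F m y)"
  shows "mol n f x = (\<Sum>m<N. F m x * (\<integral>y. f y * F m y \<partial>lcell))"
proof -
  have "mol n f x = (\<integral>y. (\<Sum>m<N. F m x * (f y * F m y)) \<partial>lcell)"
    by (simp add: mol_def F(3) sum_distrib_left mult_ac)
  also have "\<dots> = (\<Sum>m<N. \<integral>y. F m x * (f y * F m y) \<partial>lcell)"
    using integrable_smooth_mult[OF f F(1,2)] by (intro integral_sum) auto
  finally show ?thesis by simp
qed

lemma smooth_mol: "integrable lcell f \<Longrightarrow> smooth (mol n f)"
  and periodic_mol: "integrable lcell f \<Longrightarrow> periodic (mol n f)"
proof -
  assume f: "integrable lcell f"
  obtain N and F :: "nat \<Rightarrow> real^'a \<Rightarrow> real" where F: "\<And>m. m < N \<Longrightarrow> smooth (F m)" "\<And>m. m < N \<Longrightarrow> periodic (F m)"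
    "\<And>x y. trig_kernel n (x - y) = (\<Sum>m<N. F m x * F m y)" using trig_kernel_rank by blast
  have "mol n f = (\<lambda>x. \<Sum>m<N. F m x * (\<integral>y. f y * F m y \<partial>lcell))"
    using mol_expand[OF f F] by (simp add: fun_eq_iff)
  then show "smooth (mol n f)" "periodic (mol n f)"
    using F(1,2) by (auto intro!: smooth_sum smooth_mult smooth_const simp: periodic_def)
qed

text \<open>Translation invariance and evenness of the kernel bring the convolution into the form of
  \<open>approx_id\<close>.\<close>

lemma mol_shift:
  assumes f: "f \<in> borel_measurable lcell"
    and g: "g \<in> borel_measurable borel" "periodic g" "AE x in torus. f x = g x"
  shows "mol n f x = (\<integral>y. g (x + y) * trig_kernel n y \<partial>torus)"
proof -
  have km: "(\<lambda>y. trig_kernel n (x - y)) \<in> borel_measurable borel"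
    by (rule measurable_compose[OF _ trig_kernel_measurable]) simp
  have "mol n f x = (\<integral>y. g y * trig_kernel n (x - y) \<partial>torus)"
    unfolding mol_def
  proof (rule integral_rep)
    show "(\<lambda>y. f y * trig_kernel n (x - y)) \<in> borel_measurable lcell"
      by (rule borel_measurable_times[OF f lebesgue_on_borel_measurable[OF km]])
    show "(\<lambda>y. g y * trig_kernel n (x - y)) \<in> borel_measurable borel"
      by (rule borel_measurable_times[OF g(1) km])
    show "AE y in torus. f y * trig_kernel n (x - y) = g y * trig_kernel n (x - y)"
      using g(3) by eventually_elim simp
  qed
  also have "\<dots> = (\<integral>y. g (y + x) * trig_kernel n (x - (y + x)) \<partial>torus)"
  proof (rule integral_torus_shift[of "\<lambda>y. g y * trig_kernel n (x - y)" x, symmetric])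
    show "(\<lambda>y. g y * trig_kernel n (x - y)) \<in> borel_measurable borel"
      by (rule borel_measurable_times[OF g(1) km])
    have "periodic (\<lambda>y. trig_kernel n (y + (- x)))" by (rule periodic_shift[OF trig_kernel_periodic])
    moreover have "trig_kernel n (y + (- x)) = trig_kernel n (x - y)" for y
      using trig_kernel_even[of n "x - y"] by simp
    ultimately have "periodic (\<lambda>y. trig_kernel n (x - y))" by simp
    then show "periodic (\<lambda>y. g y * trig_kernel n (x - y))" using periodic_compose2[OF g(2), of "\<lambda>y. trig_kernel n (x - y)" "(*)"] by simp
  qed
  finally show ?thesis by (simp add: trig_kernel_even add.commute)
qed

lemma mol_L1:
  assumes per: "periodic f" and f: "integrable lcell f"
  shows "(\<lambda>n. \<integral>\<^sup>+x. ennreal \<bar>mol n f x - f x\<bar> \<partial>lcell) \<longlonglongrightarrow> 0"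
proof -
  obtain g where g: "g \<in> borel_measurable borel" "periodic g" "AE x in torus. f x = g x" "integrable torus g"
    using torus_rep[OF f] by blast
  have eq: "mol n f x = (\<integral>y. g (x + y) * trig_kernel n y \<partial>torus)" for n x
    using f by (intro mol_shift g) simp
  have "(\<integral>\<^sup>+x. ennreal \<bar>mol n f x - f x\<bar> \<partial>lcell) = (\<integral>\<^sup>+x. ennreal \<bar>mol n f x - g x\<bar> \<partial>torus)" for n
  proof (rule nn_integral_rep)
    show "(\<lambda>x. ennreal \<bar>mol n f x - g x\<bar>) \<in> borel_measurable borel"
      using smooth_measurable[OF smooth_mol[OF f], of n] g(1) by measurable
    show "AE x in torus. ennreal \<bar>mol n f x - f x\<bar> = ennreal \<bar>mol n f x - g x\<bar>" using g(3) by eventually_elim simp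
  qed
  then show ?thesis using approx_id_L1[OF g(1,2,4) approx_id_trig] by (simp add: eq)
qed

lemma integral_trig_kernel_shift: "(\<integral>y. trig_kernel n (x - y) \<partial>lebesgue_on (cell :: (real^'d) set)) = 1"
  using mol_shift[of "\<lambda>_. 1" "\<lambda>_. 1" n x] approx_id_trig[where 'd='d] by (simp add: mol_def periodic_const approx_id_def)

lemma integrable_const_torus: "integrable (lebesgue_on (cell :: (real^'d) set)) (\<lambda>_. c :: real)"
  by (subst integrable_rep[of _ "\<lambda>_. c"]) (auto intro: integrable_torus_bounded[of _ "\<bar>c\<bar>"])

lemma trig_kernel_reflect:
  "smooth (\<lambda>y. trig_kernel n (x - y))" "periodic (\<lambda>y. trig_kernel n (x - y))"
proof -
  have *: "(\<lambda>y. trig_kernel n (y + (- x))) = (\<lambda>y. trig_kernel n (x - y))"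
    using trig_kernel_even[of n "x - y" for y] by (simp add: fun_eq_iff)
  show "smooth (\<lambda>y. trig_kernel n (x - y))" "periodic (\<lambda>y. trig_kernel n (x - y))"
    using smooth_translate[OF trig_kernel_smooth, of n "- x"] periodic_shift[OF trig_kernel_periodic, of n "- x"]
    unfolding * by auto
qed

text \<open>The kernel is nonnegative and has mass 1 around every point, so an almost everywhere
  bound on f becomes a bound at every x.\<close>

lemma mol_bound:
  assumes f: "integrable lcell f" and K: "AE x in torus. \<bar>f x\<bar> \<le> K"
  shows "\<bar>mol n f x\<bar> \<le> K"
proof -
  note k = trig_kernel_reflect[of n x] and c = integrable_const_torus[of 1]
  have "\<bar>mol n f x\<bar> \<le> (\<integral>y. \<bar>f y * trig_kernel n (x - y)\<bar> \<partial>lcell)"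
    unfolding mol_def by (rule integral_abs_bound)
  also have "\<dots> \<le> (\<integral>y. K * trig_kernel n (x - y) \<partial>lcell)"
  proof (rule integral_mono_AE)
    show "integrable lcell (\<lambda>y. \<bar>f y * trig_kernel n (x - y)\<bar>)"
      by (intro integrable_abs integrable_smooth_mult f k)
    show "integrable lcell (\<lambda>y. K * trig_kernel n (x - y))"
      using integrable_smooth_mult[OF c k] by (intro integrable_mult_right) simp
    have "AE y in lcell. \<bar>f y\<bar> \<le> K" using K by (simp add: AE_torus_iff)
    then show "AE y in lcell. \<bar>f y * trig_kernel n (x - y)\<bar> \<le> K * trig_kernel n (x - y)"
      by eventually_elim (simp add: abs_mult trig_kernel_nonneg mult_right_mono)
  qed
  also have "\<dots> = K" by (simp add: integral_trig_kernel_shift)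
  finally show ?thesis .
qed

text \<open>The derivative falls on the kernel y \<mapsto> k(x - y), a smooth periodic test
  function; the sign from the reflection cancels the sign of the integration by parts. The scalar
  hypothesis on w allows use for single components of vector fields.\<close>

lemma mol_derivative:
  fixes f w :: "real^'d \<Rightarrow> real"
  assumes f: "integrable lcell f"
    and wp: "\<And>\<psi>. smooth \<psi> \<Longrightarrow> periodic \<psi> \<Longrightarrow> (\<integral>x. f x * partial j \<psi> x \<partial>lcell) = - (\<integral>x. w x * \<psi> x \<partial>lcell)"
  shows "partial j (mol n f) x = mol n w x"
proof -
  obtain N and F :: "nat \<Rightarrow> real^'d \<Rightarrow> real" where F: "\<And>m. m < N \<Longrightarrow> smooth (F m)" "\<And>m. m < N \<Longrightarrow> periodic (F m)"
    "\<And>x y. trig_kernel n (x - y) = (\<Sum>m<N. F m x * F m y)" using trig_kernel_rank by blast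
  define k where "k = (trig_kernel n :: real^'d \<Rightarrow> real)"
  have k: "smooth k" "periodic k" by (auto simp: k_def trig_kernel_smooth trig_kernel_periodic)
  define \<psi> where "\<psi> y = k (x - y)" for y
  have \<psi>: "smooth \<psi>" "periodic \<psi>"
  proof -
    have "\<psi> = (\<lambda>y. k (y + (- x)))"
      using trig_kernel_even[of n "x - y" for y] by (simp add: fun_eq_iff \<psi>_def k_def)
    then show "smooth \<psi>" "periodic \<psi>" using smooth_translate[OF k(1), of "- x"] periodic_shift[OF k(2), of "- x"] by auto
  qed
  have D\<psi>: "frechet_derivative \<psi> (at y) w = - frechet_derivative k (at (x - y)) w" for y w
  proof -
    have "((\<lambda>y. x - y) has_derivative (\<lambda>h. - h)) (at y)" by (auto intro!: derivative_eq_intros)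
    from diff_chain_at[OF this smooth_has_derivative(1)[OF k(1)]]
    have "(\<psi> has_derivative (\<lambda>h. frechet_derivative k (at (x - y)) (- h))) (at y)" by (simp add: o_def \<psi>_def[abs_def])
    then have "frechet_derivative \<psi> (at y) = (\<lambda>h. frechet_derivative k (at (x - y)) (- h))" by (rule frechet_derivative_eqI)
    moreover have "linear (frechet_derivative k (at (x - y)))"
      using smooth_has_derivative(1)[OF k(1)] has_derivative_linear by blast
    ultimately show ?thesis by (simp add: linear_neg)
  qed
  have DF: "(\<Sum>m<N. frechet_derivative (F m) (at x) h * F m y) = frechet_derivative k (at (x - y)) h" for y h
  proof -
    have "((\<lambda>x. x - y) has_derivative (\<lambda>h. h)) (at x)" by (auto intro!: derivative_eq_intros)
    from diff_chain_at[OF this smooth_has_derivative(1)[OF k(1)]]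
    have 1: "((\<lambda>x. k (x - y)) has_derivative frechet_derivative k (at (x - y))) (at x)" by (simp add: o_def)
    have 2: "((\<lambda>x. \<Sum>m<N. F m x * F m y) has_derivative (\<lambda>h. \<Sum>m<N. frechet_derivative (F m) (at x) h * F m y)) (at x)"
      by (intro has_derivative_sum has_derivative_mult_left smooth_has_derivative(1) F) auto
    from has_derivative_unique[OF 1 2[folded F(3), folded k_def]] show ?thesis by (simp add: fun_eq_iff)
  qed
  define c where "c m = (\<integral>y. f y * F m y \<partial>lcell)" for m
  have "((\<lambda>x. \<Sum>m<N. F m x * c m) has_derivative (\<lambda>h. \<Sum>m<N. frechet_derivative (F m) (at x) h * c m)) (at x)"
    by (intro has_derivative_sum has_derivative_mult_left smooth_has_derivative(1) F) auto
  moreover have "mol n f = (\<lambda>x. \<Sum>m<N. F m x * c m)"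
    using mol_expand[OF f F] by (simp add: fun_eq_iff c_def)
  ultimately have "partial j (mol n f) x = (\<Sum>m<N. partial j (F m) x * c m)"
    by (simp add: frechet_derivative_eqI)
  also have "\<dots> = (\<Sum>m<N. \<integral>y. partial j (F m) x * (f y * F m y) \<partial>lcell)"
    by (simp add: c_def)
  also have "\<dots> = (\<integral>y. (\<Sum>m<N. partial j (F m) x * (f y * F m y)) \<partial>lcell)"
    using integrable_smooth_mult[OF f F(1,2)] by (intro integral_sum[symmetric]) auto
  also have "\<dots> = (\<integral>y. f y * (\<Sum>m<N. partial j (F m) x * F m y) \<partial>lcell)"
    by (simp add: sum_distrib_left mult_ac)
  also have "\<dots> = - (\<integral>y. f y * partial j \<psi> y \<partial>lcell)"
    by (simp add: DF D\<psi>)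
  also have "\<dots> = (\<integral>y. w y * \<psi> y \<partial>lcell)" using wp[OF \<psi>] by simp
  finally show ?thesis by (simp add: mol_def \<psi>_def k_def)
qed

section \<open>Signed measures\<close>

lemma vector_measureD: "vector_measure M m \<Longrightarrow> range A \<subseteq> sets M \<Longrightarrow> disjoint_family A \<Longrightarrow> (\<lambda>n. m (A n)) sums m (\<Union>n. A n)"
  by (simp add: vector_measure_def)

lemma vector_measure_empty:
  assumes "vector_measure M m" shows "m {} = 0"
proof -
  have "(\<lambda>n::nat. m {}) sums m (\<Union>n::nat. {})"
    by (rule vector_measureD[OF assms]) (auto simp: disjoint_family_on_def)
  then have "(\<lambda>n::nat. m {}) \<longlonglongrightarrow> 0" by (auto dest: sums_summable summable_LIMSEQ_zero)
  then show ?thesis by (simp add: LIMSEQ_const_iff)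
qed

lemma vector_measure_Un:
  assumes "vector_measure M m" "A \<in> sets M" "B \<in> sets M" "A \<inter> B = {}"
  shows "m (A \<union> B) = m A + m B"
proof -
  have "(\<lambda>n. m (binaryset A B n)) sums m (\<Union>n. binaryset A B n)"
    using assms by (intro vector_measureD) (auto simp: range_binaryset_eq disjoint_family_on_def binaryset_def)
  moreover have "(\<lambda>n. m (binaryset A B n)) sums (m A + m B)"
    by (rule binaryset_sums) (rule vector_measure_empty[OF assms(1)])
  ultimately show ?thesis by (simp add: UN_binaryset_eq sums_unique2)
qed

lemma vector_measure_Diff:
  assumes "vector_measure M m" "A \<in> sets M" "B \<in> sets M" "B \<subseteq> A"
  shows "m (A - B) = m A - m B"
  using vector_measure_Un[OF assms(1,3), of "A - B"] assms by (auto simp: Un_absorb1)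

lemma vector_measure_linear:
  assumes "vector_measure M m" "bounded_linear L"
  shows "vector_measure M (\<lambda>A. L (m A))"
  using assms bounded_linear.sums[OF assms(2)] by (auto simp: vector_measure_def)

text \<open>The set function behind \<open>jordan_pos\<close>. As \<open>ennreal\<close> sends
  negative numbers to 0, it is the positive variation of m.\<close>

definition upper_mass :: "'a measure \<Rightarrow> ('a set \<Rightarrow> real) \<Rightarrow> 'a set \<Rightarrow> ennreal" where
  "upper_mass M m A = (SUP B\<in>{B \<in> sets M. B \<subseteq> A}. ennreal (m B))"

lemma upper_mass_upper: "B \<in> sets M \<Longrightarrow> B \<subseteq> A \<Longrightarrow> ennreal (m B) \<le> upper_mass M m A"
  unfolding upper_mass_def by (rule SUP_upper) auto

lemma upper_mass_superadd:
  assumes m: "vector_measure M m" and AB: "A \<inter> B = {}"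
  shows "upper_mass M m A + upper_mass M m B \<le> upper_mass M m (A \<union> B)"
proof -
  have ne: "{C \<in> sets M. C \<subseteq> X} \<noteq> {}" for X by blast
  have le: "ennreal (m C) + ennreal (m D) \<le> upper_mass M m (A \<union> B)"
    if CD: "C \<in> sets M" "C \<subseteq> A" "D \<in> sets M" "D \<subseteq> B" for C D
  proof -
    \<comment> \<open>A set of negative mass counts as 0 and is replaced by the empty set;
      afterwards the masses of the two disjoint sets simply add.\<close>
    define C' where "C' = (if m C \<ge> 0 then C else {})"
    define D' where "D' = (if m D \<ge> 0 then D else {})"
    have *: "C' \<in> sets M" "D' \<in> sets M" "C' \<inter> D' = {}" "C' \<union> D' \<subseteq> A \<union> B" "m C' \<ge> 0" "m D' \<ge> 0"
      "ennreal (m C) = ennreal (m C')" "ennreal (m D) = ennreal (m D')"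
      using CD AB vector_measure_empty[OF m] by (auto simp: C'_def D'_def ennreal_neg)
    have "ennreal (m C) + ennreal (m D) = ennreal (m (C' \<union> D'))"
      using * by (simp add: vector_measure_Un[OF m])
    also have "\<dots> \<le> upper_mass M m (A \<union> B)" using * by (intro upper_mass_upper) auto
    finally show ?thesis .
  qed
  have "upper_mass M m A + upper_mass M m B = (SUP C\<in>{C \<in> sets M. C \<subseteq> A}. ennreal (m C) + upper_mass M m B)"
    unfolding upper_mass_def[of M m A] by (rule ennreal_SUP_add_left[symmetric, OF ne])
  also have "\<dots> = (SUP C\<in>{C \<in> sets M. C \<subseteq> A}. SUP D\<in>{D \<in> sets M. D \<subseteq> B}. ennreal (m C) + ennreal (m D))"
    unfolding upper_mass_def[of M m B] by (intro SUP_cong refl ennreal_SUP_add_right ne)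
  also have "\<dots> \<le> upper_mass M m (A \<union> B)" using le by (intro SUP_least) auto
  finally show ?thesis .
qed

text \<open>Superadditivity bounds all finite partial sums. Conversely, any competitor B in the
  union is cut into the pieces \<open>B \<inter> A i\<close>, whose masses add up to that of
  B.\<close>

lemma upper_mass_countably_additive:
  assumes m: "vector_measure M m"
  shows "countably_additive (sets M) (upper_mass M m)"
proof (rule countably_additiveI)
  fix A :: "nat \<Rightarrow> 'a set" assume A: "range A \<subseteq> sets M" "disjoint_family A" "\<Union>(range A) \<in> sets M"
  show "(\<Sum>i. upper_mass M m (A i)) = upper_mass M m (\<Union>(range A))"
  proof (rule antisym)
    have "(\<Sum>i<n. upper_mass M m (A i)) \<le> upper_mass M m (\<Union>i<n. A i)" for n
    proof (induction n)
      case (Suc n)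
      have "(\<Sum>i<Suc n. upper_mass M m (A i)) \<le> upper_mass M m (\<Union>i<n. A i) + upper_mass M m (A n)"
        using Suc by (simp add: add_right_mono)
      also have "\<dots> \<le> upper_mass M m ((\<Union>i<n. A i) \<union> A n)"
      proof (rule upper_mass_superadd[OF m])
        have "A i \<inter> A n = {}" if "i < n" for i
          using A(2) that by (simp add: disjoint_family_on_def)
        then show "(\<Union>i<n. A i) \<inter> A n = {}" by blast
      qed
      also have "(\<Union>i<n. A i) \<union> A n = (\<Union>i<Suc n. A i)" by (auto simp: less_Suc_eq)
      finally show ?case .
    qed simp
    also have "upper_mass M m (\<Union>i<n. A i) \<le> upper_mass M m (\<Union>(range A))" for n
      unfolding upper_mass_def by (intro SUP_subset_mono) auto
    finally show "(\<Sum>i. upper_mass M m (A i)) \<le> upper_mass M m (\<Union>(range A))"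
      unfolding suminf_eq_SUP by (intro SUP_least) simp
    show "upper_mass M m (\<Union>(range A)) \<le> (\<Sum>i. upper_mass M m (A i))"
      unfolding upper_mass_def[of M m "\<Union>(range A)"]
    proof (rule SUP_least, clarify)
      fix B assume B: "B \<in> sets M" "B \<subseteq> \<Union>(range A)"
      have "(\<lambda>n. m (B \<inter> A n)) sums m (\<Union>n. B \<inter> A n)"
        using A B by (intro vector_measureD[OF m]) (auto simp: disjoint_family_on_def)
      moreover have "(\<Union>n. B \<inter> A n) = B" using B(2) by blast
      ultimately have "(\<lambda>n. \<Sum>i<n. m (B \<inter> A i)) \<longlonglongrightarrow> m B" by (simp add: sums_def)
      then have "(\<lambda>n. ennreal (\<Sum>i<n. m (B \<inter> A i))) \<longlonglongrightarrow> ennreal (m B)" by (rule tendsto_ennrealI)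
      moreover have "ennreal (\<Sum>i<n. m (B \<inter> A i)) \<le> (\<Sum>i. upper_mass M m (A i))" for n
      proof -
        have "(\<Sum>i<n. m (B \<inter> A i)) \<le> (\<Sum>i<n. max 0 (m (B \<inter> A i)))" by (intro sum_mono) simp
        then have "ennreal (\<Sum>i<n. m (B \<inter> A i)) \<le> ennreal (\<Sum>i<n. max 0 (m (B \<inter> A i)))" by (rule ennreal_leI)
        also have "\<dots> = (\<Sum>i<n. ennreal (max 0 (m (B \<inter> A i))))" by (rule sum_ennreal[symmetric]) simp
        also have "\<dots> = (\<Sum>i<n. ennreal (m (B \<inter> A i)))" by (intro sum.cong refl) (simp add: max_def ennreal_neg)
        also have "\<dots> \<le> (\<Sum>i<n. upper_mass M m (A i))" using A(1) B(1) by (intro sum_mono upper_mass_upper) auto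
        also have "\<dots> \<le> (\<Sum>i. upper_mass M m (A i))" by (intro sum_le_suminf) auto
        finally show ?thesis .
      qed
      ultimately show "ennreal (m B) \<le> (\<Sum>i. upper_mass M m (A i))" by (intro LIMSEQ_le_const2) auto
    qed
  qed
qed

lemma sets_jordan_pos[simp, measurable_cong]: "sets (jordan_pos M m) = sets M"
  and space_jordan_pos[simp]: "space (jordan_pos M m) = space M"
  by (simp_all add: jordan_pos_def sets.sets_measure_of_eq sets.space_measure_of_eq)

lemma emeasure_jordan_pos:
  assumes "vector_measure M m" "A \<in> sets M"
  shows "emeasure (jordan_pos M m) A = upper_mass M m A"
proof (rule emeasure_measure_of)
  show "jordan_pos M m = measure_of (space M) (sets M) (upper_mass M m)"
    unfolding jordan_pos_def upper_mass_def ..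
  show "countably_additive (sets (jordan_pos M m)) (upper_mass M m)"
    using upper_mass_countably_additive[OF assms(1)] by simp
  have "upper_mass M m {} = ennreal (m {})" unfolding upper_mass_def by (simp add: Collect_conv_if)
  then show "positive (sets (jordan_pos M m)) (upper_mass M m)"
    using vector_measure_empty[OF assms(1)] by (simp add: positive_def)
qed (use assms sets.space_closed in auto)

text \<open>A set of infinite positive variation contains another one such that the difference has
  mass larger than 1 in absolute value. Iteration gives disjoint differences whose masses do not
  tend to 0, against countable additivity.\<close>

lemma upper_mass_finite:
  assumes m: "vector_measure M m"
  shows "upper_mass M m (space M) < \<infinity>"
proof (rule ccontr)
  assume inf: "\<not> upper_mass M m (space M) < \<infinity>"
  define Q where "Q A \<longleftrightarrow> A \<in> sets M \<and> upper_mass M m A = \<infinity>" for A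
  have step: "\<exists>B. Q B \<and> B \<subseteq> A \<and> 1 < \<bar>m (A - B)\<bar>" if "Q A" for A
  proof -
    have A: "A \<in> sets M" "upper_mass M m A = \<infinity>" using that by (auto simp: Q_def)
    \<comment> \<open>A subset B of mass above 1 + |m A| leaves a rest A - B of mass below -1, so
      either of the two may be the next set: the infinite variation sits in one of them.\<close>
    then have "ennreal (1 + \<bar>m A\<bar>) < upper_mass M m A" by simp
    then obtain B where B: "B \<in> sets M" "B \<subseteq> A" "ennreal (1 + \<bar>m A\<bar>) < ennreal (m B)"
      unfolding upper_mass_def by (auto simp: less_SUP_iff)
    have mB: "1 + \<bar>m A\<bar> < m B"
      using B(3) ennreal_less_iff[of "1 + \<bar>m A\<bar>" "m B"] by (simp del: ennreal_plus)
    have d: "m (A - B) = m A - m B" by (rule vector_measure_Diff[OF m A(1) B(1,2)])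
    have "upper_mass M m A = upper_mass M m B + upper_mass M m (A - B)"
      using plus_emeasure[of B "jordan_pos M m" "A - B"] A(1) B(1,2)
      by (simp add: emeasure_jordan_pos[OF m] Un_absorb1)
    with A(2) have "upper_mass M m B + upper_mass M m (A - B) = top" by simp
    then consider "upper_mass M m B = \<infinity>" | "upper_mass M m (A - B) = \<infinity>" by (auto simp: ennreal_add_eq_top)
    then show ?thesis
    proof cases
      case 1
      then show ?thesis using B mB d by (intro exI[of _ B]) (auto simp: Q_def)
    next
      case 2
      moreover have "A - (A - B) = B" using B(2) by blast
      ultimately show ?thesis using A B mB by (intro exI[of _ "A - B"]) (auto simp: Q_def)
    qed
  qed
  have "upper_mass M m (space M) = \<infinity>" by (metis inf infinity_ennreal_def top.not_eq_extremum)
  then have "Q (space M)" by (simp add: Q_def)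
  then have "\<exists>A :: nat \<Rightarrow> 'a set. \<forall>n. Q (A n) \<and> (A (Suc n) \<subseteq> A n \<and> 1 < \<bar>m (A n - A (Suc n))\<bar>)"
    using step by (intro dependent_nat_choice[where P = "\<lambda>_. Q" and Q = "\<lambda>_ A B. B \<subseteq> A \<and> 1 < \<bar>m (A - B)\<bar>"]) (rule exI, assumption, simp)
  then obtain A :: "nat \<Rightarrow> 'a set" where A: "\<And>n. Q (A n)" "\<And>n. A (Suc n) \<subseteq> A n \<and> 1 < \<bar>m (A n - A (Suc n))\<bar>"
    by blast
  have dec: "A j \<subseteq> A i" if "i \<le> j" for i j
    using that by (rule lift_Suc_antimono_le[rotated]) (use A(2) in blast)
  have disj: "disjoint_family (\<lambda>n. A n - A (Suc n))"
    unfolding disjoint_family_on_def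
  proof (intro ballI impI)
    fix i j :: nat assume "i \<noteq> j"
    then have "Suc i \<le> j \<or> Suc j \<le> i" by linarith
    then have "A j \<subseteq> A (Suc i) \<or> A i \<subseteq> A (Suc j)" using dec by blast
    then show "(A i - A (Suc i)) \<inter> (A j - A (Suc j)) = {}" by blast
  qed
  have "(\<lambda>n. m (A n - A (Suc n))) sums m (\<Union>n. A n - A (Suc n))"
    using A(1) by (intro vector_measureD[OF m _ disj]) (auto simp: Q_def)
  then have "(\<lambda>n. m (A n - A (Suc n))) \<longlonglongrightarrow> 0" by (auto dest: sums_summable summable_LIMSEQ_zero)
  then have "eventually (\<lambda>n. \<bar>m (A n - A (Suc n))\<bar> < 1) sequentially"
    by (auto dest!: tendstoD[where e = 1] simp: dist_real_def)
  then obtain n where "\<bar>m (A n - A (Suc n))\<bar> < 1" unfolding eventually_sequentially by blast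
  then show False using A(2)[of n] by linarith
qed

lemma finite_measure_jordan_pos:
  assumes m: "vector_measure M m" shows "finite_measure (jordan_pos M m)"
  by (rule finite_measureI) (use upper_mass_finite[OF m] emeasure_jordan_pos[OF m, of "space M"] in \<open>auto simp: less_top\<close>)

lemma vector_measure_uminus: "vector_measure M m \<Longrightarrow> vector_measure M (\<lambda>A. - m A :: real)"
  by (rule vector_measure_linear) (auto intro: bounded_linear_minus bounded_linear_ident)

text \<open>One inequality suffices: for B in A, -m B = m (A - B) - m A, which is at most the
  positive mass of A minus m A. The other direction is the same inequality for -m.\<close>

lemma jordan_decomposition:
  assumes m: "vector_measure M m" and A: "A \<in> sets M"
  shows "m A = measure (jordan_pos M m) A - measure (jordan_pos M (\<lambda>A. - m A)) A"
proof -
  have le: "measure (jordan_pos M (\<lambda>A. - m A)) A \<le> measure (jordan_pos M m) A - m A" if m: "vector_measure M m" for m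
  proof -
    interpret P: finite_measure "jordan_pos M m" by (rule finite_measure_jordan_pos[OF m])
    interpret N: finite_measure "jordan_pos M (\<lambda>A. - m A)" by (rule finite_measure_jordan_pos[OF vector_measure_uminus[OF m]])
    have Pm: "m B \<le> measure (jordan_pos M m) A" if "B \<in> sets M" "B \<subseteq> A" for B
    proof -
      have "ennreal (m B) \<le> ennreal (measure (jordan_pos M m) A)"
        using upper_mass_upper[OF that, of m] by (simp add: emeasure_jordan_pos[OF m A, symmetric] P.emeasure_eq_measure)
      then show ?thesis by (simp add: ennreal_le_iff)
    qed
    have "upper_mass M (\<lambda>A. - m A) A \<le> ennreal (measure (jordan_pos M m) A - m A)"
      unfolding upper_mass_def
    proof (rule SUP_least, clarify)
      fix B assume B: "B \<in> sets M" "B \<subseteq> A"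
      have "m (A - B) = m A - m B" by (rule vector_measure_Diff[OF m A B])
      then show "ennreal (- m B) \<le> ennreal (measure (jordan_pos M m) A - m A)"
        using Pm[of "A - B"] A B by (intro ennreal_leI) auto
    qed
    moreover have "0 \<le> measure (jordan_pos M m) A - m A" using Pm[of A] A by simp
    moreover have "ennreal (measure (jordan_pos M (\<lambda>A. - m A)) A) = upper_mass M (\<lambda>A. - m A) A"
      using emeasure_jordan_pos[OF vector_measure_uminus[OF m] A] by (simp add: N.emeasure_eq_measure)
    ultimately show ?thesis by (metis ennreal_le_iff)
  qed
  from le[OF m] le[OF vector_measure_uminus[OF m]] show ?thesis by simp
qed

lemma signed_integral_cong_zero:
  assumes "\<And>A. A \<in> sets M \<Longrightarrow> m A = 0" shows "signed_integral M m f = 0"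
proof -
  have *: "(\<lambda>A. SUP B\<in>{B \<in> sets M. B \<subseteq> A}. ennreal (m B)) = (\<lambda>A. 0)" "(\<lambda>A. SUP B\<in>{B \<in> sets M. B \<subseteq> A}. ennreal (- m B)) = (\<lambda>A. 0)"
    using assms by (auto simp: fun_eq_iff intro!: antisym SUP_least)
  then show ?thesis by (simp add: signed_integral_def jordan_pos_def)
qed

lemma integrable_jordan_pos:
  assumes "vector_measure M m" "f \<in> borel_measurable M" "\<And>x. x \<in> space M \<Longrightarrow> \<bar>f x\<bar> \<le> B"
  shows "integrable (jordan_pos M m) (f :: _ \<Rightarrow> real)"
proof -
  interpret finite_measure "jordan_pos M m" by (rule finite_measure_jordan_pos[OF assms(1)])
  show ?thesis
    by (rule integrable_const_bound[of _ B]) (use assms in \<open>auto cong: measurable_cong_sets\<close>)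
qed

lemma signed_integral_linear:
  assumes m: "vector_measure M m"
    and f: "f \<in> borel_measurable M" "\<And>x. x \<in> space M \<Longrightarrow> \<bar>f x\<bar> \<le> B"
    and g: "g \<in> borel_measurable M" "\<And>x. x \<in> space M \<Longrightarrow> \<bar>g x\<bar> \<le> C"
  shows "signed_integral M m (\<lambda>x. a * f x + b * g x) = a * signed_integral M m f + b * signed_integral M m g"
  using integrable_jordan_pos[OF m f] integrable_jordan_pos[OF m g]
    integrable_jordan_pos[OF vector_measure_uminus[OF m] f] integrable_jordan_pos[OF vector_measure_uminus[OF m] g]
  by (simp add: signed_integral_def algebra_simps)

lemma signed_integral_const:
  assumes m: "vector_measure M m" shows "signed_integral M m (\<lambda>_. c) = c * m (space M)"
  by (subst jordan_decomposition[OF m sets.top]) (simp add: signed_integral_def right_diff_distrib mult.commute)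

section \<open>Signed measures determined by their integrals against test functions\<close>

definition add_measure :: "'a measure \<Rightarrow> 'a measure \<Rightarrow> 'a measure" where
  "add_measure P Q = measure_of (space P) (sets P) (\<lambda>A. emeasure P A + emeasure Q A)"

lemma sets_add_measure[simp, measurable_cong]: "sets (add_measure P Q) = sets P"
  and space_add_measure[simp]: "space (add_measure P Q) = space P"
  by (simp_all add: add_measure_def sets.sets_measure_of_eq sets.space_measure_of_eq)

lemma emeasure_add_measure:
  assumes "sets Q = sets P" "A \<in> sets P"
  shows "emeasure (add_measure P Q) A = emeasure P A + emeasure Q A"
proof (rule emeasure_measure_of[OF add_measure_def])
  show "countably_additive (sets (add_measure P Q)) (\<lambda>A. emeasure P A + emeasure Q A)"
    using assms by (auto intro!: countably_additiveI simp: suminf_add[symmetric] suminf_emeasure image_subset_iff)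
qed (use assms sets.space_closed in \<open>auto simp: positive_def\<close>)

lemma nn_integral_add_measure:
  assumes "sets Q = sets P" "f \<in> borel_measurable P"
  shows "(\<integral>\<^sup>+x. f x \<partial>add_measure P Q) = (\<integral>\<^sup>+x. f x \<partial>P) + (\<integral>\<^sup>+x. f x \<partial>Q)"
  using assms(2)
proof induction
  case (cong f g)
  have "(\<integral>\<^sup>+x. g x \<partial>N) = (\<integral>\<^sup>+x. f x \<partial>N)" if "space N = space P" for N
    using cong that by (intro nn_integral_cong) auto
  then show ?case using cong(4) sets_eq_imp_space_eq[OF assms(1)] by simp
next
  case (set A)
  then show ?case using assms(1) by (simp add: emeasure_add_measure)
next
  case (mult u c)
  then have "u \<in> borel_measurable Q" "u \<in> borel_measurable (add_measure P Q)"
    using assms(1) by (simp_all cong: measurable_cong_sets)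
  with mult show ?case by (simp add: nn_integral_cmult distrib_left)
next
  case (add u v)
  then have "u \<in> borel_measurable Q" "u \<in> borel_measurable (add_measure P Q)" "v \<in> borel_measurable Q" "v \<in> borel_measurable (add_measure P Q)"
    using assms(1) by (simp_all cong: measurable_cong_sets)
  with add show ?case by (simp add: nn_integral_add add_ac)
next
  case (seq U)
  then have U: "U i \<in> borel_measurable Q" "U i \<in> borel_measurable (add_measure P Q)" for i
    using assms(1) by (simp_all cong: measurable_cong_sets)
  have "incseq (\<lambda>i. \<integral>\<^sup>+x. U i x \<partial>N)" for N
    using seq(3) by (intro incseq_SucI nn_integral_mono) (auto dest: incseq_SucD le_funD)
  then show ?case
    using seq U by (simp add: nn_integral_monotone_convergence_SUP ennreal_SUP_add image_comp)
qed

text \<open>The Jordan parts of m and the parts of the density need not be compared one by one: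
  moving the negative parts to the other side gives an equality of sums of finite measures, to which
  \<open>generating_measure_eqI\<close> applies.\<close>

lemma generating_signed_eqI:
  fixes d :: "'a \<Rightarrow> real"
  assumes gen: "generating L \<A>" and fin: "finite_measure L" and sets: "sets L = sets M"
    and m: "vector_measure M m" and d: "integrable L d"
    and eq: "\<And>f. f \<in> \<A> \<Longrightarrow> signed_integral M m f = (\<integral>x. f x * d x \<partial>L)"
    and A: "A \<in> sets M"
  shows "m A = (\<integral>x. indicator A x * d x \<partial>L)"
proof -
  define dp where "dp x = max 0 (d x)" for x
  define dn where "dn x = max 0 (- d x)" for x
  have [measurable]: "d \<in> borel_measurable L" using d by simp
  have int: "integrable L dp" "integrable L dn" using d by (auto simp: dp_def[abs_def] dn_def[abs_def])
  have nn: "0 \<le> dp x" "0 \<le> dn x" and dd: "d x = dp x - dn x" for x by (auto simp: dp_def dn_def max_def)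
  have [measurable]: "dp \<in> borel_measurable L" "dn \<in> borel_measurable L" using int by auto
  define P where "P = jordan_pos M m"
  define N where "N = jordan_pos M (\<lambda>A. - m A)"
  define P' where "P' = density L (\<lambda>x. ennreal (dp x))"
  define N' where "N' = density L (\<lambda>x. ennreal (dn x))"
  have s[simp]: "sets P = sets L" "sets N = sets L" "sets P' = sets L" "sets N' = sets L"
    by (auto simp: P_def N_def P'_def N'_def sets)
  have sp[simp]: "space P = space L" "space N = space L" "space P' = space L" "space N' = space L"
    using s[THEN sets_eq_imp_space_eq] by auto
  have dens: "(\<integral>\<^sup>+x. ennreal (f x) \<partial>density L (\<lambda>x. ennreal (h x))) = ennreal (\<integral>x. f x * h x \<partial>L)"
    if f: "f \<in> borel_measurable L" "\<And>x. 0 \<le> f x \<and> f x \<le> 1" and h: "integrable L h" "\<And>x. 0 \<le> h x" for f h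
  proof -
    have [measurable]: "h \<in> borel_measurable L" using h by simp
    have "integrable L (\<lambda>x. h x * f x)"
      using f by (intro integrable_mult_bounded[OF h(1), of _ 1]) auto
    then have i: "integrable L (\<lambda>x. f x * h x)" by (simp add: mult.commute)
    have "(\<integral>\<^sup>+x. ennreal (f x) \<partial>density L (\<lambda>x. ennreal (h x))) = (\<integral>\<^sup>+x. ennreal (h x) * ennreal (f x) \<partial>L)"
      using f by (intro nn_integral_density) auto
    also have "\<dots> = (\<integral>\<^sup>+x. ennreal (f x * h x) \<partial>L)"
      using f h by (intro nn_integral_cong) (simp add: ennreal_mult mult.commute)
    also have "\<dots> = ennreal (\<integral>x. f x * h x \<partial>L)" using i f h by (intro nn_integral_eq_integral) auto
    finally show ?thesis .
  qed
  have jor: "(\<integral>\<^sup>+x. ennreal (f x) \<partial>jordan_pos M m') = ennreal (\<integral>x. f x \<partial>jordan_pos M m')" "0 \<le> (\<integral>x. f x \<partial>jordan_pos M m')"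
    if f: "f \<in> borel_measurable L" "\<And>x. 0 \<le> f x \<and> f x \<le> 1" and m': "vector_measure M m'" for f m'
  proof -
    have "integrable (jordan_pos M m') f"
      using f sets by (intro integrable_jordan_pos[OF m', of _ 1]) (auto cong: measurable_cong_sets)
    then show "(\<integral>\<^sup>+x. ennreal (f x) \<partial>jordan_pos M m') = ennreal (\<integral>x. f x \<partial>jordan_pos M m')" "0 \<le> (\<integral>x. f x \<partial>jordan_pos M m')"
      using f by (auto intro!: nn_integral_eq_integral integral_nonneg)
  qed
  note m' = vector_measure_uminus[OF m]
  have PN': "(\<integral>\<^sup>+x. ennreal (f x) \<partial>add_measure P N') = ennreal ((\<integral>x. f x \<partial>P) + (\<integral>x. f x * dn x \<partial>L))"
    "(\<integral>\<^sup>+x. ennreal (f x) \<partial>add_measure N P') = ennreal ((\<integral>x. f x \<partial>N) + (\<integral>x. f x * dp x \<partial>L))"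
    if f: "f \<in> borel_measurable L" "\<And>x. 0 \<le> f x \<and> f x \<le> 1" for f
  proof -
    have 0: "0 \<le> (\<integral>x. f x * dn x \<partial>L)" "0 \<le> (\<integral>x. f x * dp x \<partial>L)" using f nn by (auto intro!: integral_nonneg)
    have [measurable]: "f \<in> borel_measurable P" "f \<in> borel_measurable N" using f by (auto cong: measurable_cong_sets)
    show "(\<integral>\<^sup>+x. ennreal (f x) \<partial>add_measure P N') = ennreal ((\<integral>x. f x \<partial>P) + (\<integral>x. f x * dn x \<partial>L))"
      using jor[OF f m] dens[OF f int(2) nn(2)] 0
      by (subst nn_integral_add_measure) (auto simp: P_def[symmetric] N'_def[symmetric])
    show "(\<integral>\<^sup>+x. ennreal (f x) \<partial>add_measure N P') = ennreal ((\<integral>x. f x \<partial>N) + (\<integral>x. f x * dp x \<partial>L))"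
      using jor[OF f m'] dens[OF f int(1) nn(1)] 0
      by (subst nn_integral_add_measure) (auto simp: N_def[symmetric] P'_def[symmetric])
  qed
  have fm: "finite_measure (add_measure P N')" "finite_measure (add_measure N P')"
    using PN'[of "\<lambda>_. 1"] by (auto intro!: finite_measureI simp del: ennreal_plus)
  have eqm: "add_measure P N' = add_measure N P'"
  proof (rule generating_measure_eqI[OF _ _ fm])
    show "generating (add_measure P N') \<A>" using gen by (subst generating_cong[of _ L]) auto
    show "sets (add_measure N P') = sets (add_measure P N')" by simp
    fix f assume f: "f \<in> \<A>"
    then have fb: "f \<in> borel_measurable L" "\<And>x. 0 \<le> f x \<and> f x \<le> 1" using gen by (auto simp: generating_def)
    have i: "integrable L (\<lambda>x. f x * dp x)" "integrable L (\<lambda>x. f x * dn x)"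
      using integrable_mult_bounded[OF int(1) fb(1), of 1] integrable_mult_bounded[OF int(2) fb(1), of 1] fb(2)
      by (auto simp: mult.commute)
    have "(\<integral>x. f x \<partial>P) - (\<integral>x. f x \<partial>N) = (\<integral>x. f x * dp x - f x * dn x \<partial>L)"
      using eq[OF f] by (simp add: signed_integral_def P_def N_def dd right_diff_distrib)
    then have "(\<integral>x. f x \<partial>P) + (\<integral>x. f x * dn x \<partial>L) = (\<integral>x. f x \<partial>N) + (\<integral>x. f x * dp x \<partial>L)" using i by simp
    then have "(\<integral>\<^sup>+x. ennreal (f x) \<partial>add_measure P N') = (\<integral>\<^sup>+x. ennreal (f x) \<partial>add_measure N P')"
      using PN'[OF fb] by simp
    moreover have "integral\<^sup>L Q f = enn2real (\<integral>\<^sup>+x. ennreal (f x) \<partial>Q)" if "sets Q = sets L" for Q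
      using fb that by (intro integral_eq_nn_integral) (auto cong: measurable_cong_sets)
    ultimately show "(\<integral>x. f x \<partial>add_measure P N') = (\<integral>x. f x \<partial>add_measure N P')" by simp
  qed
  have AL: "A \<in> sets L" using A sets by simp
  have ind: "indicator A \<in> borel_measurable L" "\<And>x. 0 \<le> (indicator A x :: real) \<and> indicator A x \<le> (1 :: real)" using AL by (auto simp: indicator_def)
  have int1: "(\<integral>x. indicator A x \<partial>P) = measure P A" "(\<integral>x. indicator A x \<partial>N) = measure N A"
    using AL sets.sets_into_space[OF AL] by (simp_all add: Int_absorb2)
  have nonneg: "0 \<le> measure P A + (\<integral>x. indicator A x * dn x \<partial>L)" "0 \<le> measure N A + (\<integral>x. indicator A x * dp x \<partial>L)"
    using nn by (auto intro!: add_nonneg_nonneg integral_nonneg)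
  have "ennreal (measure P A + (\<integral>x. indicator A x * dn x \<partial>L)) = ennreal (measure N A + (\<integral>x. indicator A x * dp x \<partial>L))"
    using PN'[OF ind] eqm unfolding int1 by simp
  then have "measure P A - measure N A = (\<integral>x. indicator A x * dp x \<partial>L) - (\<integral>x. indicator A x * dn x \<partial>L)"
    using nonneg by (simp add: ennreal_inj)
  also have "\<dots> = (\<integral>x. indicator A x * d x \<partial>L)"
    using integrable_mult_bounded[OF int(1) ind(1), of 1] integrable_mult_bounded[OF int(2) ind(1), of 1] ind(2)
    by (simp add: dd right_diff_distrib mult.commute)
  finally show ?thesis using jordan_decomposition[OF m A] by (simp add: P_def N_def)
qed

section \<open>Bounds in Sobolev--Slobodeckii spaces\<close>

lemma abs_component_powr_le: "1 \<le> p \<Longrightarrow> \<bar>(a :: real^'m) $ i\<bar> powr p \<le> norm a powr p"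
  using component_le_norm_cart[of a i] by (intro powr_mono2) auto

lemma smooth_lipschitz:
  fixes V :: "real^'d \<Rightarrow> real"
  assumes V: "smooth V" and K: "\<And>j x. \<bar>frechet_derivative V (at x) (axis j 1)\<bar> \<le> K"
  shows "\<bar>V x - V y\<bar> \<le> real CARD('d) * K * norm (x - y)"
proof -
  have "norm (V x - V y) \<le> (real CARD('d) * K) * norm (x - y)"
  proof (rule differentiable_bound[of UNIV V "\<lambda>x. frechet_derivative V (at x)"])
    show "(V has_derivative frechet_derivative V (at x)) (at x within UNIV)" for x
      using smooth_has_derivative(1)[OF V] by simp
    show "onorm (frechet_derivative V (at x)) \<le> real CARD('d) * K" for x
    proof (rule onorm_le)
      fix h :: "real^'d"
      have lin: "linear (frechet_derivative V (at x))"
        using smooth_has_derivative(1)[OF V] has_derivative_linear by blast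
      have h: "h = (\<Sum>j\<in>UNIV. h $ j *\<^sub>R axis j 1)"
        using basis_expansion[of h, symmetric] by (simp add: scalar_mult_eq_scaleR)
      have "frechet_derivative V (at x) h = (\<Sum>j\<in>UNIV. h $ j * frechet_derivative V (at x) (axis j 1))"
        by (subst h) (simp add: linear_sum[OF lin] linear_scale[OF lin])
      also have "\<bar>\<dots>\<bar> \<le> (\<Sum>j\<in>UNIV. \<bar>h $ j * frechet_derivative V (at x) (axis j 1)\<bar>)" by (rule sum_abs)
      also have "\<dots> \<le> (\<Sum>j\<in>(UNIV::'d set). norm h * K)"
        unfolding abs_mult by (intro sum_mono mult_mono K component_le_norm_cart) auto
      finally show "norm (frechet_derivative V (at x) h) \<le> real CARD('d) * K * norm h" by (simp add: mult_ac)
    qed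
  qed auto
  then show ?thesis by simp
qed

lemma torus_vol_pos: "measure torus (cell :: (real^'d) set) > 0"
proof -
  have "(\<integral>z. trig_weight z ^ 0 \<partial>(torus :: (real^'d) measure)) > 0" by (rule trig_mass_pos)
  then show ?thesis by simp
qed

lemma tendsto_integral_mol:
  assumes per: "periodic f" and f: "integrable lcell f"
  shows "(\<lambda>n. \<integral>x. \<bar>mol n f x - f x\<bar> \<partial>lcell) \<longlonglongrightarrow> 0"
proof -
  have i: "integrable lcell (\<lambda>x. \<bar>mol n f x - f x\<bar>)" for n
    using f integrable_smooth_mult[OF integrable_const_torus[of 1] smooth_mol[OF f] periodic_mol[OF f]]
    by (intro integrable_abs integrable_diff) auto
  have "ennreal (\<integral>x. \<bar>mol n f x - f x\<bar> \<partial>lcell) = (\<integral>\<^sup>+x. ennreal \<bar>mol n f x - f x\<bar> \<partial>lcell)" for n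
    using i by (intro nn_integral_eq_integral[symmetric]) auto
  then have "(\<lambda>n. ennreal (\<integral>x. \<bar>mol n f x - f x\<bar> \<partial>lcell)) \<longlonglongrightarrow> ennreal 0"
    using mol_L1[OF assms] by simp
  then show ?thesis by (rule tendsto_ennrealD) auto
qed

text \<open>A function with bounded weak gradient is bounded: its mollifications are uniformly Lipschitz
  and have bounded mean.\<close>

lemma bounded_of_weak_gradient:
  fixes M K :: real
  shows "\<exists>C\<ge>0. \<forall>(f :: real^'d \<Rightarrow> real) (w :: 'd \<Rightarrow> real^'d \<Rightarrow> real).
      periodic f \<and> integrable lcell f \<and> (\<integral>x. \<bar>f x\<bar> \<partial>lcell) \<le> M \<and>
      (\<forall>j. integrable lcell (w j) \<and> (AE x in torus. \<bar>w j x\<bar> \<le> K) \<and>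
        (\<forall>\<psi>. smooth \<psi> \<and> periodic \<psi> \<longrightarrow> (\<integral>x. f x * partial j \<psi> x \<partial>lcell) = - (\<integral>x. w j x * \<psi> x \<partial>lcell)))
    \<longrightarrow> (AE x in torus. \<bar>f x\<bar> \<le> C)"
proof -
  define vol where "vol = measure torus (cell :: (real^'d) set)"
  have vol: "vol > 0" by (simp add: vol_def torus_vol_pos)
  obtain R where R: "\<And>x::real^'d. x \<in> cell \<Longrightarrow> norm x \<le> R" using bounded_cell by (auto simp: bounded_iff)
  \<comment> \<open>A Lipschitz constant of the mollifications times a bound for the diameter of the
    cell; absolute values are taken because K, R and M carry no sign assumption.\<close>
  define L where "L = real CARD('d) * \<bar>K\<bar> * (2 * \<bar>R\<bar>)"
  \<comment> \<open>The first term bounds the mean of the mollification once the mollification error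
    is at most 1, and L bounds its oscillation.\<close>
  define C where "C = (\<bar>M\<bar> + 1) / vol + L"
  have C: "0 \<le> C" using vol by (simp add: C_def L_def)
  show ?thesis
  proof (intro exI[of _ C] conjI C allI impI, elim conjE)
    fix f :: "real^'d \<Rightarrow> real" and w :: "'d \<Rightarrow> real^'d \<Rightarrow> real"
    assume per: "periodic f" and f: "integrable lcell f" and M: "(\<integral>x. \<bar>f x\<bar> \<partial>lcell) \<le> M"
      and all: "\<forall>j. integrable lcell (w j) \<and> (AE x in torus. \<bar>w j x\<bar> \<le> K) \<and>
        (\<forall>\<psi>. smooth \<psi> \<and> periodic \<psi> \<longrightarrow> (\<integral>x. f x * partial j \<psi> x \<partial>lcell) = - (\<integral>x. w j x * \<psi> x \<partial>lcell))"
    have w: "integrable lcell (w j)" "AE x in torus. \<bar>w j x\<bar> \<le> K" for j using all by auto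
    have wp: "(\<integral>x. f x * partial j \<psi> x \<partial>lcell) = - (\<integral>x. w j x * \<psi> x \<partial>lcell)"
      if "smooth \<psi>" "periodic \<psi>" for j \<psi> using all that by simp
    define e where "e n = (\<integral>x. \<bar>mol n f x - f x\<bar> \<partial>lcell)" for n
    have e0: "e \<longlonglongrightarrow> 0" unfolding e_def[abs_def] by (rule tendsto_integral_mol[OF per f])
    have mi: "integrable lcell (mol n f)" for n
      using integrable_smooth_mult[OF integrable_const_torus[of 1] smooth_mol[OF f] periodic_mol[OF f]] by simp
    have "AE x in lcell. \<bar>f x\<bar> - C \<le> \<bar>mol n f x - f x\<bar>" if n: "e n \<le> 1" for n
    proof (intro AE_I2)
      fix x :: "real^'d" assume "x \<in> space lcell"
      then have x: "x \<in> cell" by simp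
      have lip: "\<bar>mol n f x\<bar> \<le> \<bar>mol n f y\<bar> + L" if y: "y \<in> cell" for y
      proof -
        have "\<bar>mol n f x - mol n f y\<bar> \<le> real CARD('d) * \<bar>K\<bar> * norm (x - y)"
        proof (rule smooth_lipschitz[OF smooth_mol[OF f]])
          fix j z
          have "\<bar>mol n (w j) z\<bar> \<le> K" by (rule mol_bound[OF w])
          then show "\<bar>frechet_derivative (mol n f) (at z) (axis j 1)\<bar> \<le> \<bar>K\<bar>" by (subst mol_derivative[OF f wp]) auto
        qed
        also have "norm (x - y) \<le> 2 * \<bar>R\<bar>" using R[OF x] R[OF y] norm_triangle_ineq4[of x y] by linarith
        then have "real CARD('d) * \<bar>K\<bar> * norm (x - y) \<le> L" unfolding L_def by (intro mult_left_mono) auto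
        finally show ?thesis by linarith
      qed
      have "vol * \<bar>mol n f x\<bar> = (\<integral>y. \<bar>mol n f x\<bar> \<partial>(torus :: (real^'d) measure))" by (simp add: vol_def)
      also have "\<dots> = (\<integral>y. \<bar>mol n f x\<bar> \<partial>lebesgue_on (cell :: (real^'d) set))"
        by (rule integral_rep[symmetric]) auto
      also have "\<dots> \<le> (\<integral>y. \<bar>f y\<bar> + \<bar>mol n f y - f y\<bar> + L \<partial>lcell)"
      proof (rule integral_mono)
        show "integrable lcell (\<lambda>y. \<bar>f y\<bar> + \<bar>mol n f y - f y\<bar> + L)"
          using f mi integrable_const_torus by (intro integrable_add integrable_abs integrable_diff) auto
        fix y :: "real^'d" assume "y \<in> space lcell"
        then show "\<bar>mol n f x\<bar> \<le> \<bar>f y\<bar> + \<bar>mol n f y - f y\<bar> + L" using lip[of y] by (simp; linarith)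
      qed (rule integrable_const_torus)
      also have "\<dots> = (\<integral>x. \<bar>f x\<bar> \<partial>lcell) + e n + vol * L"
      proof -
        have "(\<integral>y. L \<partial>lebesgue_on (cell :: (real^'d) set)) = vol * L"
          using integral_rep[of "\<lambda>_. L" "\<lambda>_::real^'d. L"] by (simp add: vol_def)
        then show ?thesis using f mi[of n] integrable_const_torus[of L, where 'd='d] by (simp add: e_def)
      qed
      also have "\<dots> \<le> \<bar>M\<bar> + 1 + vol * L" using M n by linarith
      also have "\<dots> = vol * C" using vol by (simp add: C_def field_simps)
      finally have "\<bar>mol n f x\<bar> \<le> C" using vol by simp
      then show "\<bar>f x\<bar> - C \<le> \<bar>mol n f x - f x\<bar>" by linarith
    qed
    then have le: "(\<integral>\<^sup>+x. ennreal (\<bar>f x\<bar> - C) \<partial>lcell) \<le> (\<integral>\<^sup>+x. ennreal \<bar>mol n f x - f x\<bar> \<partial>lcell)" if "e n \<le> 1" for n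
      using that by (intro nn_integral_mono_AE) (auto elim!: AE_mp intro!: AE_I2 ennreal_leI)
    have "eventually (\<lambda>n. e n < 1) sequentially" by (rule order_tendstoD(2)[OF e0]) simp
    then have "eventually (\<lambda>n. (\<integral>\<^sup>+x. ennreal (\<bar>f x\<bar> - C) \<partial>lcell) \<le> (\<integral>\<^sup>+x. ennreal \<bar>mol n f x - f x\<bar> \<partial>lcell)) sequentially"
      by eventually_elim (rule le, simp)
    then have "(\<integral>\<^sup>+x. ennreal (\<bar>f x\<bar> - C) \<partial>lcell) \<le> 0"
      by (intro tendsto_lowerbound[OF mol_L1[OF per f]]) auto
    moreover have "(\<lambda>x. ennreal (\<bar>f x\<bar> - C)) \<in> borel_measurable lcell" using f by measurable
    ultimately have "AE x in lcell. ennreal (\<bar>f x\<bar> - C) = 0" by (simp add: nn_integral_0_iff_AE)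
    then have "AE x in torus. ennreal (\<bar>f x\<bar> - C) = 0" by (simp add: AE_torus_iff)
    then show "AE x in torus. \<bar>f x\<bar> \<le> C" by eventually_elim (simp add: ennreal_eq_0_iff)
  qed
qed

lemma L1_le_powr:
  fixes f :: "real^'d \<Rightarrow> real"
  assumes f: "integrable lcell f" and p: "1 \<le> p" and M: "0 \<le> M"
    and le: "(\<integral>\<^sup>+x. ennreal (\<bar>f x\<bar> powr p) \<partial>lcell) \<le> ennreal M"
  shows "(\<integral>x. \<bar>f x\<bar> \<partial>lcell) \<le> measure torus (cell :: (real^'d) set) + M"
proof -
  let ?vol = "measure torus (cell :: (real^'d) set)"
  have "ennreal (\<integral>x. \<bar>f x\<bar> \<partial>lcell) = (\<integral>\<^sup>+x. ennreal \<bar>f x\<bar> \<partial>lcell)"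
    using f by (intro nn_integral_eq_integral[symmetric]) auto
  also have "\<dots> \<le> (\<integral>\<^sup>+x. ennreal 1 + ennreal (\<bar>f x\<bar> powr p) \<partial>lcell)"
  proof (rule nn_integral_mono)
    fix x
    have "\<bar>f x\<bar> \<le> 1 + \<bar>f x\<bar> powr p" using le_add_powr[of "\<bar>f x\<bar>" 1 p] p by simp
    then have "ennreal \<bar>f x\<bar> \<le> ennreal (1 + \<bar>f x\<bar> powr p)" by (rule ennreal_leI)
    then show "ennreal \<bar>f x\<bar> \<le> ennreal 1 + ennreal (\<bar>f x\<bar> powr p)" by simp
  qed
  also have "\<dots> = (\<integral>\<^sup>+x. ennreal 1 \<partial>lebesgue_on (cell :: (real^'d) set)) + (\<integral>\<^sup>+x. ennreal (\<bar>f x\<bar> powr p) \<partial>lcell)"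
    using f by (intro nn_integral_add) auto
  also have "(\<integral>\<^sup>+x. ennreal 1 \<partial>lebesgue_on (cell :: (real^'d) set)) = ennreal ?vol"
    using nn_integral_rep[of "\<lambda>_. ennreal 1" "\<lambda>_::real^'d. ennreal 1"] by (simp add: torus.emeasure_eq_measure)
  also have "ennreal ?vol + (\<integral>\<^sup>+x. ennreal (\<bar>f x\<bar> powr p) \<partial>lcell) \<le> ennreal ?vol + ennreal M"
    using le by (intro add_left_mono)
  also have "\<dots> = ennreal (?vol + M)" using M by simp
  finally show ?thesis using M by (simp add: ennreal_le_iff del: ennreal_plus)
qed

text \<open>For s = 2 - 2/p one has (s - 1) p = p - 2, the exponent in
  \<open>gagliardo_imp_bounded\<close>. That estimate bounds the weak derivatives, and
  \<open>bounded_of_weak_gradient\<close> then bounds the function.\<close>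

lemma slobodeckii_bound:
  fixes p M :: real
  assumes p: "p > real CARD('d) + 2" and M: "0 \<le> M"
  shows "\<exists>K\<ge>0. \<forall>f :: real^'d \<Rightarrow> real^'d. slobodeckii (2 - 2 / p) p f \<and> slobodeckii_norm_power (2 - 2 / p) p f \<le> ennreal M \<longrightarrow>
      (AE x in torus. \<forall>i. \<bar>f x $ i\<bar> \<le> K \<and> (\<forall>j. \<bar>weak_partial j f x $ i\<bar> \<le> K))"
proof -
  define vol where "vol = measure torus (cell :: (real^'d) set)"
  have vol: "vol > 0" by (simp add: vol_def torus_vol_pos)
  have p1: "p \<ge> 1" using p by linarith
  have q: "real CARD('d) + (2 - 2 / p - 1) * p = real CARD('d) + p - 2" using p1 by (simp add: field_simps)
  \<comment> \<open>Since |g| is at most 1 + |g|^p, \<open>vol + M\<close> bounds the norms in the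
    mean; taking it for the seminorm as well leaves a single constant.\<close>
  have M': "0 \<le> vol + M" using vol M by simp
  obtain K1 where K1: "0 \<le> K1" "\<And>g :: real^'d \<Rightarrow> real. g \<in> borel_measurable borel \<Longrightarrow> periodic g \<Longrightarrow> integrable torus g \<Longrightarrow>
      (\<integral>x. \<bar>g x\<bar> \<partial>torus) \<le> vol + M \<Longrightarrow>
      (\<integral>\<^sup>+h. (\<integral>\<^sup>+x. ennreal (\<bar>g (x + h) - g x\<bar> powr p / norm h powr (real CARD('d) + p - 2)) \<partial>torus) \<partial>torus) \<le> ennreal (vol + M) \<Longrightarrow>
      AE x in torus. \<bar>g x\<bar> \<le> K1"
    using gagliardo_imp_bounded[OF p M'] by blast
  obtain K2 where K2: "0 \<le> K2" "\<forall>(f :: real^'d \<Rightarrow> real) (w :: 'd \<Rightarrow> real^'d \<Rightarrow> real).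
      periodic f \<and> integrable lcell f \<and> (\<integral>x. \<bar>f x\<bar> \<partial>lcell) \<le> vol + M \<and>
      (\<forall>j. integrable lcell (w j) \<and> (AE x in torus. \<bar>w j x\<bar> \<le> K1) \<and>
        (\<forall>\<psi>. smooth \<psi> \<and> periodic \<psi> \<longrightarrow> (\<integral>x. f x * partial j \<psi> x \<partial>lcell) = - (\<integral>x. w j x * \<psi> x \<partial>lcell)))
    \<longrightarrow> (AE x in torus. \<bar>f x\<bar> \<le> K2)"
    using bounded_of_weak_gradient[of "vol + M" K1, where 'd='d] by (elim exE conjE)
  have "0 \<le> max K1 K2" using K1(1) by simp
  then show ?thesis
  proof (intro exI[of _ "max K1 K2"] conjI allI impI, assumption, elim conjE)
    fix f :: "real^'d \<Rightarrow> real^'d"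
    assume f: "slobodeckii (2 - 2 / p) p f" and N: "slobodeckii_norm_power (2 - 2 / p) p f \<le> ennreal M"
    define w where "w j = weak_partial j f" for j
    have wp: "has_weak_partial j f (w j)" for j
      unfolding w_def using f by (intro has_weak_partial_weak_partial) (simp add: slobodeckii_def)
    have fL: "torus_Lp 1 f" and wL: "torus_Lp 1 (w j)" for j using wp by (auto simp: has_weak_partial_def)
    let ?Nf = "\<integral>\<^sup>+x. ennreal (norm (f x) powr p) \<partial>lcell"
    let ?Nw = "\<lambda>j. \<integral>\<^sup>+x. ennreal (norm (w j x) powr p) \<partial>lcell"
    let ?Ng = "\<lambda>j. \<integral>\<^sup>+h. (\<integral>\<^sup>+x. ennreal (norm (w j (x + h) - w j x) powr p / norm h powr (real CARD('d) + p - 2)) \<partial>lcell) \<partial>lcell"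
    have sum: "?Nf + (\<Sum>j\<in>UNIV. ?Nw j) + (\<Sum>j\<in>UNIV. ?Ng j) \<le> ennreal M"
      using N unfolding slobodeckii_norm_power_def q w_def .
    have Nf: "?Nf \<le> ennreal M"
    proof -
      have "?Nf \<le> ?Nf + (\<Sum>j\<in>UNIV. ?Nw j) + (\<Sum>j\<in>UNIV. ?Ng j)" by (intro add_increasing2) auto
      then show ?thesis using sum by (rule order_trans)
    qed
    have Nw: "?Nw j \<le> ennreal M" for j
    proof -
      have "?Nw j \<le> (\<Sum>j\<in>UNIV. ?Nw j)" by (rule member_le_sum) auto
      also have "\<dots> \<le> ?Nf + (\<Sum>j\<in>UNIV. ?Nw j)" by (rule add_increasing) auto
      also have "\<dots> \<le> ?Nf + (\<Sum>j\<in>UNIV. ?Nw j) + (\<Sum>j\<in>UNIV. ?Ng j)" by (rule add_increasing2) auto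
      finally show ?thesis using sum by (rule order_trans)
    qed
    have Ng: "?Ng j \<le> ennreal M" for j
    proof -
      have "?Ng j \<le> (\<Sum>j\<in>UNIV. ?Ng j)" by (rule member_le_sum) auto
      also have "\<dots> \<le> ?Nf + (\<Sum>j\<in>UNIV. ?Nw j) + (\<Sum>j\<in>UNIV. ?Ng j)" by (rule add_increasing) auto
      finally show ?thesis using sum by (rule order_trans)
    qed
    have comp: "(\<integral>\<^sup>+x. ennreal (\<bar>u x $ i\<bar> powr p) \<partial>lcell) \<le> (\<integral>\<^sup>+x. ennreal (norm (u x) powr p) \<partial>lcell)" for u :: "real^'d \<Rightarrow> real^'d" and i
      using p1 by (intro nn_integral_mono ennreal_leI abs_component_powr_le)
    have wb: "AE x in torus. \<bar>w j x $ i\<bar> \<le> K1" for i j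
    proof -
      have wi: "integrable lcell (\<lambda>x. w j x $ i)" using torus_Lp_1D(3)[OF wL] by (rule integrable_component)
      have wper: "periodic (\<lambda>x. w j x $ i)" using torus_Lp_1D(1)[OF wL] by (rule periodic_compose)
      obtain g where g: "g \<in> borel_measurable borel" "periodic g" "AE x in torus. w j x $ i = g x" "integrable torus g"
        using torus_rep[OF wi] by blast
      have "AE x in torus. \<bar>g x\<bar> \<le> K1"
      proof (rule K1(2)[OF g(1,2,4)])
        have "(\<integral>x. \<bar>g x\<bar> \<partial>torus) = (\<integral>x. \<bar>w j x $ i\<bar> \<partial>lcell)"
        proof (rule integral_rep[symmetric])
          show "AE x in torus. \<bar>w j x $ i\<bar> = \<bar>g x\<bar>" using g(3) by eventually_elim simp
        qed (use wi g(1) in auto)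
        also have "\<dots> \<le> vol + M"
          unfolding vol_def by (rule L1_le_powr[OF wi p1 M order_trans[OF comp Nw]])
        finally show "(\<integral>x. \<bar>g x\<bar> \<partial>torus) \<le> vol + M" .
        define G where "G h = (\<integral>\<^sup>+x. ennreal (\<bar>g (x + h) - g x\<bar> powr p / norm h powr (real CARD('d) + p - 2)) \<partial>torus)" for h
        have gm: "(\<lambda>h. ennreal (\<bar>g (x + h) - g x\<bar> powr p / norm h powr (real CARD('d) + p - 2))) \<in> borel_measurable borel"
          "(\<lambda>x. ennreal (\<bar>g (x + h) - g x\<bar> powr p / norm h powr (real CARD('d) + p - 2))) \<in> borel_measurable borel" for x h
          using g(1) by measurable
        have Gm: "G \<in> borel_measurable borel"
        proof -
          have id: "(\<lambda>x. x) \<in> torus \<rightarrow>\<^sub>M borel" by (intro borel_measurable_torus) simp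
          note [measurable] = g(1)
          have "(\<lambda>z. ennreal (\<bar>g (snd z + fst z) - g (snd z)\<bar> powr p / norm (fst z) powr (real CARD('d) + p - 2))) \<in> borel_measurable (borel \<Otimes>\<^sub>M borel)"
            by measurable
          moreover have pr: "(\<lambda>z. (fst z, snd z)) \<in> borel \<Otimes>\<^sub>M torus \<rightarrow>\<^sub>M borel \<Otimes>\<^sub>M borel"
            by (intro measurable_Pair measurable_fst measurable_compose[OF measurable_snd id])
          ultimately have "(\<lambda>z. ennreal (\<bar>g (snd z + fst z) - g (snd z)\<bar> powr p / norm (fst z) powr (real CARD('d) + p - 2))) \<in> borel_measurable (borel \<Otimes>\<^sub>M torus)"
            using measurable_compose[OF pr, of "\<lambda>z. ennreal (\<bar>g (snd z + fst z) - g (snd z)\<bar> powr p / norm (fst z) powr (real CARD('d) + p - 2))" borel]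
            by simp
          then show ?thesis unfolding G_def
            using torus.borel_measurable_nn_integral[of "\<lambda>h x. ennreal (\<bar>g (x + h) - g x\<bar> powr p / norm h powr (real CARD('d) + p - 2))" borel]
            by (simp add: split_beta')
        qed
        have "(\<integral>\<^sup>+h. G h \<partial>torus) = (\<integral>\<^sup>+h. G h \<partial>lcell)"
          by (rule nn_integral_lebesgue_on_borel[OF Gm cell_borel, symmetric])
        also have "\<dots> \<le> ?Ng j"
        proof (rule nn_integral_mono)
          fix h
          \<comment> \<open>The null set may depend on h: the outer integral only compares the inner
            integrals, one h at a time.\<close>
          have "AE x in torus. w j (x + h) $ i = g (x + h)"
            using AE_torus_shift[of "\<lambda>x. w j x $ i = g x" h] periodic_compose2[OF wper g(2), of "(=)"] g(3) by simp
          with g(3) have ae: "AE x in torus. w j x $ i = g x \<and> w j (x + h) $ i = g (x + h)" by eventually_elim simp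
          have "G h = (\<integral>\<^sup>+x. ennreal (\<bar>g (x + h) - g x\<bar> powr p / norm h powr (real CARD('d) + p - 2)) \<partial>lcell)"
            unfolding G_def by (rule nn_integral_lebesgue_on_borel[OF gm(2) cell_borel, symmetric])
          also have "\<dots> \<le> (\<integral>\<^sup>+x. ennreal (norm (w j (x + h) - w j x) powr p / norm h powr (real CARD('d) + p - 2)) \<partial>lcell)"
          proof (rule nn_integral_mono_AE)
            have "AE x in lcell. w j x $ i = g x \<and> w j (x + h) $ i = g (x + h)" using ae by (simp add: AE_torus_iff)
            then show "AE x in lcell. ennreal (\<bar>g (x + h) - g x\<bar> powr p / norm h powr (real CARD('d) + p - 2)) \<le>
                ennreal (norm (w j (x + h) - w j x) powr p / norm h powr (real CARD('d) + p - 2))"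
            proof eventually_elim
              case (elim x)
              then show ?case using abs_component_powr_le[OF p1, of "w j (x + h) - w j x" i]
                by (intro ennreal_leI divide_right_mono) auto
            qed
          qed
          finally show "G h \<le> (\<integral>\<^sup>+x. ennreal (norm (w j (x + h) - w j x) powr p / norm h powr (real CARD('d) + p - 2)) \<partial>lcell)" .
        qed
        also have "\<dots> \<le> ennreal (vol + M)" by (rule order_trans[OF Ng ennreal_leI]) (use vol in simp)
        finally show "(\<integral>\<^sup>+h. (\<integral>\<^sup>+x. ennreal (\<bar>g (x + h) - g x\<bar> powr p / norm h powr (real CARD('d) + p - 2)) \<partial>torus) \<partial>torus) \<le> ennreal (vol + M)"
          by (simp add: G_def)
      qed
      with g(3) show ?thesis by eventually_elim simp
    qed
    have fb: "AE x in torus. \<bar>f x $ i\<bar> \<le> K2" for i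
    proof (rule K2(2)[rule_format, of _ "\<lambda>j x. w j x $ i"], intro conjI allI impI)
      show fi: "integrable lcell (\<lambda>x. f x $ i)" using torus_Lp_1D(3)[OF fL] by (rule integrable_component)
      show "periodic (\<lambda>x. f x $ i)" using torus_Lp_1D(1)[OF fL] by (rule periodic_compose)
      show "(\<integral>x. \<bar>f x $ i\<bar> \<partial>lcell) \<le> vol + M"
        unfolding vol_def by (rule L1_le_powr[OF fi p1 M order_trans[OF comp Nf]])
      show "integrable lcell (\<lambda>x. w j x $ i)" for j using torus_Lp_1D(3)[OF wL] by (rule integrable_component)
    qed (rule wb, elim conjE, rule weak_partial_component[OF wp])
    have "AE x in torus. \<forall>i. \<bar>f x $ i\<bar> \<le> K2" "AE x in torus. \<forall>i j. \<bar>w j x $ i\<bar> \<le> K1"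
      using wb fb by (simp_all add: AE_all_countable)
    then show "AE x in torus. \<forall>i. \<bar>f x $ i\<bar> \<le> max K1 K2 \<and> (\<forall>j. \<bar>weak_partial j f x $ i\<bar> \<le> max K1 K2)"
      by eventually_elim (auto simp: w_def le_max_iff_disj)
  qed
qed

text \<open>Close to t, \<open>v \<tau>\<close> is \<open>v t\<close> plus a difference whose norm
  power is below 1, so the two bounds add up and no triangle inequality for the norm power is
  involved. Compactness of the time interval leaves finitely many local bounds, and their sum serves
  for all times.\<close>

lemma C_slobodeckii_bound:
  fixes v :: "real \<Rightarrow> real^'d \<Rightarrow> real^'d"
  assumes p: "p > real CARD('d) + 2" and v: "C_slobodeckii T (2 - 2 / p) p v"
  obtains K where "0 \<le> K" "\<And>t. t \<in> {0..T} \<Longrightarrow> AE x in torus. \<forall>i. \<bar>v t x $ i\<bar> \<le> K \<and> (\<forall>j. \<bar>weak_partial j (v t) x $ i\<bar> \<le> K)"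
proof -
  define N where "N f = slobodeckii_norm_power (2 - 2 / p) p f" for f :: "real^'d \<Rightarrow> real^'d"
  define B where "B K f \<longleftrightarrow> (AE x in torus. \<forall>i. \<bar>f x $ i\<bar> \<le> K \<and> (\<forall>j. \<bar>weak_partial j f x $ i\<bar> \<le> K))" for K and f :: "real^'d \<Rightarrow> real^'d"
  have sl: "slobodeckii (2 - 2 / p) p (v t)" if "t \<in> {0..T}" for t using v that by (simp add: C_slobodeckii_def)
  have wp: "has_weak_partial j (v t) (weak_partial j (v t))" if "t \<in> {0..T}" for t j
    using sl[OF that] by (intro has_weak_partial_weak_partial) (simp add: slobodeckii_def)
  have SB: "\<exists>K\<ge>0. \<forall>f. slobodeckii (2 - 2 / p) p f \<and> N f \<le> ennreal M \<longrightarrow> B K f" if "0 \<le> M" for M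
    using slobodeckii_bound[OF p that] unfolding N_def B_def .
  obtain K1 where K1: "0 \<le> K1" "\<And>f. slobodeckii (2 - 2 / p) p f \<Longrightarrow> N f \<le> ennreal 1 \<Longrightarrow> B K1 f"
    using SB[of 1] by auto
  have local: "\<exists>U K. open U \<and> t \<in> U \<and> 0 \<le> K \<and> (\<forall>\<tau>\<in>U \<inter> {0..T}. B K (v \<tau>))" if t: "t \<in> {0..T}" for t
  proof -
    have "N (v t) < \<infinity>" using sl[OF t] by (simp add: slobodeckii_def N_def)
    then obtain M where M: "0 \<le> M" "N (v t) \<le> ennreal M"
      using that[of "enn2real (N (v t))"] by simp
    obtain K2 where K2: "0 \<le> K2" "\<And>f. slobodeckii (2 - 2 / p) p f \<Longrightarrow> N f \<le> ennreal M \<Longrightarrow> B K2 f"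
      using SB[OF M(1)] by auto
    have "((\<lambda>\<tau>. N (\<lambda>x. v \<tau> x - v t x)) \<longlongrightarrow> 0) (at t within {0..T})"
      using v t by (simp add: C_slobodeckii_def N_def)
    then have "eventually (\<lambda>\<tau>. N (\<lambda>x. v \<tau> x - v t x) < 1) (at t within {0..T})" by (rule order_tendstoD(2)) simp
    then obtain U where U: "open U" "t \<in> U" "\<And>\<tau>. \<tau> \<in> U \<Longrightarrow> \<tau> \<noteq> t \<Longrightarrow> \<tau> \<in> {0..T} \<Longrightarrow> N (\<lambda>x. v \<tau> x - v t x) < 1"
      unfolding eventually_at_topological by blast
    have Bt: "B K2 (v t)" by (rule K2(2)[OF sl[OF t] M(2)])
    have "B (K1 + K2) (v \<tau>)" if \<tau>: "\<tau> \<in> U \<inter> {0..T}" for \<tau>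
    proof (cases "\<tau> = t")
      case True
      from Bt show ?thesis unfolding True B_def
      proof eventually_elim
        case (elim x)
        then show ?case using K1(1) by (auto intro!: add_increasing)
      qed
    next
      case False
      have \<tau>': "\<tau> \<in> {0..T}" using \<tau> by blast
      have wd: "has_weak_partial j (\<lambda>x. v \<tau> x - v t x) (\<lambda>x. weak_partial j (v \<tau>) x - weak_partial j (v t) x)" for j
        by (rule has_weak_partial_diff[OF wp[OF \<tau>'] wp[OF t]])
      have Nd: "N (\<lambda>x. v \<tau> x - v t x) < 1" using U(3) \<tau> False by blast
      then have "N (\<lambda>x. v \<tau> x - v t x) < \<infinity>" by (rule less_trans) simp
      then have "slobodeckii (2 - 2 / p) p (\<lambda>x. v \<tau> x - v t x)"
        using wd unfolding slobodeckii_def N_def by blast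
      then have Bd: "B K1 (\<lambda>x. v \<tau> x - v t x)" by (rule K1(2)) (use Nd in simp)
      \<comment> \<open>\<open>weak_partial\<close> is a choice, so it is additive only almost
        everywhere.\<close>
      have "AE x in torus. weak_partial j (\<lambda>x. v \<tau> x - v t x) x = weak_partial j (v \<tau>) x - weak_partial j (v t) x" for j
      proof (rule weak_partial_unique[OF has_weak_partial_weak_partial wd])
        show "\<exists>g. has_weak_partial j (\<lambda>x. v \<tau> x - v t x) g" using wd by blast
      qed
      then have "AE x in torus. \<forall>j. weak_partial j (\<lambda>x. v \<tau> x - v t x) x = weak_partial j (v \<tau>) x - weak_partial j (v t) x"
        by (simp add: AE_all_countable)
      with Bt Bd show ?thesis unfolding B_def
      proof eventually_elim
        case (elim x)
        show ?case
        proof (intro allI conjI)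
          fix i j
          have "\<bar>v t x $ i\<bar> \<le> K2" "\<bar>v \<tau> x $ i - v t x $ i\<bar> \<le> K1" using elim(1,2) by simp_all
          then show "\<bar>v \<tau> x $ i\<bar> \<le> K1 + K2" by linarith
          have "\<bar>weak_partial j (v t) x $ i\<bar> \<le> K2" "\<bar>weak_partial j (v \<tau>) x $ i - weak_partial j (v t) x $ i\<bar> \<le> K1"
            using elim by (auto simp flip: vector_minus_component)
          then show "\<bar>weak_partial j (v \<tau>) x $ i\<bar> \<le> K1 + K2" by linarith
        qed
      qed
    qed
    then show ?thesis using U(1,2) K1(1) K2(1) by (intro exI[of _ U] exI[of _ "K1 + K2"]) auto
  qed
  then obtain U K where UK: "\<And>t. t \<in> {0..T} \<Longrightarrow> open (U t)" "\<And>t. t \<in> {0..T} \<Longrightarrow> t \<in> U t" "\<And>t. t \<in> {0..T} \<Longrightarrow> 0 \<le> K t"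
    "\<And>t \<tau>. t \<in> {0..T} \<Longrightarrow> \<tau> \<in> U t \<inter> {0..T} \<Longrightarrow> B (K t) (v \<tau>)" by metis
  have "compact {0..T}" by simp
  then obtain C where C: "C \<subseteq> {0..T}" "finite C" "{0..T} \<subseteq> (\<Union>c\<in>C. U c)"
    by (rule compactE_image[of "{0..T}" "{0..T}" U]) (use UK(1,2) in auto)
  show ?thesis
  proof (rule that[of "\<Sum>c\<in>C. K c"])
    show "0 \<le> (\<Sum>c\<in>C. K c)" using C UK(3) by (intro sum_nonneg) blast
    fix t assume t: "t \<in> {0..T}"
    then obtain c where c: "c \<in> C" "t \<in> U c" using C by blast
    then have Bc: "B (K c) (v t)" using UK(4)[of c t] C t by blast
    have Kc: "K c \<le> (\<Sum>c\<in>C. K c)" using C c UK(3) by (intro member_le_sum) auto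
    from Bc show "AE x in torus. \<forall>i. \<bar>v t x $ i\<bar> \<le> (\<Sum>c\<in>C. K c) \<and> (\<forall>j. \<bar>weak_partial j (v t) x $ i\<bar> \<le> (\<Sum>c\<in>C. K c))"
      unfolding B_def
    proof eventually_elim
      case (elim x)
      then show ?case using Kc by (auto intro: order_trans)
    qed
  qed
qed

section \<open>Functions of time and space\<close>

lemma borel_rep_AE:
  fixes f u :: "'a::euclidean_space \<Rightarrow> real"
  assumes A: "A \<in> sets borel" and u: "u \<in> borel_measurable (restrict_space lborel A)"
    and eq: "AE x in restrict_space lborel A. f x = u x"
  shows "f \<in> borel_measurable (lebesgue_on A)"
    and "integrable (lebesgue_on A) f \<longleftrightarrow> integrable (restrict_space lborel A) u"
    and "integral\<^sup>L (lebesgue_on A) f = integral\<^sup>L (restrict_space lborel A) u"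
proof -
  define w where "w x = indicator A x *\<^sub>R u x" for x
  have w: "w \<in> borel_measurable borel"
    unfolding w_def using u A by (subst (asm) borel_measurable_restrict_space_iff) auto
  have eq': "AE x in lborel. x \<in> A \<longrightarrow> f x = w x"
    using eq A by (simp add: AE_restrict_space_iff w_def indicator_def)
  have "(\<lambda>x. indicator A x *\<^sub>R f x) \<in> borel_measurable lebesgue"
  proof (rule borel_measurable_AE)
    show "w \<in> borel_measurable lebesgue" using w by (simp add: measurable_completion)
    have "AE x in lborel. w x = indicator A x *\<^sub>R f x"
      using eq' by eventually_elim (auto simp: w_def indicator_def)
    then show "AE x in lebesgue. w x = indicator A x *\<^sub>R f x" by (simp add: AE_completion_iff)
  qed
  then show f: "f \<in> borel_measurable (lebesgue_on A)"
    using A by (subst borel_measurable_restrict_space_iff) auto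
  have w': "w \<in> borel_measurable (lebesgue_on A)" by (rule lebesgue_on_borel_measurable[OF w])
  have ae: "AE x in lebesgue_on A. f x = w x"
    using eq' A by (simp add: AE_restrict_space_iff AE_completion_iff)
  have c: "integrable (restrict_space lborel A) w \<longleftrightarrow> integrable (restrict_space lborel A) u"
    "integral\<^sup>L (restrict_space lborel A) w = integral\<^sup>L (restrict_space lborel A) u"
    by (auto intro!: integrable_cong integral_cong simp: w_def space_restrict_space)
  show "integrable (lebesgue_on A) f \<longleftrightarrow> integrable (restrict_space lborel A) u"
    using integrable_cong_AE[OF f w' ae] integrable_lebesgue_on_borel[OF w A] c by simp
  show "integral\<^sup>L (lebesgue_on A) f = integral\<^sup>L (restrict_space lborel A) u"
    using integral_cong_AE[OF f w' ae] integral_lebesgue_on_borel[OF w A] c by simp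
qed

lemma spacetime_borel[measurable]: "spacetime T \<in> sets borel"
  using cell_borel by (simp add: borel_prod[symmetric] pair_measureI)

abbreviation times :: "real \<Rightarrow> real measure" where
  "times T \<equiv> restrict_space lborel {0<..<T}"

interpretation times: finite_measure "times T"
proof
  have "emeasure lborel {0<..<T} < \<infinity>" using emeasure_bounded_finite[of "{0<..<T}"] by simp
  then show "emeasure (times T) (space (times T)) \<noteq> \<infinity>"
    by (simp add: emeasure_restrict_space space_restrict_space)
qed

text \<open>Lebesgue measure on the product is not the product of the completed factors, so Fubini
  is applied to the Borel measures and transferred by representatives.\<close>

lemma spacetime_measure: "restrict_space lborel (spacetime T) = times T \<Otimes>\<^sub>M (torus :: (real^'d) measure)"
proof (rule pair_measure_eqI[symmetric])
  show "sigma_finite_measure (times T)" "sigma_finite_measure (torus :: (real^'d) measure)" by unfold_locales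
  show "sets (times T \<Otimes>\<^sub>M (torus :: (real^'d) measure)) = sets (restrict_space lborel (spacetime T))"
  proof
    have m: "(\<lambda>z. z) \<in> restrict_space lborel (spacetime T) \<rightarrow>\<^sub>M times T \<Otimes>\<^sub>M (torus :: (real^'d) measure)"
    proof -
      have "(\<lambda>z. (fst z, snd z)) \<in> restrict_space lborel (spacetime T) \<rightarrow>\<^sub>M times T \<Otimes>\<^sub>M (torus :: (real^'d) measure)"
        by (intro measurable_Pair measurable_restrict_space2 measurable_restrict_space1)
           (auto simp: space_restrict_space borel_prod[symmetric])
      then show ?thesis by simp
    qed
    show "sets (times T \<Otimes>\<^sub>M (torus :: (real^'d) measure)) \<subseteq> sets (restrict_space lborel (spacetime T))"
    proof
      fix A assume A: "A \<in> sets (times T \<Otimes>\<^sub>M (torus :: (real^'d) measure))"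
      have "A \<subseteq> spacetime T" using sets.sets_into_space[OF A] by (simp add: space_pair_measure space_restrict_space)
      then show "A \<in> sets (restrict_space lborel (spacetime T))"
        using measurable_sets[OF m A] by (simp add: space_restrict_space Int_absorb2)
    qed
    have m2: "(\<lambda>z. z) \<in> times T \<Otimes>\<^sub>M (torus :: (real^'d) measure) \<rightarrow>\<^sub>M borel"
    proof -
      have "(\<lambda>z. (fst z, snd z)) \<in> times T \<Otimes>\<^sub>M (torus :: (real^'d) measure) \<rightarrow>\<^sub>M borel \<Otimes>\<^sub>M borel"
        by (intro measurable_Pair measurable_compose[OF measurable_fst] measurable_compose[OF measurable_snd] measurable_restrict_space1) auto
      then show ?thesis by (simp add: borel_prod)
    qed
    show "sets (restrict_space lborel (spacetime T)) \<subseteq> sets (times T \<Otimes>\<^sub>M (torus :: (real^'d) measure))"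
    proof
      fix A :: "(real \<times> (real^'d)) set" assume "A \<in> sets (restrict_space lborel (spacetime T))"
      then have A: "A \<in> sets borel" "A \<subseteq> spacetime T" by (auto simp: sets_restrict_space_iff)
      then show "A \<in> sets (times T \<Otimes>\<^sub>M (torus :: (real^'d) measure))"
        using measurable_sets[OF m2 A(1)] by (simp add: space_pair_measure space_restrict_space Int_absorb2)
    qed
  qed
  fix A B assume AB: "A \<in> sets (times T)" "B \<in> sets (torus :: (real^'d) measure)"
  then have s: "A \<in> sets borel" "A \<subseteq> {0<..<T}" "B \<in> sets borel" "B \<subseteq> cell" by (auto simp: sets_restrict_space_iff)
  have "emeasure (restrict_space lborel (spacetime T)) (A \<times> B) = emeasure lborel (A \<times> B)"
    using s by (intro emeasure_restrict_space) auto
  also have "\<dots> = emeasure (lborel \<Otimes>\<^sub>M lborel) (A \<times> B)" by (simp add: lborel_prod)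
  also have "\<dots> = emeasure lborel A * emeasure lborel B" using s by (intro lborel.emeasure_pair_measure_Times) auto
  also have "\<dots> = emeasure (times T) A * emeasure torus B"
    using s by (simp add: emeasure_restrict_space)
  finally show "emeasure (times T) A * emeasure torus B = emeasure (restrict_space lborel (spacetime T)) (A \<times> B)" by simp
qed

interpretation st: pair_sigma_finite "times T" "torus :: (real^'d) measure" for T ..

lemma AE_times_iff: "(AE t in ltime T. P t) \<longleftrightarrow> (AE t in times T. P t)"
  by (simp add: AE_restrict_space_iff AE_completion_iff)

lemma AE_spacetime_iff: "(AE z in lst T. P z) \<longleftrightarrow> (AE z in restrict_space lborel (spacetime T). P z)"
  by (simp add: AE_restrict_space_iff AE_completion_iff)

lemma AE_spacetime_sections:
  assumes "AE z in lebesgue_on (spacetime T :: (real \<times> (real^'d)) set). P z"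
  shows "AE t in ltime T. AE x in torus. P (t, x)"
proof -
  have "AE z in times T \<Otimes>\<^sub>M (torus :: (real^'d) measure). P z"
    using assms unfolding AE_spacetime_iff spacetime_measure .
  from st.AE_pair[OF this] show ?thesis by (simp add: AE_times_iff)
qed

lemma
  fixes f :: "real \<times> (real^'d) \<Rightarrow> real"
  assumes f: "integrable (lst T) f"
  shows spacetime_fubini_sections: "AE t in ltime T. integrable lcell (\<lambda>x. f (t, x))"
    and spacetime_fubini_integrable: "integrable (ltime T) (\<lambda>t. \<integral>x. f (t, x) \<partial>lcell)"
    and spacetime_fubini: "(\<integral>t. (\<integral>x. f (t, x) \<partial>lcell) \<partial>ltime T) = (\<integral>z. f z \<partial>lst T)"
proof -
  have fm: "f \<in> borel_measurable (lst T)" using f by simp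
  obtain g where g: "g \<in> borel_measurable borel" "AE z in lborel. z \<in> spacetime T \<longrightarrow> f z = g z"
    using lebesgue_on_ex_borel[OF fm spacetime_borel] by blast
  have eq: "AE z in restrict_space lborel (spacetime T). f z = g z"
    using g(2) by (simp add: AE_restrict_space_iff)
  have gr: "g \<in> borel_measurable (restrict_space lborel (spacetime T))" using g(1) by (intro measurable_restrict_space1) simp
  note rep = borel_rep_AE[OF spacetime_borel gr eq]
  have gi: "integrable (times T \<Otimes>\<^sub>M torus) g" using rep(2) f by (simp add: spacetime_measure)
  have "AE z in lst T. f z = g z" using eq by (simp add: AE_spacetime_iff)
  from AE_spacetime_sections[OF this]
  have sec: "AE t in times T. AE x in torus. f (t, x) = g (t, x)" by (simp add: AE_times_iff)
  have gt: "(\<lambda>x. g (t, x)) \<in> borel_measurable borel" for t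
  proof -
    have "g \<in> borel_measurable (borel \<Otimes>\<^sub>M borel)" using g(1) by (simp add: borel_prod)
    moreover have "(\<lambda>x. (t, x)) \<in> borel \<rightarrow>\<^sub>M borel \<Otimes>\<^sub>M borel" by (intro measurable_Pair) auto
    ultimately show ?thesis by (rule measurable_compose[rotated])
  qed
  have int: "AE t in times T. integrable torus (\<lambda>x. g (t, x))" by (rule st.AE_integrable_fst'[OF gi])
  have *: "AE t in times T. integrable lcell (\<lambda>x. f (t, x)) \<and> (\<integral>x. f (t, x) \<partial>lcell) = (\<integral>x. g (t, x) \<partial>torus)"
    using sec int
  proof eventually_elim
    case (elim t)
    then show ?case using borel_rep_AE[OF cell_borel borel_measurable_torus[OF gt] elim(1)] by simp
  qed
  then show "AE t in ltime T. integrable lcell (\<lambda>x. f (t, x))"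
    unfolding AE_times_iff by eventually_elim simp
  have ae: "AE t in times T. (\<integral>x. f (t, x) \<partial>lcell) = (\<integral>x. g (t, x) \<partial>torus)"
    using * by eventually_elim simp
  note G = st.integrable_fst'[OF gi]
  have Gm: "(\<lambda>t. \<integral>x. g (t, x) \<partial>torus) \<in> borel_measurable (times T)" using G by simp
  have I: "{0<..<T} \<in> sets borel" by simp
  note rep2 = borel_rep_AE[OF I Gm ae]
  show "integrable (ltime T) (\<lambda>t. \<integral>x. f (t, x) \<partial>lcell)" using rep2(2) G by simp
  show "(\<integral>t. (\<integral>x. f (t, x) \<partial>lcell) \<partial>ltime T) = (\<integral>z. f z \<partial>lst T)"
    using rep2(3) rep(3) st.integral_fst'[OF gi] by (simp add: spacetime_measure)
qed

lemma integral_time_upto: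
  fixes \<rho> :: "real \<Rightarrow> real"
  assumes "\<tau> \<le> T"
  shows "(\<integral>t. \<rho> t \<partial>ltime \<tau>) = (\<integral>t. indicator {..<\<tau>} t * \<rho> t \<partial>lebesgue_on {0<..<T :: real})"
  by (subst (1 2) integral_restrict_space) (use assms in \<open>auto intro!: integral_cong simp: indicator_def\<close>)

text \<open>Time integrals up to \<open>\<tau>\<close> are carried over to the fixed interval (0, T)
  with a cutoff; there they can be subtracted and passed to the limit.\<close>

lemma spacetime_integral_upto:
  fixes f :: "real \<times> (real^'d) \<Rightarrow> real"
  assumes f: "integrable (lst T) f" and \<tau>: "\<tau> \<le> T"
  shows "integrable (lst \<tau>) f"
    and "(\<integral>z. f z \<partial>lst \<tau>) = (\<integral>t. indicator {..<\<tau>} t * (\<integral>x. f (t, x) \<partial>lcell) \<partial>ltime T)"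
proof -
  have sp: "spacetime S \<in> sets lebesgue" for S using spacetime_borel[of S, where 'a='d] by simp
  have ind: "indicator (spacetime \<tau>) z *\<^sub>R f z = indicator (spacetime T) z *\<^sub>R (indicator {..<\<tau>} (fst z) * f z)" for z
    using \<tau> by (cases z) (auto simp: indicator_def)
  have m: "(\<lambda>z :: real \<times> (real^'d). indicator {..<\<tau>} (fst z) :: real) \<in> borel_measurable borel"
  proof -
    have "(fst :: real \<times> (real^'d) \<Rightarrow> real) \<in> borel_measurable borel" by (simp add: borel_prod[symmetric])
    from measurable_compose[OF this, of "indicator {..<\<tau>} :: real \<Rightarrow> real" borel] show ?thesis by simp
  qed
  have i: "integrable (lst T) (\<lambda>z. indicator {..<\<tau>} (fst z) * f z)"
    using integrable_mult_bounded[OF f lebesgue_on_borel_measurable[OF m], of 1] by (simp add: indicator_def mult.commute)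
  then show "integrable (lst \<tau>) f"
    using sp by (simp add: integrable_restrict_space ind[unfolded real_scaleR_def])
  have "(\<integral>z. f z \<partial>lst \<tau>) = (\<integral>z. indicator {..<\<tau>} (fst z) * f z \<partial>lst T)"
    using sp by (simp add: integral_restrict_space ind[unfolded real_scaleR_def])
  also have "\<dots> = (\<integral>t. indicator {..<\<tau>} t * (\<integral>x. f (t, x) \<partial>lcell) \<partial>ltime T)"
    using spacetime_fubini[OF i] by simp
  finally show "(\<integral>z. f z \<partial>lst \<tau>) = (\<integral>t. indicator {..<\<tau>} t * (\<integral>x. f (t, x) \<partial>lcell) \<partial>ltime T)" .
qed

section \<open>Partitions of the time interval and Gronwall's lemma\<close>

lemma integrable_indicator_times:
  assumes "integrable (lebesgue_on {0<..<T :: real}) r" "A \<in> sets borel"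
  shows "integrable (ltime T) (\<lambda>t. indicator A t * r t :: real)"
proof -
  have m: "(indicator A :: real \<Rightarrow> real) \<in> borel_measurable (ltime T)"
    by (rule lebesgue_on_borel_measurable) (use assms(2) in simp)
  have "integrable (ltime T) (\<lambda>t. r t * indicator A t)"
    by (rule integrable_mult_bounded[OF assms(1) m, of 1]) (simp add: indicator_def)
  then show ?thesis by (simp only: mult.commute)
qed

text \<open>The hypothesis freezes the coefficients at the left end of each interval. Over a uniform
  partition the right sides telescope, and as the mesh tends to 0 continuity and dominated
  convergence unfreeze the coefficients; no regularity of q enters.\<close>

lemma partition_limit:
  fixes c h :: "'k \<Rightarrow> real \<Rightarrow> real"
  assumes K: "finite K" and c: "\<And>k. k \<in> K \<Longrightarrow> continuous_on {0..T} (c k)"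
    and h: "\<And>k. k \<in> K \<Longrightarrow> integrable (ltime T) (h k)" and r: "integrable (ltime T) r"
    and step: "\<And>s t. 0 \<le> s \<Longrightarrow> s \<le> t \<Longrightarrow> t \<le> T \<Longrightarrow>
      (\<integral>u. indicator {s..<t} u * ((\<Sum>k\<in>K. c k s * h k u) - r u) \<partial>ltime T) \<le> q t - q s"
    and \<tau>: "0 \<le> \<tau>" "\<tau> \<le> T"
  shows "(\<integral>u. indicator {..<\<tau>} u * ((\<Sum>k\<in>K. c k u * h k u) - r u) \<partial>ltime T) \<le> q \<tau> - q 0"
proof (cases "\<tau> = 0")
  case True
  have "(\<integral>u. indicator {..<0} u * ((\<Sum>k\<in>K. c k u * h k u) - r u) \<partial>ltime T) = (\<integral>u. 0 \<partial>ltime T)"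
    by (intro integral_cong) (auto simp: indicator_def)
  then show ?thesis using True by simp
next
  case False
  then have \<tau>0: "\<tau> > 0" using \<tau> by simp
  let ?M = "ltime T"
  define s where "s N i = real i * \<tau> / real (Suc N)" for N i
  \<comment> \<open>The left end point of the partition interval that contains u.\<close>
  define p where "p N u = s N (nat \<lfloor>u * real (Suc N) / \<tau>\<rfloor>)" for N u
  define g where "g N u = (\<Sum>i<Suc N. indicator {s N i..<s N (Suc i)} u * ((\<Sum>k\<in>K. c k (s N i) * h k u) - r u))" for N u
  have s: "0 \<le> s N i" "s N i \<le> s N (Suc i)" "s N 0 = 0" "s N (Suc N) = \<tau>" for N i
    using \<tau>0 by (auto simp: s_def divide_right_mono mult_right_mono)
  have sT: "s N i \<le> T" if "i \<le> Suc N" for N i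
  proof -
    have "real i * \<tau> \<le> real (Suc N) * \<tau>" using that \<tau>0 by (intro mult_right_mono) auto
    then have "s N i \<le> \<tau>" by (simp add: s_def divide_le_eq mult.commute)
    then show ?thesis using \<tau> by simp
  qed
  have pi: "integrable ?M (\<lambda>u. indicator {s N i..<s N (Suc i)} u * ((\<Sum>k\<in>K. c k (s N i) * h k u) - r u))" for N i
    using h r by (intro integrable_indicator_times integrable_diff integrable_sum) auto
  have le: "(\<integral>u. g N u \<partial>?M) \<le> q \<tau> - q 0" for N
  proof -
    have "(\<integral>u. g N u \<partial>?M) = (\<Sum>i<Suc N. \<integral>u. indicator {s N i..<s N (Suc i)} u * ((\<Sum>k\<in>K. c k (s N i) * h k u) - r u) \<partial>?M)"
      unfolding g_def by (rule integral_sum) (rule pi)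
    also have "\<dots> \<le> (\<Sum>i<Suc N. q (s N (Suc i)) - q (s N i))"
      using s sT by (intro sum_mono step) auto
    also have "\<dots> = q (s N (Suc N)) - q (s N 0)" by (rule sum_lessThan_telescope)
    finally show ?thesis by (simp add: s)
  qed
  have gp: "g N u = (if u < \<tau> then (\<Sum>k\<in>K. c k (p N u) * h k u) - r u else 0)" if "0 < u" for N u
  proof -
    define i0 where "i0 = nat \<lfloor>u * real (Suc N) / \<tau>\<rfloor>"
    have iff: "u \<in> {s N i..<s N (Suc i)} \<longleftrightarrow> i = i0" for i
    proof -
      have "u \<in> {s N i..<s N (Suc i)} \<longleftrightarrow> real i \<le> u * real (Suc N) / \<tau> \<and> u * real (Suc N) / \<tau> < real i + 1"
        using \<tau>0 by (simp add: s_def field_simps)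
      also have "\<dots> \<longleftrightarrow> \<lfloor>u * real (Suc N) / \<tau>\<rfloor> = int i" by (simp add: floor_eq_iff)
      also have "\<dots> \<longleftrightarrow> i = i0"
        using \<open>0 < u\<close> \<tau>0 unfolding i0_def by (auto simp: nat_eq_iff le_floor_iff)
      finally show ?thesis .
    qed
    have i0: "i0 < Suc N \<longleftrightarrow> u < \<tau>"
    proof -
      have "i0 < Suc N \<longleftrightarrow> \<lfloor>u * real (Suc N) / \<tau>\<rfloor> < int (Suc N)"
        using \<open>0 < u\<close> \<tau>0 unfolding i0_def by (simp add: nat_less_iff)
      also have "\<dots> \<longleftrightarrow> u * real (Suc N) / \<tau> < real (Suc N)" by (simp add: floor_less_iff)
      also have "\<dots> \<longleftrightarrow> u < \<tau>" using \<tau>0 by (simp add: divide_less_eq mult.commute[of u])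
      finally show ?thesis .
    qed
    have "g N u = (\<Sum>i<Suc N. if i = i0 then (\<Sum>k\<in>K. c k (s N i) * h k u) - r u else 0)"
      unfolding g_def by (intro sum.cong refl) (auto simp: indicator_def iff[unfolded atLeastLessThan_iff] iff)
    also have "\<dots> = (if i0 < Suc N then (\<Sum>k\<in>K. c k (s N i0) * h k u) - r u else 0)"
      by (simp add: sum.delta)
    finally show ?thesis by (simp only: i0 p_def i0_def[symmetric])
  qed
  have pr: "0 \<le> p N u" "p N u \<le> u" "u - \<tau> / real (Suc N) \<le> p N u" if "0 < u" for N u
  proof -
    define y where "y = u * real (Suc N) / \<tau>"
    have y: "y \<ge> 0" "u = y * \<tau> / real (Suc N)" using that \<tau>0 by (auto simp: y_def)
    have py: "p N u = of_int \<lfloor>y\<rfloor> * \<tau> / real (Suc N)" unfolding p_def s_def y_def[symmetric] using y(1) by simp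
    have f: "0 \<le> (of_int \<lfloor>y\<rfloor> :: real)" "of_int \<lfloor>y\<rfloor> \<le> y" "y - 1 \<le> of_int \<lfloor>y\<rfloor>"
    proof -
      show "0 \<le> (of_int \<lfloor>y\<rfloor> :: real)" using y(1) by simp
      show "of_int \<lfloor>y\<rfloor> \<le> y" by (rule of_int_floor_le)
      show "y - 1 \<le> of_int \<lfloor>y\<rfloor>" by linarith
    qed
    show "0 \<le> p N u" using f \<tau>0 by (simp add: py)
    have "p N u \<le> y * \<tau> / real (Suc N)" unfolding py using f \<tau>0 by (intro divide_right_mono mult_right_mono) auto
    then show "p N u \<le> u" by (simp only: y(2)[symmetric])
    have "(y - 1) * \<tau> / real (Suc N) \<le> p N u" unfolding py using f \<tau>0 by (intro divide_right_mono mult_right_mono) auto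
    moreover have "(y - 1) * \<tau> / real (Suc N) = y * \<tau> / real (Suc N) - \<tau> / real (Suc N)"
      by (simp add: left_diff_distrib diff_divide_distrib)
    ultimately show "u - \<tau> / real (Suc N) \<le> p N u" by (simp only: y(2)[symmetric])
  qed
  have prT: "p N u \<in> {0..T}" if "0 < u" "u < T" for N u
    using pr(1,2)[OF that(1), of N] that(2) by simp
  have lim: "(\<lambda>N. g N u) \<longlonglongrightarrow> indicator {..<\<tau>} u * ((\<Sum>k\<in>K. c k u * h k u) - r u)" if u: "u \<in> {0<..<T}" for u
  proof (cases "u < \<tau>")
    case True
    have "(\<lambda>N. u - \<tau> / real (Suc N)) \<longlonglongrightarrow> u - 0"
      by (intro tendsto_intros) (use LIMSEQ_Suc[OF lim_const_over_n[of \<tau>]] in simp)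
    then have pl: "(\<lambda>N. p N u) \<longlonglongrightarrow> u"
      by (intro tendsto_sandwich[of "\<lambda>N. u - \<tau> / real (Suc N)" "\<lambda>N. p N u" _ "\<lambda>_. u"]) (use pr u in auto)
    have "(\<lambda>N. c k (p N u)) \<longlonglongrightarrow> c k u" if "k \<in> K" for k
      by (rule continuous_on_tendsto_compose[OF c[OF that] pl]) (use prT u in \<open>auto intro!: always_eventually\<close>)
    then have "(\<lambda>N. (\<Sum>k\<in>K. c k (p N u) * h k u) - r u) \<longlonglongrightarrow> (\<Sum>k\<in>K. c k u * h k u) - r u"
      by (intro tendsto_intros) auto
    then show ?thesis using True u by (simp add: gp)
  next
    case False
    then show ?thesis using u by (simp add: gp)
  qed
  have "\<exists>B. \<forall>t\<in>{0..T}. \<bar>c k t\<bar> \<le> B" if "k \<in> K" for k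
  proof -
    have "bounded (c k ` {0..T})" by (intro compact_imp_bounded compact_continuous_image c that) simp
    then show ?thesis by (auto simp: bounded_iff)
  qed
  then obtain B where B: "\<And>k t. k \<in> K \<Longrightarrow> t \<in> {0..T} \<Longrightarrow> \<bar>c k t\<bar> \<le> B k" by metis
  have "(\<lambda>N. \<integral>u. g N u \<partial>?M) \<longlonglongrightarrow> (\<integral>u. indicator {..<\<tau>} u * ((\<Sum>k\<in>K. c k u * h k u) - r u) \<partial>?M)"
  proof (rule integral_dominated_convergence[where w = "\<lambda>u. (\<Sum>k\<in>K. B k * \<bar>h k u\<bar>) + \<bar>r u\<bar>"])
    show gm: "g N \<in> borel_measurable ?M" for N
      unfolding g_def using pi by (intro borel_measurable_sum borel_measurable_integrable) auto
    show "integrable ?M (\<lambda>u. (\<Sum>k\<in>K. B k * \<bar>h k u\<bar>) + \<bar>r u\<bar>)"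
      using h r by (intro integrable_add integrable_sum) auto
    show l: "AE u in ?M. (\<lambda>N. g N u) \<longlonglongrightarrow> indicator {..<\<tau>} u * ((\<Sum>k\<in>K. c k u * h k u) - r u)"
      by (intro AE_I2 lim) (simp add: space_restrict_space)
    show "AE u in ?M. norm (g N u) \<le> (\<Sum>k\<in>K. B k * \<bar>h k u\<bar>) + \<bar>r u\<bar>" for N
    proof (rule AE_I2)
      fix u assume "u \<in> space ?M"
      then have u: "0 < u" "u < T" by (auto simp: space_restrict_space)
      have B0: "0 \<le> B k" if "k \<in> K" for k using B[OF that, of 0] \<tau> by simp
      have "\<bar>(\<Sum>k\<in>K. c k (p N u) * h k u) - r u\<bar> \<le> (\<Sum>k\<in>K. B k * \<bar>h k u\<bar>) + \<bar>r u\<bar>"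
      proof -
        have "\<bar>\<Sum>k\<in>K. c k (p N u) * h k u\<bar> \<le> (\<Sum>k\<in>K. \<bar>c k (p N u) * h k u\<bar>)" by (rule sum_abs)
        also have "\<dots> \<le> (\<Sum>k\<in>K. B k * \<bar>h k u\<bar>)"
          unfolding abs_mult using pr[OF u(1), of N] u B by (intro sum_mono mult_right_mono) auto
        finally show ?thesis by linarith
      qed
      moreover have "0 \<le> (\<Sum>k\<in>K. B k * \<bar>h k u\<bar>) + \<bar>r u\<bar>" using B0 by (intro add_nonneg_nonneg sum_nonneg) auto
      ultimately show "norm (g N u) \<le> (\<Sum>k\<in>K. B k * \<bar>h k u\<bar>) + \<bar>r u\<bar>" using u by (simp add: gp)
    qed
    have "\<And>u. u \<in> space ?M \<Longrightarrow> (\<lambda>N. g N u) \<longlonglongrightarrow> indicator {..<\<tau>} u * ((\<Sum>k\<in>K. c k u * h k u) - r u)"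
      by (rule lim) (simp add: space_restrict_space)
    then show "(\<lambda>u. indicator {..<\<tau>} u * ((\<Sum>k\<in>K. c k u * h k u) - r u)) \<in> borel_measurable ?M"
      using gm by (rule borel_measurable_LIMSEQ_metric[rotated])
  qed
  then show ?thesis by (rule LIMSEQ_le_const2) (use le in auto)
qed

text \<open>As r is merely integrable, the inequality is iterated instead of differentiated: against
  the weight \<open>exp (a * t)\<close> each iteration halves the bound.\<close>

lemma gronwall_zero:
  fixes r :: "real \<Rightarrow> real"
  assumes r: "integrable (ltime T) r" and nn: "AE t in ltime T. 0 \<le> r t"
    and B: "AE t in ltime T. r t \<le> B" and C: "0 \<le> C"
    and le: "AE \<tau> in ltime T. r \<tau> \<le> C * (\<integral>t. indicator {..<\<tau>} t * r t \<partial>ltime T)"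
  shows "AE t in ltime T. r t = 0"
proof -
  \<comment> \<open>Integrating the weight gains a factor 1 / a, so a \<ge> 2 C makes every
    iteration halve the bound; the summand 1 keeps a positive when C = 0.\<close>
  define a where "a = 2 * C + 1"
  have a: "a > 0" "C / a \<le> 1 / 2" using C by (auto simp: a_def field_simps)
  have bound: "AE t in ltime T. r t \<le> \<bar>B\<bar> / 2 ^ n * exp (a * t)" for n
  proof (induction n)
    case 0
    from B show ?case
    proof (rule AE_mp, intro AE_I2 impI)
      fix t assume "t \<in> space (ltime T)" "r t \<le> B"
      then have "1 \<le> exp (a * t)" using a by (simp add: space_restrict_space)
      then have "\<bar>B\<bar> * 1 \<le> \<bar>B\<bar> * exp (a * t)" by (intro mult_left_mono) auto
      then show "r t \<le> \<bar>B\<bar> / 2 ^ 0 * exp (a * t)" using \<open>r t \<le> B\<close> by simp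
    qed
  next
    case (Suc n)
    define A where "A = \<bar>B\<bar> / 2 ^ n"
    have A: "0 \<le> A" by (simp add: A_def)
    have int: "(\<integral>t. indicator {..<\<tau>} t * r t \<partial>ltime T) \<le> A * exp (a * \<tau>) / a" if "\<tau> \<in> {0<..<T}" for \<tau>
    proof -
      have em: "(\<lambda>t. A * exp (a * t) * indicator {0..\<tau>} t) \<in> borel_measurable borel" by measurable
      have ei: "integrable lborel (\<lambda>t. A * exp (a * t) * indicator {0..\<tau>} t)"
        and ev: "(\<integral>t. A * exp (a * t) * indicator {0..\<tau>} t \<partial>lborel) = A * exp (a * \<tau>) / a - A * exp (a * 0) / a"
      proof -
        have "has_bochner_integral lborel (\<lambda>t. A * exp (a * t) * indicator {0..\<tau>} t) (A * exp (a * \<tau>) / a - A * exp (a * 0) / a)"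
          using that a by (intro has_bochner_integral_FTC_Icc_real) (auto intro!: derivative_eq_intros continuous_intros)
        then show "integrable lborel (\<lambda>t. A * exp (a * t) * indicator {0..\<tau>} t)"
          "(\<integral>t. A * exp (a * t) * indicator {0..\<tau>} t \<partial>lborel) = A * exp (a * \<tau>) / a - A * exp (a * 0) / a"
          unfolding has_bochner_integral_iff by blast+
      qed
      have eT: "integrable (ltime T) (\<lambda>t. A * exp (a * t) * indicator {0..\<tau>} t)"
        "(\<integral>t. A * exp (a * t) * indicator {0..\<tau>} t \<partial>ltime T) \<le> (\<integral>t. A * exp (a * t) * indicator {0..\<tau>} t \<partial>lborel)"
      proof -
        have s: "{0<..<T} \<in> sets borel" by simp
        have i2: "integrable lborel (\<lambda>t. indicator {0<..<T} t *\<^sub>R (A * exp (a * t) * indicator {0..\<tau>} t))"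
          by (rule integrable_bound[OF ei]) (auto simp: indicator_def)
        then show "integrable (ltime T) (\<lambda>t. A * exp (a * t) * indicator {0..\<tau>} t)"
          by (subst integrable_lebesgue_on_borel[OF em s]) (simp add: integrable_restrict_space)
        show "(\<integral>t. A * exp (a * t) * indicator {0..\<tau>} t \<partial>ltime T) \<le> (\<integral>t. A * exp (a * t) * indicator {0..\<tau>} t \<partial>lborel)"
          unfolding integral_lebesgue_on_borel[OF em s]
          using i2 ei A by (subst integral_restrict_space) (auto intro!: integral_mono simp: indicator_def)
      qed
      have "(\<integral>t. indicator {..<\<tau>} t * r t \<partial>ltime T) \<le> (\<integral>t. A * exp (a * t) * indicator {0..\<tau>} t \<partial>ltime T)"
      proof (rule integral_mono_AE[OF integrable_indicator_times[OF r] eT(1)])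
        from Suc have "AE t in ltime T. r t \<le> A * exp (a * t)" by (simp add: A_def)
        then show "AE t in ltime T. indicator {..<\<tau>} t * r t \<le> A * exp (a * t) * indicator {0..\<tau>} t"
          by (rule AE_mp) (intro AE_I2 impI, use A in \<open>auto simp: indicator_def space_restrict_space\<close>)
      qed simp
      also have "\<dots> \<le> A * exp (a * \<tau>) / a" using eT(2) ev divide_nonneg_pos[OF A a(1)] by simp
      finally show ?thesis .
    qed
    from le show ?case
    proof (rule AE_mp, intro AE_I2 impI)
      fix \<tau> assume \<tau>: "\<tau> \<in> space (ltime T)" and l: "r \<tau> \<le> C * (\<integral>t. indicator {..<\<tau>} t * r t \<partial>ltime T)"
      have "\<tau> \<in> {0<..<T}" using \<tau> by (simp add: space_restrict_space)
      from order_trans[OF l mult_left_mono[OF int[OF this] C]]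
      have "r \<tau> \<le> C * (A * exp (a * \<tau>) / a)" .
      also have "\<dots> = (C / a) * (A * exp (a * \<tau>))" by simp
      also have "\<dots> \<le> (1 / 2) * (A * exp (a * \<tau>))" using a A by (intro mult_right_mono) auto
      finally show "r \<tau> \<le> \<bar>B\<bar> / 2 ^ Suc n * exp (a * \<tau>)" by (simp add: A_def)
    qed
  qed
  then have "AE t in ltime T. \<forall>n. r t \<le> \<bar>B\<bar> / 2 ^ n * exp (a * t)" by (simp add: AE_all_countable)
  with nn show ?thesis
  proof eventually_elim
    case (elim t)
    have "(\<lambda>n. (\<bar>B\<bar> * exp (a * t)) * (1 / 2) ^ n) \<longlonglongrightarrow> (\<bar>B\<bar> * exp (a * t)) * 0"
      by (intro tendsto_intros LIMSEQ_power_zero) simp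
    then have "r t \<le> 0" using elim(2) by (intro LIMSEQ_le_const[of "\<lambda>n. (\<bar>B\<bar> * exp (a * t)) * (1 / 2) ^ n"]) (auto simp: power_one_over field_simps)
    then show ?case using elim(1) by simp
  qed
qed

section \<open>Positive semidefinite matrix measures\<close>

definition spacetime_tests :: "real \<Rightarrow> (real \<times> (real^'d) \<Rightarrow> real) set" where
  "spacetime_tests T = {f. spacetime_test T f \<and> (\<forall>z. 0 \<le> f z \<and> f z \<le> 1)}"

lemma smooth_fst_compose: "smooth (f :: real \<Rightarrow> real) \<Longrightarrow> smooth (\<lambda>z :: real \<times> (real^'d). f (fst z))"
  by (rule smooth_bounded_linear_right[OF bounded_linear_fst])

lemma smooth_snd_compose: "smooth (f :: real^'d \<Rightarrow> real) \<Longrightarrow> smooth (\<lambda>z :: real \<times> (real^'d). f (snd z))"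
  by (rule smooth_bounded_linear_right[OF bounded_linear_snd])

lemma spacetime_test_bump:
  fixes g :: "real^'d \<Rightarrow> real"
  assumes "0 < a" "b < T" "smooth g" "periodic g"
  shows "spacetime_test T (\<lambda>z. bump (fst z - a) * bump (b - fst z) * g (snd z))"
  unfolding spacetime_test_def
proof (intro conjI allI)
  have "smooth (\<lambda>t. bump (t - a) * bump (b - t))"
    by (intro smooth_intros smooth_linear[OF bounded_linear_ident])
  from smooth_mult[OF smooth_fst_compose[OF this] smooth_snd_compose[OF assms(3)]]
  show "smooth (\<lambda>z :: real \<times> (real^'d). bump (fst z - a) * bump (b - fst z) * g (snd z))" .
  show "periodic (\<lambda>x. bump (fst (t, x) - a) * bump (b - fst (t, x)) * g (snd (t, x)))" for t
    using periodic_compose[OF assms(4), of "\<lambda>y. bump (t - a) * bump (b - t) * y"] by simp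
  show "\<exists>aa ba. 0 < aa \<and> ba < T \<and> (\<forall>t x. t \<notin> {aa..ba} \<longrightarrow> bump (fst (t, x) - a) * bump (b - fst (t, x)) * g (snd (t, x)) = 0)"
    using assms by (intro exI[of _ a] exI[of _ b]) (auto simp: bump_def)
qed

lemma spacetime_test_mult:
  assumes "spacetime_test T f" "smooth g" "\<And>t. periodic (\<lambda>x. g (t, x))"
  shows "spacetime_test T (\<lambda>z. f z * g z :: real)"
  unfolding spacetime_test_def
proof (intro conjI allI)
  show "smooth (\<lambda>z. f z * g z)" using assms by (intro smooth_mult) (auto simp: spacetime_test_def)
  have "periodic (\<lambda>x. f (t, x))" for t using assms by (simp add: spacetime_test_def)
  then show "periodic (\<lambda>x. f (t, x) * g (t, x))" for t using assms(3)[of t] by (simp add: periodic_def)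
  show "\<exists>a b. 0 < a \<and> b < T \<and> (\<forall>t x. t \<notin> {a..b} \<longrightarrow> f (t, x) * g (t, x) = 0)"
    using assms(1) unfolding spacetime_test_def by (metis mult_zero_left)
qed

text \<open>As for the torus, but the test functions vanish near both ends of the time interval, so
  neither constants nor functions of x alone belong to the class. Cutting off to time windows that
  exhaust (0, T) makes the time variable and the trigonometric functions of the coordinates
  measurable.\<close>

lemma generating_spacetime:
  assumes T: "T > 0"
  shows "generating (restrict_space lborel (spacetime T)) (spacetime_tests T :: (real \<times> (real^'d) \<Rightarrow> real) set)"
proof -
  let ?X = "spacetime T :: (real \<times> (real^'d)) set"
  let ?M = "restrict_space lborel ?X"
  let ?E = "{{z \<in> ?X. 0 < f z} | f. f \<in> (spacetime_tests T :: (real \<times> (real^'d) \<Rightarrow> real) set)}"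
  have spM: "space ?M = ?X" by (simp add: space_restrict_space)
  have sub: "?E \<subseteq> Pow ?X" by auto
  define S where "S = sigma ?X ?E"
  have S: "space S = ?X" "sets S = sigma_sets ?X ?E" using sub by (auto simp: S_def)
  have pos: "{z \<in> space S. 0 < f z} \<in> sets S" if "f \<in> spacetime_tests T" for f
    unfolding S using that by (intro sigma_sets.Basic) blast
  \<comment> \<open>The windows between \<open>al n\<close> and \<open>be n\<close> increase to the
    whole interval (0, T).\<close>
  define al where "al n = T / real (n + 2)" for n
  define be where "be n = T - T / real (n + 2)" for n
  have ab: "0 < al n" "be n < T" for n using T by (auto simp: al_def be_def)
  have ex: "\<exists>n. al n < t \<and> t < be n" if "0 < t" "t < T" for t
  proof -
    define m where "m = min t (T - t)"
    have m: "0 < m" "m \<le> t" "m \<le> T - t" using that by (auto simp: m_def)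
    obtain n where n: "T / m < real n" using reals_Archimedean2 by blast
    then have "T < real n * m" using m by (simp add: divide_less_eq)
    also have "\<dots> \<le> real (n + 2) * m" using m by (intro mult_right_mono) auto
    finally have "T / real (n + 2) < m" by (simp add: divide_less_eq mult.commute)
    then show ?thesis using m by (intro exI[of _ n]) (simp add: al_def be_def)
  qed
  have tst: "(\<lambda>z. bump (fst z - a) * bump (b - fst z) * bump (g (snd z) - c)) \<in> spacetime_tests T"
    if "0 < a" "b < T" "smooth g" "periodic g" for a b c and g :: "real^'d \<Rightarrow> real"
  proof -
    have s: "smooth (\<lambda>x. bump (g x - c))" by (intro smooth_intros that)
    have p: "periodic (\<lambda>x. bump (g x - c))" using periodic_compose[OF that(4), of "\<lambda>y. bump (y - c)"] by simp
    show ?thesis unfolding spacetime_tests_def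
      using spacetime_test_bump[OF that(1,2) s p] by (auto intro!: mult_le_one simp: bump_bounds)
  qed
  have tst_pos: "0 < bump (t - a) * bump (b - t) * bump y \<longleftrightarrow> a < t \<and> t < b \<and> 0 < y" for t a b y
    using bump_bounds(1)[of "t - a"] bump_bounds(1)[of "b - t"] bump_bounds(1)[of y] bump_bounds(3)[of "t - a"] bump_bounds(3)[of "b - t"] bump_bounds(3)[of y]
    by (auto simp: zero_less_mult_iff)
  have tm: "fst \<in> borel_measurable S"
  proof (rule borel_measurable_iff_greater[THEN iffD2], rule allI)
    fix c :: real
    have "{z \<in> space S. max c (al n) < fst z \<and> fst z < be n} \<in> sets S" for n
      using pos[OF tst[of "max c (al n)" "be n" "\<lambda>_. 1" 0]] ab[of n] by (simp add: tst_pos smooth_const periodic_const)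
    then have "(\<Union>n. {z \<in> space S. max c (al n) < fst z \<and> fst z < be n}) \<in> sets S" by (intro sets.countable_UN) auto
    also have "(\<Union>n. {z \<in> space S. max c (al n) < fst z \<and> fst z < be n}) = {z \<in> space S. c < fst z}"
      using ex by (fastforce simp: S)
    finally show "{w \<in> space S. c < fst w} \<in> sets S" .
  qed
  have gm: "(\<lambda>z. g (snd z)) \<in> borel_measurable S" if g: "smooth g" "periodic g" for g :: "real^'d \<Rightarrow> real"
  proof (rule borel_measurable_iff_greater[THEN iffD2], rule allI)
    fix c :: real
    have "{z \<in> space S. al n < fst z \<and> fst z < be n \<and> c < g (snd z)} \<in> sets S" for n
      using pos[OF tst[OF ab[of n] g, of c]] by (simp add: tst_pos)
    then have "(\<Union>n. {z \<in> space S. al n < fst z \<and> fst z < be n \<and> c < g (snd z)}) \<in> sets S" by (intro sets.countable_UN) auto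
    also have "(\<Union>n. {z \<in> space S. al n < fst z \<and> fst z < be n \<and> c < g (snd z)}) = {z \<in> space S. c < g (snd z)}"
      using ex by (fastforce simp: S)
    finally show "{w \<in> space S. c < g (snd w)} \<in> sets S" .
  qed
  have xm: "snd \<in> borel_measurable S"
  proof (rule borel_measurable_vecI, rule measurable_from_trig)
    fix i
    show "\<And>w. w \<in> space S \<Longrightarrow> - 1 \<le> snd w $ i \<and> snd w $ i < 1" by (auto simp: S cell_def)
    show "(\<lambda>w. cos (pi * snd w $ i)) \<in> borel_measurable S" by (rule gm[OF smooth_cos_nth periodic_cos_nth])
    show "(\<lambda>w. sin (pi * snd w $ i)) \<in> borel_measurable S" by (rule gm[OF smooth_sin_nth periodic_sin_nth])
  qed
  have id: "(\<lambda>z. z) \<in> borel_measurable S"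
  proof -
    have "(\<lambda>z. (fst z, snd z)) \<in> S \<rightarrow>\<^sub>M borel \<Otimes>\<^sub>M borel" using tm xm by (intro measurable_Pair) auto
    then show ?thesis by (simp add: borel_prod)
  qed
  have fm: "f \<in> borel_measurable ?M" if "f \<in> spacetime_tests T" for f
    using that by (intro measurable_restrict_space1)
      (auto simp: spacetime_tests_def spacetime_test_def intro!: borel_measurable_continuous_onI smooth_continuous_on)
  have "sets ?M = sets S"
  proof
    show "sets ?M \<subseteq> sets S"
    proof
      fix A assume "A \<in> sets ?M"
      then have A: "A \<in> sets borel" "A \<subseteq> ?X" by (auto simp: sets_restrict_space_iff)
      have "(\<lambda>x. x) -` A \<inter> space S \<in> sets S" using id A(1) by (rule measurable_sets)
      then show "A \<in> sets S" using A(2) by (simp add: S Int_absorb2)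
    qed
    show "sets S \<subseteq> sets ?M"
    proof -
      have "?E \<subseteq> sets ?M"
      proof clarify
        fix f :: "real \<times> (real^'d) \<Rightarrow> real" assume "f \<in> spacetime_tests T"
        then have [measurable]: "f \<in> borel_measurable ?M" by (rule fm)
        have "{z \<in> space ?M. 0 < f z} \<in> sets ?M" by measurable
        then show "{z \<in> ?X. 0 < f z} \<in> sets ?M" by (simp only: spM)
      qed
      from sets.sigma_sets_subset[OF this] show ?thesis by (simp only: S spM)
    qed
  qed
  moreover have "(\<lambda>z. f z * g z) \<in> spacetime_tests T" if "f \<in> spacetime_tests T" "g \<in> spacetime_tests T" for f g :: "real \<times> (real^'d) \<Rightarrow> real"
  proof -
    have "spacetime_test T (\<lambda>z. f z * g z)"
      using that by (intro spacetime_test_mult) (auto simp: spacetime_tests_def spacetime_test_def)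
    then show ?thesis using that by (auto simp: spacetime_tests_def intro: mult_le_one)
  qed
  moreover have "(\<lambda>z. 1 - (1 - f z) ^ m) \<in> spacetime_tests T" if fs: "f \<in> spacetime_tests T" for f :: "real \<times> (real^'d) \<Rightarrow> real" and m
  proof -
    have f: "smooth f" "\<And>t. periodic (\<lambda>x. f (t, x))" "\<And>z. 0 \<le> f z" "\<And>z. f z \<le> 1"
      using fs by (auto simp: spacetime_tests_def spacetime_test_def)
    obtain a b where ab: "0 < a" "b < T" "\<And>t x. t \<notin> {a..b} \<Longrightarrow> f (t, x) = 0"
      using fs unfolding spacetime_tests_def spacetime_test_def by blast
    have "spacetime_test T (\<lambda>z. 1 - (1 - f z) ^ m)"
      unfolding spacetime_test_def
    proof (intro conjI allI)
      show "smooth (\<lambda>z. 1 - (1 - f z) ^ m)" by (intro smooth_intros f)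
      show "periodic (\<lambda>x. 1 - (1 - f (t, x)) ^ m)" for t using f(2)[of t] by (simp add: periodic_def)
      show "\<exists>a b. 0 < a \<and> b < T \<and> (\<forall>t x. t \<notin> {a..b} \<longrightarrow> 1 - (1 - f (t, x)) ^ m = 0)"
        using ab by (intro exI[of _ a] exI[of _ b]) auto
    qed
    then show ?thesis using f by (auto simp: spacetime_tests_def power_le_one)
  qed
  moreover have "\<exists>F::nat \<Rightarrow> (real \<times> (real^'d) \<Rightarrow> real). range F \<subseteq> spacetime_tests T \<and> (\<Union>k. {z \<in> ?X. 0 < F k z}) = ?X"
  proof (intro exI[of _ "\<lambda>n z. bump (fst z - al n) * bump (be n - fst z) * bump (1 - 0)"] conjI)
    show "range (\<lambda>n (z :: real \<times> (real^'d)). bump (fst z - al n) * bump (be n - fst z) * bump (1 - 0)) \<subseteq> spacetime_tests T"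
      by (rule image_subsetI) (rule tst[OF ab smooth_const periodic_const])
    show "(\<Union>k. {z \<in> ?X. 0 < bump (fst z - al k) * bump (be k - fst z) * bump (1 - 0)}) = ?X"
      unfolding tst_pos using ex by fastforce
  qed
  ultimately show ?thesis
    using fm by (simp add: generating_def spM S(2)) (auto simp: spacetime_tests_def)
qed

lemma signed_integral_cong_sets:
  assumes "\<And>A. A \<in> sets M \<Longrightarrow> m A = m' A" shows "signed_integral M m f = signed_integral M m' f"
proof -
  have "jordan_pos M m = jordan_pos M m'" "jordan_pos M (\<lambda>A. - m A) = jordan_pos M (\<lambda>A. - m' A)"
    unfolding jordan_pos_def using assms
    by (auto intro!: arg_cong[of _ _ "measure_of (space M) (sets M)"] SUP_cong simp: fun_eq_iff)
  then show ?thesis by (simp add: signed_integral_def)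
qed

lemma matrix_measure_component:
  assumes "vector_measure M \<mu>" shows "vector_measure M (\<lambda>A. (\<mu> A :: real^'d^'d) $ i $ j)"
  by (rule vector_measure_linear[OF assms])
     (rule bounded_linear_compose[OF bounded_linear_vec_nth bounded_linear_vec_nth])

lemma smooth_borel_on:
  fixes \<phi> :: "real^'d \<Rightarrow> real"
  assumes "smooth \<phi>" shows "\<phi> \<in> borel_measurable (borel_on cell)"
  using smooth_measurable[OF assms] by (rule measurable_restrict_space1)

lemma space_borel_on: "space (borel_on X) = X" by (simp add: space_restrict_space)

section \<open>Pairings with a positive semidefinite matrix measure\<close>

locale psd =
  fixes \<mu> :: "(real^'d) set \<Rightarrow> real^'d^'d"
  assumes psd: "psd_measure \<mu>"
begin

definition pairing :: "'d \<Rightarrow> 'd \<Rightarrow> (real^'d \<Rightarrow> real) \<Rightarrow> real" where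
  "pairing i j \<phi> = signed_integral (borel_on cell) (\<lambda>A. \<mu> A $ i $ j) \<phi>"

lemma vm: "vector_measure (borel_on cell) (\<lambda>A. \<mu> A $ i $ j)"
  using psd by (intro matrix_measure_component) (simp add: psd_measure_def sym_matrix_measure_def)

lemma pairing_sym: "pairing i j \<phi> = pairing j i \<phi>"
  unfolding pairing_def
proof (rule signed_integral_cong_sets)
  fix A :: "(real^'d) set" assume "A \<in> sets (borel_on cell)"
  then have "transpose (\<mu> A) = \<mu> A" using psd by (auto simp: psd_measure_def sym_matrix_measure_def sym_mats_def)
  then have "transpose (\<mu> A) $ i $ j = \<mu> A $ i $ j" by simp
  then show "\<mu> A $ i $ j = \<mu> A $ j $ i" by (simp add: transpose_def)
qed

lemma pairing_linear:
  assumes "smooth \<phi>" "periodic \<phi>" "smooth \<psi>" "periodic \<psi>"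
  shows "pairing i j (\<lambda>x. a * \<phi> x + b * \<psi> x) = a * pairing i j \<phi> + b * pairing i j \<psi>"
proof -
  obtain B C where "\<And>x. \<bar>\<phi> x\<bar> \<le> B" "\<And>x. \<bar>\<psi> x\<bar> \<le> C"
    using periodic_continuous_bounded[OF smooth_continuous_on[OF assms(1)] assms(2)]
      periodic_continuous_bounded[OF smooth_continuous_on[OF assms(3)] assms(4)] by metis
  then show ?thesis unfolding pairing_def
    by (intro signed_integral_linear[OF vm, of _ B _ C] smooth_borel_on assms) auto
qed

lemma pairing_cmult: "smooth \<phi> \<Longrightarrow> periodic \<phi> \<Longrightarrow> pairing i j (\<lambda>x. a * \<phi> x) = a * pairing i j \<phi>"
  using pairing_linear[of \<phi> \<phi> i j a 0] by simp

lemma pairing_const: "pairing i j (\<lambda>_. c) = c * \<mu> cell $ i $ j"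
  unfolding pairing_def by (subst signed_integral_const[OF vm]) (simp add: space_borel_on)

lemma quadratic_nonneg:
  assumes "smooth \<phi>" "periodic \<phi>" "\<And>x. 0 \<le> \<phi> x"
  shows "0 \<le> (\<Sum>a\<in>UNIV. \<Sum>b\<in>UNIV. \<xi> $ a * (\<xi> $ b * pairing a b \<phi>))"
proof -
  have "0 \<le> matrix_integral (borel_on cell) \<mu> (\<lambda>x. \<phi> x *\<^sub>R outer \<xi> \<xi>)"
    using psd assms by (simp add: psd_measure_def)
  also have "\<dots> = (\<Sum>a\<in>UNIV. \<Sum>b\<in>UNIV. pairing a b (\<lambda>x. (\<xi> $ a * \<xi> $ b) * \<phi> x))"
    by (simp add: matrix_integral_def pairing_def outer_def mult.commute)
  also have "\<dots> = (\<Sum>a\<in>UNIV. \<Sum>b\<in>UNIV. \<xi> $ a * (\<xi> $ b * pairing a b \<phi>))"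
    by (simp only: pairing_cmult[OF assms(1,2)]) (simp only: mult.assoc)
  finally show ?thesis .
qed

text \<open>Polarisation: s = 0 reads off the diagonal entries, s = 1 and s = -1 the mixed
  ones.\<close>

lemma quadratic_axis:
  "(\<Sum>a\<in>UNIV. \<Sum>b\<in>UNIV. (axis i 1 + s *\<^sub>R axis j 1) $ a * ((axis i 1 + s *\<^sub>R axis j 1) $ b * P a b)) =
    P i i + s * P i j + s * P j i + s * s * (P j j :: real)"
proof -
  have 1: "(\<Sum>b\<in>UNIV. (axis i 1 + s *\<^sub>R axis j 1) $ b * Q b) = Q i + s * (Q j :: real)" for Q
  proof -
    have "(\<Sum>b\<in>UNIV. (axis i 1 + s *\<^sub>R axis j 1) $ b * Q b) = (\<Sum>b\<in>UNIV. (if b = i then Q b else 0) + (if b = j then s * Q b else 0))"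
      by (intro sum.cong refl) (auto simp: axis_def distrib_right)
    then show ?thesis by (simp add: sum.distrib)
  qed
  show ?thesis unfolding sum_distrib_left[symmetric] 1 by (simp add: algebra_simps)
qed

lemma diag_nonneg: "0 \<le> \<mu> cell $ i $ i"
proof -
  have "0 \<le> (\<Sum>a\<in>UNIV. \<Sum>b\<in>UNIV. (axis i 1 + 0 *\<^sub>R axis i 1) $ a * ((axis i 1 + 0 *\<^sub>R axis i 1) $ b * pairing a b (\<lambda>_. 1)))"
    by (intro quadratic_nonneg) (auto simp: smooth_const periodic_const)
  also have "\<dots> = \<mu> cell $ i $ i" unfolding quadratic_axis by (simp add: pairing_const)
  finally show ?thesis .
qed

lemma trace_nonneg: "0 \<le> trace (\<mu> cell)"
  unfolding trace_def by (intro sum_nonneg diag_nonneg)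

lemma diag_le_trace: "\<mu> cell $ i $ i \<le> trace (\<mu> cell)"
  unfolding trace_def by (rule member_le_sum) (auto simp: diag_nonneg)

text \<open>The test function \<open>\<phi> (e\<^sub>i \<otimes> e\<^sub>j + e\<^sub>j \<otimes> e\<^sub>i) + K (e\<^sub>i \<otimes> e\<^sub>i + e\<^sub>j \<otimes> e\<^sub>j)\<close> is the combination of
  \<open>(e\<^sub>i + e\<^sub>j) \<otimes> (e\<^sub>i + e\<^sub>j)\<close> and \<open>(e\<^sub>i - e\<^sub>j) \<otimes> (e\<^sub>i - e\<^sub>j)\<close> with the nonnegative weights
  \<open>(K + \<phi>) / 2\<close> and \<open>(K - \<phi>) / 2\<close>.\<close>

lemma pairing_lower:
  assumes \<phi>: "smooth \<phi>" "periodic \<phi>" "\<And>x. \<bar>\<phi> x\<bar> \<le> K"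
  shows "- (K * trace (\<mu> cell)) \<le> pairing i j \<phi>"
proof -
  have K: "0 \<le> K" using \<phi>(3)[of 0] by simp
  have sp: "smooth (\<lambda>x. (K / 2) * 1 + s * \<phi> x)" "periodic (\<lambda>x. (K / 2) * 1 + s * \<phi> x)" for s
    using \<phi> by (auto intro!: smooth_intros periodic_compose[of \<phi>])
  have q: "0 \<le> (\<Sum>a\<in>UNIV. \<Sum>b\<in>UNIV. (axis i 1 + s *\<^sub>R axis j 1) $ a * ((axis i 1 + s *\<^sub>R axis j 1) $ b * pairing a b (\<lambda>x. (K / 2) * 1 + (s / 2) * \<phi> x)))"
    if "s = 1 \<or> s = -1" for s
  proof (rule quadratic_nonneg[OF sp])
    show "0 \<le> K / 2 * 1 + s / 2 * \<phi> x" for x using \<phi>(3)[of x] that by (auto simp: abs_le_iff)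
  qed
  have lin: "pairing a b (\<lambda>x. (K / 2) * 1 + (s / 2) * \<phi> x) = (K / 2) * \<mu> cell $ a $ b + (s / 2) * pairing a b \<phi>" for a b s
    using pairing_linear[of "\<lambda>_. 1" \<phi> a b "K / 2" "s / 2"] \<phi> by (simp add: smooth_const periodic_const pairing_const)
  have "0 \<le> K * (\<mu> cell $ i $ i + \<mu> cell $ j $ j) + 2 * pairing i j \<phi>"
    using add_nonneg_nonneg[OF q[of 1] q[of "-1"]] pairing_sym[of j i \<phi>]
    unfolding quadratic_axis lin by (simp add: algebra_simps)
  moreover have "K * (\<mu> cell $ i $ i + \<mu> cell $ j $ j) \<le> K * (2 * trace (\<mu> cell))"
    using diag_le_trace[of i] diag_le_trace[of j] K by (intro mult_left_mono) auto
  ultimately show ?thesis by (simp add: algebra_simps)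
qed

lemma pairing_bound:
  assumes \<phi>: "smooth \<phi>" "periodic \<phi>" "\<And>x. \<bar>\<phi> x\<bar> \<le> K"
  shows "\<bar>pairing i j \<phi>\<bar> \<le> K * trace (\<mu> cell)"
proof -
  have "- (K * trace (\<mu> cell)) \<le> pairing i j (\<lambda>x. (-1) * \<phi> x)"
  proof (rule pairing_lower)
    show "smooth (\<lambda>x. (-1) * \<phi> x)" by (rule smooth_mult[OF smooth_const \<phi>(1)])
    show "periodic (\<lambda>x. (-1) * \<phi> x)" using periodic_compose[OF \<phi>(2), of "\<lambda>y. (-1) * y"] by simp
    show "\<bar>(-1) * \<phi> x\<bar> \<le> K" for x using \<phi>(3)[of x] by simp
  qed
  then have "pairing i j \<phi> \<le> K * trace (\<mu> cell)" using pairing_cmult[OF \<phi>(1,2), of i j "-1"] by simp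
  with pairing_lower[OF \<phi>, of i j] show ?thesis by simp
qed

text \<open>By \<open>pairing_bound\<close> all entries integrate the smooth test functions to zero,
  and these integrals determine a signed measure.\<close>

lemma zero_of_trace:
  assumes "trace (\<mu> cell) = 0" "A \<in> sets (borel_on cell)"
  shows "\<mu> A = 0"
proof -
  have "\<mu> A $ i $ j = (\<integral>x. indicator A x * 0 \<partial>torus)" for i j
  proof (rule generating_signed_eqI[OF generating_torus torus.finite_measure_axioms sets_torus vm _ _ assms(2)])
    fix f :: "real^'d \<Rightarrow> real" assume f: "f \<in> torus_tests"
    have "\<bar>pairing i j f\<bar> \<le> 1 * trace (\<mu> cell)"
      using f by (intro pairing_bound) (auto simp: torus_tests_def)
    then show "signed_integral (borel_on cell) (\<lambda>A. \<mu> A $ i $ j) f = (\<integral>x. f x * 0 \<partial>torus)"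
      using assms(1) by (simp add: pairing_def)
  qed simp
  then show ?thesis by (simp add: vec_eq_iff)
qed

lemma matrix_integral_pairing: "matrix_integral (borel_on cell) \<mu> \<Phi> = (\<Sum>i\<in>UNIV. \<Sum>j\<in>UNIV. pairing i j (\<lambda>x. \<Phi> x $ i $ j))"
  by (simp add: matrix_integral_def pairing_def)

lemma matrix_integral_lower:
  assumes "\<And>i j. smooth (\<lambda>x. \<Phi> x $ i $ j)" "\<And>i j. periodic (\<lambda>x. \<Phi> x $ i $ j)" "\<And>i j x. \<bar>\<Phi> x $ i $ j\<bar> \<le> K"
  shows "\<bar>matrix_integral (borel_on cell) \<mu> \<Phi>\<bar> \<le> real CARD('d) * real CARD('d) * K * trace (\<mu> cell)"
proof -
  have "\<bar>matrix_integral (borel_on cell) \<mu> \<Phi>\<bar> \<le> (\<Sum>i\<in>UNIV. \<Sum>j\<in>UNIV. \<bar>pairing i j (\<lambda>x. \<Phi> x $ i $ j)\<bar>)"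
    unfolding matrix_integral_pairing by (intro order_trans[OF sum_abs] sum_mono sum_abs)
  also have "\<dots> \<le> (\<Sum>i\<in>(UNIV::'d set). \<Sum>j\<in>(UNIV::'d set). K * trace (\<mu> cell))"
    by (intro sum_mono pairing_bound assms)
  finally show ?thesis by (simp add: mult_ac)
qed

text \<open>Measurability in time is provided only for symmetric test fields, whereas the velocity
  gradients paired with the defect are not symmetric.\<close>

lemma matrix_integral_sym_part:
  assumes "\<And>i j. smooth (\<lambda>x. \<Phi> x $ i $ j)" "\<And>i j. periodic (\<lambda>x. \<Phi> x $ i $ j)"
  shows "matrix_integral (borel_on cell) \<mu> (\<lambda>x. (1 / 2) *\<^sub>R (\<Phi> x + transpose (\<Phi> x))) = matrix_integral (borel_on cell) \<mu> \<Phi>"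
proof -
  have "matrix_integral (borel_on cell) \<mu> (\<lambda>x. (1 / 2) *\<^sub>R (\<Phi> x + transpose (\<Phi> x))) =
      (\<Sum>i\<in>UNIV. \<Sum>j\<in>UNIV. pairing i j (\<lambda>x. (1/2) * (\<Phi> x $ i $ j) + (1/2) * (\<Phi> x $ j $ i)))"
    unfolding matrix_integral_pairing by (simp add: transpose_def distrib_left)
  also have "\<dots> = (\<Sum>i\<in>UNIV. \<Sum>j\<in>UNIV. (1/2) * pairing i j (\<lambda>x. \<Phi> x $ i $ j) + (1/2) * pairing j i (\<lambda>x. \<Phi> x $ j $ i))"
    by (intro sum.cong refl) (simp only: pairing_linear[OF assms assms] pairing_sym)
  also have "\<dots> = (1/2) * matrix_integral (borel_on cell) \<mu> \<Phi> + (1/2) * (\<Sum>i\<in>UNIV. \<Sum>j\<in>UNIV. pairing j i (\<lambda>x. \<Phi> x $ j $ i))"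
    by (simp add: matrix_integral_pairing sum.distrib sum_distrib_left)
  also have "(\<Sum>i\<in>UNIV. \<Sum>j\<in>UNIV. pairing j i (\<lambda>x. \<Phi> x $ j $ i)) = matrix_integral (borel_on cell) \<mu> \<Phi>"
    unfolding matrix_integral_pairing by (rule sum.swap)
  finally show ?thesis by simp
qed

end

section \<open>Defect measures depending on time\<close>

lemma borel_measurable_lebesgue_on_AE:
  fixes f g :: "'a::euclidean_space \<Rightarrow> real"
  assumes f: "f \<in> borel_measurable (lebesgue_on A)" and eq: "AE x in lebesgue_on A. f x = g x" and A: "A \<in> sets borel"
  shows "g \<in> borel_measurable (lebesgue_on A)"
proof -
  have "(\<lambda>x. indicator A x *\<^sub>R f x) \<in> borel_measurable lebesgue"
    using f A by (subst (asm) borel_measurable_restrict_space_iff) auto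
  moreover have "AE x in lebesgue. x \<in> A \<longrightarrow> f x = g x" using eq A by (simp add: AE_restrict_space_iff)
  then have "AE x in lebesgue. indicator A x *\<^sub>R f x = indicator A x *\<^sub>R g x"
    by eventually_elim (auto simp: indicator_def)
  ultimately have "(\<lambda>x. indicator A x *\<^sub>R g x) \<in> borel_measurable lebesgue" by (rule borel_measurable_AE)
  then show ?thesis using A by (subst borel_measurable_restrict_space_iff) auto
qed

lemma Linf_trace:
  fixes R :: "real \<Rightarrow> (real^'d) set \<Rightarrow> real^'d^'d"
  assumes R: "Linf_psd_measures T R"
  obtains B where "AE t in ltime T. psd_measure (R t) \<and> 0 \<le> trace (R t cell) \<and> trace (R t cell) \<le> B"
    "integrable (ltime T) (\<lambda>t. trace (R t cell))"
proof -
  have psd: "AE t in ltime T. psd_measure (R t)" using R by (simp add: Linf_psd_measures_def)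
  obtain C where C: "AE t in ltime T. variation (borel_on cell) (R t) cell \<le> ennreal C"
    using R by (auto simp: Linf_psd_measures_def)
  define B where "B = real CARD('d) * max C 0"
  have ub: "AE t in ltime T. psd_measure (R t) \<and> 0 \<le> trace (R t cell) \<and> trace (R t cell) \<le> B"
    using psd C
  proof eventually_elim
    case (elim t)
    interpret psd "R t" by standard (rule elim)
    have "cell \<in> sets (borel_on (cell :: (real^'d) set))" using sets.top[of "borel_on cell"] by (simp add: space_borel_on)
    then have "(\<Sum>X\<in>{cell}. ennreal (norm (R t X))) \<le> variation (borel_on cell) (R t) cell"
      unfolding variation_def by (intro SUP_upper) (auto simp: disjoint_def)
    then have "ennreal (norm (R t cell)) \<le> ennreal C" using elim(2) by simp
    then have n: "norm (R t cell) \<le> max C 0" by (auto simp: ennreal_le_iff2 le_max_iff_disj)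
    have "R t cell $ i $ i \<le> max C 0" for i
      using component_le_norm_cart[of "R t cell $ i" i] Finite_Cartesian_Product.norm_nth_le[of "R t cell" i] n by linarith
    then have "trace (R t cell) \<le> (\<Sum>i\<in>(UNIV::'d set). max C 0)" unfolding trace_def by (intro sum_mono)
    then show ?case using elim(1) trace_nonneg by (simp add: B_def)
  qed
  \<comment> \<open>The trace is the pairing with the constant identity field, a symmetric test
    field, and so it is measurable in time.\<close>
  have "(\<lambda>t. matrix_integral (borel_on cell) (R t) (\<lambda>x. mat 1)) \<in> borel_measurable (ltime T)"
    using R by (auto simp: Linf_psd_measures_def sym_mats_def periodic_const)
  moreover have "AE t in ltime T. matrix_integral (borel_on cell) (R t) (\<lambda>x. mat 1) = trace (R t cell)"
    using psd
  proof eventually_elim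
    case (elim t)
    interpret psd "R t" by standard (rule elim)
    show ?case unfolding matrix_integral_pairing pairing_const
      by (simp add: mat_def trace_def if_distrib[of "\<lambda>c. c * _"] sum.delta cong: if_cong)
  qed
  ultimately have m: "(\<lambda>t. trace (R t cell)) \<in> borel_measurable (ltime T)"
    by (rule borel_measurable_lebesgue_on_AE) simp
  have "integrable (times T) (\<lambda>t. \<bar>B\<bar> :: real)" by (rule times.integrable_const)
  then have c: "integrable (ltime T) (\<lambda>t. \<bar>B\<bar> :: real)"
    using integrable_lebesgue_on_borel[of "\<lambda>_. \<bar>B\<bar>" "{0<..<T}"] by simp
  have "integrable (ltime T) (\<lambda>t. trace (R t cell))"
  proof (rule integrable_bound[OF c m])
    from ub show "AE t in ltime T. norm (trace (R t cell)) \<le> norm \<bar>B\<bar>" by eventually_elim simp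
  qed
  with ub show ?thesis by (rule that)
qed

lemma Linf_matrix_integral:
  fixes R :: "real \<Rightarrow> (real^'d) set \<Rightarrow> real^'d^'d"
  assumes R: "Linf_psd_measures T R"
    and \<Phi>: "\<And>i j. smooth (\<lambda>x. \<Phi> x $ i $ j)" "\<And>i j. periodic (\<lambda>x. \<Phi> x $ i $ j)" "\<And>i j x. \<bar>\<Phi> x $ i $ j\<bar> \<le> K"
  shows "integrable (ltime T) (\<lambda>t. matrix_integral (borel_on cell) (R t) \<Phi>)"
    and "AE t in ltime T. \<bar>matrix_integral (borel_on cell) (R t) \<Phi>\<bar> \<le> real CARD('d) * real CARD('d) * K * trace (R t cell)"
proof -
  have psd: "AE t in ltime T. psd_measure (R t)" using R by (simp add: Linf_psd_measures_def)
  obtain B where B: "integrable (ltime T) (\<lambda>t. trace (R t cell))" using Linf_trace[OF R] by blast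
  from psd show b: "AE t in ltime T. \<bar>matrix_integral (borel_on cell) (R t) \<Phi>\<bar> \<le> real CARD('d) * real CARD('d) * K * trace (R t cell)"
  proof eventually_elim
    case (elim t)
    interpret psd "R t" by standard (rule elim)
    show ?case by (rule matrix_integral_lower[OF \<Phi>])
  qed
  have cont: "continuous_on UNIV (\<lambda>x. (1 / 2) *\<^sub>R (\<Phi> x + transpose (\<Phi> x)))"
  proof -
    have "continuous_on UNIV (\<lambda>x. \<chi> i j. (1 / 2) * (\<Phi> x $ i $ j + \<Phi> x $ j $ i))"
      by (intro continuous_on_vec_lambda continuous_intros smooth_continuous_on \<Phi>)
    moreover have "(\<lambda>x. \<chi> i j. (1 / 2) * (\<Phi> x $ i $ j + \<Phi> x $ j $ i)) = (\<lambda>x. (1 / 2) *\<^sub>R (\<Phi> x + transpose (\<Phi> x)))"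
      by (simp add: fun_eq_iff vec_eq_iff transpose_def)
    ultimately show ?thesis by (simp only:)
  qed
  have "periodic \<Phi>" using \<Phi>(2) by (simp add: periodic_def vec_eq_iff)
  then have per: "periodic (\<lambda>x. (1 / 2) *\<^sub>R (\<Phi> x + transpose (\<Phi> x)))" by (rule periodic_compose)
  have "range (\<lambda>x. (1 / 2) *\<^sub>R (\<Phi> x + transpose (\<Phi> x))) \<subseteq> sym_mats"
    by (auto simp: sym_mats_def vec_eq_iff transpose_def add.commute)
  then have "(\<lambda>t. matrix_integral (borel_on cell) (R t) (\<lambda>x. (1 / 2) *\<^sub>R (\<Phi> x + transpose (\<Phi> x)))) \<in> borel_measurable (ltime T)"
    using R cont per by (simp add: Linf_psd_measures_def)
  moreover have "AE t in ltime T. matrix_integral (borel_on cell) (R t) (\<lambda>x. (1 / 2) *\<^sub>R (\<Phi> x + transpose (\<Phi> x))) = matrix_integral (borel_on cell) (R t) \<Phi>"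
    using psd
  proof eventually_elim
    case (elim t)
    interpret psd "R t" by standard (rule elim)
    show ?case by (rule matrix_integral_sym_part[OF \<Phi>(1,2)])
  qed
  ultimately have m: "(\<lambda>t. matrix_integral (borel_on cell) (R t) \<Phi>) \<in> borel_measurable (ltime T)"
    by (rule borel_measurable_lebesgue_on_AE) simp
  have i: "integrable (ltime T) (\<lambda>t. real CARD('d) * real CARD('d) * K * trace (R t cell))"
    using B by (rule integrable_mult_right)
  show "integrable (ltime T) (\<lambda>t. matrix_integral (borel_on cell) (R t) \<Phi>)"
  proof (rule integrable_bound[OF i m])
    from b show "AE t in ltime T. norm (matrix_integral (borel_on cell) (R t) \<Phi>) \<le> norm (real CARD('d) * real CARD('d) * K * trace (R t cell))"
      by eventually_elim simp
  qed
qed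

section \<open>Flows with bounded gradient\<close>

lemma has_derivative_vec:
  assumes "\<And>i. ((\<lambda>x. f x $ i) has_derivative (\<lambda>h. f' h $ i)) F"
  shows "((f :: 'a::real_normed_vector \<Rightarrow> real^'d) has_derivative f') F"
proof -
  have "((\<lambda>x. \<Sum>i\<in>UNIV. (f x $ i) *\<^sub>R axis i (1::real)) has_derivative (\<lambda>h. \<Sum>i\<in>UNIV. (f' h $ i) *\<^sub>R axis i 1)) F"
    by (intro has_derivative_sum has_derivative_scaleR_left assms)
  moreover have "(\<Sum>i\<in>UNIV. (u $ i) *\<^sub>R axis i (1::real)) = u" for u :: "real^'d"
    using basis_expansion[of u] by (simp only: scalar_mult_eq_scaleR)
  ultimately show ?thesis by simp
qed

lemma linear_axis_expand:
  assumes "linear (L :: real^'d \<Rightarrow> real)"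
  shows "L h = (\<Sum>j\<in>UNIV. h $ j * L (axis j 1))"
proof -
  have h: "h = (\<Sum>j\<in>UNIV. h $ j *\<^sub>R axis j 1)"
    using basis_expansion[of h, symmetric] by (simp only: scalar_mult_eq_scaleR)
  show ?thesis by (subst h) (simp only: linear_sum[OF assms] linear_scale[OF assms] real_scaleR_def)
qed

lemma C1_torus_stationary:
  fixes V :: "real^'d \<Rightarrow> real^'d"
  assumes V: "\<And>i. smooth (\<lambda>x. V x $ i)" "\<And>i. periodic (\<lambda>x. V x $ i)"
  shows "C1_torus T (\<lambda>t. V) (\<lambda>t x. 0) (\<lambda>j t x. \<chi> i. partial j (\<lambda>x. V x $ i) x)"
  unfolding C1_torus_def
proof (intro conjI ballI allI)
  show "periodic V" using V(2) by (simp add: periodic_def vec_eq_iff)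
  show "continuous_on ({0..T} \<times> UNIV) (\<lambda>(t, x). 0)" by (simp add: case_prod_beta)
  show "continuous_on ({0..T} \<times> UNIV) (\<lambda>(t, x). \<chi> i. partial j (\<lambda>x. V x $ i) x)" for j
    unfolding case_prod_beta
    by (intro continuous_on_vec_lambda continuous_on_compose2[OF smooth_continuous_on[OF smooth_has_derivative(2)[OF V(1)], of UNIV] continuous_on_snd[OF continuous_on_id]]) auto
  fix t x
  have "((\<lambda>z. V (snd z)) has_derivative (\<lambda>z. \<Sum>j\<in>UNIV. snd z $ j *\<^sub>R (\<chi> i. partial j (\<lambda>x. V x $ i) x)))
      (at (t, x) within {0..T} \<times> UNIV)"
  proof (rule has_derivative_vec)
    fix i
    have lin: "linear (frechet_derivative (\<lambda>x. V x $ i) (at x))"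
      using smooth_has_derivative(1)[OF V(1)] has_derivative_linear by blast
    have "((\<lambda>x. V x $ i) has_derivative frechet_derivative (\<lambda>x. V x $ i) (at x)) (at (snd (t, x)))"
      using smooth_has_derivative(1)[OF V(1)] by simp
    from has_derivative_compose[OF has_derivative_snd[OF has_derivative_ident] this]
    have "((\<lambda>z. V (snd z) $ i) has_derivative (\<lambda>z. frechet_derivative (\<lambda>x. V x $ i) (at x) (snd z))) (at (t, x) within {0..T} \<times> UNIV)"
      by simp
    then show "((\<lambda>z. V (snd z) $ i) has_derivative (\<lambda>z. (\<Sum>j\<in>UNIV. snd z $ j *\<^sub>R (\<chi> i. partial j (\<lambda>x. V x $ i) x)) $ i)) (at (t, x) within {0..T} \<times> UNIV)"
      by (subst (asm) linear_axis_expand[OF lin]) simp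
  qed
  then show "((\<lambda>(s, y). V y) has_derivative (\<lambda>(s, y). s *\<^sub>R 0 + (\<Sum>j\<in>UNIV. y $ j *\<^sub>R (\<chi> i. partial j (\<lambda>x. V x $ i) x))))
      (at (t, x) within {0..T} \<times> UNIV)"
    by (simp add: case_prod_beta')
qed

text \<open>What remains of the regularity class are bounds and integrability. The weak derivatives
  \<open>w\<close> are required at every time, because partition points and the initial time are
  individual times.\<close>

locale regular_flow =
  fixes T K :: real and v0 :: "real^'d \<Rightarrow> real^'d" and v :: "real \<Rightarrow> real^'d \<Rightarrow> real^'d"
    and S :: "real \<Rightarrow> real^'d \<Rightarrow> real^'d^'d" and R :: "real \<Rightarrow> (real^'d) set \<Rightarrow> real^'d^'d"
    and w :: "'d \<Rightarrow> real \<Rightarrow> real^'d \<Rightarrow> real^'d"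
  assumes T: "0 < T" and K: "0 \<le> K"
    and weak: "C_weak_L2 T v"
    and bound: "\<And>t. t \<in> {0..T} \<Longrightarrow> AE x in torus. \<forall>i. \<bar>v t x $ i\<bar> \<le> K \<and> (\<forall>j. \<bar>w j t x $ i\<bar> \<le> K)"
    and wp: "\<And>j t. t \<in> {0..T} \<Longrightarrow> has_weak_partial j (v t) (w j t)"
    and v1: "\<And>i. integrable (lst T) (\<lambda>z. v (fst z) (snd z) $ i)"
    and vv: "\<And>i j. integrable (lst T) (\<lambda>z. v (fst z) (snd z) $ i * v (fst z) (snd z) $ j)"
    and Sint: "\<And>i j. integrable (lst T) (\<lambda>z. S (fst z) (snd z) $ i $ j)"
    and Sper: "\<And>t. t \<in> {0<..<T} \<Longrightarrow> periodic (S t)"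
    and Rinf: "Linf_psd_measures T R"
    and incomp: "incompressible T v"
    and mom: "momentum_equation T v0 v S R"
begin

lemma vint: "t \<in> {0..T} \<Longrightarrow> integrable lcell (\<lambda>x. v t x $ i)"
  and wint: "t \<in> {0..T} \<Longrightarrow> integrable lcell (\<lambda>x. w j t x $ i)"
  and vper: "t \<in> {0..T} \<Longrightarrow> periodic (\<lambda>x. v t x $ i)"
  and wper: "t \<in> {0..T} \<Longrightarrow> periodic (\<lambda>x. w j t x $ i)"
proof -
  assume t: "t \<in> {0..T}"
  have 1: "torus_Lp 1 (v t)" "torus_Lp 1 (w j t)" for j using wp[OF t, of j] by (simp_all add: has_weak_partial_def)
  show "integrable lcell (\<lambda>x. v t x $ i)" by (rule integrable_component[OF torus_Lp_1D(3)[OF 1(1)]])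
  show "integrable lcell (\<lambda>x. w j t x $ i)" by (rule integrable_component[OF torus_Lp_1D(3)[OF 1(2)]])
  show "periodic (\<lambda>x. v t x $ i)" by (rule periodic_compose[OF torus_Lp_1D(1)[OF 1(1)], of "\<lambda>y. y $ i"])
  show "periodic (\<lambda>x. w j t x $ i)" by (rule periodic_compose[OF torus_Lp_1D(1)[OF 1(2)], of "\<lambda>y. y $ i"])
qed

lemma vb: "t \<in> {0..T} \<Longrightarrow> AE x in lcell. \<bar>v t x $ i\<bar> \<le> K"
  and wb: "t \<in> {0..T} \<Longrightarrow> AE x in torus. \<bar>w j t x $ i\<bar> \<le> K"
proof -
  assume t: "t \<in> {0..T}"
  show "AE x in lcell. \<bar>v t x $ i\<bar> \<le> K" unfolding AE_torus_iff using bound[OF t] by eventually_elim simp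
  show "AE x in torus. \<bar>w j t x $ i\<bar> \<le> K" using bound[OF t] by eventually_elim simp
qed

lemma continuous_pairing:
  assumes "smooth \<psi>" "periodic \<psi>"
  shows "continuous_on {0..T} (\<lambda>t. \<integral>x. v t x $ i * \<psi> x \<partial>lcell)"
proof -
  obtain B where "B > 0" and B: "\<And>x. \<bar>\<psi> x\<bar> \<le> B"
    by (rule periodic_continuous_bounded[OF smooth_continuous_on[OF assms(1)] assms(2)]) (rule that, assumption, simp)
  have pm: "\<psi> \<in> borel_measurable borel" by (rule smooth_measurable[OF assms(1)])
  have "torus_Lp 2 (\<lambda>x. \<psi> x *\<^sub>R axis i (1::real) :: real^'d)"
    unfolding torus_Lp_def
  proof (intro conjI)
    show "periodic (\<lambda>x. \<psi> x *\<^sub>R axis i (1::real) :: real^'d)" using periodic_compose[OF assms(2), of "\<lambda>y. y *\<^sub>R axis i 1"] by simp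
    have "(\<lambda>x. \<psi> x *\<^sub>R axis i (1::real) :: real^'d) \<in> borel_measurable borel" using pm by measurable
    then show "(\<lambda>x. \<psi> x *\<^sub>R axis i (1::real) :: real^'d) \<in> borel_measurable lebesgue" by (simp add: measurable_completion)
    have "\<psi> \<in> borel_measurable lcell" by (rule lebesgue_on_borel_measurable[OF pm])
    then have "integrable lcell (\<lambda>x. (\<bar>B\<bar> * \<bar>\<psi> x\<bar>))"
      using integrable_smooth_mult[OF integrable_const_torus[of 1] assms] by (intro integrable_mult_right integrable_abs) simp
    then show "integrable lcell (\<lambda>x. norm (\<psi> x *\<^sub>R axis i (1::real) :: real^'d) powr 2)"
    proof (rule integrable_bound)
      show "(\<lambda>x. norm (\<psi> x *\<^sub>R axis i (1::real) :: real^'d) powr 2) \<in> borel_measurable lcell"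
        using lebesgue_on_borel_measurable[OF pm, of cell] by measurable
      have "\<bar>\<psi> x\<bar> * \<bar>\<psi> x\<bar> \<le> \<bar>B\<bar> * \<bar>\<psi> x\<bar>" for x using B[of x] by (intro mult_right_mono) auto
      then show "AE x in lcell. norm (norm (\<psi> x *\<^sub>R axis i (1::real) :: real^'d) powr 2) \<le> norm (\<bar>B\<bar> * \<bar>\<psi> x\<bar>)"
        by (simp add: power2_eq_square)
    qed
  qed
  moreover have "\<forall>g. torus_Lp 2 g \<longrightarrow> continuous_on {0..T} (\<lambda>t. \<integral>x. v t x \<bullet> g x \<partial>lcell)"
    using weak by (simp add: C_weak_L2_def)
  ultimately have "continuous_on {0..T} (\<lambda>t. \<integral>x. v t x \<bullet> (\<psi> x *\<^sub>R axis i (1::real)) \<partial>lcell)"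
    by blast
  then show ?thesis by (simp add: inner_axis mult.commute)
qed

text \<open>Incompressibility is given integrated in time. Multiplying \<open>\<psi>\<close> by time
  cutoffs localises it, continuity of the pairing in time gives it at every interior time, and
  closure adds the two end points.\<close>

lemma divergence_pairing:
  assumes \<psi>: "smooth \<psi>" "periodic \<psi>" and s: "s \<in> {0..T}"
  shows "(\<Sum>j\<in>UNIV. \<integral>x. v s x $ j * partial j \<psi> x \<partial>lcell) = 0"
proof -
  define d where "d t = (\<Sum>j\<in>UNIV. \<integral>x. v t x $ j * partial j \<psi> x \<partial>lcell)" for t
  note sp = smooth_periodic_partial[OF \<psi>]
  have dc: "continuous_on {0..T} d" unfolding d_def by (intro continuous_on_sum continuous_pairing sp)
  have dchi: "(\<integral>t. (bump (t - a) * bump (b - t)) * d t \<partial>ltime T) = 0" for a b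
  proof -
    let ?\<chi> = "\<lambda>t. bump (t - a) * bump (b - t)"
    let ?f = "\<lambda>z. \<Sum>j\<in>UNIV. (v (fst z) (snd z) $ j) * (?\<chi> (fst z) * frechet_derivative \<psi> (at (snd z)) (axis j 1))"
    have \<chi>s: "smooth ?\<chi>" by (intro smooth_intros smooth_linear[OF bounded_linear_ident])
    have \<chi>1: "\<bar>?\<chi> t\<bar> \<le> 1" for t using bump_bounds(1,2) by (simp add: abs_mult mult_le_one)
    have C1: "C1_torus T (\<lambda>t x. ?\<chi> t * \<psi> x) (\<lambda>t x. frechet_derivative ?\<chi> (at t) 1 * \<psi> x) (\<lambda>j t x. ?\<chi> t * partial j \<psi> x)"
      unfolding C1_torus_def
    proof (intro conjI ballI allI)
      show "periodic (\<lambda>x. ?\<chi> t * \<psi> x)" for t using periodic_compose[OF \<psi>(2), of "\<lambda>y. ?\<chi> t * y"] by simp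
      show "continuous_on ({0..T} \<times> UNIV) (\<lambda>(t, x). frechet_derivative ?\<chi> (at t) 1 * \<psi> x)"
        unfolding case_prod_beta
        by (intro continuous_on_mult continuous_on_compose2[OF smooth_continuous_on[OF smooth_has_derivative(2)[OF \<chi>s], of UNIV] continuous_on_fst[OF continuous_on_id]]
            continuous_on_compose2[OF smooth_continuous_on[OF \<psi>(1), of UNIV] continuous_on_snd[OF continuous_on_id]]) auto
      show "continuous_on ({0..T} \<times> UNIV) (\<lambda>(t, x). ?\<chi> t * partial j \<psi> x)" for j
        unfolding case_prod_beta
        by (intro continuous_on_mult continuous_on_compose2[OF smooth_continuous_on[OF \<chi>s, of UNIV] continuous_on_fst[OF continuous_on_id]]
            continuous_on_compose2[OF smooth_continuous_on[OF sp(1), of UNIV] continuous_on_snd[OF continuous_on_id]]) auto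
      fix t x
      have l1: "linear (frechet_derivative ?\<chi> (at t))" using smooth_has_derivative(1)[OF \<chi>s] has_derivative_linear by blast
      have l2: "linear (frechet_derivative \<psi> (at x))" using smooth_has_derivative(1)[OF \<psi>(1)] has_derivative_linear by blast
      have e1: "frechet_derivative ?\<chi> (at t) h = h * frechet_derivative ?\<chi> (at t) 1" for h
        using linear_scale[OF l1, of h 1] by simp
      have "(?\<chi> has_derivative frechet_derivative ?\<chi> (at t)) (at (fst (t, x)))" using smooth_has_derivative(1)[OF \<chi>s] by simp
      from has_derivative_compose[OF has_derivative_fst[OF has_derivative_ident] this]
      have 1: "((\<lambda>z. ?\<chi> (fst z)) has_derivative (\<lambda>z. frechet_derivative ?\<chi> (at t) (fst z))) (at (t, x) within {0..T} \<times> UNIV)" by simp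
      have "(\<psi> has_derivative frechet_derivative \<psi> (at x)) (at (snd (t, x)))" using smooth_has_derivative(1)[OF \<psi>(1)] by simp
      from has_derivative_compose[OF has_derivative_snd[OF has_derivative_ident] this]
      have 2: "((\<lambda>z. \<psi> (snd z)) has_derivative (\<lambda>z. frechet_derivative \<psi> (at x) (snd z))) (at (t, x) within {0..T} \<times> UNIV)" by simp
      have "(\<lambda>z. ?\<chi> (fst (t, x)) * frechet_derivative \<psi> (at x) (snd z) + frechet_derivative ?\<chi> (at t) (fst z) * \<psi> (snd (t, x))) =
          (\<lambda>z. fst z *\<^sub>R (frechet_derivative ?\<chi> (at t) 1 * \<psi> x) + (\<Sum>j\<in>UNIV. snd z $ j *\<^sub>R (?\<chi> t * partial j \<psi> x)))"
        by (subst e1, subst linear_axis_expand[OF l2]) (simp add: sum_distrib_left mult_ac add.commute)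
      with has_derivative_mult[OF 1 2]
      show "((\<lambda>(s, y). ?\<chi> s * \<psi> y) has_derivative (\<lambda>(s, y). s *\<^sub>R (frechet_derivative ?\<chi> (at t) 1 * \<psi> x) + (\<Sum>j\<in>UNIV. y $ j *\<^sub>R (?\<chi> t * partial j \<psi> x))))
          (at (t, x) within {0..T} \<times> UNIV)"
        by (simp add: case_prod_beta')
    qed
    have z: "(\<integral>z. ?f z \<partial>lst T) = 0"
      using incomp[unfolded incompressible_def, rule_format, OF C1] by (simp add: case_prod_beta')
    have fj: "integrable (lst T) (\<lambda>z. (v (fst z) (snd z) $ j) * (?\<chi> (fst z) * frechet_derivative \<psi> (at (snd z)) (axis j 1)))" for j
    proof -
      obtain B where "B > 0" and B: "\<And>x. \<bar>partial j \<psi> x\<bar> \<le> B"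
        by (rule periodic_continuous_bounded[OF smooth_continuous_on[OF sp(1)[of "axis j 1"]] sp(2)[of "axis j 1"]]) (rule that, assumption, simp)
      show ?thesis
      proof (rule integrable_mult_bounded[OF v1, of _ B])
        show "(\<lambda>z. ?\<chi> (fst z) * frechet_derivative \<psi> (at (snd z)) (axis j 1)) \<in> borel_measurable (lst T)"
          by (intro lebesgue_on_borel_measurable borel_measurable_continuous_onI
              continuous_on_mult continuous_on_compose2[OF smooth_continuous_on[OF \<chi>s, of UNIV] continuous_on_fst[OF continuous_on_id]]
            continuous_on_compose2[OF smooth_continuous_on[OF sp(1), of UNIV] continuous_on_snd[OF continuous_on_id]]) auto
        have "\<bar>?\<chi> t * partial j \<psi> x\<bar> \<le> B" for t x
          using mult_mono[OF \<chi>1[of t] B[of x]] by (simp add: abs_mult)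
        then show "AE z in lst T. \<bar>?\<chi> (fst z) * frechet_derivative \<psi> (at (snd z)) (axis j 1)\<bar> \<le> B" by simp
      qed
    qed
    then have fi: "integrable (lst T) ?f" by simp
    have "(\<integral>t. ?\<chi> t * d t \<partial>ltime T) = (\<integral>t. (\<integral>x. ?f (t, x) \<partial>lcell) \<partial>ltime T)"
    proof (rule integral_cong[OF refl])
      fix t assume "t \<in> space (ltime T)"
      then have t: "t \<in> {0..T}" by (simp add: space_restrict_space)
      have "(\<integral>x. ?f (t, x) \<partial>lcell) = (\<integral>x. (\<Sum>j\<in>UNIV. ?\<chi> t * (v t x $ j * partial j \<psi> x)) \<partial>lcell)"
        by (simp add: mult_ac)
      also have "\<dots> = (\<Sum>j\<in>UNIV. \<integral>x. ?\<chi> t * (v t x $ j * partial j \<psi> x) \<partial>lcell)"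
        by (intro integral_sum integrable_mult_right integrable_smooth_mult[OF vint[OF t] sp])
      finally show "?\<chi> t * d t = (\<integral>x. ?f (t, x) \<partial>lcell)" by (simp add: d_def sum_distrib_left)
    qed
    also have "\<dots> = 0" using spacetime_fubini[OF fi] z by simp
    finally show ?thesis .
  qed
  \<comment> \<open>If d were nonzero at an interior time it would keep its sign on an interval
    around it, and the cutoff to this interval would have a nonzero integral;
    \<open>\<sigma>\<close> = 1 and \<open>\<sigma>\<close> = -1 treat the two signs.\<close>
  have no: False if s0: "0 < s0" "s0 < T" and pos: "\<sigma> * d s0 > 0" for s0 \<sigma>
  proof -
    have "continuous_on {0<..<T} (\<lambda>t. \<sigma> * d t)" by (intro continuous_intros continuous_on_subset[OF dc]) auto
    then have "open {t \<in> {0<..<T}. 0 < \<sigma> * d t}"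
      using continuous_on_open_vimage[of "{0<..<T}" "\<lambda>t. \<sigma> * d t"] by (auto dest!: spec[of _ "{0<..}"] simp: vimage_def Int_def conj_commute)
    moreover have "s0 \<in> {t \<in> {0<..<T}. 0 < \<sigma> * d t}" using s0 pos by simp
    ultimately obtain e where e: "e > 0" "ball s0 e \<subseteq> {t \<in> {0<..<T}. 0 < \<sigma> * d t}" by (meson openE)
    let ?a = "s0 - e" and ?b = "s0 + e"
    let ?g = "\<lambda>t. (bump (t - ?a) * bump (?b - t)) * (\<sigma> * d t)"
    have in_b: "t \<in> ball s0 e" if "?a < t" "t < ?b" for t using that by (simp add: dist_real_def abs_less_iff)
    have gpos: "0 < ?g t" if "?a < t" "t < ?b" for t
      using in_b[OF that] e(2) that by (auto simp: bump_bounds)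
    have gz: "?g t = 0" if "\<not> (?a < t \<and> t < ?b)" for t using that by (auto simp: bump_def)
    have g0: "0 \<le> ?g t" for t using gpos[of t] gz[of t] by (cases "?a < t \<and> t < ?b") auto
    have gm: "?g \<in> borel_measurable (ltime T)"
    proof (intro continuous_imp_measurable_on_sets_lebesgue continuous_intros)
      show "continuous_on {0<..<T} (\<lambda>t. bump (t - ?a))" "continuous_on {0<..<T} (\<lambda>t. bump (?b - t))"
        by (intro smooth_continuous_on smooth_intros smooth_linear[OF bounded_linear_ident])+
      show "continuous_on {0<..<T} d" by (rule continuous_on_subset[OF dc]) auto
    qed simp
    have "bounded (d ` {0..T})" by (intro compact_imp_bounded compact_continuous_image dc) simp
    then obtain B where "\<forall>t\<in>{0..T}. \<bar>d t\<bar> \<le> B" by (auto simp: bounded_iff)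
    note B = bspec[OF this]
    have gi: "integrable (ltime T) ?g"
    proof (rule integrable_bound[OF _ gm])
      show "integrable (ltime T) (\<lambda>t. \<bar>\<sigma>\<bar> * B)"
        using integrable_lebesgue_on_borel[of "\<lambda>_. \<bar>\<sigma>\<bar> * B" "{0<..<T}"] by simp
      show "AE t in ltime T. norm (?g t) \<le> norm (\<bar>\<sigma>\<bar> * B)"
      proof (rule AE_I2)
        fix t assume "t \<in> space (ltime T)"
        then have t: "t \<in> {0..T}" by (simp add: space_restrict_space)
        have "bump (t - ?a) * bump (?b - t) \<le> 1" using bump_bounds by (intro mult_le_one) auto
        then have "\<bar>bump (t - ?a) * bump (?b - t)\<bar> * (\<bar>\<sigma>\<bar> * \<bar>d t\<bar>) \<le> 1 * (\<bar>\<sigma>\<bar> * B)"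
          using B[OF t] bump_bounds by (intro mult_mono mult_left_mono) auto
        then show "norm (?g t) \<le> norm (\<bar>\<sigma>\<bar> * B)" using B[OF t] by (simp add: abs_mult)
      qed
    qed
    have "(\<integral>t. ?g t \<partial>ltime T) = \<sigma> * (\<integral>t. (bump (t - ?a) * bump (?b - t)) * d t \<partial>ltime T)"
      by (subst integral_mult_right_zero[symmetric]) (simp only: mult_ac)
    then have "(\<integral>t. ?g t \<partial>ltime T) = 0" by (simp only: dchi mult_zero_right)
    then have "AE t in ltime T. ?g t = 0"
      using integral_nonneg_eq_0_iff_AE[OF gi] g0 by simp
    then have "AE t in lborel. t \<in> {0<..<T} \<longrightarrow> ?g t = 0" by (simp add: AE_restrict_space_iff AE_completion_iff)
    then have ae: "AE t in lborel. t \<notin> {?a<..<?b}"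
    proof eventually_elim
      case (elim t)
      show ?case
      proof
        assume "t \<in> {?a<..<?b}"
        then have "?a < t" "t < ?b" by auto
        then show False using gpos[of t] in_b[of t] e(2) elim by auto
      qed
    qed
    have "{?a<..<?b} \<in> null_sets lborel" using ae by (subst AE_iff_null_sets) auto
    then have "emeasure lborel {?a<..<?b} = 0" by (rule null_setsD1)
    then show False using e(1) by simp
  qed
  have in0: "d t = 0" if "0 < t" "t < T" for t
    using no[OF that, of 1] no[OF that, of "-1"] by (cases "d t = 0") (auto simp: neq_iff)
  have "closure {0<..<T} = {0..T}" using T by simp
  moreover have "d t = 0" if "t \<in> closure {0<..<T}" for t
    by (rule continuous_constant_on_closure[of "{0<..<T}" d 0, OF _ _ that]) (use dc in0 T in auto)
  ultimately show ?thesis using s by (simp add: d_def)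
qed

text \<open>The reflected kernel is itself a test function, so this is weak incompressibility in
  disguise. It makes the mollified velocity an admissible test field for the momentum
  equation.\<close>

lemma mol_divergence:
  assumes s: "s \<in> {0..T}" shows "(\<Sum>j\<in>UNIV. mol n (\<lambda>x. w j s x $ j) x) = 0"
proof -
  have "mol n (\<lambda>x. w j s x $ j) x = - (\<integral>y. v s y $ j * partial j (\<lambda>y. trig_kernel n (x - y)) y \<partial>lcell)" for j
    using weak_partial_component[OF wp[OF s] trig_kernel_reflect] by (simp add: mol_def)
  then have "(\<Sum>j\<in>UNIV. mol n (\<lambda>x. w j s x $ j) x) = - (\<Sum>j\<in>UNIV. \<integral>y. v s y $ j * partial j (\<lambda>y. trig_kernel n (x - y)) y \<partial>lcell)"
    by (simp add: sum_negf)
  then show ?thesis using divergence_pairing[OF trig_kernel_reflect s] by simp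
qed

lemma mol_gradient:
  assumes s: "s \<in> {0..T}"
  shows "partial j (mol n (\<lambda>x. v s x $ i)) x = mol n (\<lambda>x. w j s x $ i) x"
  by (rule mol_derivative[OF vint[OF s] weak_partial_component[OF wp[OF s]]])

lemma mol_gradient_bound: "s \<in> {0..T} \<Longrightarrow> \<bar>mol n (\<lambda>x. w j s x $ i) x\<bar> \<le> K"
  by (rule mol_bound[OF wint wb])

end

lemma integral_double_sum:
  fixes f :: "'a::finite \<Rightarrow> 'b::finite \<Rightarrow> 'c \<Rightarrow> real"
  assumes "\<And>i j. integrable M (f i j)"
  shows "(\<integral>x. (\<Sum>i\<in>UNIV. \<Sum>j\<in>UNIV. f i j x) \<partial>M) = (\<Sum>i\<in>UNIV. \<Sum>j\<in>UNIV. \<integral>x. f i j x \<partial>M)"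
  using assms by (simp add: integral_sum integrable_sum)

text \<open>In terms of coefficients the mollified pairing is a Euclidean inner product: symmetric
  in f and g, and a sum of squares for f = g.\<close>

lemma mol_pairing:
  assumes f: "integrable lcell f" and g: "integrable lcell g"
    and F: "\<And>m. m < N \<Longrightarrow> smooth (F m)" "\<And>m. m < N \<Longrightarrow> periodic (F m)"
      "\<And>x y. trig_kernel n (x - y) = (\<Sum>m<N. F m x * F m y)"
  shows "(\<integral>x. g x * mol n f x \<partial>lcell) = (\<Sum>m<N. (\<integral>x. g x * F m x \<partial>lcell) * (\<integral>x. f x * F m x \<partial>lcell))"
proof -
  have "(\<integral>x. g x * mol n f x \<partial>lcell) = (\<integral>x. (\<Sum>m<N. (g x * F m x) * (\<integral>x. f x * F m x \<partial>lcell)) \<partial>lcell)"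
    by (simp only: mol_expand[OF f F] sum_distrib_left mult.assoc)
  also have "\<dots> = (\<Sum>m<N. \<integral>x. (g x * F m x) * (\<integral>x. f x * F m x \<partial>lcell) \<partial>lcell)"
    by (intro integral_sum integrable_mult_left integrable_smooth_mult[OF g] F) auto
  finally show ?thesis by simp
qed

lemma mol_symmetric:
  assumes f: "integrable lcell f" and g: "integrable lcell g"
  shows "(\<integral>x. g x * mol n f x \<partial>lcell) = (\<integral>x. mol n g x * f x \<partial>lcell)"
proof -
  obtain N and F :: "nat \<Rightarrow> real^'a \<Rightarrow> real" where F: "\<And>m. m < N \<Longrightarrow> smooth (F m)" "\<And>m. m < N \<Longrightarrow> periodic (F m)"
    "\<And>x y. trig_kernel n (x - y) = (\<Sum>m<N. F m x * F m y)" using trig_kernel_rank by blast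
  have "(\<integral>x. g x * mol n f x \<partial>lcell) = (\<Sum>m<N. (\<integral>x. g x * F m x \<partial>lcell) * (\<integral>x. f x * F m x \<partial>lcell))"
    by (rule mol_pairing[OF f g F])
  moreover have "(\<integral>x. f x * mol n g x \<partial>lcell) = (\<Sum>m<N. (\<integral>x. f x * F m x \<partial>lcell) * (\<integral>x. g x * F m x \<partial>lcell))"
    by (rule mol_pairing[OF g f F])
  ultimately show ?thesis by (simp add: mult.commute)
qed

context regular_flow
begin

section \<open>The momentum equation tested with mollified velocities\<close>

definition flux :: "real \<Rightarrow> 'd \<Rightarrow> 'd \<Rightarrow> real^'d \<Rightarrow> real" where
  "flux u i j x = v u x $ i * v u x $ j - S u x $ i $ j"

lemma flux_integrable: "integrable (lst T) (\<lambda>z. flux (fst z) i j (snd z))"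
  unfolding flux_def by (intro integrable_diff vv Sint)

lemma flux_smooth_integrable:
  assumes "smooth \<psi>" "periodic \<psi>"
  shows "integrable (lst T) (\<lambda>z. flux (fst z) i j (snd z) * \<psi> (snd z))"
    and "integrable (lst T) (\<lambda>z. v (fst z) (snd z) $ i * v (fst z) (snd z) $ j * \<psi> (snd z))"
    and "integrable (lst T) (\<lambda>z. S (fst z) (snd z) $ i $ j * \<psi> (snd z))"
proof -
  obtain B where "B > 0" and B: "\<And>x. \<bar>\<psi> x\<bar> \<le> B"
    by (rule periodic_continuous_bounded[OF smooth_continuous_on[OF assms(1)] assms(2)]) (rule that, assumption, simp)
  have m: "(\<lambda>z. \<psi> (snd z)) \<in> borel_measurable (lst T)"
    by (intro lebesgue_on_borel_measurable borel_measurable_continuous_onI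
        continuous_on_compose2[OF smooth_continuous_on[OF assms(1), of UNIV] continuous_on_snd[OF continuous_on_id]]) auto
  show "integrable (lst T) (\<lambda>z. flux (fst z) i j (snd z) * \<psi> (snd z))"
    by (rule integrable_mult_bounded[OF flux_integrable m, of B]) (simp add: B)
  show "integrable (lst T) (\<lambda>z. v (fst z) (snd z) $ i * v (fst z) (snd z) $ j * \<psi> (snd z))"
    by (rule integrable_mult_bounded[OF vv m, of B]) (simp add: B)
  show "integrable (lst T) (\<lambda>z. S (fst z) (snd z) $ i $ j * \<psi> (snd z))"
    by (rule integrable_mult_bounded[OF Sint m, of B]) (simp add: B)
qed

lemma flux_sections: "AE u in ltime T. \<forall>i j. integrable lcell (flux u i j)"
proof (intro eventually_all_finite)
  fix i j
  show "AE u in ltime T. integrable lcell (flux u i j)"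
    using spacetime_fubini_sections[OF flux_integrable[of i j]] by simp
qed

text \<open>Test fields constant in time suffice, since the time dependence is recovered by a
  partition. The cutoff form of the integrals allows differences of two times to be taken.\<close>

lemma momentum_stationary:
  fixes V :: "real^'d \<Rightarrow> real^'d"
  assumes V: "\<And>i. smooth (\<lambda>x. V x $ i)" "\<And>i. periodic (\<lambda>x. V x $ i)"
    and div: "\<And>x. (\<Sum>j\<in>UNIV. partial j (\<lambda>x. V x $ j) x) = 0"
    and \<tau>: "\<tau> \<in> {0..T}"
  shows "(\<integral>x. v \<tau> x \<bullet> V x \<partial>lcell) - (\<integral>x. v0 x \<bullet> V x \<partial>lcell) =
    (\<integral>u. indicator {..<\<tau>} u * (\<Sum>i\<in>UNIV. \<Sum>j\<in>UNIV. \<integral>x. flux u i j x * partial j (\<lambda>x. V x $ i) x \<partial>lcell) \<partial>ltime T) +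
    (\<integral>u. indicator {..<\<tau>} u * matrix_integral (borel_on cell) (R u) (\<lambda>x. \<chi> i j. partial j (\<lambda>x. V x $ i) x) \<partial>ltime T)"
proof -
  define dV where "dV i j x = partial j (\<lambda>x. V x $ i) x" for i j x
  have dV: "smooth (dV i j)" "periodic (dV i j)" for i j
    unfolding dV_def by (rule smooth_periodic_partial[OF V])+
  have \<tau>T: "\<tau> \<le> T" using \<tau> by simp
  have "C1_torus T (\<lambda>t. V) (\<lambda>t x. 0) (\<lambda>j t x. \<chi> i. dV i j x)"
    unfolding dV_def by (rule C1_torus_stationary[OF V])
  moreover have "\<forall>t\<in>{0..T}. \<forall>x. (\<Sum>j\<in>UNIV. (\<chi> i. dV i j x) $ j) = 0" using div by (simp add: dV_def)
  ultimately have "(\<integral>x. v \<tau> x \<bullet> V x \<partial>lcell) - (\<integral>x. v0 x \<bullet> V x \<partial>lcell) =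
      (\<integral>z. outer (v (fst z) (snd z)) (v (fst z) (snd z)) \<bullet> (\<chi> i j. dV i j (snd z)) \<partial>lst \<tau>)
      - (\<integral>z. S (fst z) (snd z) \<bullet> (\<chi> i j. dV i j (snd z)) \<partial>lst \<tau>)
      + (\<integral>t. matrix_integral (borel_on cell) (R t) (\<lambda>x. \<chi> i j. dV i j x) \<partial>ltime \<tau>)"
    using mom[unfolded momentum_equation_def Let_def, rule_format, OF \<tau>, of "\<lambda>t. V" "\<lambda>t x. 0" "\<lambda>j t x. \<chi> i. dV i j x"]
    by (simp add: case_prod_beta')
  also have "(\<integral>z. outer (v (fst z) (snd z)) (v (fst z) (snd z)) \<bullet> (\<chi> i j. dV i j (snd z)) \<partial>lst \<tau>) =
      (\<Sum>i\<in>UNIV. \<Sum>j\<in>UNIV. \<integral>z. v (fst z) (snd z) $ i * v (fst z) (snd z) $ j * dV i j (snd z) \<partial>lst \<tau>)"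
    by (simp add: inner_vec_def outer_def, intro integral_double_sum spacetime_integral_upto(1)[OF flux_smooth_integrable(2)[OF dV] \<tau>T])
  also have "(\<integral>z. S (fst z) (snd z) \<bullet> (\<chi> i j. dV i j (snd z)) \<partial>lst \<tau>) =
      (\<Sum>i\<in>UNIV. \<Sum>j\<in>UNIV. \<integral>z. S (fst z) (snd z) $ i $ j * dV i j (snd z) \<partial>lst \<tau>)"
    by (simp add: inner_vec_def, intro integral_double_sum spacetime_integral_upto(1)[OF flux_smooth_integrable(3)[OF dV] \<tau>T])
  also have "(\<Sum>i\<in>UNIV. \<Sum>j\<in>UNIV. \<integral>z. v (fst z) (snd z) $ i * v (fst z) (snd z) $ j * dV i j (snd z) \<partial>lst \<tau>)
      - (\<Sum>i\<in>UNIV. \<Sum>j\<in>UNIV. \<integral>z. S (fst z) (snd z) $ i $ j * dV i j (snd z) \<partial>lst \<tau>) =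
      (\<Sum>i\<in>UNIV. \<Sum>j\<in>UNIV. \<integral>z. flux (fst z) i j (snd z) * dV i j (snd z) \<partial>lst \<tau>)"
    unfolding sum_subtractf[symmetric] flux_def left_diff_distrib
    by (intro sum.cong refl integral_diff[symmetric]
        spacetime_integral_upto(1)[OF flux_smooth_integrable(3)[OF dV] \<tau>T] spacetime_integral_upto(1)[OF flux_smooth_integrable(2)[OF dV] \<tau>T])
  also have "\<dots> = (\<Sum>i\<in>UNIV. \<Sum>j\<in>UNIV. \<integral>u. indicator {..<\<tau>} u * (\<integral>x. flux u i j x * dV i j x \<partial>lcell) \<partial>ltime T)"
    using spacetime_integral_upto(2)[OF flux_smooth_integrable(1)[OF dV] \<tau>T] by simp
  also have "\<dots> = (\<integral>u. (\<Sum>i\<in>UNIV. \<Sum>j\<in>UNIV. indicator {..<\<tau>} u * (\<integral>x. flux u i j x * dV i j x \<partial>lcell)) \<partial>ltime T)"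
  proof -
    have "integrable (ltime T) (\<lambda>u. indicator {..<\<tau>} u * (\<integral>x. flux u i j x * dV i j x \<partial>lcell))" for i j
      using integrable_indicator_times[OF spacetime_fubini_integrable[OF flux_smooth_integrable(1)[OF dV]], of "{..<\<tau>}"] by simp
    then show ?thesis
      by (rule integral_double_sum[symmetric])
  qed
  also have "(\<integral>t. matrix_integral (borel_on cell) (R t) (\<lambda>x. \<chi> i j. dV i j x) \<partial>ltime \<tau>) =
     (\<integral>u. indicator {..<\<tau>} u * matrix_integral (borel_on cell) (R u) (\<lambda>x. \<chi> i j. dV i j x) \<partial>ltime T)"
    by (rule integral_time_upto[OF \<tau>T])
  finally show ?thesis unfolding dV_def by (simp only: sum_distrib_left)
qed

definition defect_bound :: real where
  "defect_bound = real CARD('d) * real CARD('d) * K"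

definition mol_energy :: "nat \<Rightarrow> real \<Rightarrow> real" where
  "mol_energy n \<tau> = (\<Sum>i\<in>UNIV. \<integral>x. v \<tau> x $ i * mol n (\<lambda>x. v \<tau> x $ i) x \<partial>lcell) / 2"

lemma trace_integrable: "integrable (ltime T) (\<lambda>u. trace (R u cell))"
  by (rule Linf_trace[OF Rinf])

text \<open>On each interval of a time partition the mollified velocity at the left end point is an
  admissible stationary test function, and \<open>(c t - c s) c s \<le> (c t\<^sup>2 - c s\<^sup>2) / 2\<close> for the
  finitely many coefficients \<open>c\<close> of the velocity; thus no time derivative is needed.\<close>

lemma mol_energy_lower:
  obtains h where "integrable (ltime T) h"
    "AE u in ltime T. h u = (\<Sum>i\<in>UNIV. \<Sum>j\<in>UNIV. \<integral>x. flux u i j x * mol n (\<lambda>x. w j u x $ i) x \<partial>lcell)"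
    "\<And>\<tau>. \<tau> \<in> {0..T} \<Longrightarrow> (\<integral>u. indicator {..<\<tau>} u * (h u - defect_bound * trace (R u cell)) \<partial>ltime T) \<le> mol_energy n \<tau> - mol_energy n 0"
proof -
  obtain N and F :: "nat \<Rightarrow> real^'d \<Rightarrow> real" where F: "\<And>m. m < N \<Longrightarrow> smooth (F m)" "\<And>m. m < N \<Longrightarrow> periodic (F m)"
    "\<And>x y. trig_kernel n (x - y) = (\<Sum>m<N. F m x * F m y)" using trig_kernel_rank by blast
  define I where "I = (UNIV :: 'd set) \<times> {..<N}"
  define dF where "dF j m x = partial j (F m) x" for j m x
  \<comment> \<open>Coefficients of the velocity, indexed by component and mode of the kernel; they
    are continuous in time by weak continuity. The function \<open>h k\<close> below is the flux
    tested with the gradient of the same mode.\<close>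
  define c where "c k t = (\<integral>x. v t x $ fst k * F (snd k) x \<partial>lcell)" for k :: "'d \<times> nat" and t
  define h where "h k u = (\<Sum>j\<in>UNIV. \<integral>x. flux u (fst k) j x * dF j (snd k) x \<partial>lcell)" for k :: "'d \<times> nat" and u
  have dF: "smooth (dF j m)" "periodic (dF j m)" if "m < N" for j m
    unfolding dF_def by (rule smooth_periodic_partial[OF F(1,2)[OF that]])+
  have fI: "finite I" by (simp add: I_def)
  have sumI: "(\<Sum>k\<in>I. f k) = (\<Sum>i\<in>UNIV. \<Sum>m<N. f (i, m))" for f :: "'d \<times> nat \<Rightarrow> real"
    unfolding I_def by (simp add: sum.cartesian_product)
  have cc: "continuous_on {0..T} (c k)" if "k \<in> I" for k
    unfolding c_def using that by (intro continuous_pairing F) (auto simp: I_def)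
  have hi: "integrable (ltime T) (h k)" if "k \<in> I" for k
  proof -
    have "snd k < N" using that by (auto simp: I_def)
    then have "integrable (ltime T) (\<lambda>u. \<integral>x. flux u (fst k) j x * dF j (snd k) x \<partial>lcell)" for j
      using spacetime_fubini_integrable[OF flux_smooth_integrable(1)[OF dF]] by simp
    then show ?thesis unfolding h_def by (intro integrable_sum)
  qed
  have vx: "mol n (\<lambda>x. v s x $ i) x = (\<Sum>m<N. F m x * c (i, m) s)" if "s \<in> {0..T}" for s i x
    unfolding c_def using mol_expand[OF vint[OF that] F] by simp
  have dv: "partial j (mol n (\<lambda>x. v s x $ i)) x = (\<Sum>m<N. c (i, m) s * dF j m x)" if "s \<in> {0..T}" for s i j x
  proof -
    have "(mol n (\<lambda>x. v s x $ i) has_derivative (\<lambda>y. \<Sum>m<N. frechet_derivative (F m) (at x) y * c (i, m) s)) (at x)"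
      unfolding vx[OF that, abs_def]
      by (intro has_derivative_sum has_derivative_mult_left smooth_has_derivative(1) F) auto
    from frechet_derivative_eqI[OF this] show ?thesis by (simp add: dF_def mult.commute)
  qed
  have pair: "(\<integral>x. v t x \<bullet> (\<chi> i. mol n (\<lambda>x. v s x $ i) x) \<partial>lcell) = (\<Sum>k\<in>I. c k t * c k s)" if "s \<in> {0..T}" "t \<in> {0..T}" for s t
  proof -
    have "(\<integral>x. v t x \<bullet> (\<chi> i. mol n (\<lambda>x. v s x $ i) x) \<partial>lcell) = (\<integral>x. (\<Sum>i\<in>UNIV. v t x $ i * mol n (\<lambda>x. v s x $ i) x) \<partial>lcell)"
      by (simp add: inner_vec_def)
    also have "\<dots> = (\<Sum>i\<in>UNIV. \<integral>x. v t x $ i * mol n (\<lambda>x. v s x $ i) x \<partial>lcell)"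
      by (intro integral_sum integrable_smooth_mult vint smooth_mol periodic_mol that)
    also have "\<dots> = (\<Sum>i\<in>UNIV. \<Sum>m<N. c (i, m) t * c (i, m) s)"
    proof (rule sum.cong[OF refl])
      show "(\<integral>x. v t x $ i * mol n (\<lambda>x. v s x $ i) x \<partial>lcell) = (\<Sum>m<N. c (i, m) t * c (i, m) s)" for i
        unfolding c_def fst_conv snd_conv by (rule mol_pairing[OF vint[OF that(1)] vint[OF that(2)] F])
    qed
    finally show ?thesis unfolding sumI .
  qed
  have en: "mol_energy n \<tau> = (\<Sum>k\<in>I. (c k \<tau>)\<^sup>2) / 2" if "\<tau> \<in> {0..T}" for \<tau>
  proof -
    have "(\<integral>x. v \<tau> x $ i * mol n (\<lambda>x. v \<tau> x $ i) x \<partial>lcell) = (\<Sum>m<N. c (i, m) \<tau> * c (i, m) \<tau>)" for i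
      unfolding c_def fst_conv snd_conv by (rule mol_pairing[OF vint[OF that] vint[OF that] F])
    then show ?thesis unfolding sumI mol_energy_def by (simp add: power2_eq_square)
  qed
  \<comment> \<open>A single null set of times u serves all freezing times s, because s enters
    through the coefficients only.\<close>
  have hs: "AE u in ltime T. \<forall>s\<in>{0..T}. (\<Sum>k\<in>I. c k s * h k u) =
      (\<Sum>i\<in>UNIV. \<Sum>j\<in>UNIV. \<integral>x. flux u i j x * partial j (mol n (\<lambda>x. v s x $ i)) x \<partial>lcell)"
    using flux_sections
  proof eventually_elim
    case (elim u)
    show ?case
    proof
      fix s assume s: "s \<in> {0..T}"
      have "(\<integral>x. flux u i j x * partial j (mol n (\<lambda>x. v s x $ i)) x \<partial>lcell) =
          (\<Sum>m<N. c (i, m) s * (\<integral>x. flux u i j x * dF j m x \<partial>lcell))" for i j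
      proof -
        have "(\<integral>x. flux u i j x * partial j (mol n (\<lambda>x. v s x $ i)) x \<partial>lcell) =
            (\<integral>x. (\<Sum>m<N. c (i, m) s * (flux u i j x * dF j m x)) \<partial>lcell)"
          by (simp only: dv[OF s] sum_distrib_left mult.left_commute)
        also have "\<dots> = (\<Sum>m<N. \<integral>x. c (i, m) s * (flux u i j x * dF j m x) \<partial>lcell)"
          using elim by (intro integral_sum integrable_mult_right integrable_smooth_mult dF) auto
        finally show ?thesis by simp
      qed
      then have "(\<Sum>i\<in>UNIV. \<Sum>j\<in>UNIV. \<integral>x. flux u i j x * partial j (mol n (\<lambda>x. v s x $ i)) x \<partial>lcell) =
          (\<Sum>i\<in>UNIV. \<Sum>j\<in>UNIV. \<Sum>m<N. c (i, m) s * (\<integral>x. flux u i j x * dF j m x \<partial>lcell))" by simp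
      also have "\<dots> = (\<Sum>i\<in>UNIV. \<Sum>m<N. \<Sum>j\<in>UNIV. c (i, m) s * (\<integral>x. flux u i j x * dF j m x \<partial>lcell))"
        by (intro sum.cong refl sum.swap)
      also have "\<dots> = (\<Sum>k\<in>I. c k s * h k u)" unfolding sumI h_def by (simp add: sum_distrib_left)
      finally show "(\<Sum>k\<in>I. c k s * h k u) =
        (\<Sum>i\<in>UNIV. \<Sum>j\<in>UNIV. \<integral>x. flux u i j x * partial j (mol n (\<lambda>x. v s x $ i)) x \<partial>lcell)" by simp
    qed
  qed
  have ri: "integrable (ltime T) (\<lambda>u. defect_bound * trace (R u cell))" using trace_integrable by simp
  have main: "(\<integral>u. indicator {..<\<tau>} u * ((\<Sum>k\<in>I. c k u * h k u) - defect_bound * trace (R u cell)) \<partial>ltime T) \<le>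
      (\<Sum>k\<in>I. (c k \<tau>)\<^sup>2) / 2 - (\<Sum>k\<in>I. (c k 0)\<^sup>2) / 2" if \<tau>: "\<tau> \<in> {0..T}" for \<tau>
  proof (rule partition_limit[OF fI cc hi ri])
    fix s t assume "0 \<le> s" and st: "s \<le> t" and "t \<le> T"
    then have s: "s \<in> {0..T}" and t: "t \<in> {0..T}" by auto
    define V where "V x = (\<chi> i. mol n (\<lambda>x. v s x $ i) x)" for x
    have Vi: "(\<lambda>x. V x $ i) = mol n (\<lambda>x. v s x $ i)" for i by (simp add: V_def fun_eq_iff)
    have sV: "smooth (\<lambda>x. V x $ i)" "periodic (\<lambda>x. V x $ i)" for i
      unfolding Vi by (rule smooth_mol[OF vint[OF s]] periodic_mol[OF vint[OF s]])+
    have dV: "(\<Sum>j\<in>UNIV. partial j (\<lambda>x. V x $ j) x) = 0" for x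
      unfolding Vi mol_gradient[OF s] by (rule mol_divergence[OF s])
    have bV: "\<bar>partial j (\<lambda>x. V x $ i) x\<bar> \<le> K" for i j x
      unfolding Vi mol_gradient[OF s] by (rule mol_gradient_bound[OF s])
    note sdV = smooth_periodic_partial[OF sV]
    define G where "G u = (\<Sum>i\<in>UNIV. \<Sum>j\<in>UNIV. \<integral>x. flux u i j x * partial j (\<lambda>x. V x $ i) x \<partial>lcell)" for u
    define M where "M u = matrix_integral (borel_on cell) (R u) (\<lambda>x. \<chi> i j. partial j (\<lambda>x. V x $ i) x)" for u
    have Gi: "integrable (ltime T) G"
      unfolding G_def
      using spacetime_fubini_integrable[OF flux_smooth_integrable(1)[OF sdV]]
      by (intro integrable_sum) simp
    have Mi: "integrable (ltime T) M"
      unfolding M_def by (rule Linf_matrix_integral(1)[OF Rinf, of _ K]) (simp_all add: sdV bV)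
    have MA: "AE u in ltime T. \<bar>M u\<bar> \<le> defect_bound * trace (R u cell)"
      unfolding M_def defect_bound_def by (rule Linf_matrix_integral(2)[OF Rinf]) (simp_all add: sdV bV)
    have tested: "(\<integral>x. v \<tau> x \<bullet> V x \<partial>lcell) - (\<integral>x. v0 x \<bullet> V x \<partial>lcell) =
        (\<integral>u. indicator {..<\<tau>} u * G u \<partial>ltime T) + (\<integral>u. indicator {..<\<tau>} u * M u \<partial>ltime T)" if "\<tau> \<in> {0..T}" for \<tau>
      unfolding G_def M_def by (rule momentum_stationary[OF sV dV that])
    have ii: "integrable (ltime T) (\<lambda>u. indicator A u * f u)" if "integrable (ltime T) f" "A \<in> sets borel" for A and f :: "real \<Rightarrow> real"
      by (rule integrable_indicator_times[OF that])
    have GM: "integrable (ltime T) (\<lambda>u. G u + M u)" using Gi Mi by simp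
    have "(\<integral>u. indicator {s..<t} u * ((\<Sum>k\<in>I. c k s * h k u) - defect_bound * trace (R u cell)) \<partial>ltime T) \<le>
        (\<integral>u. indicator {s..<t} u * (G u + M u) \<partial>ltime T)"
    proof (rule integral_mono_AE)
      show "integrable (ltime T) (\<lambda>u. indicator {s..<t} u * ((\<Sum>k\<in>I. c k s * h k u) - defect_bound * trace (R u cell)))"
        using hi ri by (intro ii integrable_diff integrable_sum integrable_mult_right) auto
      show "integrable (ltime T) (\<lambda>u. indicator {s..<t} u * (G u + M u))"
        by (intro ii GM) auto
      show "AE u in ltime T. indicator {s..<t} u * ((\<Sum>k\<in>I. c k s * h k u) - defect_bound * trace (R u cell)) \<le> indicator {s..<t} u * (G u + M u)"
        using hs MA
      proof eventually_elim
        case (elim u)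
        have "(\<Sum>k\<in>I. c k s * h k u) = G u" unfolding G_def Vi using elim(1) s by blast
        then show ?case using elim(2) by (intro mult_left_mono) auto
      qed
    qed
    also have "\<dots> = (\<integral>u. indicator {..<t} u * (G u + M u) - indicator {..<s} u * (G u + M u) \<partial>ltime T)"
      using st by (intro integral_cong refl) (auto simp: indicator_def)
    also have "\<dots> = (\<integral>u. indicator {..<t} u * (G u + M u) \<partial>ltime T) - (\<integral>u. indicator {..<s} u * (G u + M u) \<partial>ltime T)"
      by (intro integral_diff ii GM) auto
    also have "\<dots> = (\<integral>x. v t x \<bullet> V x \<partial>lcell) - (\<integral>x. v s x \<bullet> V x \<partial>lcell)"
    proof -
      have add: "(\<integral>u. indicator {..<\<tau>} u * (G u + M u) \<partial>ltime T) =
          (\<integral>u. indicator {..<\<tau>} u * G u \<partial>ltime T) + (\<integral>u. indicator {..<\<tau>} u * M u \<partial>ltime T)" for \<tau>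
        unfolding distrib_left by (intro integral_add ii Gi Mi) auto
      show ?thesis using tested[OF s] tested[OF t] add[of s] add[of t] by linarith
    qed
    also have "\<dots> = (\<Sum>k\<in>I. c k t * c k s) - (\<Sum>k\<in>I. c k s * c k s)"
      unfolding V_def pair[OF s t] pair[OF s s] by simp
    also have "\<dots> \<le> (\<Sum>k\<in>I. (c k t)\<^sup>2 / 2 - (c k s)\<^sup>2 / 2)"
      unfolding sum_subtractf[symmetric]
    proof (rule sum_mono)
      fix k
      show "c k t * c k s - c k s * c k s \<le> (c k t)\<^sup>2 / 2 - (c k s)\<^sup>2 / 2"
        using sum_squares_bound[of "c k t" "c k s"] by (simp add: power2_eq_square)
    qed
    also have "\<dots> = (\<Sum>k\<in>I. (c k t)\<^sup>2) / 2 - (\<Sum>k\<in>I. (c k s)\<^sup>2) / 2"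
      by (simp add: sum_subtractf sum_divide_distrib)
    finally show "(\<integral>u. indicator {s..<t} u * ((\<Sum>k\<in>I. c k s * h k u) - defect_bound * trace (R u cell)) \<partial>ltime T) \<le>
        (\<Sum>k\<in>I. (c k t)\<^sup>2) / 2 - (\<Sum>k\<in>I. (c k s)\<^sup>2) / 2" .
  qed (use \<tau> in auto)
  show ?thesis
  proof
    \<comment> \<open>With the coefficients at the running time u, the sum is the flux paired with
      the mollified gradient at u itself.\<close>
    show "integrable (ltime T) (\<lambda>u. \<Sum>k\<in>I. c k u * h k u)"
    proof (rule integrable_sum)
      fix k assume k: "k \<in> I"
      have "bounded (c k ` {0..T})" by (intro compact_imp_bounded compact_continuous_image cc k) simp
      then obtain B where B: "\<forall>t\<in>{0..T}. \<bar>c k t\<bar> \<le> B" by (auto simp: bounded_iff)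
      have "integrable (ltime T) (\<lambda>u. h k u * c k u)"
      proof (rule integrable_mult_bounded[OF hi[OF k]])
        show "c k \<in> borel_measurable (ltime T)"
          by (intro continuous_imp_measurable_on_sets_lebesgue continuous_on_subset[OF cc[OF k]]) auto
        show "AE x in ltime T. \<bar>c k x\<bar> \<le> B" using B by (intro AE_I2) (auto simp: space_restrict_space)
      qed
      then show "integrable (ltime T) (\<lambda>u. c k u * h k u)" by (simp add: mult.commute)
    qed
    show "AE u in ltime T. (\<Sum>k\<in>I. c k u * h k u) = (\<Sum>i\<in>UNIV. \<Sum>j\<in>UNIV. \<integral>x. flux u i j x * mol n (\<lambda>x. w j u x $ i) x \<partial>lcell)"
    proof -
      have "AE u in ltime T. u \<in> {0..T}" by (intro AE_I2) (auto simp: space_restrict_space)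
      with hs show ?thesis
      proof eventually_elim
        case (elim u)
        then show ?case using mol_gradient[of u n _ _ _] by simp
      qed
    qed
    show "(\<integral>u. indicator {..<\<tau>} u * ((\<Sum>k\<in>I. c k u * h k u) - defect_bound * trace (R u cell)) \<partial>ltime T) \<le> mol_energy n \<tau> - mol_energy n 0" if "\<tau> \<in> {0..T}" for \<tau>
      using main[OF that] en[OF that] en[of 0] T by simp
  qed
qed

end

section \<open>Removal of the mollification\<close>

lemma integrable_mol: "integrable lcell f \<Longrightarrow> integrable lcell (mol n f)"
  using integrable_smooth_mult[OF integrable_const_torus[of 1] smooth_mol periodic_mol, of f] by simp

text \<open>Convergence in the mean survives multiplication by a uniformly bounded factor. The
  factor may vary with n, as the mollified gradient does in the convective term.\<close>

lemma tendsto_mol_bounded: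
  assumes per: "periodic f" and f: "integrable lcell f"
    and g: "\<And>n. g n \<in> borel_measurable lcell" "\<And>n. AE x in lcell. \<bar>g n x\<bar> \<le> C"
  shows "(\<lambda>n. \<integral>x. (mol n f x - f x) * g n x \<partial>lcell) \<longlonglongrightarrow> 0"
proof (rule tendsto_rabs_zero_cancel, rule tendsto_sandwich[OF _ _ tendsto_const])
  have i: "integrable lcell (\<lambda>x. mol n f x - f x)" for n using f integrable_mol[OF f] by simp
  have gi: "integrable lcell (\<lambda>x. (mol n f x - f x) * g n x)" for n by (rule integrable_mult_bounded[OF i g])
  show "(\<lambda>n. (\<integral>x. \<bar>mol n f x - f x\<bar> \<partial>lcell) * C) \<longlonglongrightarrow> 0"
    using tendsto_mult[OF tendsto_integral_mol[OF per f] tendsto_const[of C]] by simp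
  have "\<bar>\<integral>x. (mol n f x - f x) * g n x \<partial>lcell\<bar> \<le> (\<integral>x. \<bar>mol n f x - f x\<bar> \<partial>lcell) * C" for n
  proof -
    have "\<bar>\<integral>x. (mol n f x - f x) * g n x \<partial>lcell\<bar> \<le> (\<integral>x. \<bar>(mol n f x - f x) * g n x\<bar> \<partial>lcell)"
      using integral_norm_bound[of "lcell" "\<lambda>x. (mol n f x - f x) * g n x"] by simp
    also have "\<dots> \<le> (\<integral>x. \<bar>mol n f x - f x\<bar> * C \<partial>lcell)"
    proof (rule integral_mono_AE)
      show "integrable lcell (\<lambda>x. \<bar>(mol n f x - f x) * g n x\<bar>)" using gi by (rule integrable_abs)
      show "integrable lcell (\<lambda>x. \<bar>mol n f x - f x\<bar> * C)" using i by (intro integrable_mult_left integrable_abs)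
      show "AE x in lcell. \<bar>(mol n f x - f x) * g n x\<bar> \<le> \<bar>mol n f x - f x\<bar> * C"
        using g(2)[of n] by eventually_elim (simp add: abs_mult mult_left_mono)
    qed
    finally show ?thesis by simp
  qed
  then show "\<forall>\<^sub>F n in sequentially. \<bar>\<integral>x. (mol n f x - f x) * g n x \<partial>lcell\<bar> \<le> (\<integral>x. \<bar>mol n f x - f x\<bar> \<partial>lcell) * C"
    by simp
qed auto

context regular_flow
begin

definition energy :: "real \<Rightarrow> real" where
  "energy \<tau> = (\<Sum>i\<in>UNIV. \<integral>x. v \<tau> x $ i * v \<tau> x $ i \<partial>lcell) / 2"

lemma vm: "t \<in> {0..T} \<Longrightarrow> (\<lambda>x. v t x $ i) \<in> borel_measurable lcell"
  and wm: "t \<in> {0..T} \<Longrightarrow> (\<lambda>x. w j t x $ i) \<in> borel_measurable lcell"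
  using vint wint by auto

lemma mol_energy_tendsto:
  assumes t: "t \<in> {0..T}"
  shows "(\<lambda>n. mol_energy n t) \<longlonglongrightarrow> energy t"
proof -
  have "(\<lambda>n. \<integral>x. v t x $ i * mol n (\<lambda>x. v t x $ i) x \<partial>lcell) \<longlonglongrightarrow> (\<integral>x. v t x $ i * v t x $ i \<partial>lcell)" for i
  proof -
    note b = vb[OF t, of i]
    have "(\<integral>x. (mol n (\<lambda>x. v t x $ i) x - v t x $ i) * v t x $ i \<partial>lcell) =
        (\<integral>x. v t x $ i * mol n (\<lambda>x. v t x $ i) x \<partial>lcell) - (\<integral>x. v t x $ i * v t x $ i \<partial>lcell)" for n
      by (subst integral_diff[symmetric])
         (auto intro!: integrable_smooth_mult[OF vint[OF t]] smooth_mol periodic_mol vint[OF t] integrable_mult_bounded[OF vint[OF t] vm[OF t] b] simp: algebra_simps)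
    then have "(\<lambda>n. (\<integral>x. v t x $ i * mol n (\<lambda>x. v t x $ i) x \<partial>lcell) - (\<integral>x. v t x $ i * v t x $ i \<partial>lcell)) \<longlonglongrightarrow> 0"
      using tendsto_mol_bounded[OF vper[OF t] vint[OF t] vm[OF t] b, of i] by simp
    then show ?thesis by (rule LIM_zero_cancel)
  qed
  then show ?thesis unfolding mol_energy_def energy_def by (intro tendsto_intros) auto
qed

text \<open>As \<open>v\<close> is divergence free, the factor \<open>v\<^sub>i\<close> may be replaced by its distance to its own
  mollification, which tends to 0.\<close>

lemma convective_tendsto:
  assumes t: "t \<in> {0..T}"
  shows "(\<lambda>n. \<Sum>i\<in>UNIV. \<Sum>j\<in>UNIV. \<integral>x. (v t x $ i * v t x $ j) * mol n (\<lambda>x. w j t x $ i) x \<partial>lcell) \<longlonglongrightarrow> 0"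
proof -
  let ?V = "\<lambda>n i. mol n (\<lambda>x. v t x $ i)" and ?W = "\<lambda>n i j. mol n (\<lambda>x. w j t x $ i)"
  note sV = smooth_mol[OF vint[OF t]] and pV = periodic_mol[OF vint[OF t]]
    and sW = smooth_mol[OF wint[OF t]] and pW = periodic_mol[OF wint[OF t]]
  note b = vb[OF t]
  have gm: "(\<lambda>x. v t x $ j * ?W n i j x) \<in> borel_measurable lcell" for n i j
    using integrable_smooth_mult[OF vint[OF t] sW pW] by auto
  have gb: "AE x in lcell. \<bar>v t x $ j * ?W n i j x\<bar> \<le> K * K" for n i j
    using b[of j] by eventually_elim (use mol_gradient_bound[OF t] K in \<open>auto simp: abs_mult intro: mult_mono\<close>)
  have "(\<integral>x. (?V n i x - v t x $ i) * (v t x $ j * ?W n i j x) \<partial>lcell) =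
      (\<integral>x. v t x $ j * (?V n i x * ?W n i j x) \<partial>lcell) - (\<integral>x. (v t x $ i * v t x $ j) * ?W n i j x \<partial>lcell)" for n i j
  proof -
    have 1: "integrable lcell (\<lambda>x. v t x $ j * ?V n i x * ?W n i j x)"
      by (intro integrable_smooth_mult vint[OF t] sW pW sV pV)
    have 2: "integrable lcell (\<lambda>x. (v t x $ i * v t x $ j) * ?W n i j x)"
      by (intro integrable_smooth_mult sW pW integrable_mult_bounded[OF vint[OF t] vm[OF t] b])
    have "(\<lambda>x. (?V n i x - v t x $ i) * (v t x $ j * ?W n i j x)) = (\<lambda>x. v t x $ j * ?V n i x * ?W n i j x - (v t x $ i * v t x $ j) * ?W n i j x)"
      by (simp add: fun_eq_iff algebra_simps)
    moreover have "(\<lambda>x. v t x $ j * (?V n i x * ?W n i j x)) = (\<lambda>x. v t x $ j * ?V n i x * ?W n i j x)"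
      by (simp only: mult.assoc)
    ultimately show ?thesis using integral_diff[OF 1 2] by (simp only:)
  qed
  moreover have zero: "(\<Sum>i\<in>UNIV. \<Sum>j\<in>UNIV. \<integral>x. v t x $ j * (?V n i x * ?W n i j x) \<partial>lcell) = 0" for n
  proof (rule sum.neutral, rule ballI)
    fix i
    \<comment> \<open>The product of a mollified component with its derivative is the derivative of
      half its square, a smooth periodic function to which weak incompressibility applies.\<close>
    let ?\<psi> = "\<lambda>x. (?V n i x * ?V n i x) * (1 / 2)"
    have "partial j ?\<psi> x = ?V n i x * ?W n i j x" for x j
    proof -
      have d: "(?V n i has_derivative frechet_derivative (?V n i) (at x)) (at x)" by (rule smooth_has_derivative(1)[OF sV])
      have "(?\<psi> has_derivative (\<lambda>h. (?V n i x * frechet_derivative (?V n i) (at x) h + frechet_derivative (?V n i) (at x) h * ?V n i x) * (1 / 2))) (at x)"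
        by (intro has_derivative_mult_left has_derivative_mult d)
      from frechet_derivative_eqI[OF this] show ?thesis by (simp add: mol_gradient[OF t])
    qed
    moreover have "smooth ?\<psi>" by (intro smooth_mult smooth_const sV)
    moreover have "periodic ?\<psi>" by (rule periodic_compose[OF pV, of "\<lambda>y. (y * y) * (1 / 2)"])
    ultimately show "(\<Sum>j\<in>UNIV. \<integral>x. v t x $ j * (?V n i x * ?W n i j x) \<partial>lcell) = 0"
      using divergence_pairing[OF _ _ t, of ?\<psi>] by simp
  qed
  ultimately have eq: "(\<Sum>i\<in>UNIV. \<Sum>j\<in>UNIV. \<integral>x. (v t x $ i * v t x $ j) * ?W n i j x \<partial>lcell) =
      (\<Sum>i\<in>UNIV. \<Sum>j\<in>UNIV. - (\<integral>x. (?V n i x - v t x $ i) * (v t x $ j * ?W n i j x) \<partial>lcell))" for n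
    using zero[of n] by (simp add: sum_subtractf)
  have "(\<lambda>n. \<Sum>i\<in>UNIV. \<Sum>j\<in>UNIV. - (\<integral>x. (?V n i x - v t x $ i) * (v t x $ j * ?W n i j x) \<partial>lcell)) \<longlonglongrightarrow> (\<Sum>i\<in>(UNIV::'d set). \<Sum>j\<in>(UNIV::'d set). - 0)"
    by (intro tendsto_sum tendsto_minus tendsto_mol_bounded[OF vper[OF t] vint[OF t] gm gb])
  then show ?thesis unfolding eq by simp
qed

text \<open>The stress is merely integrable, so convergence of the mollified gradient in the mean is
  not enough. Symmetry of the mollifier moves it onto the stress, which converges in the mean, while
  the gradient is bounded.\<close>

lemma stress_tendsto:
  assumes t: "t \<in> {0<..<T}" and S: "\<And>i j. integrable lcell (\<lambda>x. S t x $ i $ j)"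
  shows "(\<lambda>n. \<Sum>i\<in>UNIV. \<Sum>j\<in>UNIV. \<integral>x. S t x $ i $ j * mol n (\<lambda>x. w j t x $ i) x \<partial>lcell) \<longlonglongrightarrow>
    (\<Sum>i\<in>UNIV. \<Sum>j\<in>UNIV. \<integral>x. S t x $ i $ j * w j t x $ i \<partial>lcell)"
proof (intro tendsto_sum)
  fix i j
  have t': "t \<in> {0..T}" using t by auto
  have b: "AE x in lcell. \<bar>w j t x $ i\<bar> \<le> K" using wb[OF t'] by (simp only: AE_torus_iff)
  have Sp: "periodic (\<lambda>x. S t x $ i $ j)" by (rule periodic_compose[OF Sper[OF t], of "\<lambda>y. y $ i $ j"])
  have "(\<integral>x. (mol n (\<lambda>x. S t x $ i $ j) x - S t x $ i $ j) * w j t x $ i \<partial>lcell) =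
     (\<integral>x. S t x $ i $ j * mol n (\<lambda>x. w j t x $ i) x \<partial>lcell) - (\<integral>x. S t x $ i $ j * w j t x $ i \<partial>lcell)" for n
    unfolding mol_symmetric[OF wint[OF t'] S] left_diff_distrib
    by (intro integral_diff integrable_mult_bounded[OF _ wm[OF t'] b] integrable_mol S)
  then have "(\<lambda>n. (\<integral>x. S t x $ i $ j * mol n (\<lambda>x. w j t x $ i) x \<partial>lcell) - (\<integral>x. S t x $ i $ j * w j t x $ i \<partial>lcell)) \<longlonglongrightarrow> 0"
    using tendsto_mol_bounded[OF Sp S wm[OF t'] b] by simp
  then show "(\<lambda>n. \<integral>x. S t x $ i $ j * mol n (\<lambda>x. w j t x $ i) x \<partial>lcell) \<longlonglongrightarrow> (\<integral>x. S t x $ i $ j * w j t x $ i \<partial>lcell)"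
    by (rule LIM_zero_cancel)
qed

text \<open>As n grows, the convective part of the flux disappears and the stress part tends to the
  stress power. The latter is represented by an integrable \<open>\<sigma>\<close>, because
  \<open>w\<close> is chosen separately at each time and carries no joint measurability.\<close>

lemma energy_lower:
  assumes \<sigma>: "integrable (ltime T) \<sigma>"
      "AE u in ltime T. \<sigma> u = (\<Sum>i\<in>UNIV. \<Sum>j\<in>UNIV. \<integral>x. S u x $ i $ j * w j u x $ i \<partial>lcell)"
    and \<tau>: "\<tau> \<in> {0..T}"
  shows "- (\<integral>u. indicator {..<\<tau>} u * (\<sigma> u + defect_bound * trace (R u cell)) \<partial>ltime T) \<le> energy \<tau> - energy 0"
proof -
  let ?L = "ltime T"
  define P where "P n h \<longleftrightarrow> integrable ?L h \<and>
      (AE u in ?L. h u = (\<Sum>i\<in>UNIV. \<Sum>j\<in>UNIV. \<integral>x. flux u i j x * mol n (\<lambda>x. w j u x $ i) x \<partial>lcell)) \<and>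
      (\<integral>u. indicator {..<\<tau>} u * (h u - defect_bound * trace (R u cell)) \<partial>?L) \<le> mol_energy n \<tau> - mol_energy n 0" for n h
  have "\<exists>h. P n h" for n
  proof (rule mol_energy_lower[of n])
    fix h
    assume "integrable ?L h"
      "AE u in ?L. h u = (\<Sum>i\<in>UNIV. \<Sum>j\<in>UNIV. \<integral>x. flux u i j x * mol n (\<lambda>x. w j u x $ i) x \<partial>lcell)"
      "\<And>\<tau>. \<tau> \<in> {0..T} \<Longrightarrow> (\<integral>u. indicator {..<\<tau>} u * (h u - defect_bound * trace (R u cell)) \<partial>?L) \<le> mol_energy n \<tau> - mol_energy n 0"
    then have "P n h" unfolding P_def using \<tau> by (intro conjI)
    then show "\<exists>h. P n h" by (rule exI[of _ h])
  qed
  then obtain h where hP: "\<And>n. P n (h n)" by metis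
  have h: "integrable ?L (h n)"
      "AE u in ?L. h n u = (\<Sum>i\<in>UNIV. \<Sum>j\<in>UNIV. \<integral>x. flux u i j x * mol n (\<lambda>x. w j u x $ i) x \<partial>lcell)"
      "(\<integral>u. indicator {..<\<tau>} u * (h n u - defect_bound * trace (R u cell)) \<partial>?L) \<le> mol_energy n \<tau> - mol_energy n 0" for n
    using hP[of n] by (simp_all only: P_def)
  \<comment> \<open>A majorant independent of n, available because the mollified derivatives stay
    below K.\<close>
  define \<Phi> where "\<Phi> u = (\<Sum>i\<in>UNIV. \<Sum>j\<in>UNIV. (\<integral>x. \<bar>flux u i j x\<bar> \<partial>lcell) * K)" for u
  have \<Phi>i: "integrable ?L \<Phi>"
    unfolding \<Phi>_def using spacetime_fubini_integrable[OF integrable_abs[OF flux_integrable]]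
    by (intro integrable_sum integrable_mult_left) simp
  have Ssec: "AE u in ?L. \<forall>i j. integrable lcell (\<lambda>x. S u x $ i $ j)"
  proof (intro eventually_all_finite)
    fix i j
    show "AE u in ?L. integrable lcell (\<lambda>x. S u x $ i $ j)"
      using spacetime_fubini_sections[OF Sint[of i j]] by simp
  qed
  have inT: "AE u in ?L. u \<in> {0<..<T}" by (intro AE_I2) (auto simp: space_restrict_space)
  have hall: "AE u in ?L. \<forall>n. h n u = (\<Sum>i\<in>UNIV. \<Sum>j\<in>UNIV. \<integral>x. flux u i j x * mol n (\<lambda>x. w j u x $ i) x \<partial>lcell)"
    unfolding AE_all_countable using h(2) by blast
  have hb: "AE u in ?L. \<forall>n. \<bar>h n u\<bar> \<le> \<Phi> u"
    using hall flux_sections inT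
  proof eventually_elim
    case (elim u)
    then have t: "u \<in> {0..T}" by auto
    have "\<bar>\<integral>x. flux u i j x * mol n (\<lambda>x. w j u x $ i) x \<partial>lcell\<bar> \<le> (\<integral>x. \<bar>flux u i j x\<bar> \<partial>lcell) * K" for n i j
    proof -
      have i: "integrable lcell (\<lambda>x. flux u i j x * mol n (\<lambda>x. w j u x $ i) x)"
        using elim(2) by (intro integrable_smooth_mult smooth_mol periodic_mol wint[OF t]) auto
      have "\<bar>\<integral>x. flux u i j x * mol n (\<lambda>x. w j u x $ i) x \<partial>lcell\<bar> \<le> (\<integral>x. \<bar>flux u i j x * mol n (\<lambda>x. w j u x $ i) x\<bar> \<partial>lcell)"
        using integral_norm_bound[of "lcell" "\<lambda>x. flux u i j x * mol n (\<lambda>x. w j u x $ i) x"] by simp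
      also have "\<dots> \<le> (\<integral>x. \<bar>flux u i j x\<bar> * K \<partial>lcell)"
        using elim(2) mol_gradient_bound[OF t]
        by (intro integral_mono integrable_abs i integrable_mult_left) (auto simp: abs_mult intro: mult_left_mono)
      finally show ?thesis by simp
    qed
    then show ?case
      unfolding \<Phi>_def using elim(1) by (auto intro!: order_trans[OF sum_abs] sum_mono)
  qed
  have hlim: "AE u in ?L. (\<lambda>n. h n u) \<longlonglongrightarrow> - \<sigma> u"
    using hall Ssec inT \<sigma>(2)
  proof eventually_elim
    case (elim u)
    then have t: "u \<in> {0..T}" by auto
    have S: "integrable lcell (\<lambda>x. S u x $ i $ j)" for i j using elim(2) by blast
    have "h n u = (\<Sum>i\<in>UNIV. \<Sum>j\<in>UNIV. \<integral>x. (v u x $ i * v u x $ j) * mol n (\<lambda>x. w j u x $ i) x \<partial>lcell) -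
        (\<Sum>i\<in>UNIV. \<Sum>j\<in>UNIV. \<integral>x. S u x $ i $ j * mol n (\<lambda>x. w j u x $ i) x \<partial>lcell)" for n
    proof -
      note b = vb[OF t]
      show ?thesis
        unfolding elim(1)[rule_format] flux_def left_diff_distrib sum_subtractf[symmetric]
        by (intro sum.cong refl integral_diff integrable_smooth_mult smooth_mol periodic_mol wint[OF t] S
            integrable_mult_bounded[OF vint[OF t] vm[OF t] b])
    qed
    then show ?case
      using tendsto_diff[OF convective_tendsto[OF t] stress_tendsto[OF elim(3) S]] elim(4) by simp
  qed
  have tri: "integrable ?L (\<lambda>u. defect_bound * trace (R u cell))" using trace_integrable by simp
  let ?d = "\<lambda>u. indicator {..<\<tau>} u * (defect_bound * trace (R u cell)) :: real"
  have di: "integrable ?L ?d" by (rule integrable_indicator_times[OF tri]) simp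
  have "(\<lambda>n. \<integral>u. indicator {..<\<tau>} u * h n u \<partial>?L) \<longlonglongrightarrow> (\<integral>u. indicator {..<\<tau>} u * - \<sigma> u \<partial>?L)"
  proof (rule integral_dominated_convergence[where w = \<Phi>])
    have "integrable ?L (\<lambda>u. indicator {..<\<tau>} u * - \<sigma> u)" using \<sigma>(1) by (intro integrable_indicator_times) auto
    then show "(\<lambda>u. indicator {..<\<tau>} u * - \<sigma> u) \<in> borel_measurable ?L" by (rule borel_measurable_integrable)
    show "(\<lambda>u. indicator {..<\<tau>} u * h n u) \<in> borel_measurable ?L" for n
      using integrable_indicator_times[OF h(1), of "{..<\<tau>}"] by (intro borel_measurable_integrable) auto
    show "AE u in ?L. (\<lambda>n. indicator {..<\<tau>} u * h n u) \<longlonglongrightarrow> indicator {..<\<tau>} u * - \<sigma> u"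
      using hlim by eventually_elim (intro tendsto_mult tendsto_const)
    show "AE u in ?L. norm (indicator {..<\<tau>} u * h n u) \<le> \<Phi> u" for n
      using hb
    proof eventually_elim
      case (elim u)
      then have "\<bar>h n u\<bar> \<le> \<Phi> u" by blast
      then show ?case using abs_ge_zero[of "h n u"] by (auto simp: indicator_def)
    qed
  qed (rule \<Phi>i)
  then have "(\<lambda>n. (\<integral>u. indicator {..<\<tau>} u * h n u \<partial>?L) - (\<integral>u. ?d u \<partial>?L)) \<longlonglongrightarrow> (\<integral>u. indicator {..<\<tau>} u * - \<sigma> u \<partial>?L) - (\<integral>u. ?d u \<partial>?L)"
    by (intro tendsto_diff tendsto_const)
  moreover have "(\<lambda>n. mol_energy n \<tau> - mol_energy n 0) \<longlonglongrightarrow> energy \<tau> - energy 0"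
    using T by (intro tendsto_diff mol_energy_tendsto \<tau>) auto
  moreover have "(\<integral>u. indicator {..<\<tau>} u * h n u \<partial>?L) - (\<integral>u. ?d u \<partial>?L) \<le> mol_energy n \<tau> - mol_energy n 0" for n
  proof -
    have "(\<integral>u. indicator {..<\<tau>} u * (h n u - defect_bound * trace (R u cell)) \<partial>?L) = (\<integral>u. indicator {..<\<tau>} u * h n u \<partial>?L) - (\<integral>u. ?d u \<partial>?L)"
      unfolding right_diff_distrib by (intro integral_diff integrable_indicator_times[OF h(1)] di) auto
    then show ?thesis using h(3)[of n] by simp
  qed
  ultimately have "(\<integral>u. indicator {..<\<tau>} u * - \<sigma> u \<partial>?L) - (\<integral>u. ?d u \<partial>?L) \<le> energy \<tau> - energy 0"
    by (intro LIMSEQ_le) auto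
  moreover have "(\<integral>u. indicator {..<\<tau>} u * (\<sigma> u + defect_bound * trace (R u cell)) \<partial>?L) = (\<integral>u. indicator {..<\<tau>} u * \<sigma> u \<partial>?L) + (\<integral>u. ?d u \<partial>?L)"
    unfolding distrib_left by (intro integral_add integrable_indicator_times[OF \<sigma>(1)] di) auto
  ultimately show ?thesis by simp
qed

text \<open>The test function is the mollified difference of the two data; since the kernel has finite
  rank, the resulting integral is a sum of squares.\<close>

lemma initial_datum:
  assumes w0: "\<And>j. has_weak_partial j v0 (w0 j)" and div0: "divergence_free v0"
  shows "AE x in torus. v 0 x = v0 x"
proof -
  have z: "0 \<in> {0..T}" using T by simp
  define u where "u x = v 0 x - v0 x" for x
  have up: "has_weak_partial j u (\<lambda>x. w j 0 x - w0 j x)" for j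
    unfolding u_def by (rule has_weak_partial_diff[OF wp[OF z] w0])
  then have u1: "torus_Lp 1 u" by (simp add: has_weak_partial_def)
  have v01: "torus_Lp 1 v0" using w0 by (simp add: has_weak_partial_def)
  have ui: "integrable lcell (\<lambda>x. u x $ i)" for i by (rule integrable_component[OF torus_Lp_1D(3)[OF u1]])
  have v0i: "integrable lcell (\<lambda>x. v0 x $ i)" for i by (rule integrable_component[OF torus_Lp_1D(3)[OF v01]])
  have uper: "periodic (\<lambda>x. u x $ i)" for i by (rule periodic_compose[OF torus_Lp_1D(1)[OF u1], of "\<lambda>y. y $ i"])
  define V where "V n x = (\<chi> i. mol n (\<lambda>x. u x $ i) x)" for n x
  have Vi: "(\<lambda>x. V n x $ i) = mol n (\<lambda>x. u x $ i)" for n i by (simp add: V_def fun_eq_iff)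
  have sV: "smooth (\<lambda>x. V n x $ i)" "periodic (\<lambda>x. V n x $ i)" for n i
    unfolding Vi by (rule smooth_mol[OF ui] periodic_mol[OF ui])+
  have dpair: "(\<Sum>j\<in>UNIV. \<integral>x. u x $ j * partial j \<psi> x \<partial>lcell) = 0" if \<psi>: "smooth \<psi>" "periodic \<psi>" for \<psi>
  proof -
    note sp = smooth_periodic_partial[OF \<psi>]
    have "(\<integral>x. (\<Sum>j\<in>UNIV. v0 x $ j * partial j \<psi> x) \<partial>lcell) = 0"
      using div0 \<psi> unfolding divergence_free_def by blast
    moreover have "(\<integral>x. (\<Sum>j\<in>UNIV. v0 x $ j * partial j \<psi> x) \<partial>lcell) =
        (\<Sum>j\<in>UNIV. \<integral>x. v0 x $ j * partial j \<psi> x \<partial>lcell)"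
      by (intro integral_sum integrable_smooth_mult v0i sp)
    moreover have "(\<integral>x. u x $ j * partial j \<psi> x \<partial>lcell) =
        (\<integral>x. v 0 x $ j * partial j \<psi> x \<partial>lcell) - (\<integral>x. v0 x $ j * partial j \<psi> x \<partial>lcell)" for j
      unfolding u_def vector_minus_component left_diff_distrib
      by (intro integral_diff integrable_smooth_mult v0i vint[OF z] sp)
    ultimately show ?thesis using divergence_pairing[OF \<psi> z] by (simp add: sum_subtractf)
  qed
  have dV: "(\<Sum>j\<in>UNIV. partial j (\<lambda>x. V n x $ j) x) = 0" for n x
  proof -
    have "partial j (\<lambda>x. V n x $ j) x = - (\<integral>y. u y $ j * partial j (\<lambda>y. trig_kernel n (x - y)) y \<partial>lcell)" for j
    proof -
      have "partial j (mol n (\<lambda>x. u x $ j)) x = mol n (\<lambda>x. (w j 0 x - w0 j x) $ j) x"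
        by (rule mol_derivative[OF ui weak_partial_component[OF up]])
      then show ?thesis unfolding Vi using weak_partial_component[OF up trig_kernel_reflect] by (simp add: mol_def)
    qed
    then show ?thesis using dpair[OF trig_kernel_reflect] by (simp add: sum_negf)
  qed
  have "AE x in torus. u x $ i = 0" for i
  proof -
    have zero: "mol n (\<lambda>x. u x $ i) x = 0" for n i x
    proof -
      obtain N and F :: "nat \<Rightarrow> real^'d \<Rightarrow> real" where F: "\<And>m. m < N \<Longrightarrow> smooth (F m)" "\<And>m. m < N \<Longrightarrow> periodic (F m)"
        "\<And>x y. trig_kernel n (x - y) = (\<Sum>m<N. F m x * F m y)" using trig_kernel_rank by blast
      \<comment> \<open>At time 0 the time integrals in the momentum equation run over an empty
        interval.\<close>
      have "(\<integral>x. v 0 x \<bullet> V n x \<partial>lcell) - (\<integral>x. v0 x \<bullet> V n x \<partial>lcell) = 0"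
      proof -
        have "(\<integral>u. indicator {..<0} u * f u \<partial>ltime T) = 0" for f :: "real \<Rightarrow> real"
          by (rule integral_eq_zero_AE) (auto intro!: AE_I2 simp: space_restrict_space)
        then show ?thesis using momentum_stationary[OF sV dV z] by simp
      qed
      moreover have "(\<integral>x. f x \<bullet> V n x \<partial>lcell) = (\<Sum>i\<in>UNIV. \<integral>x. f x $ i * mol n (\<lambda>x. u x $ i) x \<partial>lcell)"
        if f: "\<And>i. integrable lcell (\<lambda>x. f x $ i)" for f
      proof -
        have "(\<integral>x. f x \<bullet> V n x \<partial>lcell) = (\<integral>x. (\<Sum>i\<in>UNIV. f x $ i * mol n (\<lambda>x. u x $ i) x) \<partial>lcell)"
          by (simp add: inner_vec_def V_def)
        also have "\<dots> = (\<Sum>i\<in>UNIV. \<integral>x. f x $ i * mol n (\<lambda>x. u x $ i) x \<partial>lcell)"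
          by (intro integral_sum integrable_smooth_mult f smooth_mol periodic_mol ui)
        finally show ?thesis .
      qed
      ultimately have "(\<Sum>i\<in>UNIV. (\<integral>x. v 0 x $ i * mol n (\<lambda>x. u x $ i) x \<partial>lcell) - (\<integral>x. v0 x $ i * mol n (\<lambda>x. u x $ i) x \<partial>lcell)) = 0"
        using vint[OF z] v0i by (simp add: sum_subtractf)
      moreover have "(\<integral>x. v 0 x $ i * mol n (\<lambda>x. u x $ i) x \<partial>lcell) - (\<integral>x. v0 x $ i * mol n (\<lambda>x. u x $ i) x \<partial>lcell) =
          (\<Sum>m<N. (\<integral>x. u x $ i * F m x \<partial>lcell)\<^sup>2)" for i
      proof -
        have "(\<integral>x. v 0 x $ i * mol n (\<lambda>x. u x $ i) x \<partial>lcell) - (\<integral>x. v0 x $ i * mol n (\<lambda>x. u x $ i) x \<partial>lcell) =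
            (\<integral>x. u x $ i * mol n (\<lambda>x. u x $ i) x \<partial>lcell)"
          by (subst integral_diff[symmetric])
             (auto intro!: integrable_smooth_mult vint[OF z] v0i smooth_mol periodic_mol ui simp: left_diff_distrib u_def[abs_def])
        also have "\<dots> = (\<Sum>m<N. (\<integral>x. u x $ i * F m x \<partial>lcell) * (\<integral>x. u x $ i * F m x \<partial>lcell))"
          by (rule mol_pairing[OF ui ui F])
        finally show ?thesis by (simp add: power2_eq_square)
      qed
      ultimately have "(\<Sum>i\<in>UNIV. \<Sum>m<N. (\<integral>x. u x $ i * F m x \<partial>lcell)\<^sup>2) = 0" by simp
      then have "(\<Sum>m<N. (\<integral>x. u x $ i * F m x \<partial>lcell)\<^sup>2) = 0"
        by (subst (asm) sum_nonneg_eq_0_iff) (auto intro: sum_nonneg)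
      then have "(\<integral>x. u x $ i * F m x \<partial>lcell) = 0" if "m < N" for m
        using that by (subst (asm) sum_nonneg_eq_0_iff) auto
      moreover have "mol n (\<lambda>x. u x $ i) x = (\<Sum>m<N. F m x * (\<integral>y. u y $ i * F m y \<partial>lcell))"
        by (rule mol_expand[OF ui F])
      ultimately show ?thesis by simp
    qed
    have "(\<lambda>n::nat. \<integral>x. \<bar>u x $ i\<bar> \<partial>lcell) \<longlonglongrightarrow> 0"
      using tendsto_integral_mol[OF uper ui, of i] by (simp add: zero)
    then have "(\<integral>x. \<bar>u x $ i\<bar> \<partial>lcell) = 0" using LIMSEQ_unique tendsto_const by blast
    then have "AE x in lcell. \<bar>u x $ i\<bar> = 0"
      using integral_nonneg_eq_0_iff_AE[OF integrable_abs[OF ui[of i]]] by simp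
    then show ?thesis by (simp add: AE_torus_iff)
  qed
  then have "AE x in torus. \<forall>i. u x $ i = 0" by (rule eventually_all_finite)
  then show ?thesis by eventually_elim (simp add: u_def vec_eq_iff)
qed

end

section \<open>The symmetric gradient\<close>

lemma sym_mats_iff: "A \<in> sym_mats \<longleftrightarrow> (\<forall>k l. A $ k $ l = A $ l $ k)"
  by (auto simp: sym_mats_def transpose_def vec_eq_iff)

lemma bounded_linear_axis: "bounded_linear (axis i :: 'b::euclidean_space \<Rightarrow> 'b^'m)"
  by (intro linear_conv_bounded_linear[THEN iffD1] linearI) (auto simp: axis_def vec_eq_iff)

lemma integrable_vecI:
  fixes f :: "'a \<Rightarrow> 'b::euclidean_space^'m"
  assumes "\<And>i. integrable M (\<lambda>x. f x $ i)"
  shows "integrable M f"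
proof -
  have "f x = (\<Sum>i\<in>UNIV. axis i (f x $ i))" for x
    by (simp add: vec_eq_iff axis_def)
  moreover have "integrable M (\<lambda>x. \<Sum>i\<in>UNIV. axis i (f x $ i))"
    by (intro integrable_sum integrable_bounded_linear[OF bounded_linear_axis] assms)
  ultimately show ?thesis by (simp add: fun_eq_iff cong: integrable_cong)
qed

lemma integrable_smooth_mult_spacetime:
  fixes f g :: "real \<times> (real^'d) \<Rightarrow> real"
  assumes g: "integrable (lst T) g" and f: "smooth f"
  shows "integrable (lst T) (\<lambda>z. g z * f z)"
proof -
  let ?C = "{0..T} \<times> cbox (\<chi> i. -1) (\<chi> i. 1) :: (real \<times> (real^'d)) set"
  have "compact (f ` ?C)" by (intro compact_continuous_image smooth_continuous_on[OF f] compact_Times) auto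
  then have "bounded (f ` ?C)" by (rule compact_imp_bounded)
  then obtain B where B0: "\<forall>y\<in>f ` ?C. norm y \<le> B" unfolding bounded_iff by blast
  have B: "\<bar>f z\<bar> \<le> B" if "z \<in> ?C" for z using bspec[OF B0 imageI[OF that]] by simp
  show ?thesis
  proof (rule integrable_mult_bounded[OF g])
    show "f \<in> borel_measurable (lst T)"
      by (intro lebesgue_on_borel_measurable borel_measurable_continuous_onI smooth_continuous_on f)
    have sub: "spacetime T \<subseteq> ?C" using cell_subset_cbox by (intro Sigma_mono) auto
    show "AE z in lst T. \<bar>f z\<bar> \<le> B"
    proof (rule AE_I2)
      fix z assume "z \<in> space (lst T :: (real \<times> (real^'d)) measure)"
      then have "z \<in> spacetime T" by (simp add: space_restrict_space)
      then show "\<bar>f z\<bar> \<le> B" by (intro B subsetD[OF sub])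
    qed
  qed
qed

lemma smooth_section:
  fixes f :: "real \<times> (real^'d) \<Rightarrow> real"
  assumes f: "smooth f"
  shows "smooth (\<lambda>x. f (t, x))"
    and "frechet_derivative (\<lambda>x. f (t, x)) (at x) h = frechet_derivative f (at (t, x)) (0, h)"
proof -
  have "bounded_linear (\<lambda>x::real^'d. (0::real, x))" by (rule bounded_linear_Pair[OF bounded_linear_zero bounded_linear_ident])
  from smooth_bounded_linear_right[OF this smooth_translate[OF f, of "(t, 0)"]]
  show "smooth (\<lambda>x. f (t, x))" by simp
  have "((\<lambda>x. (t, x)) has_derivative (\<lambda>h. (0, h))) (at x)" by (intro derivative_intros)
  from has_derivative_compose[OF this smooth_has_derivative(1)[OF f]]
  show "frechet_derivative (\<lambda>x. f (t, x)) (at x) h = frechet_derivative f (at (t, x)) (0, h)"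
    by (simp add: frechet_derivative_eqI)
qed

lemma weak_partial_spacetime:
  fixes v :: "real \<Rightarrow> real^'d \<Rightarrow> real^'d" and f :: "real \<times> (real^'d) \<Rightarrow> real"
  assumes v: "integrable (lst T) (\<lambda>z. v (fst z) (snd z) $ i)"
    and g: "integrable (lst T) (\<lambda>z. g (fst z) (snd z) $ i)"
    and wp: "AE t in ltime T. has_weak_partial j (v t) (g t)"
    and f: "smooth f" "\<And>t. periodic (\<lambda>x. f (t, x))"
  shows "(\<integral>z. v (fst z) (snd z) $ i * frechet_derivative f (at z) (0, axis j 1) \<partial>lst T) =
    - (\<integral>z. g (fst z) (snd z) $ i * f z \<partial>lst T)"
proof -
  have i1: "integrable (lst T) (\<lambda>z. v (fst z) (snd z) $ i * frechet_derivative f (at z) (0, axis j 1))"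
    by (rule integrable_smooth_mult_spacetime[OF v smooth_has_derivative(2)[OF f(1)]])
  have i2: "integrable (lst T) (\<lambda>z. - (g (fst z) (snd z) $ i * f z))"
    using integrable_smooth_mult_spacetime[OF g f(1)] by simp
  have "(\<integral>t. (\<integral>x. v t x $ i * frechet_derivative f (at (t, x)) (0, axis j 1) \<partial>lcell) \<partial>ltime T) =
      (\<integral>t. (\<integral>x. - (g t x $ i * f (t, x)) \<partial>lcell) \<partial>ltime T)"
  proof (rule integral_cong_AE)
    show "(\<lambda>t. \<integral>x. v t x $ i * frechet_derivative f (at (t, x)) (0, axis j 1) \<partial>lcell) \<in> borel_measurable (ltime T)"
      using spacetime_fubini_integrable[OF i1] by auto
    show "(\<lambda>t. \<integral>x. - (g t x $ i * f (t, x)) \<partial>lcell) \<in> borel_measurable (ltime T)"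
      using borel_measurable_integrable[OF spacetime_fubini_integrable[OF i2]] by (simp only: fst_conv snd_conv)
    show "AE t in ltime T. (\<integral>x. v t x $ i * frechet_derivative f (at (t, x)) (0, axis j 1) \<partial>lcell) =
        (\<integral>x. - (g t x $ i * f (t, x)) \<partial>lcell)"
      using wp
    proof eventually_elim
      case (elim t)
      from weak_partial_component[OF elim smooth_section(1)[OF f(1)] f(2)] show ?case
        by (simp add: smooth_section(2)[OF f(1)])
    qed
  qed
  then show ?thesis using spacetime_fubini[OF i1] spacetime_fubini[OF i2] by simp
qed

lemma matrix_component_derivative:
  fixes \<Psi> :: "'a::real_normed_vector \<Rightarrow> real^'d^'d"
  assumes "smooth \<Psi>"
  shows "smooth (\<lambda>z. \<Psi> z $ i $ j)" "frechet_derivative (\<lambda>z. \<Psi> z $ i $ j) (at z) h = frechet_derivative \<Psi> (at z) h $ i $ j"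
proof -
  have bl: "bounded_linear (\<lambda>A :: real^'d^'d. A $ i $ j)"
    by (rule bounded_linear_compose[OF bounded_linear_vec_nth bounded_linear_vec_nth])
  show "smooth (\<lambda>z. \<Psi> z $ i $ j)" by (rule smooth_bounded_linear_left[OF bl assms])
  have "((\<lambda>z. \<Psi> z $ i $ j) has_derivative (\<lambda>h. frechet_derivative \<Psi> (at z) h $ i $ j)) (at z)"
    by (rule bounded_linear.has_derivative[OF bl smooth_has_derivative(1)[OF assms]])
  from frechet_derivative_eqI[OF this]
  show "frechet_derivative (\<lambda>z. \<Psi> z $ i $ j) (at z) h = frechet_derivative \<Psi> (at z) h $ i $ j" by simp
qed

text \<open>Here \<open>g j\<close> stands for the derivative in direction j, so the (i, j) entry of
  the gradient is \<open>g j z $ i\<close>.\<close>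

definition sym_part :: "('d \<Rightarrow> 'a \<Rightarrow> real^'d) \<Rightarrow> 'a \<Rightarrow> real^'d^'d" where
  "sym_part g z = (\<chi> i j. (g j z $ i + g i z $ j) / 2)"

lemma sym_part_sym: "sym_part g z \<in> sym_mats"
  by (simp add: sym_part_def sym_mats_iff add.commute)

lemma inner_sym_part:
  assumes "A \<in> sym_mats"
  shows "A \<bullet> sym_part g z = (\<Sum>i\<in>UNIV. \<Sum>j\<in>UNIV. A $ i $ j * g j z $ i)"
proof -
  have "A \<bullet> sym_part g z = (\<Sum>i\<in>UNIV. \<Sum>j\<in>UNIV. A $ i $ j * g j z $ i / 2) + (\<Sum>i\<in>UNIV. \<Sum>j\<in>UNIV. A $ i $ j * g i z $ j / 2)"
    by (simp add: inner_vec_def sym_part_def sum.distrib[symmetric] distrib_left add_divide_distrib)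
  also have "(\<Sum>i\<in>UNIV. \<Sum>j\<in>UNIV. A $ i $ j * g i z $ j / 2) = (\<Sum>i\<in>UNIV. \<Sum>j\<in>UNIV. A $ i $ j * g j z $ i / 2)"
    using assms by (subst sum.swap) (simp add: sym_mats_iff)
  finally show ?thesis by (simp add: sum.distrib[symmetric])
qed

text \<open>Against symmetric test fields the symmetric part may be replaced by the full gradient,
  and each entry is then integrated by parts on almost every time slice.\<close>

lemma symgrad_is_function_sym_part:
  fixes v :: "real \<Rightarrow> real^'d \<Rightarrow> real^'d" and g :: "'d \<Rightarrow> real \<Rightarrow> real^'d \<Rightarrow> real^'d"
  assumes v: "\<And>i. integrable (lst T) (\<lambda>z. v (fst z) (snd z) $ i)"
    and g: "\<And>i j. integrable (lst T) (\<lambda>z. g j (fst z) (snd z) $ i)"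
    and wp: "\<And>j. AE t in ltime T. has_weak_partial j (v t) (g j t)"
  shows "symgrad_is_function T v (sym_part (\<lambda>j z. g j (fst z) (snd z)))"
  unfolding symgrad_is_function_def
proof (intro conjI allI impI)
  let ?D = "sym_part (\<lambda>j z. g j (fst z) (snd z))"
  show "integrable (lst T) ?D"
    unfolding sym_part_def by (intro integrable_vecI) (simp add: g)
  show "range ?D \<subseteq> sym_mats" using sym_part_sym by auto
  fix \<Psi> :: "real \<times> (real^'d) \<Rightarrow> real^'d^'d" assume \<Psi>: "spacetime_test T \<Psi> \<and> range \<Psi> \<subseteq> sym_mats"
  then have s: "smooth \<Psi>" and per: "\<And>t. periodic (\<lambda>x. \<Psi> (t, x))" and \<Psi>sym: "\<And>z. \<Psi> z \<in> sym_mats"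
    by (auto simp: spacetime_test_def)
  note s' = matrix_component_derivative[OF s]
  have per': "periodic (\<lambda>x. \<Psi> (t, x) $ i $ j)" for t i j by (rule periodic_compose[OF per, of "\<lambda>y. y $ i $ j"])
  have "(\<integral>z. \<Psi> z \<bullet> ?D z \<partial>lst T) =
      (\<integral>z. (\<Sum>i\<in>UNIV. \<Sum>j\<in>UNIV. g j (fst z) (snd z) $ i * \<Psi> z $ i $ j) \<partial>lst T)"
    by (simp only: inner_sym_part[OF \<Psi>sym] mult.commute)
  also have "\<dots> = (\<Sum>i\<in>UNIV. \<Sum>j\<in>UNIV. \<integral>z. g j (fst z) (snd z) $ i * \<Psi> z $ i $ j \<partial>lst T)"
    by (intro integral_double_sum integrable_smooth_mult_spacetime g s')
  also have "\<dots> = - (\<Sum>i\<in>UNIV. \<Sum>j\<in>UNIV. \<integral>z. v (fst z) (snd z) $ i * frechet_derivative \<Psi> (at z) (0, axis j 1) $ i $ j \<partial>lst T)"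
    using weak_partial_spacetime[OF v g wp s'(1) per'] by (simp add: s'(2) sum_negf)
  also have "(\<Sum>i\<in>UNIV. \<Sum>j\<in>UNIV. \<integral>z. v (fst z) (snd z) $ i * frechet_derivative \<Psi> (at z) (0, axis j 1) $ i $ j \<partial>lst T) =
      (\<integral>z. (\<Sum>i\<in>UNIV. \<Sum>j\<in>UNIV. v (fst z) (snd z) $ i * frechet_derivative \<Psi> (at z) (0, axis j 1) $ i $ j) \<partial>lst T)"
  proof -
    have "integrable (lst T) (\<lambda>z. v (fst z) (snd z) $ i * frechet_derivative \<Psi> (at z) (0, axis j 1) $ i $ j)" for i j
      using integrable_smooth_mult_spacetime[OF v smooth_has_derivative(2)[OF s'(1)]] by (simp add: s'(2))
    then show ?thesis
      by (rule integral_double_sum[symmetric])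
  qed
  finally show "(\<integral>z. \<Psi> z \<bullet> ?D z \<partial>lst T) = symgrad_dist T v \<Psi>"
    by (simp add: symgrad_dist_def case_prod_beta')
qed

section \<open>The measure-valued symmetric gradient and its density\<close>

lemma set_integral_borel_rep:
  fixes h g :: "'a::euclidean_space \<Rightarrow> 'b::euclidean_space"
  assumes X: "X \<in> sets borel" and h: "integrable (lebesgue_on X) h" and g: "g \<in> borel_measurable borel" "AE x in lborel. x \<in> X \<longrightarrow> h x = g x"
    and A: "A \<in> sets borel" "A \<subseteq> X"
  shows "set_lebesgue_integral lebesgue A h = set_lebesgue_integral (restrict_space lborel X) A g"
proof -
  have m: "(\<lambda>x. indicator X x *\<^sub>R h x) \<in> borel_measurable lebesgue"
    using h X by (subst borel_measurable_restrict_space_iff[symmetric]) auto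
  have "A \<in> sets lebesgue" using A(1) by simp
  then have "(\<lambda>x. indicator A x *\<^sub>R (indicator X x *\<^sub>R h x)) \<in> borel_measurable lebesgue"
    by (rule borel_measurable_scaleR[OF borel_measurable_indicator m])
  moreover have "indicator A x *\<^sub>R (indicator X x *\<^sub>R h x) = indicator A x *\<^sub>R h x" for x using A(2) by (auto simp: indicator_def)
  ultimately have 1: "(\<lambda>x. indicator A x *\<^sub>R h x) \<in> borel_measurable lebesgue" by (simp only:)
  have 2: "(\<lambda>x. indicator A x *\<^sub>R g x) \<in> borel_measurable borel" using g(1) A by measurable
  have 3: "AE x in lebesgue. indicator A x *\<^sub>R h x = indicator A x *\<^sub>R g x"
    unfolding AE_completion_iff using g(2) by eventually_elim (use A(2) in \<open>auto simp: indicator_def\<close>)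
  have "set_lebesgue_integral lebesgue A h = (\<integral>x. indicator A x *\<^sub>R g x \<partial>lebesgue)"
    unfolding set_lebesgue_integral_def using 2 by (intro integral_cong_AE 1 3) (simp add: measurable_completion)
  also have "\<dots> = (\<integral>x. indicator A x *\<^sub>R g x \<partial>lborel)" using 2 by (simp add: integral_completion)
  also have "\<dots> = (\<integral>x. indicator X x *\<^sub>R (indicator A x *\<^sub>R g x) \<partial>lborel)"
    using A(2) by (intro integral_cong refl) (auto simp: indicator_def)
  also have "\<dots> = set_lebesgue_integral (restrict_space lborel X) A g"
    unfolding set_lebesgue_integral_def using X by (subst integral_restrict_space) auto
  finally show ?thesis .
qed

lemma borel_rep_integrable:
  fixes h :: "'a::euclidean_space \<Rightarrow> 'b::euclidean_space"
  assumes X: "X \<in> sets borel" and h: "integrable (lebesgue_on X) h"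
  obtains g where "g \<in> borel_measurable borel" "AE x in lborel. x \<in> X \<longrightarrow> h x = g x" "integrable (restrict_space lborel X) g"
proof -
  obtain g where g: "g \<in> borel_measurable borel" "AE x in lborel. x \<in> X \<longrightarrow> h x = g x"
    using lebesgue_on_ex_borel[OF borel_measurable_integrable[OF h] X] by blast
  have "AE x in lebesgue_on X. h x = g x" using g(2) X by (simp add: AE_restrict_space_iff AE_completion_iff)
  then have "integrable (lebesgue_on X) g"
    using h lebesgue_on_borel_measurable[OF g(1)] by (subst integrable_cong_AE[symmetric]) auto
  then have "integrable (restrict_space lborel X) g" using integrable_lebesgue_on_borel[OF g(1) X] by simp
  with g show ?thesis by (rule that)
qed

text \<open>The measure and the function represent the same distribution on symmetric test fields.
  Testing entry by entry gives equal integrals over \<open>spacetime_tests\<close>, and these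
  determine a signed measure.\<close>

lemma symgrad_measure_density:
  fixes v :: "real \<Rightarrow> real^'d \<Rightarrow> real^'d"
  assumes T: "T > 0" and \<mu>: "symgrad_is_measure T v \<mu>" and D: "symgrad_is_function T v D"
    and A: "A \<in> sets (borel_on (spacetime T))"
  shows "\<mu> A = set_lebesgue_integral lebesgue A D"
proof -
  let ?X = "spacetime T :: (real \<times> (real^'d)) set"
  let ?L = "restrict_space lborel ?X"
  have Di: "integrable (lebesgue_on ?X) D" and Dsym: "D z \<in> sym_mats" for z using D by (auto simp: symgrad_is_function_def)
  have vm: "vector_measure (borel_on ?X) \<mu>" and \<mu>sym: "\<And>A. A \<in> sets (borel_on ?X) \<Longrightarrow> \<mu> A \<in> sym_mats"
    using \<mu> by (auto simp: symgrad_is_measure_def sym_matrix_measure_def)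
  note vmc = matrix_measure_component[OF vm]
  obtain g where g: "g \<in> borel_measurable borel" "AE x in lborel. x \<in> ?X \<longrightarrow> D x = g x" "integrable ?L g"
    using borel_rep_integrable[OF spacetime_borel Di] by blast
  have gij: "integrable ?L (\<lambda>z. g z $ i $ j)" for i j by (intro integrable_component g(3))
  have A': "A \<in> sets borel" "A \<subseteq> ?X" using A by (auto simp: sets_restrict_space)
  have finL: "finite_measure ?L"
    unfolding spacetime_measure by (intro finite_measure_pair_measure times.finite_measure_axioms torus.finite_measure_axioms)
  have comp: "\<mu> A $ i $ j = (\<integral>z. indicator A z * g z $ i $ j \<partial>?L)" for i j
  proof (rule generating_signed_eqI[OF generating_spacetime[OF T] finL _ vmc gij _ A])
    show "sets ?L = sets (borel_on ?X)" by (simp add: sets_restrict_space)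
    fix f :: "real \<times> (real^'d) \<Rightarrow> real" assume f: "f \<in> spacetime_tests T"
    \<comment> \<open>Only symmetric fields may be tested. This one pairs with B to B_ij + B_ji,
      which is 2 B_ij for symmetric B, also when i = j.\<close>
    define E where "E = axis i (axis j (1::real)) + axis j (axis i 1)"
    define \<Psi> where "\<Psi> z = f z *\<^sub>R E" for z
    have ft: "spacetime_test T f" and fb: "\<And>z. 0 \<le> f z \<and> f z \<le> 1" using f by (auto simp: spacetime_tests_def)
    have fs: "smooth f" using ft by (simp add: spacetime_test_def)
    have Esym: "E $ k $ l = E $ l $ k" for k l by (auto simp: E_def axis_def)
    have "spacetime_test T \<Psi>"
      unfolding spacetime_test_def
    proof (intro conjI allI)
      show "smooth \<Psi>" unfolding \<Psi>_def by (rule smooth_bounded_linear_left[OF bounded_linear_scaleR_left fs])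
      have "periodic (\<lambda>x. f (t, x))" for t using ft by (simp add: spacetime_test_def)
      from periodic_compose[OF this, of "\<lambda>y. y *\<^sub>R E"] show "periodic (\<lambda>x. \<Psi> (t, x))" for t by (simp add: \<Psi>_def)
      obtain a b where "0 < a" "b < T" "\<forall>t x. t \<notin> {a..b} \<longrightarrow> f (t, x) = 0" using ft unfolding spacetime_test_def by blast
      then show "\<exists>a b. 0 < a \<and> b < T \<and> (\<forall>t x. t \<notin> {a..b} \<longrightarrow> \<Psi> (t, x) = 0)"
        by (intro exI[of _ a] exI[of _ b]) (simp add: \<Psi>_def)
    qed
    moreover have "range \<Psi> \<subseteq> sym_mats" using Esym by (auto simp: \<Psi>_def sym_mats_iff)
    ultimately have eq: "matrix_integral (borel_on ?X) \<mu> \<Psi> = (\<integral>z. \<Psi> z \<bullet> D z \<partial>lebesgue_on ?X)"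
      using \<mu> D by (simp add: symgrad_is_measure_def symgrad_is_function_def)
    have pick: "(\<Sum>k\<in>UNIV. \<Sum>l\<in>UNIV. E $ k $ l * B $ k $ l) = B $ i $ j + B $ j $ i" for B :: "real^'d^'d"
    proof -
      have "(\<Sum>k\<in>UNIV. \<Sum>l\<in>UNIV. E $ k $ l * B $ k $ l) = E \<bullet> B" by (simp add: inner_vec_def)
      then show ?thesis by (simp add: E_def inner_add_left inner_axis')
    qed
    define s where "s k l = signed_integral (borel_on ?X) (\<lambda>A. \<mu> A $ k $ l) f" for k l
    have fm: "f \<in> borel_measurable (borel_on ?X)"
      by (intro measurable_restrict_space1 borel_measurable_continuous_onI smooth_continuous_on fs)
    have "signed_integral (borel_on ?X) (\<lambda>A. \<mu> A $ k $ l) (\<lambda>z. \<Psi> z $ k $ l) = E $ k $ l * s k l" for k l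
      using signed_integral_linear[OF vmc[of k l] fm _ fm, of 1 1 "E $ k $ l" 0] fb
      by (simp add: \<Psi>_def s_def mult.commute)
    then have "matrix_integral (borel_on ?X) \<mu> \<Psi> = (\<Sum>k\<in>UNIV. \<Sum>l\<in>UNIV. E $ k $ l * (\<chi> k l. s k l) $ k $ l)"
      by (simp add: matrix_integral_def)
    also have "\<dots> = s i j + s j i" by (subst pick) simp
    also have "s j i = s i j"
      unfolding s_def using \<mu>sym by (intro signed_integral_cong_sets) (auto simp: sym_mats_iff)
    finally have 1: "matrix_integral (borel_on ?X) \<mu> \<Psi> = 2 * s i j" by simp
    have "\<Psi> z \<bullet> D z = 2 * (f z * D z $ i $ j)" for z
    proof -
      have "\<Psi> z \<bullet> D z = f z * (\<Sum>k\<in>UNIV. \<Sum>l\<in>UNIV. E $ k $ l * D z $ k $ l)" by (simp add: \<Psi>_def inner_vec_def sum_distrib_left mult.assoc)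
      also have "\<dots> = f z * (D z $ i $ j + D z $ j $ i)" by (simp only: pick)
      also have "D z $ j $ i = D z $ i $ j" using Dsym[of z] by (simp add: sym_mats_iff)
      finally show ?thesis by simp
    qed
    then have "(\<integral>z. \<Psi> z \<bullet> D z \<partial>lebesgue_on ?X) = 2 * (\<integral>z. f z * D z $ i $ j \<partial>lebesgue_on ?X)" by simp
    also have "(\<integral>z. f z * D z $ i $ j \<partial>lebesgue_on ?X) = (\<integral>z. f z * g z $ i $ j \<partial>?L)"
    proof (rule borel_rep_AE(3)[OF spacetime_borel])
      have "f \<in> borel_measurable ?L" using fm by (simp cong: measurable_cong_sets add: sets_restrict_space)
      then show "(\<lambda>z. f z * g z $ i $ j) \<in> borel_measurable ?L" using gij[of i j] by (intro borel_measurable_times) auto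
      show "AE x in ?L. f x * D x $ i $ j = f x * g x $ i $ j"
        using g(2) by (simp add: AE_restrict_space_iff) (auto elim: eventually_mono)
    qed
    finally show "signed_integral (borel_on ?X) (\<lambda>A. \<mu> A $ i $ j) f = (\<integral>z. f z * g z $ i $ j \<partial>?L)"
      using eq 1 by (simp add: s_def)
  qed
  have gA: "integrable ?L (\<lambda>z. indicator A z *\<^sub>R g z)"
    using A' by (intro integrable_mult_indicator g(3)) (auto simp: sets_restrict_space)
  have "set_lebesgue_integral lebesgue A D = (\<integral>z. indicator A z *\<^sub>R g z \<partial>?L)"
    using set_integral_borel_rep[OF spacetime_borel Di g(1,2) A'] by (simp add: set_lebesgue_integral_def)
  moreover have "(\<integral>z. indicator A z *\<^sub>R g z \<partial>?L) $ i $ j = (\<integral>z. indicator A z * g z $ i $ j \<partial>?L)" for i j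
    using integral_bounded_linear[OF bounded_linear_compose[OF bounded_linear_vec_nth[of j] bounded_linear_vec_nth[of i]] gA] by simp
  ultimately show ?thesis by (simp add: vec_eq_iff comp)
qed

lemma emeasure_variation_measure_zero: "emeasure (variation_measure M (\<lambda>_. 0)) A = 0"
proof -
  have "variation M (\<lambda>_. 0 :: 'b::real_normed_vector) = (\<lambda>_. 0)"
  proof
    fix A
    have "variation M (\<lambda>_. 0 :: 'b) A = (SUP P\<in>{P. finite P \<and> disjoint P \<and> P \<subseteq> sets M \<and> \<Union>P \<subseteq> A}. 0)"
      by (simp add: variation_def)
    also have "\<dots> = 0" by (rule SUP_eq_const) auto
    finally show "variation M (\<lambda>_. 0 :: 'b) A = 0" .
  qed
  then show ?thesis by (simp add: variation_measure_def emeasure_measure_of_conv)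
qed

text \<open>The decomposition inside \<open>convex_of_measure\<close> is an unspecified choice. As D
  with vanishing singular part is a decomposition, the chosen one is genuine, and its density equals
  D almost everywhere. The singular term is nonnegative, so dropping it gives the direction that the
  energy inequality calls for.\<close>

lemma convex_of_measure_density:
  fixes D :: "'a::euclidean_space \<Rightarrow> real^'d^'d"
  assumes X: "X \<in> sets borel" and D: "integrable (lebesgue_on X) D" "\<And>z. D z \<in> sym_mats"
    and \<mu>: "\<And>A. A \<in> sets (borel_on X) \<Longrightarrow> \<mu> A = set_lebesgue_integral lebesgue A D" and B: "B \<subseteq> X"
  shows "(\<integral>\<^sup>+z\<in>B. ennreal (F (D z)) \<partial>lebesgue) \<le> convex_of_measure F X \<mu> B"
proof -
  define dec where "dec = (SOME (h, \<mu>s, \<sigma>). lebesgue_decomposition X \<mu> h \<mu>s \<sigma>)"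
  have sX: "sets (restrict_space lborel X) = sets (borel_on X)" by (simp add: sets_restrict_space)
  have "lebesgue_decomposition X \<mu> D (\<lambda>_. 0) (\<lambda>_. 0)"
    unfolding lebesgue_decomposition_def
  proof (intro conjI)
    show "sym_matrix_measure X (\<lambda>_. 0 :: real^'d^'d)" by (simp add: sym_matrix_measure_def vector_measure_def sym_mats_iff)
    show "\<exists>N\<in>sets (borel_on X). emeasure lborel N = 0 \<and> (\<forall>A\<in>sets (borel_on X). A \<inter> N = {} \<longrightarrow> (0::real^'d^'d) = 0)"
      by (rule bexI[of _ "{}"]) auto
    \<comment> \<open>The variation of the zero measure is zero, so the whole space is a null set
      and the normalisation of the polar factor holds vacuously.\<close>
    have "space (variation_measure (borel_on X) (\<lambda>_. 0 :: real^'d^'d)) \<in> null_sets (variation_measure (borel_on X) (\<lambda>_. 0 :: real^'d^'d))"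
      by (simp add: null_sets_def emeasure_variation_measure_zero)
    then show "AE z in variation_measure (borel_on X) (\<lambda>_. 0 :: real^'d^'d). norm (0 :: real^'d^'d) = 1"
      by (rule AE_I') auto
  qed (use D \<mu> in \<open>auto simp: sym_mats_iff set_lebesgue_integral_def\<close>)
  then have "case (D, (\<lambda>_. 0) :: 'a set \<Rightarrow> real^'d^'d, (\<lambda>_. 0) :: 'a \<Rightarrow> real^'d^'d) of (h, \<mu>s, \<sigma>) \<Rightarrow> lebesgue_decomposition X \<mu> h \<mu>s \<sigma>" by simp
  then have "case dec of (h, \<mu>s, \<sigma>) \<Rightarrow> lebesgue_decomposition X \<mu> h \<mu>s \<sigma>" unfolding dec_def by (rule someI)
  moreover obtain h \<mu>s \<sigma> where dec: "dec = (h, \<mu>s, \<sigma>)" by (cases dec)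
  ultimately have ld: "lebesgue_decomposition X \<mu> h \<mu>s \<sigma>" by simp
  note ldc = ld[unfolded lebesgue_decomposition_def]
  have hi: "integrable (lebesgue_on X) h" by (rule conjunct1[OF ldc])
  have \<mu>h: "\<mu> A = set_lebesgue_integral lebesgue A h + \<mu>s A" if "A \<in> sets (borel_on X)" for A
    by (rule bspec[OF conjunct1[OF conjunct2[OF conjunct2[OF conjunct2[OF ldc]]]] that])
  obtain N where N: "N \<in> sets (borel_on X)" and Nc: "emeasure lborel N = 0 \<and> (\<forall>A\<in>sets (borel_on X). A \<inter> N = {} \<longrightarrow> \<mu>s A = 0)"
    by (rule bexE[OF conjunct1[OF conjunct2[OF conjunct2[OF conjunct2[OF conjunct2[OF ldc]]]]]])
  have N0: "\<mu>s A = 0" if "A \<in> sets (borel_on X)" "A \<inter> N = {}" for A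
    by (rule mp[OF bspec[OF conjunct2[OF Nc] that(1)] that(2)])
  obtain g where g: "g \<in> borel_measurable borel" "AE x in lborel. x \<in> X \<longrightarrow> D x = g x" "integrable (restrict_space lborel X) g"
    using borel_rep_integrable[OF X D(1)] by blast
  obtain k where k: "k \<in> borel_measurable borel" "AE x in lborel. x \<in> X \<longrightarrow> h x = k x" "integrable (restrict_space lborel X) k"
    using borel_rep_integrable[OF X hi] by blast
  have N': "N \<in> sets borel" "N \<in> null_sets lborel" using N conjunct1[OF Nc] X by (auto simp: sets_restrict_space)
  interpret sf: sigma_finite_measure "restrict_space lborel X"
    using X by (intro sigma_finite_measure_restrict_space sigma_finite_lborel) auto
  have "AE x in restrict_space lborel X. g x = k x"
  proof (rule sf.density_unique_banach[OF g(3) k(3)])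
    fix A assume "A \<in> sets (restrict_space lborel X)"
    then have A: "A \<in> sets borel" "A \<subseteq> X" using X by (auto simp: sets_restrict_space)
    have AN: "A - N \<in> sets (borel_on X)" "A - N \<in> sets borel" "A - N \<subseteq> X" using A N' X by (auto simp: sets_restrict_space)
    \<comment> \<open>The singular part is carried by the Lebesgue null set N: off N the two
      densities have equal integrals, and removing N changes none of them.\<close>
    have drop: "set_lebesgue_integral (restrict_space lborel X) (A - N) f = set_lebesgue_integral (restrict_space lborel X) A f"
      if f: "f \<in> borel_measurable borel" for f :: "'a \<Rightarrow> real^'d^'d"
      unfolding set_lebesgue_integral_def
    proof (rule integral_cong_AE)
      have "AE x in lborel. x \<notin> N" by (rule AE_not_in[OF N'(2)])
      then show "AE x in restrict_space lborel X. indicator (A - N) x *\<^sub>R f x = indicator A x *\<^sub>R f x"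
        using X by (simp add: AE_restrict_space_iff) (auto elim!: eventually_mono simp: indicator_def)
    qed (use f A AN in \<open>auto intro!: measurable_restrict_space1 borel_measurable_scaleR borel_measurable_indicator\<close>)
    have "set_lebesgue_integral lebesgue (A - N) D = set_lebesgue_integral lebesgue (A - N) h"
      using \<mu>[OF AN(1)] \<mu>h[OF AN(1)] N0[OF AN(1)] by (simp add: Int_commute)
    then show "set_lebesgue_integral (restrict_space lborel X) A g = set_lebesgue_integral (restrict_space lborel X) A k"
      unfolding set_integral_borel_rep[OF X D(1) g(1,2) AN(2,3)] set_integral_borel_rep[OF X hi k(1,2) AN(2,3)]
        drop[OF g(1)] drop[OF k(1)] .
  qed
  then have "AE x in lborel. x \<in> X \<longrightarrow> g x = k x" using X by (simp add: AE_restrict_space_iff)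
  with g(2) k(2) have "AE x in lborel. x \<in> X \<longrightarrow> D x = h x" by eventually_elim simp
  then have "AE x in lebesgue. x \<in> X \<longrightarrow> D x = h x" by (simp only: AE_completion_iff)
  then have "(\<integral>\<^sup>+z\<in>B. ennreal (F (D z)) \<partial>lebesgue) = (\<integral>\<^sup>+z\<in>B. ennreal (F (h z)) \<partial>lebesgue)"
    by (intro nn_integral_cong_AE) (use B in \<open>auto elim!: eventually_mono simp: indicator_def\<close>)
  then show ?thesis unfolding convex_of_measure_def dec_def[symmetric] dec by simp
qed

section \<open>The dissipation balance\<close>

text \<open>A supremum of affine functions is lower semicontinuous: its superlevel sets are unions
  of open half-spaces, so the uncountable index set does no harm.\<close>

lemma conjugate_measurable: "conjugate F \<in> borel_measurable borel"
proof (rule borel_measurableI_greater)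
  fix y :: ereal
  have "{A. y < conjugate F A} = (\<Union>D\<in>sym_mats. {A. y < ereal (A \<bullet> D - F D)})"
    by (auto simp: conjugate_def less_SUP_iff)
  moreover have "open {A. y < ereal (A \<bullet> D - F D)}" for D :: "real^'a^'a"
  proof -
    have "continuous_on UNIV (\<lambda>A :: real^'a^'a. ereal (A \<bullet> D - F D))"
      by (intro continuous_on_ereal continuous_intros)
    from open_vimage[OF open_greaterThan this, of y] show ?thesis by (simp add: vimage_def greaterThan_def)
  qed
  ultimately have "open {A. y < conjugate F A}" by auto
  then show "{A \<in> space borel. y < conjugate F A} \<in> sets borel" by simp
qed

lemma conjugate_nonneg: "F 0 = 0 \<Longrightarrow> 0 \<le> conjugate F A"
  unfolding conjugate_def by (rule SUP_upper2[of 0]) (auto simp: sym_mats_iff)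

lemma fenchel_young: "D \<in> sym_mats \<Longrightarrow> ereal (A \<bullet> D) \<le> ereal (F D) + conjugate F A"
proof -
  assume "D \<in> sym_mats"
  then have "ereal (A \<bullet> D - F D) \<le> conjugate F A" unfolding conjugate_def by (rule SUP_upper)
  then show ?thesis by (cases "conjugate F A") auto
qed

text \<open>Convexity is given on a subspace only. Composition with the projection onto symmetric
  matrices yields a finite convex function on all matrices, and such a function is
  continuous.\<close>

lemma convex_sym_continuous:
  fixes F :: "real^'d^'d \<Rightarrow> real"
  assumes "convex_on sym_mats F"
  shows "continuous_on UNIV (\<lambda>A. F ((1 / 2) *\<^sub>R (A + transpose A)))"
proof (rule convex_on_continuous[OF open_UNIV])
  have sym: "(1 / 2) *\<^sub>R (A + transpose A) \<in> sym_mats" for A :: "real^'d^'d"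
    by (simp add: sym_mats_iff transpose_def add.commute)
  show "convex_on UNIV (\<lambda>A. F ((1 / 2) *\<^sub>R (A + transpose A)))"
  proof (rule convex_onI)
    fix t :: real and x y :: "real^'d^'d" assume t: "0 < t" "t < 1"
    have e: "(1 / 2) *\<^sub>R ((1 - t) *\<^sub>R x + t *\<^sub>R y + transpose ((1 - t) *\<^sub>R x + t *\<^sub>R y)) =
        (1 - t) *\<^sub>R ((1 / 2) *\<^sub>R (x + transpose x)) + t *\<^sub>R ((1 / 2) *\<^sub>R (y + transpose y))"
      by (simp add: vec_eq_iff transpose_def field_simps)
    show "F ((1 / 2) *\<^sub>R ((1 - t) *\<^sub>R x + t *\<^sub>R y + transpose ((1 - t) *\<^sub>R x + t *\<^sub>R y)))
        \<le> (1 - t) * F ((1 / 2) *\<^sub>R (x + transpose x)) + t * F ((1 / 2) *\<^sub>R (y + transpose y))"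
      unfolding e using t by (intro convex_onD[OF assms] sym) auto
  qed simp
qed

text \<open>Finite total dissipation makes the conjugate finite almost everywhere. The real-valued
  version X allows the stress power to be subtracted under a Bochner integral.\<close>

lemma sum_integrable_representative:
  fixes f s :: "'a \<Rightarrow> real" and c :: "'a \<Rightarrow> ereal"
  assumes f: "f \<in> borel_measurable M" "\<And>z. 0 \<le> f z" and c: "c \<in> borel_measurable M" "\<And>z. 0 \<le> c z"
    and fin: "(\<integral>\<^sup>+z. ennreal (f z) \<partial>M) + (\<integral>\<^sup>+z. e2ennreal (c z) \<partial>M) < \<infinity>"
  obtains X where "integrable M X" "AE z in M. ereal (X z) = ereal (f z) + c z"
    "ennreal (\<integral>z. X z \<partial>M) = (\<integral>\<^sup>+z. ennreal (f z) \<partial>M) + (\<integral>\<^sup>+z. e2ennreal (c z) \<partial>M)"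
proof -
  define g where "g z = ennreal (f z) + e2ennreal (c z)" for z
  have cm: "(\<lambda>z. e2ennreal (c z)) \<in> borel_measurable M" by (rule measurable_compose[OF c(1) measurable_e2ennreal])
  have gm: "g \<in> borel_measurable M" unfolding g_def using f(1) cm by measurable
  have gi: "(\<integral>\<^sup>+z. g z \<partial>M) = (\<integral>\<^sup>+z. ennreal (f z) \<partial>M) + (\<integral>\<^sup>+z. e2ennreal (c z) \<partial>M)"
    unfolding g_def using f(1) cm by (intro nn_integral_add) measurable
  have "AE z in M. g z \<noteq> \<infinity>" using fin gi by (intro nn_integral_PInf_AE gm) auto
  then have g: "AE z in M. ennreal (enn2real (g z)) = g z" by eventually_elim (simp add: less_top)
  then have gi': "(\<integral>\<^sup>+z. ennreal (enn2real (g z)) \<partial>M) = (\<integral>\<^sup>+z. g z \<partial>M)" by (intro nn_integral_cong_AE)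
  have X: "integrable M (\<lambda>z. enn2real (g z))"
    using gm gi' gi fin by (intro integrableI_nonneg) auto
  have "AE z in M. ereal (enn2real (g z)) = ereal (f z) + c z"
    using g
  proof eventually_elim
    case (elim z)
    have "e2ennreal (c z) \<noteq> \<infinity>" using elim unfolding g_def by (metis ennreal_add_eq_top ennreal_neq_top infinity_ennreal_def)
    then obtain r where r: "c z = ereal r" "0 \<le> r" using c(2)[of z] by (cases "c z") auto
    have "g z = ennreal (f z + r)" unfolding g_def r(1) using f(2)[of z] r(2) by simp
    then show ?case using f(2)[of z] r by (simp add: ennreal_plus[symmetric] del: ennreal_plus)
  qed
  moreover have "ennreal (\<integral>z. enn2real (g z) \<partial>M) = (\<integral>\<^sup>+z. ennreal (f z) \<partial>M) + (\<integral>\<^sup>+z. e2ennreal (c z) \<partial>M)"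
    using nn_integral_eq_integral[OF X] gi' gi by simp
  ultimately show ?thesis using that[OF X] by blast
qed

text \<open>Otherwise a whole interval ending at T would be a null set. This picks good times
  arbitrarily close to T.\<close>

lemma AE_times_late:
  assumes P: "AE t in lebesgue_on {0<..<T::real}. P t" and a: "0 \<le> a" "a < T"
  obtains t where "a < t" "t < T" "P t"
proof (rule ccontr)
  assume "\<not> thesis"
  with that have no: "\<not> P t" if "a < t" "t < T" for t using \<open>\<not> thesis\<close> that by metis
  have "AE t in lborel. t \<in> {0<..<T} \<longrightarrow> P t" using P by (simp add: AE_restrict_space_iff AE_completion_iff)
  then have "AE t in lborel. t \<notin> {a<..<T}" by eventually_elim (use no a in auto)
  then have "{a<..<T} \<in> null_sets lborel" by (subst AE_iff_null_sets) auto
  then have "emeasure lborel {a<..<T} = 0" by (rule null_setsD1)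
  then show False using a by simp
qed

lemma integrable_const_spacetime: "integrable (lebesgue_on (spacetime T :: (real \<times> (real^'d)) set)) (\<lambda>_. c :: real)"
  by (subst integrable_lebesgue_on_borel)
     (auto simp: spacetime_measure intro!: finite_measure.integrable_const finite_measure_pair_measure times.finite_measure_axioms torus.finite_measure_axioms)

section \<open>The energy balance of the flow\<close>

definition flow_gradient :: "('d \<Rightarrow> real \<Rightarrow> real^'d \<Rightarrow> real^'d) \<Rightarrow> real \<times> (real^'d) \<Rightarrow> real^'d^'d" where
  "flow_gradient g = sym_part (\<lambda>j z. g j (fst z) (snd z))"

context regular_flow
begin

text \<open>On almost every time slice the representative g agrees with the bounded
  \<open>w\<close>; by Fubini its excess over K integrates to zero.\<close>

lemma gradient_bounded:
  assumes g: "integrable (lst T) (\<lambda>z. g (fst z) (snd z) $ i)"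
    and wg: "AE t in ltime T. has_weak_partial j (v t) (g t)"
  shows "AE z in lst T. \<bar>g (fst z) (snd z) $ i\<bar> \<le> K"
proof -
  let ?e = "\<lambda>z. max 0 (\<bar>g (fst z) (snd z) $ i\<bar> - K)"
  have ei: "integrable (lst T) ?e"
    using g integrable_const_spacetime by (intro integrable_max integrable_diff integrable_abs) auto
  have "(\<integral>z. ?e z \<partial>lst T) = (\<integral>t. (\<integral>x. ?e (t, x) \<partial>lcell) \<partial>ltime T)"
    using spacetime_fubini[OF ei] by simp
  also have "\<dots> = 0"
  proof (rule integral_eq_zero_AE)
    have "AE t in ltime T. t \<in> {0..T}" by (intro AE_I2) (auto simp: space_restrict_space)
    with wg show "AE t in ltime T. (\<integral>x. ?e (t, x) \<partial>lcell) = 0"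
    proof eventually_elim
      case (elim t)
      have "AE x in torus. ?e (t, x) = 0"
        using weak_partial_unique[OF wp[OF elim(2), of j] elim(1)] wb[OF elim(2), of j i] by eventually_elim (simp add: max_def)
      then have "AE x in lcell. ?e (t, x) = 0" unfolding AE_torus_iff .
      then show ?case by (rule integral_eq_zero_AE)
    qed
  qed
  finally have "AE z in lst T. ?e z = 0"
    using integral_nonneg_eq_0_iff_AE[OF ei] by simp
  then show ?thesis by eventually_elim (simp add: max_def split: if_splits)
qed

context
  fixes g :: "'d \<Rightarrow> real \<Rightarrow> real^'d \<Rightarrow> real^'d"
  assumes gi: "\<And>i j. integrable (lst T) (\<lambda>z. g j (fst z) (snd z) $ i)"
    and gwp: "\<And>j. AE t in ltime T. has_weak_partial j (v t) (g j t)"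
    and Ssym: "\<And>t x. S t x \<in> sym_mats"
begin

lemma stress_gradient_integrable:
  "integrable (lst T) (\<lambda>z. S (fst z) (snd z) $ i $ j * g j (fst z) (snd z) $ i)"
  by (rule integrable_mult_bounded[OF Sint borel_measurable_integrable[OF gi] gradient_bounded[OF gi gwp]])

lemma stress_power: "S (fst z) (snd z) \<bullet> flow_gradient g z = (\<Sum>i\<in>UNIV. \<Sum>j\<in>UNIV. S (fst z) (snd z) $ i $ j * g j (fst z) (snd z) $ i)"
  unfolding flow_gradient_def by (rule inner_sym_part[OF Ssym])

lemma stress_power_integrable: "integrable (lst T) (\<lambda>z. S (fst z) (snd z) \<bullet> flow_gradient g z)"
  unfolding stress_power by (intro integrable_sum stress_gradient_integrable)

text \<open>The bridge between the two gradients: \<open>g\<close> is jointly measurable and a weak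
  derivative for almost every time, \<open>w\<close> is one at every time, and by uniqueness they
  agree on almost every slice.\<close>

lemma stress_power_sections:
  "AE u in ltime T. (\<integral>x. S u x \<bullet> flow_gradient g (u, x) \<partial>lcell) =
    (\<Sum>i\<in>UNIV. \<Sum>j\<in>UNIV. \<integral>x. S u x $ i $ j * w j u x $ i \<partial>lcell)"
proof -
  have s: "AE u in ltime T. \<forall>i j. integrable lcell (\<lambda>x. S u x $ i $ j * g j u x $ i) \<and> integrable lcell (\<lambda>x. S u x $ i $ j)"
  proof (intro eventually_all_finite eventually_conj)
    show "AE u in ltime T. integrable lcell (\<lambda>x. S u x $ i $ j * g j u x $ i)" for i j
      using spacetime_fubini_sections[OF stress_gradient_integrable[of i j]] by simp
    show "AE u in ltime T. integrable lcell (\<lambda>x. S u x $ i $ j)" for i j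
      using spacetime_fubini_sections[OF Sint[of i j]] by simp
  qed
  have "AE u in ltime T. \<forall>j. has_weak_partial j (v u) (g j u)"
    by (intro eventually_all_finite gwp)
  moreover have "AE t in ltime T. t \<in> {0..T}" by (intro AE_I2) (auto simp: space_restrict_space)
  ultimately show ?thesis using s
  proof eventually_elim
    case (elim u)
    have "(\<integral>x. S u x $ i $ j * g j u x $ i \<partial>lcell) = (\<integral>x. S u x $ i $ j * w j u x $ i \<partial>lcell)" for i j
    proof (rule integral_cong_AE)
      show "(\<lambda>x. S u x $ i $ j * g j u x $ i) \<in> borel_measurable lcell" using elim(3) by auto
      have "(\<lambda>x. S u x $ i $ j) \<in> borel_measurable lcell" using elim(3) by auto
      then show "(\<lambda>x. S u x $ i $ j * w j u x $ i) \<in> borel_measurable lcell" using wm[OF elim(2)] by (rule borel_measurable_times)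
      have "AE x in torus. g j u x = w j u x" by (rule weak_partial_unique[OF elim(1)[rule_format] wp[OF elim(2)]])
      then have "AE x in lcell. g j u x = w j u x" unfolding AE_torus_iff .
      then show "AE x in lcell. S u x $ i $ j * g j u x $ i = S u x $ i $ j * w j u x $ i" by eventually_elim simp
    qed
    moreover have "(\<integral>x. S u x \<bullet> flow_gradient g (u, x) \<partial>lcell) = (\<integral>x. (\<Sum>i\<in>UNIV. \<Sum>j\<in>UNIV. S u x $ i $ j * g j u x $ i) \<partial>lcell)"
      using stress_power[of "(u, _)"] by simp
    moreover have "\<dots> = (\<Sum>i\<in>UNIV. \<Sum>j\<in>UNIV. \<integral>x. S u x $ i $ j * g j u x $ i \<partial>lcell)"
      using elim(3) by (intro integral_double_sum) auto
    ultimately show ?case by simp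
  qed
qed

lemma flow_gradient_sym: "flow_gradient g z \<in> sym_mats"
  unfolding flow_gradient_def by (rule sym_part_sym)

lemma symgrad_flow_gradient: "symgrad_is_function T v (flow_gradient g)"
  unfolding flow_gradient_def by (rule symgrad_is_function_sym_part[OF v1 gi gwp])

lemma dissipation_balance:
  fixes F :: "real^'d^'d \<Rightarrow> real"
  assumes F: "convex_on sym_mats F" "\<And>A. A \<in> sym_mats \<Longrightarrow> 0 \<le> F A" "F 0 = 0"
    and en: "AE \<tau> in ltime T. ennreal (energy \<tau>) + ennreal (trace (R \<tau> cell) / 2) +
      ((\<integral>\<^sup>+z. ennreal (F (flow_gradient g z)) \<partial>lst \<tau>) + (\<integral>\<^sup>+z. e2ennreal (conjugate F (S (fst z) (snd z))) \<partial>lst \<tau>))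
      \<le> ennreal (energy 0)"
  shows "AE t in ltime T. trace (R t cell) = 0"
    and "AE z in lst T. ereal (S (fst z) (snd z) \<bullet> flow_gradient g z) = ereal (F (flow_gradient g z)) + conjugate F (S (fst z) (snd z))"
proof -
  let ?L = "ltime T"
  define sg where "sg z = S (fst z) (snd z) \<bullet> flow_gradient g z" for z
  define cj where "cj z = conjugate F (S (fst z) (snd z))" for z
  have sgi: "integrable (lst T) sg" unfolding sg_def by (rule stress_power_integrable)
  have Dm: "flow_gradient g \<in> borel_measurable (lst T)" using symgrad_flow_gradient by (auto simp: symgrad_is_function_def)
  have Sm: "(\<lambda>z. S (fst z) (snd z)) \<in> borel_measurable (lst T)"
    by (intro borel_measurable_integrable integrable_vecI Sint)
  have FD: "F (flow_gradient g z) = (\<lambda>A. F ((1 / 2) *\<^sub>R (A + transpose A))) (flow_gradient g z)" for z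
    using flow_gradient_sym[of z] by (simp add: sym_mats_def scaleR_2[symmetric])
  have Fm: "(\<lambda>z. F (flow_gradient g z)) \<in> borel_measurable (lst T)"
    unfolding FD by (rule measurable_compose[OF Dm borel_measurable_continuous_onI[OF convex_sym_continuous[OF F(1)]]])
  have cm: "cj \<in> borel_measurable (lst T)"
    unfolding cj_def by (rule measurable_compose[OF Sm conjugate_measurable])
  have mono: "f \<in> borel_measurable (lst \<tau>)" if "f \<in> borel_measurable (lst T)" "\<tau> \<le> T"
    for f :: "real \<times> (real^'d) \<Rightarrow> 'z::topological_space" and \<tau>
    using that by (intro measurable_restrict_mono[OF that(1)]) auto
  have F0: "0 \<le> F (flow_gradient g z)" for z by (rule F(2)[OF flow_gradient_sym])
  have c0: "0 \<le> cj z" for z unfolding cj_def by (rule conjugate_nonneg[of F, OF F(3)])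
  have fy: "ereal (sg z) \<le> ereal (F (flow_gradient g z)) + cj z" for z unfolding sg_def cj_def by (rule fenchel_young[OF flow_gradient_sym])
  obtain B where B: "AE t in ?L. psd_measure (R t) \<and> 0 \<le> trace (R t cell) \<and> trace (R t cell) \<le> B"
    using Linf_trace(1)[OF Rinf] by blast
  have inT: "AE t in ?L. t \<in> {0<..<T}" by (intro AE_I2) (auto simp: space_restrict_space)
  define tri where "tri \<tau> = (\<integral>t. indicator {..<\<tau>} t * trace (R t cell) \<partial>?L)" for \<tau>
  \<comment> \<open>The energy inequality gives finite dissipation only up to an admissible time, so
    X is chosen anew for each \<open>\<tau>\<close>.\<close>
  have balance: "AE \<tau> in ?L. \<exists>X. integrable (lst \<tau>) X \<and>
      (AE z in lst \<tau>. ereal (X z) = ereal (F (flow_gradient g z)) + cj z) \<and>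
      trace (R \<tau> cell) / 2 + (\<integral>z. X z - sg z \<partial>lst \<tau>) \<le> defect_bound * tri \<tau>"
    using en B inT
  proof eventually_elim
    case (elim \<tau>)
    then have \<tau>: "\<tau> \<in> {0..T}" "\<tau> \<le> T" by auto
    have fin: "(\<integral>\<^sup>+z. ennreal (F (flow_gradient g z)) \<partial>lst \<tau>) + (\<integral>\<^sup>+z. e2ennreal (cj z) \<partial>lst \<tau>) \<le> ennreal (energy 0)"
      using elim(1) unfolding cj_def by (rule order_trans[rotated]) simp
    then have "(\<integral>\<^sup>+z. ennreal (F (flow_gradient g z)) \<partial>lst \<tau>) + (\<integral>\<^sup>+z. e2ennreal (cj z) \<partial>lst \<tau>) < \<infinity>"
      by (rule le_less_trans) simp
    then obtain X where X: "integrable (lst \<tau>) X" "AE z in lst \<tau>. ereal (X z) = ereal (F (flow_gradient g z)) + cj z"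
      "ennreal (\<integral>z. X z \<partial>lst \<tau>) = (\<integral>\<^sup>+z. ennreal (F (flow_gradient g z)) \<partial>lst \<tau>) + (\<integral>\<^sup>+z. e2ennreal (cj z) \<partial>lst \<tau>)"
      by (rule sum_integrable_representative[OF mono[OF Fm \<tau>(2)] F0 mono[OF cm \<tau>(2)] c0])
    have X0: "0 \<le> (\<integral>z. X z \<partial>lst \<tau>)"
    proof (rule integral_nonneg_AE)
      show "AE z in lst \<tau>. 0 \<le> X z"
        using X(2)
      proof eventually_elim
        case (elim z)
        have "0 \<le> ereal (F (flow_gradient g z)) + cj z" using F0 c0 by simp
        then show ?case unfolding elim[symmetric] by simp
      qed
    qed
    have e0: "0 \<le> energy t" for t unfolding energy_def by (simp add: sum_nonneg)
    have "ennreal (energy \<tau> + trace (R \<tau> cell) / 2 + (\<integral>z. X z \<partial>lst \<tau>)) \<le> ennreal (energy 0)"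
      using elim(1,2) X0 e0 unfolding X(3)[unfolded cj_def, symmetric] by (simp add: ennreal_plus[symmetric] del: ennreal_plus)
    then have up: "energy \<tau> + trace (R \<tau> cell) / 2 + (\<integral>z. X z \<partial>lst \<tau>) \<le> energy 0"
      using e0 by (simp add: ennreal_le_iff)
    let ?s = "\<lambda>u. \<integral>x. S u x \<bullet> flow_gradient g (u, x) \<partial>lcell"
    have si: "integrable ?L ?s" using spacetime_fubini_integrable[OF sgi] by (simp add: sg_def)
    have low: "- (\<integral>u. indicator {..<\<tau>} u * (?s u + defect_bound * trace (R u cell)) \<partial>?L) \<le> energy \<tau> - energy 0"
      by (rule energy_lower[OF si stress_power_sections \<tau>(1)])
    have "(\<integral>u. indicator {..<\<tau>} u * (?s u + defect_bound * trace (R u cell)) \<partial>?L) =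
        (\<integral>u. indicator {..<\<tau>} u * ?s u + defect_bound * (indicator {..<\<tau>} u * trace (R u cell)) \<partial>?L)"
      by (simp only: distrib_left mult.left_commute)
    also have "\<dots> = (\<integral>u. indicator {..<\<tau>} u * ?s u \<partial>?L) + (\<integral>u. defect_bound * (indicator {..<\<tau>} u * trace (R u cell)) \<partial>?L)"
      by (intro integral_add integrable_indicator_times si integrable_mult_right trace_integrable) auto
    also have "(\<integral>u. indicator {..<\<tau>} u * ?s u \<partial>?L) = (\<integral>z. sg z \<partial>lst \<tau>)"
      using spacetime_integral_upto(2)[OF sgi \<tau>(2)] by (simp add: sg_def)
    finally have "- (\<integral>z. sg z \<partial>lst \<tau>) - defect_bound * tri \<tau> \<le> energy \<tau> - energy 0"
      using low by (simp add: tri_def)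
    moreover have "(\<integral>z. X z - sg z \<partial>lst \<tau>) = (\<integral>z. X z \<partial>lst \<tau>) - (\<integral>z. sg z \<partial>lst \<tau>)"
      by (rule integral_diff[OF X(1) spacetime_integral_upto(1)[OF sgi \<tau>(2)]])
    ultimately have "trace (R \<tau> cell) / 2 + (\<integral>z. X z - sg z \<partial>lst \<tau>) \<le> defect_bound * tri \<tau>"
      using up by linarith
    with X(1,2) show ?case by (intro exI[of _ X] conjI)
  qed
  have gap: "AE z in M. sg z \<le> X z" if "AE z in M. ereal (X z) = ereal (F (flow_gradient g z)) + cj z" for M X
    using that
  proof eventually_elim
    case (elim z)
    then show ?case using fy[of z] by (metis ereal_less_eq(3))
  qed
  have db: "0 \<le> defect_bound" using K by (simp add: defect_bound_def)
  have "AE \<tau> in ?L. trace (R \<tau> cell) \<le> (2 * defect_bound) * tri \<tau>"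
    using balance
  proof eventually_elim
    case (elim \<tau>)
    then obtain X where X: "AE z in lst \<tau>. ereal (X z) = ereal (F (flow_gradient g z)) + cj z"
      "trace (R \<tau> cell) / 2 + (\<integral>z. X z - sg z \<partial>lst \<tau>) \<le> defect_bound * tri \<tau>" by blast
    have "0 \<le> (\<integral>z. X z - sg z \<partial>lst \<tau>)"
      using gap[OF X(1)] by (intro integral_nonneg_AE) (auto elim: eventually_mono)
    then show ?case using X(2) by simp
  qed
  moreover have "AE t in ?L. 0 \<le> trace (R t cell)" "AE t in ?L. trace (R t cell) \<le> B"
    using B by (auto elim: eventually_mono)
  ultimately show tr: "AE t in ?L. trace (R t cell) = 0"
    using db unfolding tri_def by (intro gronwall_zero[OF trace_integrable, of B "2 * defect_bound"]) auto
  have tri0: "tri \<tau> = 0" for \<tau>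
    unfolding tri_def using tr by (intro integral_eq_zero_AE) (auto elim: eventually_mono)
  define Q where "Q z \<longleftrightarrow> ereal (sg z) = ereal (F (flow_gradient g z)) + cj z" for z
  have "AE \<tau> in ?L. AE z in lst \<tau>. Q z"
    using balance B inT
  proof eventually_elim
    case (elim \<tau>)
    then obtain X where X: "integrable (lst \<tau>) X" "AE z in lst \<tau>. ereal (X z) = ereal (F (flow_gradient g z)) + cj z"
      "trace (R \<tau> cell) / 2 + (\<integral>z. X z - sg z \<partial>lst \<tau>) \<le> defect_bound * tri \<tau>" by blast
    have \<tau>: "\<tau> \<le> T" using elim by auto
    have nn: "AE z in lst \<tau>. 0 \<le> X z - sg z" using gap[OF X(2)] by eventually_elim simp
    have i: "integrable (lst \<tau>) (\<lambda>z. X z - sg z)"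
      using X(1) spacetime_integral_upto(1)[OF sgi \<tau>] by simp
    have "(\<integral>z. X z - sg z \<partial>lst \<tau>) = 0"
      using X(3) elim(2) integral_nonneg_AE[OF nn] by (simp add: tri0)
    then have "AE z in lst \<tau>. X z - sg z = 0"
      using integral_nonneg_eq_0_iff_AE[OF i nn] by simp
    with X(2) show ?case by eventually_elim (simp add: Q_def)
  qed
  note good = this
  \<comment> \<open>The equality is known on (0, t) for almost every t only. Good times t n above a
    n increase to T in the limit and so cover the whole interval; \<open>n + 1\<close> makes a n
    nonnegative from n = 0 on.\<close>
  define a where "a n = T - T / real (n + 1)" for n
  have a: "0 \<le> a n" "a n < T" for n using T by (simp_all add: a_def field_simps)
  have "\<exists>t. a n < t \<and> t < T \<and> (AE z in lebesgue_on (spacetime t). Q z)" for n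
    by (rule AE_times_late[OF good a]) blast
  then obtain t where t: "\<And>n. a n < t n" "\<And>n. AE z in lebesgue_on (spacetime (t n)). Q z" by metis
  have "AE z in lborel. \<forall>n. z \<in> spacetime (t n) \<longrightarrow> Q z"
    unfolding AE_all_countable using t(2) by (simp add: AE_restrict_space_iff AE_completion_iff)
  then have "AE z in lborel. z \<in> spacetime T \<longrightarrow> Q z"
  proof eventually_elim
    case (elim z)
    show ?case
    proof
      assume z: "z \<in> spacetime T"
      have "(\<lambda>n. T - T / real (Suc n)) \<longlonglongrightarrow> T - 0"
        by (intro tendsto_diff tendsto_const LIMSEQ_Suc[OF lim_const_over_n])
      then have "a \<longlonglongrightarrow> T" by (simp add: a_def[abs_def])
      then have "\<forall>\<^sub>F n in sequentially. fst z < a n" using z by (intro order_tendstoD(1)) auto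
      then obtain n where "fst z < a n" by (auto simp: eventually_sequentially)
      then have "z \<in> spacetime (t n)" using z t(1)[of n] by auto
      then show "Q z" using elim by blast
    qed
  qed
  then show "AE z in lst T. ereal (S (fst z) (snd z) \<bullet> flow_gradient g z) = ereal (F (flow_gradient g z)) + conjugate F (S (fst z) (snd z))"
    by (simp add: Q_def sg_def cj_def AE_restrict_space_iff AE_completion_iff)
qed

end

end

section \<open>From the regularity class to the conclusion\<close>

lemma spacetime_Lp_measurable:
  "spacetime_Lp T q u \<Longrightarrow> (\<lambda>z. u (fst z) (snd z)) \<in> borel_measurable (lst T)"
  "spacetime_Lp T q u \<Longrightarrow> integrable (lst T) (\<lambda>z. norm (u (fst z) (snd z)) powr q)"
  by (simp_all add: spacetime_Lp_def torus_field_def case_prod_beta')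

lemma spacetime_Lp_integrable:
  fixes u :: "real \<Rightarrow> real^'d \<Rightarrow> 'b::euclidean_space"
  assumes u: "spacetime_Lp T q u" and q: "1 \<le> q"
  shows "integrable (lst T) (\<lambda>z. u (fst z) (snd z))"
proof (rule integrable_bound)
  show "integrable (lst T) (\<lambda>z. 1 + norm (u (fst z) (snd z)) powr q)"
    using spacetime_Lp_measurable(2)[OF u] integrable_const_spacetime by (intro integrable_add)
  show "(\<lambda>z. u (fst z) (snd z)) \<in> borel_measurable (lst T)" by (rule spacetime_Lp_measurable(1)[OF u])
  have "norm (u t x) \<le> norm (1 + norm (u t x) powr q)" for t x
    using le_add_powr[of "norm (u t x)" 1 q] q by simp
  then show "AE z in lst T. norm (u (fst z) (snd z)) \<le> norm (1 + norm (u (fst z) (snd z)) powr q)" by simp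
qed

lemma spacetime_Lp_mult_integrable:
  fixes u :: "real \<Rightarrow> real^'d \<Rightarrow> real^'d"
  assumes u: "spacetime_Lp T q u" and q: "2 \<le> q"
  shows "integrable (lst T) (\<lambda>z. u (fst z) (snd z) $ i * u (fst z) (snd z) $ j)"
proof (rule integrable_bound)
  note m = spacetime_Lp_measurable(1)[OF u]
  show "integrable (lst T) (\<lambda>z. 1 + norm (u (fst z) (snd z)) powr q)"
    using spacetime_Lp_measurable(2)[OF u] integrable_const_spacetime by (intro integrable_add)
  have c: "(\<lambda>z. u (fst z) (snd z) $ k) \<in> borel_measurable (lst T)" for k
    by (rule measurable_compose[OF m borel_measurable_continuous_onI]) (intro continuous_intros)
  show "(\<lambda>z. u (fst z) (snd z) $ i * u (fst z) (snd z) $ j) \<in> borel_measurable (lst T)"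
    by (rule borel_measurable_times[OF c c])
  have "norm (y $ i * y $ j) \<le> norm (1 + norm y powr q)" for y :: "real^'d"
  proof -
    have "norm (y $ i * y $ j) \<le> norm y * norm y"
      using component_le_norm_cart[of y i] component_le_norm_cart[of y j] by (simp add: abs_mult mult_mono)
    also have "\<dots> \<le> 1 + norm y powr q"
    proof (cases "norm y \<le> 1")
      case True
      then have "norm y * norm y \<le> 1" by (intro mult_le_one) auto
      then show ?thesis using powr_ge_zero[of "norm y" q] by linarith
    next
      case False
      then have "norm y * norm y = norm y powr 2" by (simp add: powr_numeral power2_eq_square)
      also have "\<dots> \<le> norm y powr q" using False q by (intro powr_mono) auto
      finally show ?thesis by simp
    qed
    finally show ?thesis by simp
  qed
  then show "AE z in lst T. norm (u (fst z) (snd z) $ i * u (fst z) (snd z) $ j) \<le> norm (1 + norm (u (fst z) (snd z)) powr q)"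
    by simp
qed

lemma matrix_integral_zero:
  assumes "\<And>A. A \<in> sets M \<Longrightarrow> \<mu> A = 0"
  shows "matrix_integral M \<mu> \<Phi> = 0"
  unfolding matrix_integral_def using assms by (intro sum.neutral ballI signed_integral_cong_zero) auto

lemma (in regular_flow) energy_norm:
  assumes t: "t \<in> {0..T}"
  shows "(\<integral>x. (norm (v t x))\<^sup>2 / 2 \<partial>lcell) = energy t"
proof -
  note b = vb[OF t]
  have "(\<integral>x. (norm (v t x))\<^sup>2 / 2 \<partial>lcell) = (\<integral>x. (\<Sum>i\<in>UNIV. v t x $ i * v t x $ i) \<partial>lcell) / 2"
    by (simp add: power2_norm_eq_inner inner_vec_def)
  also have "(\<integral>x. (\<Sum>i\<in>UNIV. v t x $ i * v t x $ i) \<partial>lcell) = (\<Sum>i\<in>UNIV. \<integral>x. v t x $ i * v t x $ i \<partial>lcell)"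
    by (intro integral_sum integrable_mult_bounded[OF vint[OF t] vm[OF t] b])
  finally show ?thesis by (simp add: energy_def)
qed

theorem theorem2p8:
  fixes F :: "real^'d^'d \<Rightarrow> real"
    and v0 :: "real^'d \<Rightarrow> real^'d"
    and v :: "real \<Rightarrow> real^'d \<Rightarrow> real^'d"
    and S :: "real \<Rightarrow> real^'d \<Rightarrow> real^'d^'d"
    and R :: "real \<Rightarrow> (real^'d) set \<Rightarrow> real^'d^'d"
    and p T :: real
  assumes "CARD('d) = 2 \<or> CARD('d) = 3"
    and "p > real CARD('d) + 2"
    and "T > 0"
    and "convex_on sym_mats F"
    and "\<forall>D\<in>sym_mats. 0 \<le> F D"
    and "F 0 = 0"
    and "\<exists>r>0. \<forall>A\<in>sym_mats. norm A < r \<longrightarrow> 0 \<le> conjugate F A \<and> conjugate F A < \<infinity>"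
    and "\<exists>r'>0. Dom (conjugate F) \<subseteq>
           {A + B | A B. A \<in> polar_set (Dom (asymptotic F)) \<and> B \<in> sym_mats \<and> norm B < r'}"
    and "slobodeckii (2 - 2 / p) p v0"
    and "divergence_free v0"
    and "dissipative_solution T F v0 v S R"
    and "regularity_class T p v"
  shows "(AE t in lebesgue_on {0<..<T}. \<forall>A\<in>sets (borel_on cell). R t A = 0) \<and>
         rheological_law T F v S \<and>
         strong_solution T p F v0 v S"
proof -
  note p = assms(2) and T = assms(3) and reg = assms(12)
  define w where "w j t = weak_partial j (v t)" for j t
  have weak: "C_weak_L2 T v" and stress: "stress_field T S" and Rinf: "Linf_psd_measures T R" and incomp: "incompressible T v"
    and mom: "momentum_equation T v0 v S R" using assms(11) by (simp_all add: dissipative_solution_def)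
  obtain \<mu> where \<mu>: "symgrad_is_measure T v \<mu>" and en: "energy_inequality T F v0 v \<mu> S R"
    using assms(11) unfolding dissipative_solution_def by blast
  have Csl: "C_slobodeckii T (2 - 2 / p) p v" and W: "Lp_W2p T p v" using reg by (simp_all add: regularity_class_def)
  have vp: "spacetime_Lp T p v" using W by (simp add: Lp_W2p_def)
  have Sp: "spacetime_Lp T 1 S" and Ssym: "\<And>t x. S t x \<in> sym_mats" using stress by (simp_all add: stress_field_def)
  obtain K where K: "0 \<le> K" "\<And>t. t \<in> {0..T} \<Longrightarrow> AE x in torus. \<forall>i. \<bar>v t x $ i\<bar> \<le> K \<and> (\<forall>j. \<bar>weak_partial j (v t) x $ i\<bar> \<le> K)"
    by (rule C_slobodeckii_bound[OF p Csl]) (rule that, assumption, simp)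
  interpret regular_flow T K v0 v S R w
  proof unfold_locales
    show "AE x in torus. \<forall>i. \<bar>v t x $ i\<bar> \<le> K \<and> (\<forall>j. \<bar>w j t x $ i\<bar> \<le> K)" if "t \<in> {0..T}" for t
      unfolding w_def by (rule K(2)[OF that])
    show "has_weak_partial j (v t) (w j t)" if "t \<in> {0..T}" for j t
      unfolding w_def using Csl that by (intro has_weak_partial_weak_partial) (auto simp: C_slobodeckii_def slobodeckii_def)
    show "integrable (lst T) (\<lambda>z. v (fst z) (snd z) $ i)" for i
      using p by (intro integrable_component spacetime_Lp_integrable[OF vp]) simp
    show "integrable (lst T) (\<lambda>z. v (fst z) (snd z) $ i * v (fst z) (snd z) $ j)" for i j
      using p by (intro spacetime_Lp_mult_integrable[OF vp]) simp
    show "integrable (lst T) (\<lambda>z. S (fst z) (snd z) $ i $ j)" for i j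
      by (intro integrable_component spacetime_Lp_integrable[OF Sp]) simp
    show "periodic (S t)" if "t \<in> {0<..<T}" for t
      using Sp that by (simp add: spacetime_Lp_def torus_field_def)
  qed (fact T K(1) weak Rinf incomp mom)+
  \<comment> \<open>Unlike \<open>w\<close>, which is defined at every time, \<open>G\<close> is
    jointly measurable in time and space; it provides the symmetric gradient as an integrable
    function.\<close>
  obtain G H where G: "\<And>j. spacetime_Lp T p (G j)"
    and GH: "AE t in ltime T. \<forall>j. has_weak_partial j (v t) (G j t) \<and> (\<forall>k. has_weak_partial k (G j t) (H j k t))"
    using W unfolding Lp_W2p_def by blast
  have gi: "integrable (lst T) (\<lambda>z. G j (fst z) (snd z) $ i)" for i j
    using p by (intro integrable_component spacetime_Lp_integrable[OF G]) simp
  have gwp: "AE t in ltime T. has_weak_partial j (v t) (G j t)" for j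
    using GH by eventually_elim simp
  define D where "D = flow_gradient G"
  have Dfun: "symgrad_is_function T v D" unfolding D_def by (rule symgrad_flow_gradient[OF gi gwp Ssym])
  then have Di: "integrable (lst T) D" and Dsym: "D z \<in> sym_mats" for z
    by (auto simp: symgrad_is_function_def)
  have w0: "has_weak_partial j v0 (weak_partial j v0)" for j
    using assms(9) by (intro has_weak_partial_weak_partial) (simp add: slobodeckii_def)
  have init: "AE x in lcell. v 0 x = v0 x"
    using initial_datum[OF w0 assms(10)] by (simp only: AE_torus_iff)
  \<comment> \<open>The energy inequality is stated with \<open>v0\<close> and the lower energy
    bound with \<open>v 0\<close>; the identification of the initial datum makes the two energies
    equal.\<close>
  have E0: "(\<integral>x. (norm (v0 x))\<^sup>2 / 2 \<partial>lcell) = energy 0"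
  proof -
    have "v0 \<in> borel_measurable lcell" "v 0 \<in> borel_measurable lcell"
      using w0 wp[of 0] T by (auto simp: has_weak_partial_def intro!: torus_Lp_1D(2))
    then have "(\<integral>x. (norm (v0 x))\<^sup>2 / 2 \<partial>lcell) = (\<integral>x. (norm (v 0 x))\<^sup>2 / 2 \<partial>lcell)"
      using init by (intro integral_cong_AE) (auto elim: eventually_mono)
    then show ?thesis using energy_norm[of 0] T by simp
  qed
  have inT: "AE \<tau> in ltime T. \<tau> \<in> {0<..<T}" by (intro AE_I2) (auto simp: space_restrict_space)
  have en': "AE \<tau> in ltime T. ennreal (energy \<tau>) + ennreal (trace (R \<tau> cell) / 2) +
      ((\<integral>\<^sup>+z. ennreal (F (flow_gradient G z)) \<partial>lst \<tau>) + (\<integral>\<^sup>+z. e2ennreal (conjugate F (S (fst z) (snd z))) \<partial>lst \<tau>))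
      \<le> ennreal (energy 0)"
    using en[unfolded energy_inequality_def] inT
  proof eventually_elim
    case (elim \<tau>)
    have "(\<integral>\<^sup>+z. ennreal (F (D z)) \<partial>lst \<tau>) = (\<integral>\<^sup>+z\<in>spacetime \<tau>. ennreal (F (D z)) \<partial>lebesgue)"
      by (subst nn_integral_restrict_space) (auto intro: sets_completionI_sets)
    \<comment> \<open>The energy inequality involves some measure \<open>\<mu>\<close> representing
      the symmetric gradient; by uniqueness it has the density D.\<close>
    also have "\<dots> \<le> convex_of_measure F (spacetime T) \<mu> (spacetime \<tau>)"
      using elim(2) by (intro convex_of_measure_density[OF spacetime_borel Di Dsym] symgrad_measure_density[OF T \<mu> Dfun]) auto
    finally have "ennreal (energy \<tau>) + ennreal (trace (R \<tau> cell) / 2) +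
        ((\<integral>\<^sup>+z. ennreal (F (D z)) \<partial>lst \<tau>) + (\<integral>\<^sup>+z. e2ennreal (conjugate F (S (fst z) (snd z))) \<partial>lst \<tau>))
        \<le> ennreal (energy \<tau>) + ennreal (trace (R \<tau> cell) / 2) +
        (convex_of_measure F (spacetime T) \<mu> (spacetime \<tau>) + (\<integral>\<^sup>+z. e2ennreal (conjugate F (S (fst z) (snd z))) \<partial>lst \<tau>))"
      by (intro add_mono order_refl)
    also have "\<dots> \<le> ennreal (energy 0)"
      using elim energy_norm[of \<tau>] E0 by (simp add: case_prod_beta')
    finally show ?case by (simp add: D_def)
  qed
  have tr: "AE t in ltime T. trace (R t cell) = 0"
    by (rule dissipation_balance(1)[OF gi gwp Ssym assms(4) bspec[OF assms(5)] assms(6) en'])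
  have eq: "AE z in lst T. ereal (S (fst z) (snd z) \<bullet> flow_gradient G z) = ereal (F (flow_gradient G z)) + conjugate F (S (fst z) (snd z))"
    by (rule dissipation_balance(2)[OF gi gwp Ssym assms(4) bspec[OF assms(5)] assms(6) en'])
  obtain B where B: "AE t in ltime T. psd_measure (R t) \<and> 0 \<le> trace (R t cell) \<and> trace (R t cell) \<le> B"
    using Linf_trace(1)[OF Rinf] by blast
  have Rz: "AE t in ltime T. \<forall>A\<in>sets (borel_on cell). R t A = 0"
    using tr B
  proof eventually_elim
    case (elim t)
    then show ?case using psd.zero_of_trace[OF psd.intro] by blast
  qed
  have rheo: "rheological_law T F v S"
    unfolding rheological_law_def using Dfun eq by (intro exI[of _ D]) (simp add: D_def case_prod_beta')
  have "momentum_equation T v0 v S (\<lambda>_ _. 0)"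
    unfolding momentum_equation_def Let_def
  proof (intro ballI allI impI, elim conjE)
    fix \<tau> \<phi> \<phi>t \<phi>x assume \<tau>: "\<tau> \<in> {0..T}" and \<phi>: "C1_torus T \<phi> \<phi>t \<phi>x" "\<forall>t\<in>{0..T}. \<forall>x. (\<Sum>j\<in>UNIV. (\<phi>x j t x :: real^'d) $ j) = 0"
    have "AE t in lborel. t \<in> {0<..<T} \<longrightarrow> (\<forall>A\<in>sets (borel_on cell). R t A = 0)"
      using Rz by (simp add: AE_restrict_space_iff AE_completion_iff)
    then have "AE t in lborel. t \<in> {0<..<\<tau>} \<longrightarrow> (\<forall>A\<in>sets (borel_on cell). R t A = 0)"
      by eventually_elim (use \<tau> in auto)
    then have "AE t in ltime \<tau>. \<forall>A\<in>sets (borel_on cell). R t A = 0"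
      by (simp add: AE_restrict_space_iff AE_completion_iff)
    then have "AE t in ltime \<tau>. matrix_integral (borel_on cell) (R t) (\<lambda>x. \<chi> i j. \<phi>x j t x $ i) = 0"
      by eventually_elim (intro matrix_integral_zero, blast)
    then have z: "(\<integral>t. matrix_integral (borel_on cell) (R t) (\<lambda>x. \<chi> i j. \<phi>x j t x $ i) \<partial>ltime \<tau>) = 0"
      by (rule integral_eq_zero_AE)
    show "(\<integral>x. v \<tau> x \<bullet> \<phi> \<tau> x \<partial>lcell) - (\<integral>x. v0 x \<bullet> \<phi> 0 x \<partial>lcell) =
          (\<integral>(t, x). v t x \<bullet> \<phi>t t x + outer (v t x) (v t x) \<bullet> (\<chi> i j. \<phi>x j t x $ i) \<partial>lst \<tau>)
          - (\<integral>(t, x). S t x \<bullet> (\<chi> i j. \<phi>x j t x $ i) \<partial>lst \<tau>)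
          + (\<integral>t. matrix_integral (borel_on cell) (\<lambda>_. 0) (\<lambda>x. \<chi> i j. \<phi>x j t x $ i) \<partial>ltime \<tau>)"
      using mom[unfolded momentum_equation_def Let_def, rule_format, OF \<tau>, of \<phi> \<phi>t \<phi>x] \<phi> unfolding z
      by (simp add: matrix_integral_zero)
  qed
  with reg stress incomp init rheo have "strong_solution T p F v0 v S" by (simp add: strong_solution_def)
  with Rz rheo show ?thesis by blast
qed

end
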